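(* Let $\{G_n\}$ be a sequence of finite, simple, connected, regular graphs with degree tending to infinity and, for each $n$, let $\{W_n(e)\}_{e\in E(G_n)}$ be i.i.d. uniform$[0,1]$ weights. Let $M_n$ be the minimal spanning tree of $(G_n,W_n)$, viewed as an unweighted graph. Then the local limit of $M_n$ is $(M,\emptyset)$, where $M$ is the connected component of the root $\emptyset$ in the wired minimal spanning forest on the Poisson-weighted infinite tree, viewed as an unweighted rooted graph.
   Context: Minimal spanning tree: for a finite connected graph with injective edge weights, it is the unique spanning tree of minimal total edge weight (the weights $W_n$ are almost surely distinct). Local limit (unweighted): a random locally finite rooted graph $(G,\rho)$ (viewed up to root-preserving graph isomorphism) is the local limit of a sequence of finite, possibly random, graphs $(H_n)$ if for every integer $r>0$ the random rooted graphs $(B_{H_n}(\rho_n,r),\rho_n)$ converge in distribution to $(B_G(\rho,r),\rho)$, where, given $(H_n)$, the $\rho_n$ are independent uniformly chosen vertices of $H_n$, and $B_H(v,r)$ denotes the ball of radius $r$ around $v$ in the graph distance. Rooted graphs are equipped with the metric $\operatorname{dist}((G_1,\rho_1),(G_2,\rho_2))=1/(1+\alpha)$, $\alpha$ being the supremum of the integers $r>0$ for which the rooted balls of radius $r$ are isomorphic by a root-preserving isomorphism ($\alpha=\infty$ if the rooted graphs are equivalent). PWIT: the Ulam--Harris tree $U$ has vertex set $V(U)=\bigcup_{k\ge 0}\mathbb{N}^k$ with $\mathbb{N}=\{1,2,\dots\}$ and $\mathbb{N}^0=\{\emptyset\}$; for $k\ge1$ each $v=(n_1,\dots,n_k)$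 is joined by an edge to its parent $(n_1,\dots,n_{k-1})$. Independently for each $v\in V(U)$ let $w^{(v)}_1<w^{(v)}_2<\cdots$ be the points of a homogeneous rate one Poisson point process on $[0,\infty)$, and give the edge between $v$ and its child $(v,i)$ the weight $w^{(v)}_i$. With these weights $W$, $(U,\emptyset,W)$ is the Poisson-weighted infinite tree (PWIT). Invasion percolation: for $u\in V(U)$ let $I_0(u)$ be the graph with the single vertex $u$; given $I_n(u)$, let $I_{n+1}(u)=I_n(u)\cup\{e\}$ where $e$ is the edge of lowest weight among the edges not in $I_n(u)$ but incident to a vertex of $I_n(u)$. The tree $T^{(u)}=\bigcup_{n\ge0}I_n(u)$ is the invasion percolation cluster of $u$. The wired minimal spanning forest (WMSF) on the PWIT is the union of all the trees $T^{(u)}$, $u\in V(U)$ (equivalently, it is obtained from the PWIT by deleting every edge whose weight is maximal in some extended cycle containing it, where an extended cycle is a cycle or the union of two disjoint infinite simple paths started from a common vertex). *)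

theory Defs
  imports "HOL-Probability.Probability" "HOL-Library.Diagonal_Subsequence"
begin

section \<open>Graphs\<close>

datatype 'v graph = Graph (verts: "'v set") (edges: "'v set set")

definition simple_graph :: "'v graph \<Rightarrow> bool" where
  "simple_graph G \<longleftrightarrow> (\<forall>e\<in>edges G. \<exists>u\<in>verts G. \<exists>v\<in>verts G. u \<noteq> v \<and> e = {u, v})"

definition adj :: "'v graph \<Rightarrow> 'v rel" where
  "adj G = {(u, v). {u, v} \<in> edges G}"

definition graph_connected :: "'v graph \<Rightarrow> bool" where
  "graph_connected G \<longleftrightarrow> verts G \<noteq> {} \<and> (\<forall>u\<in>verts G. \<forall>v\<in>verts G. (u, v) \<in> (adj G)\<^sup>*)"

definition locally_finite :: "'v graph \<Rightarrow> bool" where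
  "locally_finite G \<longleftrightarrow> (\<forall>v\<in>verts G. finite {u. (v, u) \<in> adj G})"

definition regular :: "nat \<Rightarrow> 'v graph \<Rightarrow> bool" where
  "regular d G \<longleftrightarrow> (\<forall>v\<in>verts G. finite {u. (v, u) \<in> adj G} \<and> card {u. (v, u) \<in> adj G} = d)"

definition gdist :: "'v graph \<Rightarrow> 'v \<Rightarrow> 'v \<Rightarrow> enat" where
  "gdist G u v = Inf {enat k | k. (u, v) \<in> adj G ^^ k}"

definition induced :: "'v graph \<Rightarrow> 'v set \<Rightarrow> 'v graph" where
  "induced G S = Graph (verts G \<inter> S) {e \<in> edges G. e \<subseteq> S}"

definition graph_ball :: "'v graph \<Rightarrow> 'v \<Rightarrow> nat \<Rightarrow> 'v graph" where
  "graph_ball G v r = induced G {u. gdist G v u \<le> enat r}"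

definition component :: "'v graph \<Rightarrow> 'v \<Rightarrow> 'v graph" where
  "component G v = induced G {u. (v, u) \<in> (adj G)\<^sup>*}"


section \<open>Minimal spanning trees\<close>

definition is_cycle :: "'v graph \<Rightarrow> 'v list \<Rightarrow> bool" where
  "is_cycle G p \<longleftrightarrow> length p \<ge> 3 \<and> distinct p \<and>
     (\<forall>i<length p. {p ! i, p ! (Suc i mod length p)} \<in> edges G)"

definition is_tree :: "'v graph \<Rightarrow> bool" where
  "is_tree T \<longleftrightarrow> simple_graph T \<and> graph_connected T \<and> (\<nexists>p. is_cycle T p)"

definition spanning_tree :: "'v graph \<Rightarrow> 'v graph \<Rightarrow> bool" where
  "spanning_tree G T \<longleftrightarrow> verts T = verts G \<and> edges T \<subseteq> edges G \<and> is_tree T"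

definition is_mst :: "'v graph \<Rightarrow> ('v set \<Rightarrow> real) \<Rightarrow> 'v graph \<Rightarrow> bool" where
  "is_mst G w T \<longleftrightarrow> spanning_tree G T \<and>
     (\<forall>T'. spanning_tree G T' \<longrightarrow> sum w (edges T) \<le> sum w (edges T'))"

text \<open>Only meaningful where the minimiser is unique, e.g. for injective weights on a finite
  connected graph.\<close>

definition mst :: "'v graph \<Rightarrow> ('v set \<Rightarrow> real) \<Rightarrow> 'v graph" where
  "mst G w = (THE T. is_mst G w T)"


section \<open>Invasion percolation and the wired minimal spanning forest\<close>

definition boundary :: "'v graph \<Rightarrow> 'v graph \<Rightarrow> 'v set set" where
  "boundary G I = {e \<in> edges G - edges I. e \<inter> verts I \<noteq> {}}"

text \<open>All boundary edges of lowest weight are added; for distinct weights there is at most one, so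
  the convention for ties plays no role almost surely.\<close>

definition lowest :: "('v set \<Rightarrow> real) \<Rightarrow> 'v set set \<Rightarrow> 'v set set" where
  "lowest w B = {e \<in> B. \<forall>e'\<in>B. w e \<le> w e'}"

primrec invasion :: "'v graph \<Rightarrow> ('v set \<Rightarrow> real) \<Rightarrow> 'v \<Rightarrow> nat \<Rightarrow> 'v graph" where
  "invasion G w u 0 = Graph {u} {}"
| "invasion G w u (Suc n) =
     (let I = invasion G w u n; L = lowest w (boundary G I)
      in Graph (verts I \<union> \<Union>L) (edges I \<union> L))"

definition invasion_cluster :: "'v graph \<Rightarrow> ('v set \<Rightarrow> real) \<Rightarrow> 'v \<Rightarrow> 'v graph" where
  "invasion_cluster G w u =
     Graph (\<Union>n. verts (invasion G w u n)) (\<Union>n. edges (invasion G w u n))"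

definition wmsf :: "'v graph \<Rightarrow> ('v set \<Rightarrow> real) \<Rightarrow> 'v graph" where
  "wmsf G w = Graph (\<Union>u\<in>verts G. verts (invasion_cluster G w u))
                    (\<Union>u\<in>verts G. edges (invasion_cluster G w u))"


section \<open>The Poisson-weighted infinite tree\<close>

definition ulam_harris :: "nat list graph" where
  "ulam_harris = Graph {v. set v \<subseteq> {1..}} {{v, v @ [i]} | v i. set v \<subseteq> {1..} \<and> 1 \<le> i}"

definition child_weight :: "(nat list \<Rightarrow> nat \<Rightarrow> real) \<Rightarrow> nat list set \<Rightarrow> real" where
  "child_weight w e = (THE x. \<exists>v i. e = {v, v @ [i]} \<and> x = w v i)"

text \<open>\<open>x 1 < x 2 < \<dots>\<close> are the points of a homogeneous Poisson process of rate one on the half-line.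
  Local finiteness is the divergence of \<open>x\<close>; on bounded sets the counts are therefore almost surely
  genuine cardinalities.\<close>

definition unit_poisson_points :: "'q measure \<Rightarrow> (nat \<Rightarrow> 'q \<Rightarrow> real) \<Rightarrow> bool" where
  "unit_poisson_points Q x \<longleftrightarrow>
     (\<forall>i\<ge>1. x i \<in> borel_measurable Q) \<and>
     (AE \<omega> in Q. 0 \<le> x 1 \<omega> \<and> (\<forall>i\<ge>1. x i \<omega> < x (Suc i) \<omega>) \<and>
        filterlim (\<lambda>i. x i \<omega>) at_top sequentially) \<and>
     (\<forall>A\<in>sets borel. A \<subseteq> {0..} \<and> bounded A \<longrightarrow>
        (\<forall>k. measure Q {\<omega> \<in> space Q. card {i. 1 \<le> i \<and> x i \<omega> \<in> A} = k}
           = exp (- measure lborel A) * measure lborel A ^ k / fact k)) \<and>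
     (\<forall>(A :: nat \<Rightarrow> real set) J. finite J \<and> disjoint_family_on A J \<and>
        (\<forall>j\<in>J. A j \<in> sets borel \<and> A j \<subseteq> {0..} \<and> bounded (A j)) \<longrightarrow>
        prob_space.indep_vars Q (\<lambda>_. count_space UNIV)
          (\<lambda>j \<omega>. card {i. 1 \<le> i \<and> x i \<omega> \<in> A j}) J)"

definition pwit_weights :: "'q measure \<Rightarrow> (nat list \<Rightarrow> nat \<Rightarrow> 'q \<Rightarrow> real) \<Rightarrow> bool" where
  "pwit_weights Q w \<longleftrightarrow>
     prob_space Q \<and>
     (\<forall>v\<in>verts ulam_harris. unit_poisson_points Q (w v)) \<and>
     prob_space.indep_vars Q (\<lambda>_. PiM {1..} (\<lambda>_. borel)) (\<lambda>v \<omega>. \<lambda>i\<in>{1..}. w v i \<omega>)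
       (verts ulam_harris)"


section \<open>Rooted graphs up to isomorphism\<close>

definition rooted_iso_by :: "('v \<Rightarrow> 'w) \<Rightarrow> 'v graph \<times> 'v \<Rightarrow> 'w graph \<times> 'w \<Rightarrow> bool" where
  "rooted_iso_by \<phi> X Y \<longleftrightarrow>
     bij_betw \<phi> (verts (fst X)) (verts (fst Y)) \<and> \<phi> (snd X) = snd Y \<and>
     (\<forall>u\<in>verts (fst X). \<forall>v\<in>verts (fst X). (u, v) \<in> adj (fst X) \<longleftrightarrow> (\<phi> u, \<phi> v) \<in> adj (fst Y))"

definition rooted_iso :: "'v graph \<times> 'v \<Rightarrow> 'w graph \<times> 'w \<Rightarrow> bool" where
  "rooted_iso X Y \<longleftrightarrow> (\<exists>\<phi>. rooted_iso_by \<phi> X Y)"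

definition lf_rooted :: "'v graph \<times> 'v \<Rightarrow> bool" where
  "lf_rooted X \<longleftrightarrow> simple_graph (fst X) \<and> graph_connected (fst X) \<and> locally_finite (fst X) \<and>
     snd X \<in> verts (fst X)"

definition rooted_ball :: "'v graph \<times> 'v \<Rightarrow> nat \<Rightarrow> 'v graph \<times> 'v" where
  "rooted_ball X r = (graph_ball (fst X) (snd X) r, snd X)"

text \<open>The supremum of the empty set is 0, so rooted graphs with different unit balls are at
  distance 1.\<close>

definition rooted_agreement :: "'v graph \<times> 'v \<Rightarrow> 'w graph \<times> 'w \<Rightarrow> enat" where
  "rooted_agreement X Y = Sup {enat r | r. r > 0 \<and> rooted_iso (rooted_ball X r) (rooted_ball Y r)}"

definition rooted_dist :: "'v graph \<times> 'v \<Rightarrow> 'w graph \<times> 'w \<Rightarrow> real" where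
  "rooted_dist X Y = (case rooted_agreement X Y of enat k \<Rightarrow> 1 / (1 + real k) | \<infinity> \<Rightarrow> 0)"

lemma gdist_le_iff: "gdist G u v \<le> enat r \<longleftrightarrow> (\<exists>k\<le>r. (u, v) \<in> adj G ^^ k)"
proof
  assume *: "gdist G u v \<le> enat r"
  let ?S = "{enat k | k. (u, v) \<in> adj G ^^ k}"
  have "?S \<noteq> {}"
  proof
    assume "?S = {}"
    then have "gdist G u v = \<infinity>" unfolding gdist_def by (simp add: Inf_enat_def)
    with * show False by simp
  qed
  then have "Inf ?S \<in> ?S" unfolding Inf_enat_def by (auto intro: LeastI)
  then show "\<exists>k\<le>r. (u, v) \<in> adj G ^^ k" using * unfolding gdist_def by auto
next
  assume "\<exists>k\<le>r. (u, v) \<in> adj G ^^ k"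
  then obtain k where k: "k \<le> r" "(u, v) \<in> adj G ^^ k" by auto
  then have "gdist G u v \<le> enat k" unfolding gdist_def by (intro Inf_lower) auto
  with k show "gdist G u v \<le> enat r" by (meson enat_ord_simps(1) order_trans)
qed

lemma verts_graph_ball:
  "verts (graph_ball G v r) = {u \<in> verts G. \<exists>k\<le>r. (v, u) \<in> adj G ^^ k}"
  by (auto simp: graph_ball_def induced_def gdist_le_iff)

lemma adj_induced: "adj (induced G S) = {(u, v). (u, v) \<in> adj G \<and> u \<in> S \<and> v \<in> S}"
  by (auto simp: induced_def adj_def)

lemma simple_adjD: "simple_graph G \<Longrightarrow> (u, v) \<in> adj G \<Longrightarrow> u \<in> verts G \<and> v \<in> verts G \<and> u \<noteq> v"
proof -
  assume "simple_graph G" "(u, v) \<in> adj G"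
  then obtain x y where "x \<in> verts G" "y \<in> verts G" "x \<noteq> y" "{u, v} = {x, y}"
    unfolding simple_graph_def adj_def by blast
  then show ?thesis by (auto simp: doubleton_eq_iff)
qed

lemma adj_sym: "(u, v) \<in> adj G \<Longrightarrow> (v, u) \<in> adj G"
  by (simp add: adj_def insert_commute)

lemma relpow_adj_verts:
  assumes "simple_graph G" "(u, v) \<in> adj G ^^ k" "u \<in> verts G" shows "v \<in> verts G"
  using assms(2)
proof (induction k arbitrary: v)
  case 0 then show ?case using assms by simp
next
  case (Suc k) then show ?case using simple_adjD[OF assms(1)] by auto
qed

lemma adj_graph_ball:
  assumes "simple_graph G"
  shows "adj (graph_ball G v r) =
    {(x, y). (x, y) \<in> adj G \<and> x \<in> verts (graph_ball G v r) \<and> y \<in> verts (graph_ball G v r)}"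
  using simple_adjD[OF assms] unfolding graph_ball_def adj_induced by (auto simp: induced_def)

lemma simple_induced: "simple_graph G \<Longrightarrow> simple_graph (induced G S)"
  unfolding simple_graph_def
proof
  fix e assume *: "\<forall>e\<in>edges G. \<exists>u\<in>verts G. \<exists>v\<in>verts G. u \<noteq> v \<and> e = {u, v}"
    and "e \<in> edges (induced G S)"
  then have e: "e \<in> edges G" "e \<subseteq> S" by (auto simp: induced_def)
  with * obtain u v where uv: "u \<in> verts G" "v \<in> verts G" "u \<noteq> v" "e = {u, v}" by blast
  show "\<exists>u\<in>verts (induced G S). \<exists>v\<in>verts (induced G S). u \<noteq> v \<and> e = {u, v}"
    by (rule bexI[of _ u], rule bexI[of _ v]) (use uv e in \<open>auto simp: induced_def\<close>)
qed

lemma simple_graph_ball: "simple_graph G \<Longrightarrow> simple_graph (graph_ball G v r)"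
  unfolding graph_ball_def by (rule simple_induced)

lemma rooted_iso_by_inv:
  assumes "rooted_iso_by \<phi> X Y" "snd X \<in> verts (fst X)"
  shows "rooted_iso_by (inv_into (verts (fst X)) \<phi>) Y X"
proof -
  let ?V = "verts (fst X)" and ?W = "verts (fst Y)"
  let ?g = "inv_into ?V \<phi>"
  have b: "bij_betw \<phi> ?V ?W" and root: "\<phi> (snd X) = snd Y"
    and a: "\<And>u v. u \<in> ?V \<Longrightarrow> v \<in> ?V \<Longrightarrow> (u, v) \<in> adj (fst X) \<longleftrightarrow> (\<phi> u, \<phi> v) \<in> adj (fst Y)"
    using assms unfolding rooted_iso_by_def by auto
  have "?g (snd Y) = snd X"
    using b root assms(2) by (metis bij_betw_inv_into_left)
  moreover have "(u, v) \<in> adj (fst Y) \<longleftrightarrow> (?g u, ?g v) \<in> adj (fst X)" if "u \<in> ?W" "v \<in> ?W" for u v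
  proof -
    have "?g u \<in> ?V" "?g v \<in> ?V" using that bij_betwE[OF bij_betw_inv_into[OF b]] by blast+
    moreover have "\<phi> (?g u) = u" "\<phi> (?g v) = v" using that bij_betw_inv_into_right[OF b] by blast+
    ultimately show ?thesis using a[of "?g u" "?g v"] by simp
  qed
  ultimately show ?thesis
    unfolding rooted_iso_by_def using bij_betw_inv_into[OF b] by auto
qed

lemma rooted_iso_sym:
  "rooted_iso X Y \<Longrightarrow> snd X \<in> verts (fst X) \<Longrightarrow> rooted_iso Y X"
  unfolding rooted_iso_def using rooted_iso_by_inv by blast

lemma rooted_iso_refl: "rooted_iso X X"
  unfolding rooted_iso_def rooted_iso_by_def by (intro exI[of _ id]) auto

lemma rooted_iso_trans:
  assumes "rooted_iso X Y" "rooted_iso Y Z" shows "rooted_iso X Z"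
proof -
  obtain f g where f: "rooted_iso_by f X Y" and g: "rooted_iso_by g Y Z"
    using assms unfolding rooted_iso_def by auto
  have "f v \<in> verts (fst Y)" if "v \<in> verts (fst X)" for v
    using f that unfolding rooted_iso_by_def by (meson bij_betwE)
  then have "rooted_iso_by (g \<circ> f) X Z"
    using f g unfolding rooted_iso_by_def by (auto intro: bij_betw_trans)
  then show ?thesis unfolding rooted_iso_def by auto
qed

lemma rooted_iso_by_relpow:
  assumes iso: "rooted_iso_by \<phi> X Y" and s: "simple_graph (fst X)"
    and u: "u \<in> verts (fst X)" and k: "(u, v) \<in> adj (fst X) ^^ k"
  shows "(\<phi> u, \<phi> v) \<in> adj (fst Y) ^^ k"
  using k
proof (induction k arbitrary: v)
  case 0 then show ?case by simp
next
  case (Suc k)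
  then obtain z where z: "(u, z) \<in> adj (fst X) ^^ k" "(z, v) \<in> adj (fst X)" by auto
  have "(\<phi> z, \<phi> v) \<in> adj (fst Y)"
    using iso z(2) simple_adjD[OF s z(2)] unfolding rooted_iso_by_def by auto
  with Suc.IH[OF z(1)] show ?case by auto
qed

lemma rooted_iso_by_ball:
  assumes iso: "rooted_iso_by \<phi> X Y" and sX: "simple_graph (fst X)" and sY: "simple_graph (fst Y)"
    and root: "snd X \<in> verts (fst X)"
  shows "rooted_iso_by \<phi> (rooted_ball X r) (rooted_ball Y r)"
proof -
  let ?V = "verts (fst X)" and ?W = "verts (fst Y)"
  let ?B = "verts (graph_ball (fst X) (snd X) r)" and ?C = "verts (graph_ball (fst Y) (snd Y) r)"
  let ?g = "inv_into ?V \<phi>"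
  have b: "bij_betw \<phi> ?V ?W" and rt: "\<phi> (snd X) = snd Y"
    using iso unfolding rooted_iso_by_def by auto
  have rY: "snd Y \<in> ?W" using b rt root by (metis bij_betwE)
  have g: "rooted_iso_by ?g Y X" by (rule rooted_iso_by_inv[OF iso root])
  have "\<phi> ` ?B \<subseteq> ?C"
    using rooted_iso_by_relpow[OF iso sX root] b rt by (auto simp: verts_graph_ball bij_betw_def)
  moreover have "?C \<subseteq> \<phi> ` ?B"
  proof
    fix w assume w: "w \<in> ?C"
    then obtain k where k: "k \<le> r" "(snd Y, w) \<in> adj (fst Y) ^^ k" and wW: "w \<in> ?W"
      by (auto simp: verts_graph_ball)
    have "(?g (snd Y), ?g w) \<in> adj (fst X) ^^ k"
      by (rule rooted_iso_by_relpow[OF g sY rY k(2)])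
    moreover have "?g (snd Y) = snd X" using g unfolding rooted_iso_by_def by auto
    moreover have "?g w \<in> ?V" using g wW unfolding rooted_iso_by_def by (meson bij_betwE)
    ultimately have "?g w \<in> ?B" using k by (auto simp: verts_graph_ball)
    moreover have "\<phi> (?g w) = w" using b wW by (metis bij_betw_inv_into_right)
    ultimately show "w \<in> \<phi> ` ?B" by force
  qed
  ultimately have im: "\<phi> ` ?B = ?C" by auto
  have "inj_on \<phi> ?B"
    by (rule inj_on_subset[of _ ?V]) (use b in \<open>auto simp: bij_betw_def verts_graph_ball\<close>)
  with im have "bij_betw \<phi> ?B ?C" by (simp add: bij_betw_def)
  moreover have "(u, v) \<in> adj (graph_ball (fst X) (snd X) r) \<longleftrightarrow>
      (\<phi> u, \<phi> v) \<in> adj (graph_ball (fst Y) (snd Y) r)" if "u \<in> ?B" "v \<in> ?B" for u v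
  proof -
    have "u \<in> ?V" "v \<in> ?V" using that by (auto simp: verts_graph_ball)
    moreover have "\<phi> u \<in> ?C" "\<phi> v \<in> ?C" using that im by auto
    ultimately show ?thesis
      using that iso unfolding adj_graph_ball[OF sX] adj_graph_ball[OF sY] rooted_iso_by_def by auto
  qed
  ultimately show ?thesis unfolding rooted_iso_by_def rooted_ball_def using rt by auto
qed

lemma relpow_in_ball:
  assumes "simple_graph G" "v \<in> verts G" "(v, u) \<in> adj G ^^ k" "k \<le> r"
  shows "(v, u) \<in> adj (graph_ball G v r) ^^ k"
  using assms(3,4)
proof (induction k arbitrary: u)
  case 0 then show ?case by simp
next
  case (Suc k)
  then obtain z where z: "(v, z) \<in> adj G ^^ k" "(z, u) \<in> adj G" by auto
  have "z \<in> verts (graph_ball G v r)" "u \<in> verts (graph_ball G v r)"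
    using simple_adjD[OF assms(1) z(2)] z Suc.prems Suc_leD unfolding verts_graph_ball by blast+
  then have "(z, u) \<in> adj (graph_ball G v r)" using z adj_graph_ball[OF assms(1)] by auto
  with Suc z show ?case by auto
qed

lemma rooted_ball_ball:
  assumes s: "simple_graph (fst X)" and root: "snd X \<in> verts (fst X)" and le: "r \<le> R"
  shows "rooted_ball (rooted_ball X R) r = rooted_ball X r"
proof -
  let ?G = "fst X" and ?v = "snd X"
  let ?B = "graph_ball ?G ?v R"
  have sub: "adj ?B \<subseteq> adj ?G" unfolding adj_graph_ball[OF s] by auto
  have mono: "adj ?B ^^ k \<subseteq> adj ?G ^^ k" for k
    by (induction k) (use sub in auto)
  have V: "verts (graph_ball ?B ?v r) = verts (graph_ball ?G ?v r)"
  proof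
    show "verts (graph_ball ?B ?v r) \<subseteq> verts (graph_ball ?G ?v r)"
      using mono unfolding verts_graph_ball[of ?B] verts_graph_ball by blast
    show "verts (graph_ball ?G ?v r) \<subseteq> verts (graph_ball ?B ?v r)"
    proof
      fix u assume "u \<in> verts (graph_ball ?G ?v r)"
      then obtain k where k: "k \<le> r" "(?v, u) \<in> adj ?G ^^ k" "u \<in> verts ?G"
        by (auto simp: verts_graph_ball)
      with relpow_in_ball[OF s root k(2), of R] le
      show "u \<in> verts (graph_ball ?B ?v r)"
        unfolding verts_graph_ball[of ?B] verts_graph_ball[of ?G] by (blast intro: order_trans)
    qed
  qed
  have E: "edges (graph_ball G v r) = {e \<in> edges G. e \<subseteq> verts (graph_ball G v r)}"
    if "simple_graph G" for G :: "'a graph" and v r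
    using that unfolding graph_ball_def induced_def simple_graph_def by fastforce
  have sub2: "verts (graph_ball ?G ?v r) \<subseteq> verts ?B"
    using le unfolding verts_graph_ball by (blast intro: order_trans)
  have "edges (graph_ball ?B ?v r) = edges (graph_ball ?G ?v r)"
    using sub2 unfolding E[OF simple_graph_ball[OF s]] V E[OF s] by auto
  with V show ?thesis unfolding rooted_ball_def by (simp add: graph.expand)
qed

lemma root_in_ball: "snd X \<in> verts (fst X) \<Longrightarrow> snd (rooted_ball X r) \<in> verts (fst (rooted_ball X r))"
  by (auto simp: rooted_ball_def verts_graph_ball intro: exI[of _ 0])

lemma rooted_iso_ball_mono:
  assumes X: "lf_rooted X" and Y: "lf_rooted Y"
    and iso: "rooted_iso (rooted_ball X R) (rooted_ball Y R)" and le: "r \<le> R"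
  shows "rooted_iso (rooted_ball X r) (rooted_ball Y r)"
proof -
  obtain \<phi> where "rooted_iso_by \<phi> (rooted_ball X R) (rooted_ball Y R)"
    using iso unfolding rooted_iso_def by auto
  then have "rooted_iso_by \<phi> (rooted_ball (rooted_ball X R) r) (rooted_ball (rooted_ball Y R) r)"
    using X Y root_in_ball[of X R]
    by (elim rooted_iso_by_ball) (auto simp: lf_rooted_def rooted_ball_def simple_graph_ball)
  then show ?thesis
    using X Y le unfolding rooted_iso_def lf_rooted_def by (auto simp: rooted_ball_ball)
qed

lemma rooted_iso_balls:
  assumes "lf_rooted X" "lf_rooted Y" "rooted_iso X Y"
  shows "rooted_iso (rooted_ball X r) (rooted_ball Y r)"
  using assms rooted_iso_by_ball unfolding rooted_iso_def lf_rooted_def by blast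

lemma finite_graph_ball:
  assumes "lf_rooted X" shows "finite (verts (graph_ball (fst X) (snd X) r))"
proof -
  have s: "simple_graph (fst X)" and lf: "locally_finite (fst X)" and root: "snd X \<in> verts (fst X)"
    using assms by (auto simp: lf_rooted_def)
  have "finite {u. (snd X, u) \<in> adj (fst X) ^^ k}" for k
  proof (induction k)
    case 0 then show ?case by simp
  next
    case (Suc k)
    have "{u. (snd X, u) \<in> adj (fst X) ^^ Suc k} =
        (\<Union>z\<in>{z. (snd X, z) \<in> adj (fst X) ^^ k}. {u. (z, u) \<in> adj (fst X)})" by auto
    then show ?case
      using Suc relpow_adj_verts[OF s _ root] lf by (auto simp: locally_finite_def)
  qed
  then have "finite (\<Union>k\<in>{..r}. {u. (snd X, u) \<in> adj (fst X) ^^ k})" by blast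
  then show ?thesis by (rule rev_finite_subset) (auto simp: verts_graph_ball)
qed

lemma eventually_in_ball:
  assumes "lf_rooted X" "v \<in> verts (fst X)"
  shows "\<exists>d. \<forall>r\<ge>d. v \<in> verts (graph_ball (fst X) (snd X) r)"
proof -
  have "(snd X, v) \<in> (adj (fst X))\<^sup>*"
    using assms by (auto simp: lf_rooted_def graph_connected_def)
  then obtain k where "(snd X, v) \<in> adj (fst X) ^^ k" using rtrancl_imp_relpow by blast
  then show ?thesis using assms(2) by (auto simp: verts_graph_ball)
qed

lemma rooted_iso_if_balls:
  fixes X Y :: "nat graph \<times> nat"
  assumes X: "lf_rooted X" and Y: "lf_rooted Y"
    and iso: "\<And>r. rooted_iso (rooted_ball X r) (rooted_ball Y r)"
  shows "rooted_iso X Y"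
proof -
  let ?V = "verts (fst X)" and ?W = "verts (fst Y)"
  let ?B = "\<lambda>r. verts (graph_ball (fst X) (snd X) r)"
  let ?C = "\<lambda>r. verts (graph_ball (fst Y) (snd Y) r)"
  have sX: "simple_graph (fst X)" and sY: "simple_graph (fst Y)"
    and rX: "snd X \<in> ?V" and rY: "snd Y \<in> ?W" using X Y by (auto simp: lf_rooted_def)
  obtain \<phi> where "\<forall>r. rooted_iso_by (\<phi> r) (rooted_ball X r) (rooted_ball Y r)"
    using iso unfolding rooted_iso_def by metis
  then have \<phi>: "rooted_iso_by (\<phi> r) (rooted_ball X r) (rooted_ball Y r)" for r by blast
  have \<phi>': "rooted_iso_by (\<phi> R) (rooted_ball X r) (rooted_ball Y r)" if "r \<le> R" for r R
    using rooted_iso_by_ball[OF \<phi>[of R], of r] rooted_ball_ball[OF sX rX that]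
      rooted_ball_ball[OF sY rY that] root_in_ball[OF rX] sX sY
    by (auto simp: rooted_ball_def simple_graph_ball)
  have bij: "bij_betw (\<phi> R) (?B r) (?C r)" if "r \<le> R" for r R
    using \<phi>'[OF that] unfolding rooted_iso_by_def rooted_ball_def by auto
  define P where "P v s \<longleftrightarrow> (v \<in> ?V \<longrightarrow> (\<exists>c. \<forall>n. \<phi> (s n) v = c))" for v :: nat and s :: "nat \<Rightarrow> nat"
  interpret subseqs P
  proof
    fix v :: nat and s :: "nat \<Rightarrow> nat" assume s: "strict_mono s"
    show "\<exists>r'. strict_mono r' \<and> P v (s \<circ> r')"
    proof (cases "v \<in> ?V")
      case False then show ?thesis using strict_mono_id by (auto simp: P_def)
    next
      case True
      then obtain d where d: "\<And>r. r \<ge> d \<Longrightarrow> v \<in> ?B r" using eventually_in_ball[OF X] by blast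
      have "(\<lambda>n. \<phi> (s n) v) ` {d..} \<subseteq> ?C d"
      proof
        fix w assume "w \<in> (\<lambda>n. \<phi> (s n) v) ` {d..}"
        then obtain n where n: "n \<ge> d" "w = \<phi> (s n) v" by auto
        have "d \<le> s n" using n seq_suble[OF s, of n] by simp
        from bij[OF this] d[of d] n show "w \<in> ?C d" by (auto dest: bij_betwE)
      qed
      then have "finite ((\<lambda>n. \<phi> (s n) v) ` {d..})"
        using finite_graph_ball[OF Y] finite_subset by blast
      then obtain a where "infinite {n \<in> {d..}. \<phi> (s n) v = \<phi> (s a) v}"
        using pigeonhole_infinite[of "{d..}" "\<lambda>n. \<phi> (s n) v"] infinite_Ici by blast
      from infinite_enumerate[OF this] obtain r' :: "nat \<Rightarrow> nat"
        where "strict_mono r'" "\<forall>n. r' n \<in> {n \<in> {d..}. \<phi> (s n) v = \<phi> (s a) v}" by blast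
      then show ?thesis by (auto simp: P_def)
    qed
  qed
  have "P v (diagseq \<circ> ((+) (Suc v)))" for v
    by (rule diagseq_holds) (auto simp: P_def)
  then have *: "\<exists>c. \<forall>n. \<phi> (diagseq (Suc v + n)) v = c" if "v \<in> ?V" for v
    using that unfolding P_def comp_def by blast
  have "\<forall>v. \<exists>c. v \<in> ?V \<longrightarrow> (\<forall>n\<ge>Suc v. \<phi> (diagseq n) v = c)"
  proof
    fix v
    show "\<exists>c. v \<in> ?V \<longrightarrow> (\<forall>n\<ge>Suc v. \<phi> (diagseq n) v = c)"
    proof (cases "v \<in> ?V")
      case True
      then obtain c where "\<And>n. \<phi> (diagseq (Suc v + n)) v = c" using * by blast
      then have "\<forall>n\<ge>Suc v. \<phi> (diagseq n) v = c" by (metis le_Suc_ex)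
      then show ?thesis by blast
    qed simp
  qed
  from choice[OF this] obtain \<psi>
    where \<psi>: "\<And>v n. v \<in> ?V \<Longrightarrow> n \<ge> Suc v \<Longrightarrow> \<phi> (diagseq n) v = \<psi> v" by blast
  \<comment> \<open>on every finite set of vertices \<open>\<psi>\<close> coincides with some \<open>\<phi> R\<close> with \<open>R\<close> arbitrarily large\<close>
  have agree: "\<exists>R\<ge>d. \<forall>v\<in>S. \<phi> R v = \<psi> v" if "finite S" "S \<subseteq> ?V" for S d
  proof -
    define n where "n = Max (insert d (Suc ` S))"
    have "n \<ge> d" "\<And>v. v \<in> S \<Longrightarrow> n \<ge> Suc v" using that by (auto simp: n_def)
    moreover have "diagseq n \<ge> n" by (rule seq_suble[OF subseq_diagseq])
    ultimately show ?thesis using \<psi> that by (intro exI[of _ "diagseq n"]) auto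
  qed
  have BV: "?B r \<subseteq> ?V" and CW: "?C r \<subseteq> ?W" for r by (auto simp: verts_graph_ball)
  have pair: "\<exists>r R. u \<in> ?B r \<and> v \<in> ?B r \<and> r \<le> R \<and> \<phi> R u = \<psi> u \<and> \<phi> R v = \<psi> v"
    if uv: "u \<in> ?V" "v \<in> ?V" for u v
  proof -
    obtain d1 d2 where "\<And>r. r \<ge> d1 \<Longrightarrow> u \<in> ?B r" "\<And>r. r \<ge> d2 \<Longrightarrow> v \<in> ?B r"
      using eventually_in_ball[OF X] uv by meson
    then have "u \<in> ?B (max d1 d2)" "v \<in> ?B (max d1 d2)" by auto
    moreover obtain R where "R \<ge> max d1 d2" "\<forall>x\<in>{u, v}. \<phi> R x = \<psi> x"
      using agree[of "{u, v}" "max d1 d2"] uv by auto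
    ultimately show ?thesis by blast
  qed
  have "inj_on \<psi> ?V"
  proof (rule inj_onI)
    fix u v assume uv: "u \<in> ?V" "v \<in> ?V" "\<psi> u = \<psi> v"
    obtain r R where "u \<in> ?B r" "v \<in> ?B r" "r \<le> R" "\<phi> R u = \<psi> u" "\<phi> R v = \<psi> v"
      using pair uv by blast
    then show "u = v" using bij[of r R] uv(3) by (metis bij_betw_def inj_onD)
  qed
  moreover have "\<psi> ` ?V = ?W"
  proof
    show "\<psi> ` ?V \<subseteq> ?W"
    proof
      fix w assume "w \<in> \<psi> ` ?V"
      then obtain v where v: "v \<in> ?V" "w = \<psi> v" by auto
      then obtain r R where "v \<in> ?B r" "r \<le> R" "\<phi> R v = \<psi> v" using pair by blast
      then have "w \<in> ?C r" using bij[of r R] v by (metis bij_betwE)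
      then show "w \<in> ?W" using CW by blast
    qed
    show "?W \<subseteq> \<psi> ` ?V"
    proof
      fix w assume "w \<in> ?W"
      then obtain d where d: "w \<in> ?C d" using eventually_in_ball[OF Y] by blast
      obtain R where R: "R \<ge> d" "\<forall>v\<in>?B d. \<phi> R v = \<psi> v"
        using agree[OF finite_graph_ball[OF X] BV] by blast
      have "w \<in> \<phi> R ` ?B d" using bij[OF R(1)] d by (auto simp: bij_betw_def)
      then show "w \<in> \<psi> ` ?V" using R(2) BV by force
    qed
  qed
  moreover have "\<psi> (snd X) = snd Y"
  proof -
    obtain R where "\<phi> R (snd X) = \<psi> (snd X)" using pair[OF rX rX] by blast
    moreover have "\<phi> R (snd X) = snd Y" using \<phi>[of R] unfolding rooted_iso_by_def rooted_ball_def by auto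
    ultimately show ?thesis by simp
  qed
  moreover have "(u, v) \<in> adj (fst X) \<longleftrightarrow> (\<psi> u, \<psi> v) \<in> adj (fst Y)" if uv: "u \<in> ?V" "v \<in> ?V" for u v
  proof -
    obtain r R where r: "u \<in> ?B r" "v \<in> ?B r" "r \<le> R" "\<phi> R u = \<psi> u" "\<phi> R v = \<psi> v"
      using pair uv by blast
    then have "\<psi> u \<in> ?C r" "\<psi> v \<in> ?C r" using bij[of r R] by (metis bij_betwE)+
    then show ?thesis
      using r \<phi>'[OF r(3)]
      unfolding rooted_iso_by_def rooted_ball_def by (auto simp: adj_graph_ball[OF sX] adj_graph_ball[OF sY])
  qed
  ultimately have "rooted_iso_by \<psi> X Y" unfolding rooted_iso_by_def bij_betw_def by auto
  then show ?thesis unfolding rooted_iso_def by auto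
qed

lemma rooted_agreement_infinite:
  assumes "lf_rooted X" "lf_rooted Y" "rooted_agreement X Y = \<infinity>"
  shows "rooted_iso (rooted_ball X r) (rooted_ball Y r)"
proof (rule ccontr)
  assume "\<not> rooted_iso (rooted_ball X r) (rooted_ball Y r)"
  then have "\<And>R. rooted_iso (rooted_ball X R) (rooted_ball Y R) \<Longrightarrow> R < r"
    using rooted_iso_ball_mono[OF assms(1,2)] by (meson not_le)
  then have "rooted_agreement X Y \<le> enat r"
    unfolding rooted_agreement_def by (intro Sup_least) (force intro: less_imp_le)
  with assms(3) show False by simp
qed

lemma rooted_agreement_ge:
  assumes "rooted_iso (rooted_ball X r) (rooted_ball Y r)"
  shows "enat r \<le> rooted_agreement X Y"
  using assms unfolding rooted_agreement_def by (cases "r = 0") (auto intro!: Sup_upper simp: zero_enat_def[symmetric])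

lemma rooted_agreement_ball:
  assumes "lf_rooted X" "lf_rooted Y" "enat r \<le> rooted_agreement X Y" "r > 0"
  shows "rooted_iso (rooted_ball X r) (rooted_ball Y r)"
proof (rule ccontr)
  assume "\<not> rooted_iso (rooted_ball X r) (rooted_ball Y r)"
  then have "\<And>R. rooted_iso (rooted_ball X R) (rooted_ball Y R) \<Longrightarrow> R \<le> r - 1"
    using rooted_iso_ball_mono[OF assms(1,2)] assms(4) by (metis One_nat_def Suc_pred less_Suc_eq_le not_le)
  then have "rooted_agreement X Y \<le> enat (r - 1)"
    unfolding rooted_agreement_def by (intro Sup_least) force
  with assms(3) have "enat r \<le> enat (r - 1)" by (rule order_trans)
  with assms(4) show False by simp
qed

lemma rooted_agreement_ultra:
  assumes X: "lf_rooted X" and Y: "lf_rooted Y" and Z: "lf_rooted Z"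
  shows "min (rooted_agreement X Z) (rooted_agreement Y Z) \<le> rooted_agreement X Y"
proof (rule ccontr)
  assume "\<not> ?thesis"
  then have lt: "rooted_agreement X Y < rooted_agreement X Z" "rooted_agreement X Y < rooted_agreement Y Z"
    by (simp_all add: not_le)
  then obtain k where k: "rooted_agreement X Y = enat k" by (cases "rooted_agreement X Y") auto
  have "enat (Suc k) \<le> rooted_agreement X Z" "enat (Suc k) \<le> rooted_agreement Y Z"
    using lt k by (auto simp: Suc_ile_eq)
  then have "rooted_iso (rooted_ball X (Suc k)) (rooted_ball Z (Suc k))"
    "rooted_iso (rooted_ball Y (Suc k)) (rooted_ball Z (Suc k))"
    using rooted_agreement_ball X Y Z by blast+
  then have "rooted_iso (rooted_ball X (Suc k)) (rooted_ball Y (Suc k))"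
    by (meson Y lf_rooted_def root_in_ball rooted_iso_sym rooted_iso_trans)
  then have "enat (Suc k) \<le> enat k" using rooted_agreement_ge k by metis
  then show False by simp
qed

lemma rooted_dist_ultra:
  assumes "lf_rooted X" "lf_rooted Y" "lf_rooted Z"
  shows "rooted_dist X Y \<le> rooted_dist X Z + rooted_dist Y Z"
proof -
  define f where "f a = (case a of enat k \<Rightarrow> 1 / (1 + real k) | \<infinity> \<Rightarrow> 0)" for a
  have f0: "f a \<ge> 0" for a by (auto simp: f_def split: enat.split)
  have anti: "f b \<le> f a" if "a \<le> b" for a b
    using that by (cases a; cases b) (auto simp: f_def frac_le)
  have "f (rooted_agreement X Y) \<le> f (min (rooted_agreement X Z) (rooted_agreement Y Z))"
    by (rule anti[OF rooted_agreement_ultra[OF assms]])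
  also have "\<dots> \<le> f (rooted_agreement X Z) + f (rooted_agreement Y Z)"
    using f0 by (auto simp: min_def)
  finally show ?thesis by (simp add: rooted_dist_def f_def)
qed

lemma rooted_agreement_cong:
  assumes "lf_rooted X" "lf_rooted X'" "rooted_iso X X'" "lf_rooted Y" "lf_rooted Y'" "rooted_iso Y Y'"
  shows "rooted_agreement X Y = rooted_agreement X' Y'"
proof -
  have "rooted_iso (rooted_ball X r) (rooted_ball Y r) \<longleftrightarrow>
      rooted_iso (rooted_ball X' r) (rooted_ball Y' r)" for r
    using rooted_iso_balls[OF assms(1-3), of r] rooted_iso_balls[OF assms(4-6), of r] assms
    by (meson lf_rooted_def root_in_ball rooted_iso_sym rooted_iso_trans)
  then show ?thesis by (simp add: rooted_agreement_def)
qed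

text \<open>Connected locally finite graphs are countable, so vertices in \<open>nat\<close> represent all of them
  (see \<open>rooted_class_iso\<close>).\<close>

definition rooted_equiv :: "nat graph \<times> nat \<Rightarrow> nat graph \<times> nat \<Rightarrow> bool" where
  "rooted_equiv X Y \<longleftrightarrow> lf_rooted X \<and> lf_rooted Y \<and> rooted_iso X Y"

quotient_type rooted_graph = "nat graph \<times> nat" / partial: rooted_equiv
proof (rule part_equivpI)
  have "lf_rooted (Graph {0} {}, 0::nat)"
    by (auto simp: lf_rooted_def simple_graph_def graph_connected_def locally_finite_def adj_def)
  then show "\<exists>X. rooted_equiv X X" unfolding rooted_equiv_def using rooted_iso_refl by blast
  show "symp rooted_equiv"
    by (rule sympI) (auto simp: rooted_equiv_def lf_rooted_def intro: rooted_iso_sym)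
  show "transp rooted_equiv"
    by (rule transpI) (auto simp: rooted_equiv_def intro: rooted_iso_trans)
qed

instantiation rooted_graph :: metric_space
begin

lift_definition dist_rooted_graph :: "rooted_graph \<Rightarrow> rooted_graph \<Rightarrow> real" is rooted_dist
  unfolding rooted_equiv_def rooted_dist_def using rooted_agreement_cong by metis

definition uniformity_rooted_graph :: "(rooted_graph \<times> rooted_graph) filter" where
  "uniformity_rooted_graph = (INF e\<in>{0<..}. principal {(x, y). dist x y < e})"

definition open_rooted_graph :: "rooted_graph set \<Rightarrow> bool" where
  "open_rooted_graph U = (\<forall>x\<in>U. eventually (\<lambda>(x', y). x' = x \<longrightarrow> y \<in> U) uniformity)"

instance
proof
  fix x y z :: rooted_graph
  show "dist x y = 0 \<longleftrightarrow> x = y"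
  proof (transfer, goal_cases)
    case (1 X Y)
    then have X: "lf_rooted X" and Y: "lf_rooted Y" by (auto simp: rooted_equiv_def)
    show ?case
    proof
      assume "rooted_dist X Y = 0"
      then have "rooted_agreement X Y = \<infinity>" by (auto simp: rooted_dist_def split: enat.splits)
      then have "rooted_iso X Y"
        using rooted_iso_if_balls[OF X Y] rooted_agreement_infinite[OF X Y] by blast
      then show "rooted_equiv X Y" using X Y by (simp add: rooted_equiv_def)
    next
      assume "rooted_equiv X Y"
      then have "enat r \<le> rooted_agreement X Y" for r
        using rooted_iso_balls[OF X Y] rooted_agreement_ge unfolding rooted_equiv_def by blast
      then have "rooted_agreement X Y = \<infinity>"
        by (metis Suc_n_not_le_n enat_ord_simps(1) not_infinity_eq)
      then show "rooted_dist X Y = 0" by (simp add: rooted_dist_def)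
    qed
  qed
  show "dist x y \<le> dist x z + dist y z"
  proof (transfer, goal_cases)
    case (1 X Y Z)
    then show ?case by (intro rooted_dist_ultra) (auto simp: rooted_equiv_def)
  qed
qed (simp_all add: uniformity_rooted_graph_def open_rooted_graph_def)

end

text \<open>Constant off the connected locally finite rooted graphs; for the random graphs below this is
  a null event.\<close>

definition rooted_class :: "'v graph \<times> 'v \<Rightarrow> rooted_graph" where
  "rooted_class X =
     (if lf_rooted X then abs_rooted_graph (SOME Y. lf_rooted Y \<and> rooted_iso X Y) else undefined)"

lemma ex_nat_representative:
  fixes X :: "'v graph \<times> 'v"
  assumes X: "lf_rooted X"
  shows "\<exists>Y :: nat graph \<times> nat. lf_rooted Y \<and> rooted_iso X Y"
proof -
  let ?V = "verts (fst X)"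
  have "?V \<subseteq> (\<Union>r. verts (graph_ball (fst X) (snd X) r))"
    using eventually_in_ball[OF X] by blast
  moreover have "countable (\<Union>r. verts (graph_ball (fst X) (snd X) r))"
    using finite_graph_ball[OF X] by (blast intro: countable_finite countable_UN)
  ultimately have "countable ?V" using countable_subset by blast
  then obtain f :: "'v \<Rightarrow> nat" where f: "inj_on f ?V" unfolding countable_def by blast
  have s: "simple_graph (fst X)" and c: "graph_connected (fst X)" and l: "locally_finite (fst X)"
    and root: "snd X \<in> ?V" using X by (auto simp: lf_rooted_def)
  define H where "H = Graph (f ` ?V) {{f u, f v} | u v. (u, v) \<in> adj (fst X)}"
  have VH: "verts H = f ` ?V" and EH: "edges H = {{f u, f v} | u v. (u, v) \<in> adj (fst X)}"
    by (simp_all add: H_def)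
  have aV: "u \<in> ?V" "v \<in> ?V" "u \<noteq> v" if "(u, v) \<in> adj (fst X)" for u v
    using simple_adjD[OF s that] by auto
  have adjH: "adj H = {(f u, f v) | u v. (u, v) \<in> adj (fst X)}"
  proof (rule set_eqI, safe)
    fix a b assume "(a, b) \<in> adj H"
    then obtain u v where "{a, b} = {f u, f v}" "(u, v) \<in> adj (fst X)"
      unfolding adj_def[of H] EH by blast
    then show "\<exists>u v. (a, b) = (f u, f v) \<and> (u, v) \<in> adj (fst X)"
      using adj_sym[of u v "fst X"] by (auto simp: doubleton_eq_iff)
  next
    fix u v assume "(u, v) \<in> adj (fst X)"
    then show "(f u, f v) \<in> adj H" unfolding adj_def[of H] EH by blast
  qed
  have "(u, v) \<in> adj (fst X)" if uv: "(f u, f v) \<in> adj H" "u \<in> ?V" "v \<in> ?V" for u v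
  proof -
    obtain x y where xy: "f u = f x" "f v = f y" "(x, y) \<in> adj (fst X)"
      using uv(1) unfolding adjH by auto
    with aV(1,2)[OF xy(3)] uv(2,3) f have "u = x" "v = y" by (meson inj_onD)+
    with xy show ?thesis by simp
  qed
  then have iso: "rooted_iso X (H, f (snd X))"
    using f unfolding rooted_iso_def rooted_iso_by_def
    by (intro exI[of _ f]) (auto simp: bij_betw_def adjH VH)
  have "simple_graph H"
    unfolding simple_graph_def
  proof
    fix e assume "e \<in> edges H"
    then obtain u v where e: "e = {f u, f v}" "(u, v) \<in> adj (fst X)" by (auto simp: H_def)
    with aV[OF e(2)] f have "f u \<noteq> f v" "f u \<in> verts H" "f v \<in> verts H"
      by (auto simp: VH dest: inj_onD)
    with e show "\<exists>u\<in>verts H. \<exists>v\<in>verts H. u \<noteq> v \<and> e = {u, v}" by blast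
  qed
  moreover have "graph_connected H"
  proof -
    have "(f u, f v) \<in> (adj H)\<^sup>*" if "(u, v) \<in> (adj (fst X))\<^sup>*" for u v
      using that
    proof induction
      case base then show ?case by simp
    next
      case (step y z)
      then have "(f y, f z) \<in> adj H" unfolding adjH by auto
      with step.IH show ?case by (rule rtrancl_into_rtrancl)
    qed
    then show ?thesis using c unfolding graph_connected_def by (auto simp: H_def)
  qed
  moreover have "locally_finite H"
  proof -
    have "{u. (f v, u) \<in> adj H} \<subseteq> f ` {u. (v, u) \<in> adj (fst X)}" if "v \<in> ?V" for v
    proof
      fix a assume "a \<in> {u. (f v, u) \<in> adj H}"
      then obtain x y where xy: "f v = f x" "a = f y" "(x, y) \<in> adj (fst X)"
        unfolding adjH by auto
      with aV(1)[OF xy(3)] that f have "v = x" by (meson inj_onD)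
      with xy show "a \<in> f ` {u. (v, u) \<in> adj (fst X)}" by simp
    qed
    then have "finite {u. (f v, u) \<in> adj H}" if "v \<in> ?V" for v
      using that l unfolding locally_finite_def by (meson finite_imageI finite_subset)
    then show ?thesis unfolding locally_finite_def by (auto simp: H_def)
  qed
  ultimately have "lf_rooted (H, f (snd X))" using root by (auto simp: lf_rooted_def H_def)
  with iso show ?thesis by blast
qed

lemma rooted_class_iso:
  assumes "lf_rooted X" shows "rooted_iso X (rep_rooted_graph (rooted_class X))"
proof -
  define Y where "Y = (SOME Y :: nat graph \<times> nat. lf_rooted Y \<and> rooted_iso X Y)"
  have Y: "lf_rooted Y" "rooted_iso X Y"
    using someI_ex[OF ex_nat_representative[OF assms]] unfolding Y_def by auto
  then have "rooted_equiv Y Y" by (simp add: rooted_equiv_def rooted_iso_refl)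
  then have "rooted_equiv Y (rep_rooted_graph (abs_rooted_graph Y))"
    by (metis Quotient3_rooted_graph Quotient3_abs_rep Quotient3_rel Quotient3_rep_reflp)
  then show ?thesis
    using Y(2) assms unfolding rooted_class_def Y_def[symmetric]
    by (auto simp: rooted_equiv_def intro: rooted_iso_trans)
qed


section \<open>Local limits\<close>

definition converges_weakly :: "(nat \<Rightarrow> 'm :: metric_space measure) \<Rightarrow> 'm measure \<Rightarrow> bool" where
  "converges_weakly \<mu> \<nu> \<longleftrightarrow>
     (\<forall>f :: 'm \<Rightarrow> real. continuous_on UNIV f \<and> bounded (range f) \<longrightarrow>
        (\<lambda>n. integral\<^sup>L (\<mu> n) f) \<longlonglongrightarrow> integral\<^sup>L \<nu> f)"

definition random_finite_graph :: "'p measure \<Rightarrow> ('p \<Rightarrow> 'v graph) \<Rightarrow> bool" where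
  "random_finite_graph P H \<longleftrightarrow> prob_space P \<and> H \<in> P \<rightarrow>\<^sub>M count_space UNIV \<and>
     (AE \<omega> in P. simple_graph (H \<omega>) \<and> finite (verts (H \<omega>)) \<and> verts (H \<omega>) \<noteq> {})"

definition random_rooted_graph :: "'q measure \<Rightarrow> ('q \<Rightarrow> 'w graph \<times> 'w) \<Rightarrow> bool" where
  "random_rooted_graph Q X \<longleftrightarrow> prob_space Q \<and> (\<lambda>\<omega>. rooted_class (X \<omega>)) \<in> borel_measurable Q \<and>
     (AE \<omega> in Q. lf_rooted (X \<omega>))"

text \<open>The law of \<open>(B\<^bsub>H\<^esub>(\<rho>, r), \<rho>)\<close> where, given \<open>H\<close>, the root \<open>\<rho>\<close> is a uniform vertex of \<open>H\<close>.\<close>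

definition uniform_root_ball_law :: "'p measure \<Rightarrow> ('p \<Rightarrow> 'v graph) \<Rightarrow> nat \<Rightarrow> rooted_graph measure" where
  "uniform_root_ball_law P H r =
     P \<bind> (\<lambda>\<omega>. distr (measure_pmf (pmf_of_set (verts (H \<omega>)))) borel
                   (\<lambda>\<rho>. rooted_class (rooted_ball (H \<omega>, \<rho>) r)))"

definition is_local_limit ::
  "(nat \<Rightarrow> 'p measure) \<Rightarrow> (nat \<Rightarrow> 'p \<Rightarrow> 'v graph) \<Rightarrow> 'q measure \<Rightarrow> ('q \<Rightarrow> 'w graph \<times> 'w) \<Rightarrow> bool" where
  "is_local_limit P H Q X \<longleftrightarrow>
     (\<forall>n. random_finite_graph (P n) (H n)) \<and> random_rooted_graph Q X \<and>
     (\<forall>r>0. converges_weakly (\<lambda>n. uniform_root_ball_law (P n) (H n) r)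
                (distr Q borel (\<lambda>\<omega>. rooted_class (rooted_ball (X \<omega>) r))))"

end

theory Submission
  imports Defs "HOL-Library.Sublist"
begin

text \<open>Multiply the weights of \<open>G n\<close> by its degree \<open>d n\<close>. An edge belongs to the minimal spanning tree iff
  its endpoints are not joined by lighter edges (\<open>mst_eq_kruskal\<close>), and it belongs to the wired minimal
  spanning forest of the Poisson-weighted infinite tree iff one of its two endpoints has a finite
  cluster of lighter edges (\<open>wmsf_edge_iff\<close>). Neither condition is local, but both are approximated
  from below by a local one: \<open>good_graph K l\<close> keeps the edges lighter than \<open>l\<close> that have an endpoint whose
  cluster of lighter edges is exhausted within \<open>K\<close> steps and misses the other endpoint. In the infinite
  tree every edge of the forest is kept once \<open>K\<close> and \<open>l\<close> are large (\<open>wmsf_eventually_good\<close>).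

  In the finite graphs the minimal spanning tree has few further edges, by a deterministic count
  (\<open>kruskal_minus_good_card\<close>): a light edge of it that is not kept merges two clusters of more than \<open>K\<close>
  vertices, which happens at most \<open>card V / (K + 1)\<close> times, and the edges of weight at least \<open>l\<close> are
  no more than the clusters at level \<open>l\<close>, of which the small ones contain a vertex with fewer than \<open>K\<close>
  edges lighter than \<open>l\<close>. For \<open>l\<close> large in terms of \<open>K\<close> such vertices are rare. A few additional edges
  change the ball only around few roots, as long as the balls have bounded size (\<open>card_balls_agree\<close>).

  The local comparison of \<open>G n\<close> with the infinite tree uses lower bounds only (\<open>local_lower_bound\<close>).
  A code is a finite tree, explored to depth \<open>R\<close> along the edges lighter than \<open>l\<close>, with the
  weights rounded down to multiples of \<open>h\<close>, no two edges in the same bin. A code with \<open>m\<close>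
  edges and \<open>t\<close> explored vertices has probability \<open>h ^ m * exp (- l * t)\<close> in the infinite tree
  (\<open>prob_code_event\<close>). In a \<open>d\<close>-regular graph there are at least \<open>(d - m - 1) ^ m\<close> injective
  images of the tree, whatever the short cycles are, and each is realised with probability at least
  \<open>(h / d) ^ m * (1 - l / d) ^ (d * t)\<close>, so in the limit the probability is at least as large
  (\<open>prob_encodes\<close>). Different codes exclude each other (\<open>encodes_unique\<close>), and codes exhaust the
  infinite tree as \<open>h\<close> decreases (\<open>valid_codes_likely\<close>). Thus every event decided by codes has
  asymptotically at least its limiting probability. Lower bounds for an event of the balls of the
  minimal spanning tree and for its complement give convergence.

  It also has to be shown that the component of the root is locally finite. Since a spanning tree has
  no more edges than vertices, the mean size of a unit ball is at most 3, and Markov's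
  inequality passes to the limit (\<open>AE_finite_root_degree\<close>); the other vertices follow because the
  descendants of a vertex carry a Poisson-weighted infinite tree again (\<open>wmsf_descendants\<close>).\<close>

section \<open>Local approximations of the spanning forests, and codes\<close>

definition below :: "'v graph \<Rightarrow> ('v set \<Rightarrow> real) \<Rightarrow> real \<Rightarrow> 'v graph" where
  "below G w t = Graph (verts G) {e \<in> edges G. w e < t}"

definition reach :: "'v rel \<Rightarrow> nat \<Rightarrow> 'v \<Rightarrow> 'v set" where
  "reach A k x = {y. \<exists>j\<le>k. (x, y) \<in> A ^^ j}"

text \<open>The endpoint \<open>z\<close> of the edge \<open>{z, z'}\<close> has a cluster of lighter edges that is exhausted within \<open>K\<close> steps
  and misses \<open>z'\<close>: a condition that looks only at a ball of radius \<open>K + 1\<close>.\<close>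

definition shut_in :: "'v graph \<Rightarrow> ('v set \<Rightarrow> real) \<Rightarrow> nat \<Rightarrow> 'v \<Rightarrow> 'v \<Rightarrow> bool" where
  "shut_in G w K z z' \<longleftrightarrow>
     (let A = adj (below G w (w {z, z'}))
      in A `` reach A K z \<subseteq> reach A K z \<and> z' \<notin> reach A K z)"

definition good_graph :: "nat \<Rightarrow> real \<Rightarrow> 'v graph \<Rightarrow> ('v set \<Rightarrow> real) \<Rightarrow> 'v graph" where
  "good_graph K l G w =
     Graph (verts G) {e \<in> edges G. w e < l \<and> (\<exists>z z'. e = {z, z'} \<and> shut_in G w K z z')}"

text \<open>The output of Kruskal's algorithm, without running it: an edge is accepted iff the lighter edges do not
  already join its endpoints.\<close>

definition kruskal :: "'v graph \<Rightarrow> ('v set \<Rightarrow> real) \<Rightarrow> 'v graph" where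
  "kruskal G w = Graph (verts G)
     {e \<in> edges G. \<forall>z z'. e = {z, z'} \<longrightarrow> (z, z') \<notin> (adj (below G w (w e)))\<^sup>*}"

text \<open>A code \<open>\<tau>\<close> lists for every vertex the bins of the edges to its children in increasing order, so the
  length of \<open>\<tau> v\<close> is the number of children. Bin \<open>b\<close> stands for the weights in
  \<open>{b * h ..< (b + 1) * h}\<close>. Vertices are named as in the Ulam-Harris tree, hence the children are
  numbered from 1.\<close>

definition code_tree :: "(nat list \<Rightarrow> nat list) \<Rightarrow> nat \<Rightarrow> nat list set" where
  "code_tree \<tau> R =
     {v. length v \<le> R \<and> (\<forall>k<length v. 1 \<le> v ! k \<and> v ! k \<le> length (\<tau> (take k v)))}"

definition tree_step :: "nat list \<Rightarrow> nat list \<Rightarrow> bool" where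
  "tree_step v u \<longleftrightarrow> (\<exists>i. u = v @ [i] \<or> v = u @ [i])"

text \<open>Disjoint bins make the order of the weights readable from the code. The value \<open>[]\<close> outside the explored
  tree makes a code determined by its tree, so that different codes exclude each other.\<close>

definition valid_code :: "nat \<Rightarrow> nat \<Rightarrow> (nat list \<Rightarrow> nat list) \<Rightarrow> bool" where
  "valid_code L R \<tau> \<longleftrightarrow>
     (\<forall>v. v \<notin> code_tree \<tau> R \<longrightarrow> \<tau> v = []) \<and>
     (\<forall>v. sorted_wrt (<) (\<tau> v) \<and> set (\<tau> v) \<subseteq> {..<L}) \<and>
     (\<forall>v v'. v \<noteq> v' \<longrightarrow> set (\<tau> v) \<inter> set (\<tau> v') = {})"

text \<open>The weights around \<open>\<rho>\<close> look like the code \<open>\<tau>\<close>, with \<open>\<phi>\<close> the position of its vertices. The vertices up to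
  depth \<open>R\<close> are explored, and those have no edge lighter than \<open>L * h\<close> besides the edges of the code;
  heavier edges, and edges between vertices at depth \<open>R + 1\<close>, are not restricted.\<close>

definition encodes :: "nat \<Rightarrow> real \<Rightarrow> nat \<Rightarrow> (nat list \<Rightarrow> nat list) \<Rightarrow>
    'v graph \<Rightarrow> ('v set \<Rightarrow> real) \<Rightarrow> 'v \<Rightarrow> (nat list \<Rightarrow> 'v) \<Rightarrow> bool" where
  "encodes R h L \<tau> G w \<rho> \<phi> \<longleftrightarrow>
     \<phi> [] = \<rho> \<and> inj_on \<phi> (code_tree \<tau> (Suc R)) \<and> \<phi> ` code_tree \<tau> (Suc R) \<subseteq> verts G \<and>
     (\<forall>v i. v @ [i] \<in> code_tree \<tau> (Suc R) \<longrightarrow> {\<phi> v, \<phi> (v @ [i])} \<in> edges G \<and>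
        real (\<tau> v ! (i - 1)) * h \<le> w {\<phi> v, \<phi> (v @ [i])} \<and>
        w {\<phi> v, \<phi> (v @ [i])} < real (Suc (\<tau> v ! (i - 1))) * h) \<and>
     (\<forall>v\<in>code_tree \<tau> R. \<forall>y. {\<phi> v, y} \<in> edges G \<and> w {\<phi> v, y} < real L * h \<longrightarrow>
        (\<exists>u\<in>code_tree \<tau> (Suc R). y = \<phi> u \<and> tree_step v u))"

text \<open>What holds almost surely for the weights of the Poisson-weighted infinite tree and suffices for the
  deterministic part of the argument.\<close>

definition weight_array :: "(nat list \<Rightarrow> nat \<Rightarrow> real) \<Rightarrow> bool" where
  "weight_array x \<longleftrightarrow> (\<forall>v\<in>verts ulam_harris. 0 \<le> x v 1 \<and> (\<forall>i\<ge>1. x v i < x v (Suc i)) \<and>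
     filterlim (x v) at_top sequentially)"

lemma adj_below: "adj (below G w t) = {(x, y). {x, y} \<in> edges G \<and> w {x, y} < t}"
  by (simp add: below_def adj_def)

lemma adj_below_iff: "(x, y) \<in> adj (below G w t) \<longleftrightarrow> {x, y} \<in> edges G \<and> w {x, y} < t"
  by (simp add: adj_below)

lemma verts_good_graph [simp]: "verts (good_graph K l G w) = verts G"
  by (simp add: good_graph_def)

lemma verts_kruskal [simp]: "verts (kruskal G w) = verts G"
  by (simp add: kruskal_def)

lemma adj_iff: "(u, v) \<in> adj G \<longleftrightarrow> {u, v} \<in> edges G"
  by (simp add: adj_def)

lemma simple_edgeE:
  assumes "simple_graph G" "e \<in> edges G"
  obtains u v where "u \<in> verts G" "v \<in> verts G" "u \<noteq> v" "e = {u, v}"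
  using assms unfolding simple_graph_def by blast

lemma simple_edgeD:
  assumes "simple_graph G" "{u, v} \<in> edges G"
  shows "u \<in> verts G" "v \<in> verts G" "u \<noteq> v"
  using simple_adjD[OF assms(1)] assms(2) by (auto simp: adj_iff)

lemma simple_subgraph:
  "simple_graph G \<Longrightarrow> verts H = verts G \<Longrightarrow> edges H \<subseteq> edges G \<Longrightarrow> simple_graph H"
  unfolding simple_graph_def by auto

lemma sym_adj: "sym (adj G)"
  by (auto intro!: symI adj_sym)

lemma reach_0 [simp]: "reach A 0 x = {x}"
  by (auto simp: reach_def)

lemma reach_self [simp]: "x \<in> reach A k x"
  by (auto simp: reach_def intro!: exI[of _ 0])

lemma reach_mono: "j \<le> k \<Longrightarrow> reach A j x \<subseteq> reach A k x"
  by (auto simp: reach_def intro: order_trans)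

lemma reach_rtrancl: "y \<in> reach A k x \<Longrightarrow> (x, y) \<in> A\<^sup>*"
  by (auto simp: reach_def dest: relpow_imp_rtrancl)

lemma reach_closed:
  assumes "A `` reach A k x \<subseteq> reach A k x" "(x, y) \<in> A\<^sup>*"
  shows "y \<in> reach A k x"
  using assms(2) by induction (use assms(1) in auto)

section \<open>Connectivity of edge sets and the minimal spanning tree\<close>

definition conn :: "'v set set \<Rightarrow> 'v rel" where
  "conn A = {(x, y). {x, y} \<in> A}\<^sup>*"

text \<open>Every edge is a bridge. In this form acyclicity is stable under the exchange of edges.\<close>

definition acyclic_edges :: "'v set set \<Rightarrow> bool" where
  "acyclic_edges A \<longleftrightarrow> (\<forall>u v. {u, v} \<in> A \<longrightarrow> (u, v) \<notin> conn (A - {{u, v}}))"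

lemma adj_rtrancl: "(adj G)\<^sup>* = conn (edges G)"
  by (simp add: conn_def adj_def)

lemma conn_refl [simp]: "(x, x) \<in> conn A"
  by (simp add: conn_def)

lemma conn_edge: "{x, y} \<in> A \<Longrightarrow> (x, y) \<in> conn A"
  by (auto simp: conn_def)

lemma conn_trans: "(x, y) \<in> conn A \<Longrightarrow> (y, z) \<in> conn A \<Longrightarrow> (x, z) \<in> conn A"
  unfolding conn_def by (rule rtrancl_trans)

lemma conn_sym: "(x, y) \<in> conn A \<Longrightarrow> (y, x) \<in> conn A"
proof -
  have "sym {(x, y). {x, y} \<in> A}" by (auto intro!: symI simp: insert_commute)
  then show "(x, y) \<in> conn A \<Longrightarrow> (y, x) \<in> conn A"
    unfolding conn_def by (metis sym_rtrancl symD)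
qed

lemma conn_least:
  assumes "\<And>c d. {c, d} \<in> A \<Longrightarrow> (c, d) \<in> conn B" shows "conn A \<subseteq> conn B"
proof
  fix p assume "p \<in> conn A"
  then obtain x y where p: "p = (x, y)" "(x, y) \<in> {(x, y). {x, y} \<in> A}\<^sup>*"
    by (cases p) (auto simp: conn_def)
  from p(2) have "(x, y) \<in> conn B"
    by induction (use assms in \<open>auto intro: conn_trans\<close>)
  with p show "p \<in> conn B" by simp
qed

lemma conn_mono: "A \<subseteq> B \<Longrightarrow> conn A \<subseteq> conn B"
  by (rule conn_least) (auto intro: conn_edge)

lemma conn_insert:
  "(x, y) \<in> conn (insert {a, b} A) \<longleftrightarrow>
     (x, y) \<in> conn A \<or> (x, a) \<in> conn A \<and> (b, y) \<in> conn A \<or> (x, b) \<in> conn A \<and> (a, y) \<in> conn A"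
  (is "?l \<longleftrightarrow> ?r x y")
proof
  assume ?l
  then have "(x, y) \<in> {(x, y). {x, y} \<in> insert {a, b} A}\<^sup>*" by (simp add: conn_def)
  then show "?r x y"
  proof induction
    case base then show ?case by simp
  next
    case (step y z)
    then consider "{y, z} \<in> A" | "y = a" "z = b" | "y = b" "z = a" by (auto simp: doubleton_eq_iff)
    then show ?case
    proof cases
      case 1
      then have "(y, z) \<in> conn A" by (rule conn_edge)
      with step.IH show ?thesis by (meson conn_trans)
    next
      case 2
      with step.IH show ?thesis by (meson conn_refl conn_trans conn_sym)
    next
      case 3
      with step.IH show ?thesis by (meson conn_refl conn_trans conn_sym)
    qed
  qed
next
  assume r: "?r x y"
  have *: "conn A \<subseteq> conn (insert {a, b} A)" by (rule conn_mono) auto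
  have "(a, b) \<in> conn (insert {a, b} A)" by (rule conn_edge) simp
  with r * show ?l by (meson conn_trans conn_sym subsetD)
qed

lemma acyclic_insert:
  assumes A: "acyclic_edges A" and pq: "(p, q) \<notin> conn A"
  shows "acyclic_edges (insert {p, q} A)"
  unfolding acyclic_edges_def
proof (intro allI impI notI)
  fix u v assume uv: "{u, v} \<in> insert {p, q} A" and c: "(u, v) \<in> conn (insert {p, q} A - {{u, v}})"
  have npq: "{p, q} \<notin> A" using pq conn_edge by metis
  show False
  proof (cases "{u, v} = {p, q}")
    case True
    then have "insert {p, q} A - {{u, v}} = A" using npq by auto
    with c have "(u, v) \<in> conn A" by simp
    moreover have "u = p \<and> v = q \<or> u = q \<and> v = p" using True by (auto simp: doubleton_eq_iff)
    ultimately show False using pq conn_sym by metis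
  next
    case False
    then have uvA: "{u, v} \<in> A" using uv by auto
    have "insert {p, q} A - {{u, v}} = insert {p, q} (A - {{u, v}})" using False by auto
    with c have c': "(u, v) \<in> conn (insert {p, q} (A - {{u, v}}))" by simp
    have m: "conn (A - {{u, v}}) \<subseteq> conn A" by (rule conn_mono) auto
    have n: "(u, v) \<notin> conn (A - {{u, v}})" using A uvA unfolding acyclic_edges_def by blast
    have uv': "(u, v) \<in> conn A" using uvA by (rule conn_edge)
    from c' n consider "(u, p) \<in> conn A" "(q, v) \<in> conn A" | "(u, q) \<in> conn A" "(p, v) \<in> conn A"
      unfolding conn_insert using m by blast
    then have "(p, q) \<in> conn A" by cases (use uv' in \<open>meson conn_trans conn_sym\<close>)+
    with pq show False by simp
  qed
qed

lemma acyclic_subset: "acyclic_edges A \<Longrightarrow> B \<subseteq> A \<Longrightarrow> acyclic_edges B"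
  unfolding acyclic_edges_def by (meson Diff_mono conn_mono order_refl subsetD)

lemma distinct_path:
  assumes "(u, v) \<in> R\<^sup>*"
  shows "\<exists>p. distinct p \<and> p \<noteq> [] \<and> hd p = u \<and> last p = v \<and> (\<forall>i. Suc i < length p \<longrightarrow> (p ! i, p ! Suc i) \<in> R)"
  using assms
proof induction
  case base
  show ?case by (rule exI[of _ "[u]"]) auto
next
  case (step y z)
  then obtain p where p: "distinct p" "p \<noteq> []" "hd p = u" "last p = y"
    "\<And>i. Suc i < length p \<Longrightarrow> (p ! i, p ! Suc i) \<in> R" by blast
  show ?case
  proof (cases "z \<in> set p")
    case True
    then obtain k where k: "k < length p" "p ! k = z" by (auto simp: in_set_conv_nth)
    have "last (take (Suc k) p) = z" using k by (simp add: take_Suc_conv_app_nth)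
    then show ?thesis
      using p k by (intro exI[of _ "take (Suc k) p"]) (auto simp: hd_conv_nth)
  next
    case False
    have "((p @ [z]) ! i, (p @ [z]) ! Suc i) \<in> R" if "Suc i < length (p @ [z])" for i
    proof (cases "Suc i < length p")
      case True then show ?thesis using p(5)[of i] by (simp add: nth_append)
    next
      case False
      with that have "i = length p - 1" "Suc i = length p" by auto
      then show ?thesis using p(2,4) step.hyps(2) by (simp add: nth_append last_conv_nth)
    qed
    then show ?thesis using p False by (intro exI[of _ "p @ [z]"]) auto
  qed
qed

text \<open>A path without repetition that joins the endpoints of an edge and avoids this edge closes up to a
  cycle; it has length at least 3 because the edge itself is avoided.\<close>

lemma no_cycle_iff_acyclic:
  assumes s: "simple_graph T"
  shows "(\<nexists>p. is_cycle T p) \<longleftrightarrow> acyclic_edges (edges T)"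
proof
  assume nc: "\<nexists>p. is_cycle T p"
  show "acyclic_edges (edges T)" unfolding acyclic_edges_def
  proof (intro allI impI notI)
    fix u v assume uv: "{u, v} \<in> edges T" and c: "(u, v) \<in> conn (edges T - {{u, v}})"
    have ne: "u \<noteq> v" using simple_edgeD[OF s uv] by simp
    obtain p where p: "distinct p" "p \<noteq> []" "hd p = u" "last p = v"
      "\<And>i. Suc i < length p \<Longrightarrow> {p ! i, p ! Suc i} \<in> edges T - {{u, v}}"
      using distinct_path[OF c[unfolded conn_def]] by blast
    have l1: "length p \<noteq> 1" using p(3,4) ne by (cases p) auto
    have l2: "length p \<noteq> 2"
    proof
      assume "length p = 2"
      then have "p ! 0 = u" "p ! 1 = v" "Suc 0 < length p"
        using p by (auto simp: hd_conv_nth last_conv_nth)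
      with p(5)[of 0] show False by simp
    qed
    have l3: "length p \<ge> 3" using l1 l2 p(2) by (metis One_nat_def Suc_1 Suc_leI length_0_conv less_one linorder_neqE_nat not_less_eq numeral_3_eq_3)
    have "{p ! i, p ! (Suc i mod length p)} \<in> edges T" if "i < length p" for i
    proof (cases "Suc i < length p")
      case True then show ?thesis using p(5)[of i] by simp
    next
      case False
      with that have "Suc i = length p" by simp
      then have "i = length p - 1" "Suc i mod length p = 0" by auto
      then show ?thesis using p uv by (simp add: hd_conv_nth last_conv_nth insert_commute)
    qed
    then have "is_cycle T p" using l3 p by (simp add: is_cycle_def)
    with nc show False by blast
  qed
next
  assume A: "acyclic_edges (edges T)"
  show "\<nexists>p. is_cycle T p"
  proof
    assume "\<exists>p. is_cycle T p"
    then obtain p where l: "length p \<ge> 3" and d: "distinct p"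
      and e: "\<And>i. i < length p \<Longrightarrow> {p ! i, p ! (Suc i mod length p)} \<in> edges T"
      unfolding is_cycle_def by blast
    define n where "n = length p - 1"
    have n: "length p = Suc n" "n \<ge> 2" using l by (auto simp: n_def)
    have last: "{p ! 0, p ! n} \<in> edges T" using e[of n] n by (simp add: insert_commute)
    have inj: "p ! i = p ! j \<longleftrightarrow> i = j" if "i \<le> n" "j \<le> n" for i j
      using d n that by (simp add: nth_eq_iff_index_eq)
    have "(p ! 0, p ! i) \<in> conn (edges T - {{p ! 0, p ! n}})" if "i \<le> n" for i
      using that
    proof (induction i)
      case 0 then show ?case by simp
    next
      case (Suc i)
      have "{p ! i, p ! Suc i} \<in> edges T" using e[of i] Suc.prems n by simp
      moreover have "{p ! i, p ! Suc i} \<noteq> {p ! 0, p ! n}"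
        using Suc.prems n inj[of i 0] inj[of "Suc i" 0] inj[of "Suc i" n] by (auto simp: doubleton_eq_iff)
      ultimately have "(p ! i, p ! Suc i) \<in> conn (edges T - {{p ! 0, p ! n}})"
        by (intro conn_edge) auto
      with Suc show ?case by (meson Suc_leD conn_trans)
    qed
    then have "(p ! 0, p ! n) \<in> conn (edges T - {{p ! 0, p ! n}})" by simp
    with A last show False unfolding acyclic_edges_def by blast
  qed
qed

lemma finite_edges:
  assumes s: "simple_graph G" and f: "finite (verts G)" shows "finite (edges G)"
proof (rule finite_subset)
  show "edges G \<subseteq> Pow (verts G)"
  proof
    fix e assume "e \<in> edges G"
    then obtain u v where "u \<in> verts G" "v \<in> verts G" "e = {u, v}" by (rule simple_edgeE[OF s])
    then show "e \<in> Pow (verts G)" by simp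
  qed
qed (use f in simp)

lemma edges_kruskal_iff:
  "{a, b} \<in> edges (kruskal G w) \<longleftrightarrow>
     {a, b} \<in> edges G \<and> (a, b) \<notin> conn {f \<in> edges G. w f < w {a, b}}"
proof -
  have "(z, z') \<in> conn X \<longleftrightarrow> (a, b) \<in> conn X" if "{a, b} = {z, z'}" for z z' X
    using that conn_sym unfolding doubleton_eq_iff by metis
  then show ?thesis
    unfolding kruskal_def graph.sel adj_rtrancl below_def mem_Collect_eq by blast
qed

lemma kruskal_subset: "edges (kruskal G w) \<subseteq> edges G"
  by (auto simp: kruskal_def)

lemma acyclic_kruskal:
  assumes s: "simple_graph G" and f: "finite (verts G)" and i: "inj_on w (edges G)"
  shows "acyclic_edges (edges (kruskal G w))"
proof -
  have fE: "finite (edges (kruskal G w))"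
    using finite_edges[OF s f] kruskal_subset finite_subset by blast
  have "S \<subseteq> edges (kruskal G w) \<longrightarrow> acyclic_edges S" if "finite S" for S
    using that
  proof (induction S rule: finite_ranking_induct[where f = w])
    case empty then show ?case by (simp add: acyclic_edges_def)
  next
    case (insert x S)
    show ?case
    proof (cases "x \<in> S")
      case True then show ?thesis using insert by (simp add: insert_absorb)
    next
      case False
      show ?thesis
      proof
        assume sub: "insert x S \<subseteq> edges (kruskal G w)"
        then have xk: "x \<in> edges (kruskal G w)" and xG: "x \<in> edges G" using kruskal_subset by auto
        obtain a b where ab: "x = {a, b}" using simple_edgeE[OF s xG] by metis
        have "S \<subseteq> {f \<in> edges G. w f < w x}"
        proof
          fix y assume y: "y \<in> S"
          then have "y \<in> edges G" "y \<noteq> x" "w y \<le> w x" using sub kruskal_subset[of G w] False insert by auto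
          moreover have "w y \<noteq> w x" using inj_onD[OF i, of y x] calculation xG by auto
          ultimately show "y \<in> {f \<in> edges G. w f < w x}" by simp
        qed
        then have "conn S \<subseteq> conn {f \<in> edges G. w f < w x}" by (rule conn_mono)
        then have "(a, b) \<notin> conn S" using xk by (auto simp: ab edges_kruskal_iff)
        then show "acyclic_edges (insert x S)" unfolding ab using insert sub by (intro acyclic_insert) auto
      qed
    qed
  qed
  with fE show ?thesis by blast
qed

lemma conn_kruskal:
  assumes s: "simple_graph G" and f: "finite (verts G)"
  shows "conn (edges (kruskal G w)) = conn (edges G)"
proof
  show "conn (edges (kruskal G w)) \<subseteq> conn (edges G)" by (rule conn_mono[OF kruskal_subset])
  have fE: "finite (edges G)" using finite_edges[OF s f] .
  have "{a, b} \<in> edges G \<Longrightarrow> (a, b) \<in> conn (edges (kruskal G w))" for a b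
  proof (induction "card {f \<in> edges G. w f < w {a, b}}" arbitrary: a b rule: less_induct)
    case less
    show ?case
    proof (cases "{a, b} \<in> edges (kruskal G w)")
      case True then show ?thesis by (rule conn_edge)
    next
      case False
      then have c: "(a, b) \<in> conn {f \<in> edges G. w f < w {a, b}}"
        using less.prems by (auto simp: edges_kruskal_iff)
      have "conn {f \<in> edges G. w f < w {a, b}} \<subseteq> conn (edges (kruskal G w))"
      proof (rule conn_least)
        fix c d assume cd: "{c, d} \<in> {f \<in> edges G. w f < w {a, b}}"
        have "card {f \<in> edges G. w f < w {c, d}} < card {f \<in> edges G. w f < w {a, b}}"
          using cd fE by (intro psubset_card_mono) auto
        then show "(c, d) \<in> conn (edges (kruskal G w))" using less.hyps cd by blast
      qed
      with c show ?thesis by blast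
    qed
  qed
  then show "conn (edges G) \<subseteq> conn (edges (kruskal G w))" by (rule conn_least)
qed

lemma spanning_tree_iff:
  assumes s: "simple_graph G" and c: "verts G \<noteq> {}"
  shows "spanning_tree G T \<longleftrightarrow> verts T = verts G \<and> edges T \<subseteq> edges G \<and> acyclic_edges (edges T) \<and>
     verts G \<times> verts G \<subseteq> conn (edges T)"
  using simple_subgraph[OF s, of T] no_cycle_iff_acyclic[of T] c
  unfolding spanning_tree_def is_tree_def graph_connected_def adj_rtrancl by blast

lemma spanning_tree_kruskal:
  assumes s: "simple_graph G" and f: "finite (verts G)" and c: "graph_connected G"
    and i: "inj_on w (edges G)"
  shows "spanning_tree G (kruskal G w)"
proof -
  have c': "verts G \<noteq> {}" "verts G \<times> verts G \<subseteq> conn (edges G)"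
    using c unfolding graph_connected_def adj_rtrancl by auto
  show ?thesis
    unfolding spanning_tree_iff[OF s c'(1)]
    using acyclic_kruskal[OF s f i] conn_kruskal[OF s f, of w] kruskal_subset[of G w] c'(2) by simp
qed

text \<open>A spanning tree of minimal weight has no edge whose endpoints are joined by lighter edges:
  otherwise one of these lighter edges reconnects the two sides left by its removal. So it is
  contained in the acyclic set of Kruskal edges, and being connected it is all of it.\<close>

lemma mst_edges_kruskal:
  assumes s: "simple_graph G" and f: "finite (verts G)" and c: "graph_connected G"
    and i: "inj_on w (edges G)" and T: "is_mst G w T"
  shows "T = kruskal G w"
proof -
  have c': "verts G \<noteq> {}" using c unfolding graph_connected_def by auto
  have sp: "spanning_tree G T" using T by (simp add: is_mst_def)
  then have VT: "verts T = verts G" and ET: "edges T \<subseteq> edges G" and AT: "acyclic_edges (edges T)"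
    and CT: "verts G \<times> verts G \<subseteq> conn (edges T)"
    unfolding spanning_tree_iff[OF s c'] by auto
  have fT: "finite (edges T)" using finite_edges[OF s f] ET finite_subset by blast
  have sub: "edges T \<subseteq> edges (kruskal G w)"
  proof
    fix e assume e: "e \<in> edges T"
    then have eG: "e \<in> edges G" using ET by blast
    then obtain a b where ab: "e = {a, b}" "a \<in> verts G" "b \<in> verts G" using simple_edgeE[OF s] by metis
    show "e \<in> edges (kruskal G w)"
    proof (rule ccontr)
      assume "e \<notin> edges (kruskal G w)"
      then have c1: "(a, b) \<in> conn {f \<in> edges G. w f < w e}" using eG by (auto simp: ab edges_kruskal_iff)
      let ?A = "edges T - {e}"
      have c2: "(a, b) \<notin> conn ?A" using AT e unfolding acyclic_edges_def ab(1) by blast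
      then obtain c d where cd: "{c, d} \<in> edges G" "w {c, d} < w e" "(c, d) \<notin> conn ?A"
        using c1 conn_least[of "{f \<in> edges G. w f < w e}" ?A] by blast
      \<comment> \<open>Exchanging the edge for the lighter edge \<open>{c, d}\<close> gives a lighter spanning tree.\<close>
      have cdV: "c \<in> verts G" "d \<in> verts G" using simple_edgeD[OF s cd(1)] by auto
      have cdT: "{c, d} \<notin> edges T" using cd conn_edge[of c d ?A] by auto
      define T' where "T' = Graph (verts G) (insert {c, d} ?A)"
      have eq: "insert {a, b} ?A = edges T" using e ab by auto
      have "(c, d) \<in> conn (insert {a, b} ?A)" unfolding eq using CT cdV by auto
      then have ab': "(a, b) \<in> conn (insert {c, d} ?A)"
        unfolding conn_insert using cd(3) by (meson conn_sym)
      have "conn (insert {a, b} ?A) \<subseteq> conn (insert {c, d} ?A)"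
      proof (rule conn_least)
        fix x y assume "{x, y} \<in> insert {a, b} ?A"
        then consider "{x, y} \<in> ?A" | "x = a" "y = b" | "x = b" "y = a" by (auto simp: doubleton_eq_iff)
        then show "(x, y) \<in> conn (insert {c, d} ?A)"
          by cases (use ab' in \<open>auto intro: conn_edge conn_sym\<close>)
      qed
      then have "spanning_tree G T'"
        unfolding spanning_tree_iff[OF s c']
        using CT cd(1) ET acyclic_insert[OF acyclic_subset[OF AT] cd(3)] by (auto simp: T'_def eq)
      then have "sum w (edges T) \<le> sum w (edges T')" using T by (simp add: is_mst_def)
      moreover have "sum w (edges T') = w {c, d} + sum w ?A"
        using fT cdT by (simp add: T'_def)
      moreover have "sum w (edges T) = w e + sum w ?A" using fT e by (simp add: sum.remove)
      ultimately show False using cd(2) by simp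
    qed
  qed
  moreover have "edges (kruskal G w) \<subseteq> edges T"
  proof
    fix e assume e: "e \<in> edges (kruskal G w)"
    then have eG: "e \<in> edges G" using kruskal_subset by blast
    then obtain a b where ab: "e = {a, b}" "a \<in> verts G" "b \<in> verts G" using simple_edgeE[OF s] by metis
    show "e \<in> edges T"
    proof (rule ccontr)
      assume "e \<notin> edges T"
      then have "conn (edges T) \<subseteq> conn (edges (kruskal G w) - {e})" using sub by (intro conn_mono) auto
      then have "(a, b) \<in> conn (edges (kruskal G w) - {e})" using CT ab by auto
      with acyclic_kruskal[OF s f i] e show False unfolding acyclic_edges_def ab(1) by blast
    qed
  qed
  ultimately show ?thesis using VT by (cases T) (auto simp: kruskal_def)
qed

lemma finite_spanning_trees:
  assumes "simple_graph G" "finite (verts G)"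
  shows "finite {T. spanning_tree G T}"
proof -
  have "{T. spanning_tree G T} \<subseteq> Graph (verts G) ` Pow (edges G)"
  proof
    fix T assume "T \<in> {T. spanning_tree G T}"
    then have "T = Graph (verts G) (edges T)" "edges T \<in> Pow (edges G)"
      by (cases T, auto simp: spanning_tree_def)+
    then show "T \<in> Graph (verts G) ` Pow (edges G)" by blast
  qed
  then show ?thesis using finite_edges[OF assms] finite_subset by blast
qed

lemma mst_eq_kruskal:
  assumes s: "simple_graph G" and f: "finite (verts G)" and c: "graph_connected G"
    and i: "inj_on w (edges G)"
  shows "mst G w = kruskal G w"
proof -
  let ?S = "{T. spanning_tree G T}"
  have "finite ?S" "?S \<noteq> {}" using finite_spanning_trees[OF s f] spanning_tree_kruskal[OF s f c i] by auto
  from arg_min_if_finite[OF this, of "\<lambda>T. sum w (edges T)"]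
  obtain T where "T \<in> ?S" "\<And>T'. T' \<in> ?S \<Longrightarrow> sum w (edges T) \<le> sum w (edges T')"
    by (meson not_le)
  then have m: "is_mst G w T" by (simp add: is_mst_def)
  show ?thesis unfolding mst_def
  proof (rule the_equality)
    show "is_mst G w (kruskal G w)" using m mst_edges_kruskal[OF s f c i m] by simp
  qed (rule mst_edges_kruskal[OF s f c i])
qed

section \<open>Counting the edges of the minimal spanning tree\<close>

definition cluster :: "'v set set \<Rightarrow> 'v \<Rightarrow> 'v set" where
  "cluster A v = {u. (v, u) \<in> conn A}"

definition clusters :: "'v set \<Rightarrow> 'v set set \<Rightarrow> 'v set set" where
  "clusters V A = cluster A ` V"

lemma cluster_self [simp]: "v \<in> cluster A v"
  by (simp add: cluster_def)

lemma cluster_eqI: "(u, v) \<in> conn A \<Longrightarrow> cluster A u = cluster A v"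
  unfolding cluster_def by (meson conn_trans conn_sym Collect_cong)

lemma cluster_eq_iff: "cluster A u = cluster A v \<longleftrightarrow> (u, v) \<in> conn A"
  using cluster_eqI by (metis cluster_def conn_refl mem_Collect_eq conn_sym)

lemma cluster_disjoint: "cluster A u \<noteq> cluster A v \<Longrightarrow> cluster A u \<inter> cluster A v = {}"
  unfolding cluster_eq_iff by (auto simp: cluster_def) (meson conn_trans conn_sym)

lemma cluster_subset:
  assumes "simple_graph G" "A \<subseteq> edges G" "v \<in> verts G"
  shows "cluster A v \<subseteq> verts G"
proof
  fix u assume "u \<in> cluster A v"
  then have "(v, u) \<in> {(x, y). {x, y} \<in> A}\<^sup>*" by (simp add: cluster_def conn_def)
  then show "u \<in> verts G"
  proof induction
    case base then show ?case using assms by simp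
  next
    case (step y z)
    then show ?case using simple_edgeD[OF assms(1), of y z] assms(2) by auto
  qed
qed

lemma cluster_insert:
  assumes n: "(a, b) \<notin> conn A"
  shows "cluster (insert {a, b} A) v =
    (if v \<in> cluster A a \<union> cluster A b then cluster A a \<union> cluster A b else cluster A v)"
  unfolding cluster_def conn_insert by (auto intro: conn_trans conn_sym)

lemma clusters_insert:
  assumes n: "(a, b) \<notin> conn A" and V: "a \<in> V" "b \<in> V"
  shows "clusters V (insert {a, b} A) =
    insert (cluster A a \<union> cluster A b) (clusters V A - {cluster A a, cluster A b})"
proof -
  have *: "cluster A v = cluster A a \<or> cluster A v = cluster A b \<longleftrightarrow> v \<in> cluster A a \<union> cluster A b" for v
    unfolding cluster_eq_iff by (auto simp: cluster_def intro: conn_sym)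
  show ?thesis
  proof (rule set_eqI)
    fix X
    show "X \<in> clusters V (insert {a, b} A) \<longleftrightarrow>
      X \<in> insert (cluster A a \<union> cluster A b) (clusters V A - {cluster A a, cluster A b})"
    proof
      assume "X \<in> clusters V (insert {a, b} A)"
      then obtain v where v: "v \<in> V" "X = cluster (insert {a, b} A) v" by (auto simp: clusters_def)
      then show "X \<in> insert (cluster A a \<union> cluster A b) (clusters V A - {cluster A a, cluster A b})"
        using *[of v] unfolding cluster_insert[OF n] clusters_def by (auto split: if_splits)
    next
      assume "X \<in> insert (cluster A a \<union> cluster A b) (clusters V A - {cluster A a, cluster A b})"
      then consider "X = cluster A a \<union> cluster A b" |
        v where "v \<in> V" "X = cluster A v" "X \<noteq> cluster A a" "X \<noteq> cluster A b"
        by (auto simp: clusters_def)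
      then show "X \<in> clusters V (insert {a, b} A)"
      proof cases
        case 1
        then have "X = cluster (insert {a, b} A) a" unfolding cluster_insert[OF n] by simp
        then show ?thesis using V by (simp add: clusters_def)
      next
        case 2
        then have "X = cluster (insert {a, b} A) v" using *[of v] unfolding cluster_insert[OF n] by simp
        then show ?thesis using 2 by (simp add: clusters_def)
      qed
    qed
  qed
qed

lemma clusters_insert_conn:
  assumes "(a, b) \<in> conn A" shows "clusters V (insert {a, b} A) = clusters V A"
proof -
  have "conn (insert {a, b} A) = conn A"
  proof (rule antisym)
    show "conn (insert {a, b} A) \<subseteq> conn A"
      by (rule conn_least) (use assms in \<open>auto simp: doubleton_eq_iff intro: conn_edge conn_sym\<close>)
  qed (rule conn_mono, auto)
  then show ?thesis by (simp add: clusters_def cluster_def)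
qed

text \<open>Kruskal's algorithm adds the edges in increasing order, so up to the next edge \<open>x\<close> the edges
  present are those lighter than \<open>x\<close>.\<close>

lemma lower_set_eq:
  fixes w :: "'e \<Rightarrow> real"
  assumes i: "inj_on w E" and S: "insert x S \<subseteq> E" "x \<notin> S" "\<And>y. y \<in> S \<Longrightarrow> w y \<le> w x"
    and low: "\<And>e f. e \<in> insert x S \<Longrightarrow> f \<in> E \<Longrightarrow> w f < w e \<Longrightarrow> f \<in> insert x S"
  shows "S = {f \<in> E. w f < w x}"
proof (rule set_eqI)
  fix y
  show "y \<in> S \<longleftrightarrow> y \<in> {f \<in> E. w f < w x}"
  proof
    assume y: "y \<in> S"
    then have "w y \<noteq> w x" using i S by (metis inj_onD insert_subset subsetD)
    then show "y \<in> {f \<in> E. w f < w x}" using S y by force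
  next
    assume "y \<in> {f \<in> E. w f < w x}"
    then show "y \<in> S" using low[of x y] by auto
  qed
qed

lemma lower_set_lower:
  assumes "S = {f \<in> E. w f < w x}" "e \<in> S" "f \<in> E" "w f < (w e :: real)" shows "f \<in> S"
  using assms by auto

definition big_clusters :: "nat \<Rightarrow> 'v set \<Rightarrow> 'v set set \<Rightarrow> 'v set set" where
  "big_clusters K V A = {C \<in> clusters V A. card C > K}"

text \<open>The edges that merge two clusters of more than \<open>K\<close> vertices each when they are added in increasing order.\<close>

definition balanced_edges :: "nat \<Rightarrow> 'v graph \<Rightarrow> ('v set \<Rightarrow> real) \<Rightarrow> 'v set set" where
  "balanced_edges K G w = {e \<in> edges (kruskal G w).
     \<forall>z\<in>e. card (cluster {f \<in> edges G. w f < w e} z) > K}"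

text \<open>When the edges are added in increasing order, call a cluster big if it has more than \<open>K\<close> vertices.
  A Kruskal edge joining two big clusters lowers the number of big clusters by one, and a new
  big cluster needs \<open>K + 1\<close> vertices that were in no big cluster before. Hence the sum of the number
  of balanced edges so far and the number of big clusters is at most \<open>1 / (K + 1)\<close> times the number
  of vertices in big clusters.\<close>

lemma balanced_edges_potential:
  assumes s: "simple_graph G" and f: "finite (verts G)" and i: "inj_on w (edges G)"
    and S: "finite S" "S \<subseteq> edges G" "\<And>e f. e \<in> S \<Longrightarrow> f \<in> edges G \<Longrightarrow> w f < w e \<Longrightarrow> f \<in> S"
  shows "Suc K * (card (S \<inter> balanced_edges K G w) + card (big_clusters K (verts G) S))
    \<le> card (\<Union> (big_clusters K (verts G) S))"
  using S
proof (induction S rule: finite_ranking_induct[where f = w])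
  case empty
  show ?case
  proof -
    have "conn {} = (Id :: ('a \<times> 'a) set)" by (auto simp: conn_def)
    then have c: "C \<in> clusters (verts G) {} \<Longrightarrow> card C = 1" for C
      by (auto simp: clusters_def cluster_def)
    show ?thesis
    proof (cases "K = 0")
      case True
      have "big_clusters K (verts G) {} = (\<lambda>v. {v}) ` verts G" unfolding big_clusters_def True
        using c by (auto simp: clusters_def cluster_def \<open>conn {} = Id\<close>)
      then show ?thesis using True by (simp add: card_image)
    next
      case False
      have "big_clusters K (verts G) {} = {}" unfolding big_clusters_def using c False by auto
      then show ?thesis by simp
    qed
  qed
next
  case (insert x S)
  let ?V = "verts G"
  show ?case
  proof (cases "x \<in> S")
    case True then show ?thesis using insert by (simp add: insert_absorb)
  next
    case False
    have xG: "x \<in> edges G" using insert.prems by simp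
    obtain a b where ab: "a \<in> ?V" "b \<in> ?V" "x = {a, b}" using simple_edgeE[OF s xG] by metis
    have Seq: "S = {f \<in> edges G. w f < w x}"
      by (rule lower_set_eq[OF i insert.prems(1) False insert.hyps(2) insert.prems(2)])
    have IH: "Suc K * (card (S \<inter> balanced_edges K G w) + card (big_clusters K ?V S))
        \<le> card (\<Union> (big_clusters K ?V S))"
      by (rule insert.IH) (use insert.prems(1) in simp, erule lower_set_lower[OF Seq])
    have fC: "finite (clusters ?V A)" for A using f by (simp add: clusters_def)
    have fB: "finite (big_clusters K ?V A)" for A using fC by (simp add: big_clusters_def)
    have SG: "S \<subseteq> edges G" using insert.prems by auto
    have cV: "cluster S v \<subseteq> ?V" if "v \<in> ?V" for v using cluster_subset[OF s SG that] .
    have fcl: "finite (cluster S v)" if "v \<in> ?V" for v using cV[OF that] f finite_subset by blast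
    have fU: "finite (\<Union> (big_clusters K ?V S))"
      using fcl by (auto simp: big_clusters_def clusters_def f)
    show ?thesis
    proof (cases "(a, b) \<in> conn S")
      case True
      then have "x \<notin> edges (kruskal G w)" using edges_kruskal_iff[of a b] Seq ab by auto
      then have "insert x S \<inter> balanced_edges K G w = S \<inter> balanced_edges K G w"
        by (auto simp: balanced_edges_def)
      moreover have "big_clusters K ?V (insert x S) = big_clusters K ?V S"
        unfolding big_clusters_def ab(3) clusters_insert_conn[OF True] ..
      ultimately show ?thesis using IH by simp
    next
      case n: False
      then have xk: "x \<in> edges (kruskal G w)" using edges_kruskal_iff[of a b] Seq ab xG by auto
      define Ca Cb where "Ca = cluster S a" and "Cb = cluster S b"
      have ne: "Ca \<noteq> Cb" using n by (simp add: Ca_def Cb_def cluster_eq_iff)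
      have dj: "Ca \<inter> Cb = {}" using cluster_disjoint[OF ne[unfolded Ca_def Cb_def]] by (simp add: Ca_def Cb_def)
      have fab: "finite Ca" "finite Cb" using fcl ab by (auto simp: Ca_def Cb_def)
      have inC: "Ca \<in> clusters ?V S" "Cb \<in> clusters ?V S" using ab by (auto simp: Ca_def Cb_def clusters_def)
      have cu: "card (Ca \<union> Cb) = card Ca + card Cb" using fab dj by (rule card_Un_disjoint)
      have pos: "card Ca > 0" "card Cb > 0"
        using fab by (auto simp: card_gt_0_iff Ca_def Cb_def) (metis cluster_self empty_iff)+
      have new: "clusters ?V (insert x S) = insert (Ca \<union> Cb) (clusters ?V S - {Ca, Cb})"
        unfolding ab(3) Ca_def Cb_def using clusters_insert[OF n ab(1,2)] .
      have notin: "Ca \<union> Cb \<notin> clusters ?V S"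
      proof
        assume "Ca \<union> Cb \<in> clusters ?V S"
        then obtain v where v: "Ca \<union> Cb = cluster S v" by (auto simp: clusters_def)
        have "a \<in> Ca \<union> Cb" "b \<in> Ca \<union> Cb" by (simp_all add: Ca_def Cb_def)
        then have "a \<in> cluster S v" "b \<in> cluster S v" unfolding v by simp_all
        then show False using n unfolding cluster_def mem_Collect_eq by (meson conn_sym conn_trans)
      qed
      define B where "B = big_clusters K ?V S - {Ca, Cb}"
      have fBB: "finite B" using fB by (simp add: B_def)
      have bb: "x \<in> balanced_edges K G w \<longleftrightarrow> card Ca > K \<and> card Cb > K"
      proof -
        have "x \<in> balanced_edges K G w \<longleftrightarrow> (\<forall>z\<in>x. card (cluster S z) > K)"
          using xk Seq by (simp add: balanced_edges_def)
        then show ?thesis by (simp add: ab(3) Ca_def Cb_def)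
      qed
      have disjB: "C \<inter> Ca = {}" "C \<inter> Cb = {}" if "C \<in> B" for C
      proof -
        obtain v where "C = cluster S v" using \<open>C \<in> B\<close> by (auto simp: B_def big_clusters_def clusters_def)
        moreover have "C \<noteq> Ca" "C \<noteq> Cb" using \<open>C \<in> B\<close> by (auto simp: B_def)
        ultimately show "C \<inter> Ca = {}" "C \<inter> Cb = {}"
          unfolding Ca_def Cb_def by (auto intro!: cluster_disjoint simp del: cluster_eq_iff)
      qed
      have fUB: "finite (\<Union> B)" using fU by (rule rev_finite_subset) (auto simp: B_def)
      have dUB: "\<Union> B \<inter> Ca = {}" "\<Union> B \<inter> Cb = {}" "\<Union> B \<inter> (Ca \<union> Cb) = {}" using disjB by auto
      have newbig: "big_clusters K ?V (insert x S) = (if card (Ca \<union> Cb) > K then insert (Ca \<union> Cb) B else B)"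
        unfolding big_clusters_def new B_def by auto
      have oldbig: "big_clusters K ?V S = B \<union> (if card Ca > K then {Ca} else {}) \<union> (if card Cb > K then {Cb} else {})"
        using inC unfolding B_def big_clusters_def by auto
      have nB: "Ca \<notin> B" "Cb \<notin> B" "Ca \<union> Cb \<notin> B" using notin by (auto simp: B_def big_clusters_def)
      have cIns: "card (insert x S \<inter> balanced_edges K G w) =
          card (S \<inter> balanced_edges K G w) + (if x \<in> balanced_edges K G w then 1 else 0)"
        using False insert.hyps(1) by auto
      \<comment> \<open>A merge of two big clusters trades a big cluster for a balanced edge; only the creation of a
        big cluster needs new vertices.\<close>
      consider (bb) "card Ca > K" "card Cb > K" | (bs) "card Ca > K" "\<not> card Cb > K"
        | (sb) "\<not> card Ca > K" "card Cb > K" | (ss) "\<not> card Ca > K" "\<not> card Cb > K" by blast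
      then show ?thesis
      proof cases
        case bb
        then show ?thesis using IH cIns newbig oldbig fBB nB ne fUB dUB cu fab dj \<open>x \<in> _ \<longleftrightarrow> _\<close>
          by (auto simp: card_Un_disjoint Un_commute Un_left_commute)
      next
        case bs
        then have "card (\<Union> (big_clusters K ?V (insert x S))) = card (\<Union> B) + (card Ca + card Cb)"
          "card (\<Union> (big_clusters K ?V S)) = card (\<Union> B) + card Ca"
          using newbig oldbig cu fab fUB dUB by (auto simp: card_Un_disjoint Int_commute Un_commute[of _ "\<Union> B"])
        then show ?thesis using bs IH cIns newbig oldbig fBB nB cu \<open>x \<in> _ \<longleftrightarrow> _\<close> by auto
      next
        case sb
        then have "card (\<Union> (big_clusters K ?V (insert x S))) = card (\<Union> B) + (card Ca + card Cb)"
          "card (\<Union> (big_clusters K ?V S)) = card (\<Union> B) + card Cb"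
          using newbig oldbig cu fab fUB dUB by (auto simp: card_Un_disjoint Int_commute Un_commute[of _ "\<Union> B"])
        then show ?thesis using sb IH cIns newbig oldbig fBB nB cu \<open>x \<in> _ \<longleftrightarrow> _\<close> by auto
      next
        case ss
        show ?thesis
        proof (cases "card (Ca \<union> Cb) > K")
          case True
          then have "card (\<Union> (big_clusters K ?V (insert x S))) = card (\<Union> B) + card (Ca \<union> Cb)"
            using newbig fab fUB dUB by (simp add: card_Un_disjoint Int_commute Un_commute[of _ "\<Union> B"])
          moreover have "Suc K \<le> card (Ca \<union> Cb)" using True by simp
          ultimately show ?thesis using ss True IH cIns newbig oldbig fBB nB \<open>x \<in> _ \<longleftrightarrow> _\<close> by auto
        next
          case False
          then show ?thesis using ss IH cIns newbig oldbig \<open>x \<in> _ \<longleftrightarrow> _\<close> by auto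
        qed
      qed
    qed
  qed
qed

text \<open>Every Kruskal edge of weight at least \<open>l\<close> merges two of the clusters left at level \<open>l\<close>.\<close>

lemma heavy_edges_potential:
  assumes s: "simple_graph G" and f: "finite (verts G)" and i: "inj_on w (edges G)"
    and S: "finite S" "S \<subseteq> {e \<in> edges G. l \<le> w e}"
      "\<And>e f. e \<in> S \<Longrightarrow> f \<in> {e \<in> edges G. l \<le> w e} \<Longrightarrow> w f < w e \<Longrightarrow> f \<in> S"
  shows "card (S \<inter> edges (kruskal G w)) + card (clusters (verts G) (S \<union> {e \<in> edges G. w e < l}))
    \<le> card (clusters (verts G) {e \<in> edges G. w e < l})"
  using S
proof (induction S rule: finite_ranking_induct[where f = w])
  case empty then show ?case by simp
next
  case (insert x S)
  let ?V = "verts G" and ?E = "{e \<in> edges G. w e < l}"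
  show ?case
  proof (cases "x \<in> S")
    case True then show ?thesis using insert by (simp add: insert_absorb)
  next
    case False
    have xG: "x \<in> edges G" and xl: "l \<le> w x" using insert.prems by auto
    obtain a b where ab: "a \<in> ?V" "b \<in> ?V" "x = {a, b}" using simple_edgeE[OF s xG] by metis
    have i': "inj_on w {e \<in> edges G. l \<le> w e}" using i by (rule inj_on_subset) auto
    have Seq: "S = {f \<in> {e \<in> edges G. l \<le> w e}. w f < w x}"
      by (rule lower_set_eq[OF i' insert.prems(1) False insert.hyps(2) insert.prems(2)])
    have SE: "S \<union> ?E = {f \<in> edges G. w f < w x}" unfolding Seq using xl by auto
    have IH: "card (S \<inter> edges (kruskal G w)) + card (clusters ?V (S \<union> ?E)) \<le> card (clusters ?V ?E)"
      by (rule insert.IH) (use insert.prems(1) in simp, erule lower_set_lower[OF Seq])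
    have fC: "finite (clusters ?V A)" for A using f by (simp add: clusters_def)
    show ?thesis
    proof (cases "(a, b) \<in> conn (S \<union> ?E)")
      case True
      then have "x \<notin> edges (kruskal G w)" using edges_kruskal_iff[of a b] SE ab by auto
      moreover have "clusters ?V (insert x S \<union> ?E) = clusters ?V (S \<union> ?E)"
        using clusters_insert_conn[OF True, of ?V] by (simp add: ab(3))
      ultimately show ?thesis using IH by simp
    next
      case n: False
      then have xk: "x \<in> edges (kruskal G w)" using edges_kruskal_iff[of a b] SE ab xG by auto
      define A where "A = S \<union> ?E"
      have nA: "(a, b) \<notin> conn A" using n by (simp add: A_def)
      have new: "clusters ?V (insert x S \<union> ?E) = insert (cluster A a \<union> cluster A b) (clusters ?V A - {cluster A a, cluster A b})"
        using clusters_insert[OF nA ab(1,2)] by (simp add: ab(3) A_def)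
      have in2: "{cluster A a, cluster A b} \<subseteq> clusters ?V A" using ab by (auto simp: clusters_def)
      have "card {cluster A a, cluster A b} = 2" using nA by (simp add: cluster_eq_iff)
      then have "card (clusters ?V A - {cluster A a, cluster A b}) + 2 = card (clusters ?V A)"
        using card_Diff_subset[OF _ in2] card_mono[OF fC in2] by simp
      moreover have "card (clusters ?V (insert x S \<union> ?E)) \<le> Suc (card (clusters ?V A - {cluster A a, cluster A b}))"
        unfolding new by (rule card_insert_le_m1) auto
      moreover have "card (insert x S \<inter> edges (kruskal G w)) = Suc (card (S \<inter> edges (kruskal G w)))"
        using xk False insert.hyps(1) by simp
      ultimately show ?thesis using IH by (simp add: A_def)
    qed
  qed
qed

lemma heavy_kruskal_card:
  assumes s: "simple_graph G" and f: "finite (verts G)" and i: "inj_on w (edges G)"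
  shows "card {e \<in> edges (kruskal G w). l \<le> w e} \<le> card (clusters (verts G) {e \<in> edges G. w e < l})"
proof -
  have "{e \<in> edges (kruskal G w). l \<le> w e} = {e \<in> edges G. l \<le> w e} \<inter> edges (kruskal G w)"
    using kruskal_subset by auto
  then show ?thesis
    using heavy_edges_potential[OF s f i, of "{e \<in> edges G. l \<le> w e}" l] finite_edges[OF s f] by simp
qed

text \<open>At a level that does not exceed any weight the clusters are the single vertices.\<close>

lemma card_kruskal_le:
  assumes s: "simple_graph G" and f: "finite (verts G)" and i: "inj_on w (edges G)"
  shows "card (edges (kruskal G w)) \<le> card (verts G)"
proof -
  have fE: "finite (edges G)" by (rule finite_edges[OF s f])
  define l where "l = Min (insert 0 (w ` edges G))"
  have l: "l \<le> w e" if "e \<in> edges G" for e using fE that by (auto simp: l_def)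
  then have "{e \<in> edges (kruskal G w). l \<le> w e} = edges (kruskal G w)" using kruskal_subset by auto
  then have "card (edges (kruskal G w)) \<le> card (clusters (verts G) {e \<in> edges G. w e < l})"
    using heavy_kruskal_card[OF s f i, of l] by simp
  also have "\<dots> \<le> card (verts G)" unfolding clusters_def by (rule card_image_le[OF f])
  finally show ?thesis .
qed

text \<open>The set reached grows with every step until it is closed.\<close>

lemma card_rtrancl_if_not_closed:
  assumes f: "finite {y. (z, y) \<in> A\<^sup>*}" and n: "\<not> A `` reach A K z \<subseteq> reach A K z"
  shows "card {y. (z, y) \<in> A\<^sup>*} > K"
proof -
  have fin: "finite (reach A j z)" for j
    by (rule finite_subset[OF _ f]) (auto dest: reach_rtrancl)
  have step: "reach A (Suc j) z = insert z (A `` reach A j z)" for j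
  proof (rule set_eqI)
    fix y show "y \<in> reach A (Suc j) z \<longleftrightarrow> y \<in> insert z (A `` reach A j z)"
    proof
      assume "y \<in> reach A (Suc j) z"
      then obtain i where i: "i \<le> Suc j" "(z, y) \<in> A ^^ i" by (auto simp: reach_def)
      show "y \<in> insert z (A `` reach A j z)"
      proof (cases i)
        case 0 then show ?thesis using i by simp
      next
        case (Suc i')
        then obtain x where "(z, x) \<in> A ^^ i'" "(x, y) \<in> A" using i by auto
        then show ?thesis using i Suc by (auto simp: reach_def)
      qed
    next
      assume "y \<in> insert z (A `` reach A j z)"
      then show "y \<in> reach A (Suc j) z"
        by (auto simp: reach_def) (metis Suc_le_mono relpow_Suc_I)+
    qed
  qed
  have grow: "card (reach A j z) > j" if "j \<le> K" for j
    using that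
  proof (induction j)
    case 0 then show ?case by simp
  next
    case (Suc j)
    have "reach A j z \<noteq> reach A (Suc j) z"
    proof
      assume eq: "reach A j z = reach A (Suc j) z"
      have "reach A (j + k) z = reach A j z" for k
      proof (induction k)
        case 0 then show ?case by simp
      next
        case (Suc k)
        have "reach A (j + Suc k) z = insert z (A `` reach A (j + k) z)" using step[of "j + k"] by simp
        also have "\<dots> = reach A (Suc j) z" by (simp add: Suc step)
        finally show ?case using eq by simp
      qed
      from this[of "K - j"] have "reach A K z = reach A j z" using Suc.prems by simp
      moreover have "A `` reach A j z \<subseteq> reach A j z"
        using step[of j] unfolding eq[symmetric] by blast
      ultimately have "A `` reach A K z \<subseteq> reach A K z" by (simp only:)
      with n show False by simp
    qed
    then have "reach A j z \<subset> reach A (Suc j) z" by (simp add: psubset_eq reach_mono)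
    then have "card (reach A j z) < card (reach A (Suc j) z)" by (rule psubset_card_mono[OF fin])
    then show ?case using Suc by simp
  qed
  have "reach A K z \<subseteq> {y. (z, y) \<in> A\<^sup>*}" by (auto dest: reach_rtrancl)
  then have "card (reach A K z) \<le> card {y. (z, y) \<in> A\<^sup>*}" by (rule card_mono[OF f])
  with grow[of K] show ?thesis by simp
qed

lemma good_subset_kruskal: "edges (good_graph K l G w) \<subseteq> edges (kruskal G w)"
proof
  fix e assume "e \<in> edges (good_graph K l G w)"
  then obtain z z' where e: "e \<in> edges G" "e = {z, z'}" "shut_in G w K z z'" by (auto simp: good_graph_def)
  then have "(z, z') \<notin> (adj (below G w (w e)))\<^sup>*"
    using reach_closed unfolding shut_in_def Let_def by metis
  then show "e \<in> edges (kruskal G w)"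
    using e edges_kruskal_iff[of z z' G w] by (simp add: adj_rtrancl below_def)
qed

text \<open>A Kruskal edge never has its endpoints joined by lighter edges, so the only way to be dropped is that the
  clusters of both endpoints are not exhausted within \<open>K\<close> steps.\<close>

lemma good_graph_symmetric_shut:
  assumes "e \<in> edges (kruskal G w)" "e = {z, z'}" "e \<notin> edges (good_graph K l G w)" "w e < l"
  shows "\<not> adj (below G w (w e)) `` reach (adj (below G w (w e))) K z \<subseteq> reach (adj (below G w (w e))) K z"
proof
  assume c: "adj (below G w (w e)) `` reach (adj (below G w (w e))) K z \<subseteq> reach (adj (below G w (w e))) K z"
  have "(z, z') \<notin> (adj (below G w (w e)))\<^sup>*"
    using assms(1,2) edges_kruskal_iff[of z z' G w] by (simp add: adj_rtrancl below_def)
  then have "z' \<notin> reach (adj (below G w (w e))) K z" using reach_rtrancl by metis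
  then have "shut_in G w K z z'" using c assms(2) by (simp add: shut_in_def)
  then show False using assms kruskal_subset by (fastforce simp: good_graph_def)
qed

text \<open>A light edge that is not kept merges two big clusters, and a heavy edge merges two of the clusters at level
  \<open>l\<close>. The big clusters at level \<open>l\<close> are paid for by the same potential as the balanced edges; a small
  cluster contains a vertex with fewer than \<open>K\<close> light edges.\<close>

theorem kruskal_minus_good_card:
  assumes s: "simple_graph G" and f: "finite (verts G)" and i: "inj_on w (edges G)"
  shows "Suc K * card (edges (kruskal G w) - edges (good_graph K l G w))
    \<le> card (verts G) + Suc K * card {v \<in> verts G. card {y. {v, y} \<in> edges G \<and> w {v, y} < l} < K}"
proof -
  let ?V = "verts G" and ?E = "{e \<in> edges G. w e < l}"
  let ?low = "{v \<in> ?V. card {y. {v, y} \<in> edges G \<and> w {v, y} < l} < K}"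
  have fE: "finite (edges G)" by (rule finite_edges[OF s f])
  have fC: "finite (clusters ?V A)" for A using f by (simp add: clusters_def)
  have fcl: "finite (cluster A v)" if "A \<subseteq> edges G" "v \<in> ?V" for A v
    using cluster_subset[OF s that] f finite_subset by blast
  have light: "(edges (kruskal G w) - edges (good_graph K l G w)) \<inter> ?E \<subseteq> ?E \<inter> balanced_edges K G w"
  proof
    fix e assume e: "e \<in> (edges (kruskal G w) - edges (good_graph K l G w)) \<inter> ?E"
    have "card (cluster {f \<in> edges G. w f < w e} z) > K" if z: "z \<in> e" for z
    proof -
      obtain a b where ab: "a \<in> ?V" "b \<in> ?V" "e = {a, b}" using e simple_edgeE[OF s] by (metis Int_iff mem_Collect_eq)
      then obtain z' where z': "e = {z, z'}" using z by auto
      have zV: "z \<in> ?V" using z ab by auto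
      let ?A = "adj (below G w (w e))"
      have eq: "{y. (z, y) \<in> ?A\<^sup>*} = cluster {f \<in> edges G. w f < w e} z"
        by (simp add: adj_rtrancl below_def cluster_def)
      show ?thesis
        using card_rtrancl_if_not_closed[of z ?A K] good_graph_symmetric_shut[of e G w z z' K l] e z'
          fcl[of "{f \<in> edges G. w f < w e}" z] zV unfolding eq by auto
    qed
    then show "e \<in> ?E \<inter> balanced_edges K G w" using e by (auto simp: balanced_edges_def)
  qed
  have bal: "Suc K * (card (?E \<inter> balanced_edges K G w) + card (big_clusters K ?V ?E)) \<le> card ?V"
  proof -
    have "\<Union> (big_clusters K ?V ?E) \<subseteq> ?V"
      using cluster_subset[OF s, of ?E] by (auto simp: big_clusters_def clusters_def)
    then have "card (\<Union> (big_clusters K ?V ?E)) \<le> card ?V" by (rule card_mono[OF f])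
    moreover have "Suc K * (card (?E \<inter> balanced_edges K G w) + card (big_clusters K ?V ?E))
        \<le> card (\<Union> (big_clusters K ?V ?E))"
      by (rule balanced_edges_potential[OF s f i]) (use fE in auto)
    ultimately show ?thesis by simp
  qed
  have small: "card (clusters ?V ?E) \<le> card (big_clusters K ?V ?E) + card ?low"
  proof -
    have "clusters ?V ?E \<subseteq> big_clusters K ?V ?E \<union> cluster ?E ` ?low"
    proof
      fix C assume C: "C \<in> clusters ?V ?E"
      then obtain v where v: "v \<in> ?V" "C = cluster ?E v" by (auto simp: clusters_def)
      show "C \<in> big_clusters K ?V ?E \<union> cluster ?E ` ?low"
      proof (cases "card C > K")
        case True then show ?thesis using C by (simp add: big_clusters_def)
      next
        case False
        let ?N = "{y. {v, y} \<in> edges G \<and> w {v, y} < l}"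
        have sub: "insert v ?N \<subseteq> C" unfolding v by (auto simp: cluster_def intro: conn_edge)
        have vN: "v \<notin> ?N" using simple_edgeD[OF s, of v v] by auto
        have fN: "finite C" unfolding v using fcl[of ?E v] v by auto
        have "finite ?N" by (rule finite_subset[OF _ fN]) (use sub in simp)
        then have "Suc (card ?N) \<le> card C" using card_mono[OF fN sub] vN by simp
        then have "v \<in> ?low" using False v by simp
        then show ?thesis using v by auto
      qed
    qed
    then have "card (clusters ?V ?E) \<le> card (big_clusters K ?V ?E \<union> cluster ?E ` ?low)"
      by (rule card_mono[rotated]) (use f fC in \<open>auto simp: big_clusters_def\<close>)
    also have "\<dots> \<le> card (big_clusters K ?V ?E) + card (cluster ?E ` ?low)" by (rule card_Un_le)
    also have "card (cluster ?E ` ?low) \<le> card ?low" by (rule card_image_le) (use f in simp)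
    finally show ?thesis by simp
  qed
  have fk: "finite (edges (kruskal G w))" using fE kruskal_subset finite_subset by blast
  have "edges (kruskal G w) - edges (good_graph K l G w) \<subseteq>
      (?E \<inter> balanced_edges K G w) \<union> {e \<in> edges (kruskal G w). l \<le> w e}"
    using light kruskal_subset[of G w] by (auto simp: not_less)
  then have "card (edges (kruskal G w) - edges (good_graph K l G w)) \<le>
      card ((?E \<inter> balanced_edges K G w) \<union> {e \<in> edges (kruskal G w). l \<le> w e})"
    by (rule card_mono[rotated]) (use fk fE in auto)
  also have "\<dots> \<le> card (?E \<inter> balanced_edges K G w) + card {e \<in> edges (kruskal G w). l \<le> w e}"
    by (rule card_Un_le)
  also have "\<dots> \<le> card (?E \<inter> balanced_edges K G w) + card (big_clusters K ?V ?E) + card ?low"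
    using heavy_kruskal_card[OF s f i, of l] small by simp
  finally have "Suc K * card (edges (kruskal G w) - edges (good_graph K l G w)) \<le>
      Suc K * (card (?E \<inter> balanced_edges K G w) + card (big_clusters K ?V ?E) + card ?low)"
    by (rule mult_le_mono2)
  also have "\<dots> \<le> card ?V + Suc K * card ?low" using bal by (simp add: algebra_simps)
  finally show ?thesis .
qed

section \<open>Codes of finite weighted trees and their embeddings\<close>

lemma Nil_in_code_tree [simp]: "[] \<in> code_tree \<tau> R"
  by (simp add: code_tree_def)

lemma snoc_in_code_tree:
  "v @ [i] \<in> code_tree \<tau> (Suc R) \<longleftrightarrow> v \<in> code_tree \<tau> R \<and> 1 \<le> i \<and> i \<le> length (\<tau> v)"
proof -
  have "(\<forall>k<Suc (length v). P k) \<longleftrightarrow> (\<forall>k<length v. P k) \<and> P (length v)" for P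
    by (auto simp: less_Suc_eq)
  moreover have "(\<forall>k<length v. 1 \<le> (v @ [i]) ! k \<and> (v @ [i]) ! k \<le> length (\<tau> (take k (v @ [i])))) \<longleftrightarrow>
     (\<forall>k<length v. 1 \<le> v ! k \<and> v ! k \<le> length (\<tau> (take k v)))"
    by (auto simp: nth_append)
  ultimately show ?thesis by (auto simp: code_tree_def)
qed

lemma code_tree_length: "v \<in> code_tree \<tau> R \<Longrightarrow> length v \<le> R"
  by (simp add: code_tree_def)

lemma code_tree_mono: "R \<le> R' \<Longrightarrow> code_tree \<tau> R \<subseteq> code_tree \<tau> R'"
  by (auto simp: code_tree_def)

lemma code_tree_Suc_length: "v \<in> code_tree \<tau> (Suc R) \<Longrightarrow> length v \<le> R \<Longrightarrow> v \<in> code_tree \<tau> R"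
  by (auto simp: code_tree_def)

lemma code_tree_uh: "v \<in> code_tree \<tau> R \<Longrightarrow> set v \<subseteq> {1..}"
  by (fastforce simp: code_tree_def in_set_conv_nth)

lemma code_tree_cases:
  assumes "v \<in> code_tree \<tau> (Suc R)"
  obtains "v = []" | u i where "v = u @ [i]" "u \<in> code_tree \<tau> R" "1 \<le> i" "i \<le> length (\<tau> u)"
proof (cases v rule: rev_cases)
  case Nil then show ?thesis using that by blast
next
  case (snoc u i)
  then show ?thesis using assms that(2)[OF snoc] snoc_in_code_tree[of u i \<tau> R] by blast
qed

lemma finite_code_tree: "finite (code_tree \<tau> R)"
proof (induction R)
  case 0
  have "code_tree \<tau> 0 = {[]}" by (auto simp: code_tree_def)
  then show ?case by simp
next
  case (Suc R)
  have "code_tree \<tau> (Suc R) \<subseteq> insert [] (\<Union>v\<in>code_tree \<tau> R. (\<lambda>i. v @ [i]) ` {1..length (\<tau> v)})"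
  proof
    fix v assume "v \<in> code_tree \<tau> (Suc R)"
    then show "v \<in> insert [] (\<Union>v\<in>code_tree \<tau> R. (\<lambda>i. v @ [i]) ` {1..length (\<tau> v)})"
    proof (cases rule: code_tree_cases)
      case 1 then show ?thesis by simp
    next
      case (2 u i)
      then have "v \<in> (\<lambda>i. u @ [i]) ` {1..length (\<tau> u)}" by auto
      then show ?thesis using 2 by blast
    qed
  qed
  then show ?case using Suc finite_subset by fastforce
qed

lemma tree_step_length: "tree_step u v \<Longrightarrow> length v \<le> Suc (length u)"
  by (auto simp: tree_step_def)

lemma encodesD:
  assumes "encodes R h L \<tau> G w \<rho> \<phi>"
  shows "\<phi> [] = \<rho>" "inj_on \<phi> (code_tree \<tau> (Suc R))" "\<And>v. v \<in> code_tree \<tau> (Suc R) \<Longrightarrow> \<phi> v \<in> verts G"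
    "\<And>v i. v @ [i] \<in> code_tree \<tau> (Suc R) \<Longrightarrow> {\<phi> v, \<phi> (v @ [i])} \<in> edges G"
    "\<And>v i. v @ [i] \<in> code_tree \<tau> (Suc R) \<Longrightarrow> real (\<tau> v ! (i - 1)) * h \<le> w {\<phi> v, \<phi> (v @ [i])}"
    "\<And>v i. v @ [i] \<in> code_tree \<tau> (Suc R) \<Longrightarrow> w {\<phi> v, \<phi> (v @ [i])} < real (Suc (\<tau> v ! (i - 1))) * h"
    "\<And>v y. v \<in> code_tree \<tau> R \<Longrightarrow> {\<phi> v, y} \<in> edges G \<Longrightarrow> w {\<phi> v, y} < real L * h \<Longrightarrow>
        \<exists>u\<in>code_tree \<tau> (Suc R). y = \<phi> u \<and> tree_step v u"
  using assms unfolding encodes_def by blast+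

lemma valid_codeD:
  assumes "valid_code L R \<tau>"
  shows "v \<notin> code_tree \<tau> R \<Longrightarrow> \<tau> v = []" "sorted_wrt (<) (\<tau> v)" "set (\<tau> v) \<subseteq> {..<L}"
    "v \<noteq> v' \<Longrightarrow> set (\<tau> v) \<inter> set (\<tau> v') = {}"
  using assms unfolding valid_code_def by blast+

lemma valid_code_bin_less:
  assumes V: "valid_code L R \<tau>" and "v @ [i] \<in> code_tree \<tau> (Suc R)"
  shows "\<tau> v ! (i - 1) < L" "\<tau> v ! (i - 1) \<in> set (\<tau> v)" "i - 1 < length (\<tau> v)"
proof -
  show i: "i - 1 < length (\<tau> v)" using assms(2) unfolding snoc_in_code_tree by auto
  then show "\<tau> v ! (i - 1) \<in> set (\<tau> v)" by simp
  then show "\<tau> v ! (i - 1) < L" using valid_codeD(3)[OF V, of v] by auto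
qed

lemma valid_code_bin_inj:
  assumes V: "valid_code L R \<tau>" and v: "v @ [i] \<in> code_tree \<tau> (Suc R)" and v': "v' @ [i'] \<in> code_tree \<tau> (Suc R)"
    and eq: "\<tau> v ! (i - 1) = \<tau> v' ! (i' - 1)"
  shows "v = v' \<and> i = i'"
proof -
  have vv: "v = v'"
    using valid_codeD(4)[OF V, of v v'] valid_code_bin_less(2)[OF V v] valid_code_bin_less(2)[OF V v'] eq by auto
  have "distinct (\<tau> v)" using valid_codeD(2)[OF V] strict_sorted_iff by blast
  then have "i - 1 = i' - 1"
    using eq valid_code_bin_less(3)[OF V v] valid_code_bin_less(3)[OF V v'] vv by (simp add: nth_eq_iff_index_eq)
  moreover have "1 \<le> i" "1 \<le> i'" using v v' unfolding snoc_in_code_tree by auto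
  ultimately show ?thesis using vv by auto
qed

lemma encodes_weight_less_iff:
  assumes V: "valid_code L R \<tau>" and E: "encodes R h L \<tau> G w \<rho> \<phi>" and h: "h > 0"
    and v: "v @ [i] \<in> code_tree \<tau> (Suc R)" and v': "v' @ [i'] \<in> code_tree \<tau> (Suc R)"
  shows "w {\<phi> v, \<phi> (v @ [i])} < w {\<phi> v', \<phi> (v' @ [i'])} \<longleftrightarrow> \<tau> v ! (i - 1) < \<tau> v' ! (i' - 1)"
proof -
  define b b' where "b = \<tau> v ! (i - 1)" and "b' = \<tau> v' ! (i' - 1)"
  have less: "w {\<phi> v, \<phi> (v @ [i])} < w {\<phi> v', \<phi> (v' @ [i'])}"
    if "\<tau> v ! (i - 1) < \<tau> v' ! (i' - 1)" "v @ [i] \<in> code_tree \<tau> (Suc R)" "v' @ [i'] \<in> code_tree \<tau> (Suc R)" for v i v' i'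
  proof -
    have "w {\<phi> v, \<phi> (v @ [i])} < real (Suc (\<tau> v ! (i - 1))) * h" using encodesD(6)[OF E that(2)] .
    also have "\<dots> \<le> real (\<tau> v' ! (i' - 1)) * h" using that(1) h by (intro mult_right_mono) auto
    also have "\<dots> \<le> w {\<phi> v', \<phi> (v' @ [i'])}" using encodesD(5)[OF E that(3)] .
    finally show ?thesis .
  qed
  consider "b < b'" | "b' < b" | "b = b'" by linarith
  then show ?thesis
  proof cases
    case 1 then show ?thesis using less[OF _ v v'] by (simp add: b_def b'_def)
  next
    case 2 then show ?thesis using less[OF _ v' v] by (simp add: b_def b'_def)
  next
    case 3
    then have "v = v' \<and> i = i'" using valid_code_bin_inj[OF V v v'] by (simp add: b_def b'_def)
    then show ?thesis by simp
  qed
qed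

lemma encodes_light:
  assumes V: "valid_code L R \<tau>" and E: "encodes R h L \<tau> G w \<rho> \<phi>" and h: "h > 0"
    and v: "v @ [i] \<in> code_tree \<tau> (Suc R)"
  shows "w {\<phi> v, \<phi> (v @ [i])} < real L * h"
proof -
  have "w {\<phi> v, \<phi> (v @ [i])} < real (Suc (\<tau> v ! (i - 1))) * h" using encodesD(6)[OF E v] .
  also have "\<dots> \<le> real L * h" using valid_code_bin_less(1)[OF V v] h by (intro mult_right_mono) auto
  finally show ?thesis .
qed

text \<open>The explored part as a weighted graph of its own, with the bins as weights. Every graph in which the code
  is found is compared with this one.\<close>

definition code_graph :: "(nat list \<Rightarrow> nat list) \<Rightarrow> nat \<Rightarrow> nat list graph" where
  "code_graph \<tau> R = Graph (code_tree \<tau> (Suc R)) {{v, v @ [i]} | v i. v @ [i] \<in> code_tree \<tau> (Suc R)}"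

definition code_bin :: "(nat list \<Rightarrow> nat list) \<Rightarrow> nat list set \<Rightarrow> real" where
  "code_bin \<tau> = child_weight (\<lambda>v i. real (\<tau> v ! (i - 1)))"

lemma snoc_doubleton_eq: "{v, v @ [i]} = {v', v' @ [i']} \<longleftrightarrow> v = v' \<and> i = i'"
proof
  assume *: "{v, v @ [i]} = {v', v' @ [i']}"
  show "v = v' \<and> i = i'"
  proof (cases "v = v'")
    case True with * show ?thesis by (auto simp: doubleton_eq_iff)
  next
    case False
    with * have a: "v = v' @ [i']" "v @ [i] = v'" by (auto simp: doubleton_eq_iff)
    then have "length v = Suc (length v')" "Suc (length v) = length v'"
      by (metis length_append_singleton)+
    then show ?thesis by simp
  qed
qed auto

lemma code_bin_edge: "code_bin \<tau> {v, v @ [i]} = real (\<tau> v ! (i - 1))"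
  unfolding code_bin_def child_weight_def snoc_doubleton_eq by (rule the_equality) auto

lemma verts_code_graph [simp]: "verts (code_graph \<tau> R) = code_tree \<tau> (Suc R)"
  by (simp add: code_graph_def)

lemma code_graph_edgeE:
  assumes "{u, v} \<in> edges (code_graph \<tau> R)"
  obtains i where "v = u @ [i]" "v \<in> code_tree \<tau> (Suc R)" | i where "u = v @ [i]" "u \<in> code_tree \<tau> (Suc R)"
proof -
  from assms obtain a i where "{u, v} = {a, a @ [i]}" "a @ [i] \<in> code_tree \<tau> (Suc R)"
    unfolding code_graph_def by auto
  then have "u = a \<and> v = a @ [i] \<or> u = a @ [i] \<and> v = a" unfolding doubleton_eq_iff by blast
  then show ?thesis using that \<open>a @ [i] \<in> _\<close> by blast
qed

lemma code_tree_parent: "v @ [i] \<in> code_tree \<tau> (Suc R) \<Longrightarrow> v \<in> code_tree \<tau> (Suc R)"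
  using code_tree_mono[of R "Suc R" \<tau>] unfolding snoc_in_code_tree by auto

lemma code_graph_pair_iff:
  "{u, v} \<in> edges (code_graph \<tau> R) \<longleftrightarrow> u \<in> code_tree \<tau> (Suc R) \<and> v \<in> code_tree \<tau> (Suc R) \<and> tree_step u v"
proof
  assume "{u, v} \<in> edges (code_graph \<tau> R)"
  then show "u \<in> code_tree \<tau> (Suc R) \<and> v \<in> code_tree \<tau> (Suc R) \<and> tree_step u v"
    by (rule code_graph_edgeE) (auto simp: tree_step_def dest: code_tree_parent)
next
  assume *: "u \<in> code_tree \<tau> (Suc R) \<and> v \<in> code_tree \<tau> (Suc R) \<and> tree_step u v"
  then consider i where "v = u @ [i]" | i where "u = v @ [i]" unfolding tree_step_def by blast
  then show "{u, v} \<in> edges (code_graph \<tau> R)"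
  proof cases
    case 1 then show ?thesis using * unfolding code_graph_def by auto
  next
    case 2
    then have "{u, v} = {v, v @ [i]}" by (simp add: insert_commute)
    then show ?thesis using * 2 unfolding code_graph_def by auto
  qed
qed

lemma simple_code_graph: "simple_graph (code_graph \<tau> R)"
  unfolding simple_graph_def
proof
  fix e assume "e \<in> edges (code_graph \<tau> R)"
  then obtain a i where "e = {a, a @ [i]}" "a @ [i] \<in> code_tree \<tau> (Suc R)" unfolding code_graph_def by auto
  then have "a \<in> verts (code_graph \<tau> R)" "a @ [i] \<in> verts (code_graph \<tau> R)" "a \<noteq> a @ [i]" "e = {a, a @ [i]}"
    using code_tree_parent[of a i \<tau> R] by auto
  then show "\<exists>u\<in>verts (code_graph \<tau> R). \<exists>v\<in>verts (code_graph \<tau> R). u \<noteq> v \<and> e = {u, v}" by metis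
qed

text \<open>A step increases the depth by at most one, so a walk that is short enough takes all its steps from
  vertices at depth at most \<open>D\<close>, where the neighbourhoods are known to match.\<close>

lemma relpow_match:
  fixes A0 :: "nat list rel" and A :: "'v rel"
  assumes len: "\<And>v u. (v, u) \<in> A0 \<Longrightarrow> length u \<le> Suc (length v)" and T: "A0 \<subseteq> T \<times> T"
    and match: "\<And>v y. v \<in> T \<Longrightarrow> length v \<le> D \<Longrightarrow> (\<phi> v, y) \<in> A \<longleftrightarrow> (\<exists>u. y = \<phi> u \<and> (v, u) \<in> A0)"
    and v: "v \<in> T" "length v + k \<le> Suc D"
  shows "(\<phi> v, y) \<in> A ^^ k \<longleftrightarrow> (\<exists>u\<in>T. y = \<phi> u \<and> (v, u) \<in> A0 ^^ k)"
  using v(2)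
proof (induction k arbitrary: y)
  case 0 then show ?case using v by auto
next
  case (Suc k)
  have IH: "(\<phi> v, z) \<in> A ^^ k \<longleftrightarrow> (\<exists>u\<in>T. z = \<phi> u \<and> (v, u) \<in> A0 ^^ k)" for z using Suc by auto
  have len': "length u \<le> length v + j" if "(v, u) \<in> A0 ^^ j" for u j
    using that
  proof (induction j arbitrary: u)
    case (Suc j)
    then obtain a where "(v, a) \<in> A0 ^^ j" "(a, u) \<in> A0" by auto
    then show ?case using Suc.IH[of a] len[of a u] by simp
  qed simp
  show ?case
  proof
    assume "(\<phi> v, y) \<in> A ^^ Suc k"
    then obtain z where z: "(\<phi> v, z) \<in> A ^^ k" "(z, y) \<in> A" by auto
    then obtain u where u: "u \<in> T" "z = \<phi> u" "(v, u) \<in> A0 ^^ k" using IH by blast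
    have "length u \<le> D" using len'[OF u(3)] Suc.prems by simp
    then obtain u' where "y = \<phi> u'" "(u, u') \<in> A0" using match[OF u(1)] z(2) u(2) by blast
    then show "\<exists>u\<in>T. y = \<phi> u \<and> (v, u) \<in> A0 ^^ Suc k" using u T by auto
  next
    assume "\<exists>u\<in>T. y = \<phi> u \<and> (v, u) \<in> A0 ^^ Suc k"
    then obtain u a where u: "y = \<phi> u" "(v, a) \<in> A0 ^^ k" "(a, u) \<in> A0" by auto
    have aT: "a \<in> T" using u T by auto
    have "length a \<le> D" using len'[OF u(2)] Suc.prems by simp
    then have "(\<phi> a, y) \<in> A" using match[OF aT] u by blast
    moreover have "(\<phi> v, \<phi> a) \<in> A ^^ k" using IH u aT by blast
    ultimately show "(\<phi> v, y) \<in> A ^^ Suc k" by auto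
  qed
qed

context
  fixes R L :: nat and h :: real and \<tau> and G :: "'v graph" and w \<rho> \<phi>
  assumes V: "valid_code L R \<tau>" and E: "encodes R h L \<tau> G w \<rho> \<phi>" and h: "h > 0"
begin

abbreviation (input) "TT \<equiv> code_tree \<tau> (Suc R)"
abbreviation (input) "CG \<equiv> code_graph \<tau> R"

lemma phi_edge:
  assumes e: "{v, u} \<in> edges CG"
  shows "{\<phi> v, \<phi> u} \<in> edges G" "w {\<phi> v, \<phi> u} < real L * h"
proof -
  from e have "{\<phi> v, \<phi> u} \<in> edges G \<and> w {\<phi> v, \<phi> u} < real L * h"
  proof (rule code_graph_edgeE)
    fix i assume "u = v @ [i]" "u \<in> TT"
    then show ?thesis using encodesD(4)[OF E, of v i] encodes_light[OF V E h, of v i] by simp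
  next
    fix i assume "v = u @ [i]" "v \<in> TT"
    then show ?thesis using encodesD(4)[OF E, of u i] encodes_light[OF V E h, of u i] by (simp add: insert_commute)
  qed
  then show "{\<phi> v, \<phi> u} \<in> edges G" "w {\<phi> v, \<phi> u} < real L * h" by auto
qed

lemma phi_edge_less:
  assumes e: "{v, u} \<in> edges CG" and e': "{v', u'} \<in> edges CG"
  shows "w {\<phi> v, \<phi> u} < w {\<phi> v', \<phi> u'} \<longleftrightarrow> code_bin \<tau> {v, u} < code_bin \<tau> {v', u'}"
proof -
  have norm: "\<exists>a i. {v, u} = {a, a @ [i]} \<and> {\<phi> v, \<phi> u} = {\<phi> a, \<phi> (a @ [i])} \<and> a @ [i] \<in> TT"
    if "{v, u} \<in> edges CG" for v u
    using that
  proof (rule code_graph_edgeE)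
    fix i assume "u = v @ [i]" "u \<in> TT"
    then show ?thesis by (intro exI[of _ v] exI[of _ i]) simp
  next
    fix i assume "v = u @ [i]" "v \<in> TT"
    then show ?thesis by (intro exI[of _ u] exI[of _ i]) (simp add: insert_commute)
  qed
  from norm[OF e] obtain a i where a: "{v, u} = {a, a @ [i]}" "{\<phi> v, \<phi> u} = {\<phi> a, \<phi> (a @ [i])}" "a @ [i] \<in> TT" by blast
  from norm[OF e'] obtain b j where b: "{v', u'} = {b, b @ [j]}" "{\<phi> v', \<phi> u'} = {\<phi> b, \<phi> (b @ [j])}" "b @ [j] \<in> TT" by blast
  show ?thesis unfolding a(1,2) b(1,2) code_bin_edge
    using encodes_weight_less_iff[OF V E h a(3) b(3)] by simp
qed

lemma phi_inj: "u \<in> TT \<Longrightarrow> v \<in> TT \<Longrightarrow> \<phi> u = \<phi> v \<longleftrightarrow> u = v"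
  using encodesD(2)[OF E] by (auto dest: inj_onD)

lemma phi_light_match:
  assumes v: "v \<in> TT" "length v \<le> R"
  shows "{\<phi> v, y} \<in> edges G \<and> w {\<phi> v, y} < real L * h \<longleftrightarrow> (\<exists>u. y = \<phi> u \<and> {v, u} \<in> edges CG)"
proof
  assume "{\<phi> v, y} \<in> edges G \<and> w {\<phi> v, y} < real L * h"
  then obtain u where "u \<in> TT" "y = \<phi> u" "tree_step v u"
    using encodesD(7)[OF E code_tree_Suc_length[OF v], of y] by blast
  then show "\<exists>u. y = \<phi> u \<and> {v, u} \<in> edges CG" using v code_graph_pair_iff by blast
next
  assume "\<exists>u. y = \<phi> u \<and> {v, u} \<in> edges CG"
  then show "{\<phi> v, y} \<in> edges G \<and> w {\<phi> v, y} < real L * h" using phi_edge by blast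
qed

lemma phi_below_match:
  assumes e: "{a, b} \<in> edges CG" and v: "v \<in> TT" "length v \<le> R"
  shows "(\<phi> v, y) \<in> adj (below G w (w {\<phi> a, \<phi> b})) \<longleftrightarrow>
    (\<exists>u. y = \<phi> u \<and> (v, u) \<in> adj (below CG (code_bin \<tau>) (code_bin \<tau> {a, b})))"
proof
  assume "(\<phi> v, y) \<in> adj (below G w (w {\<phi> a, \<phi> b}))"
  then have y: "{\<phi> v, y} \<in> edges G" "w {\<phi> v, y} < w {\<phi> a, \<phi> b}" by (auto simp: adj_below_iff)
  then have "w {\<phi> v, y} < real L * h" using phi_edge(2)[OF e] by simp
  then obtain u where u: "y = \<phi> u" "{v, u} \<in> edges CG" using phi_light_match[OF v, of y] y by blast
  then have "code_bin \<tau> {v, u} < code_bin \<tau> {a, b}" using phi_edge_less[OF u(2) e] y by simp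
  with u show "\<exists>u. y = \<phi> u \<and> (v, u) \<in> adj (below CG (code_bin \<tau>) (code_bin \<tau> {a, b}))"
    by (auto simp: adj_below_iff)
next
  assume "\<exists>u. y = \<phi> u \<and> (v, u) \<in> adj (below CG (code_bin \<tau>) (code_bin \<tau> {a, b}))"
  then obtain u where u: "y = \<phi> u" "{v, u} \<in> edges CG" "code_bin \<tau> {v, u} < code_bin \<tau> {a, b}"
    by (auto simp: adj_below_iff)
  then show "(\<phi> v, y) \<in> adj (below G w (w {\<phi> a, \<phi> b}))"
    using phi_edge(1)[OF u(2)] phi_edge_less[OF u(2) e] by (simp add: adj_below_iff)
qed

lemma phi_shut_match:
  assumes e: "{v, v'} \<in> edges CG" and K: "length v + Suc K \<le> Suc R"
  shows "shut_in G w K (\<phi> v) (\<phi> v') \<longleftrightarrow> shut_in CG (code_bin \<tau>) K v v'"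
proof -
  let ?A = "adj (below G w (w {\<phi> v, \<phi> v'}))" and ?AM = "adj (below CG (code_bin \<tau>) (code_bin \<tau> {v, v'}))"
  have vT: "v \<in> TT" "v' \<in> TT" using e unfolding code_graph_pair_iff by auto
  have A0: "?AM \<subseteq> TT \<times> TT" by (auto simp: adj_below_iff code_graph_pair_iff)
  have len: "length u \<le> Suc (length a)" if "(a, u) \<in> ?AM" for a u
    using that by (auto simp: adj_below_iff code_graph_pair_iff dest: tree_step_length)
  have rel: "(\<phi> v, y) \<in> ?A ^^ k \<longleftrightarrow> (\<exists>u\<in>TT. y = \<phi> u \<and> (v, u) \<in> ?AM ^^ k)" if "length v + k \<le> Suc R" for k y
  proof (rule relpow_match[where D = R, OF _ A0 _ vT(1) that])
    show "length u \<le> Suc (length a)" if "(a, u) \<in> ?AM" for a u using len[OF that] .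
    show "(\<phi> a, y) \<in> ?A \<longleftrightarrow> (\<exists>u. y = \<phi> u \<and> (a, u) \<in> ?AM)" if a: "a \<in> TT" "length a \<le> R" for a y
      using phi_below_match[OF e a] .
  qed
  have reach_phi: "reach ?A K (\<phi> v) = \<phi> ` reach ?AM K v"
  proof -
    have T0: "u \<in> TT" if "(v, u) \<in> ?AM ^^ k" for u k
      using that vT A0 by (cases k) auto
    show ?thesis using rel K T0 unfolding reach_def by (force simp: image_def)
  qed
  have sub: "reach ?AM K v \<subseteq> TT"
  proof
    fix u assume "u \<in> reach ?AM K v"
    then obtain k where "(v, u) \<in> ?AM ^^ k" by (auto simp: reach_def)
    then show "u \<in> TT" using vT A0 by (cases k) auto
  qed
  have short: "length u \<le> R" if u: "u \<in> reach ?AM K v" for u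
  proof -
    obtain k where k: "k \<le> K" "(v, u) \<in> ?AM ^^ k" using u by (auto simp: reach_def)
    have "length a \<le> length v + j" if "(v, a) \<in> ?AM ^^ j" for a j
      using that
    proof (induction j arbitrary: a)
      case (Suc j)
      then obtain b where "(v, b) \<in> ?AM ^^ j" "(b, a) \<in> ?AM" by auto
      then show ?case using Suc.IH[of b] len[of b a] by simp
    qed simp
    from this[OF k(2)] show ?thesis using k(1) K by simp
  qed
  have "?A `` reach ?A K (\<phi> v) = \<phi> ` (?AM `` reach ?AM K v)"
  proof (rule set_eqI)
    fix y
    have "y \<in> ?A `` reach ?A K (\<phi> v) \<longleftrightarrow> (\<exists>a\<in>reach ?AM K v. (\<phi> a, y) \<in> ?A)" unfolding reach_phi by blast
    also have "\<dots> \<longleftrightarrow> (\<exists>a\<in>reach ?AM K v. \<exists>u. y = \<phi> u \<and> (a, u) \<in> ?AM)"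
      using phi_below_match[OF e] sub short by (intro bex_cong refl) blast
    also have "\<dots> \<longleftrightarrow> y \<in> \<phi> ` (?AM `` reach ?AM K v)" by blast
    finally show "y \<in> ?A `` reach ?A K (\<phi> v) \<longleftrightarrow> y \<in> \<phi> ` (?AM `` reach ?AM K v)" .
  qed
  moreover have "\<phi> ` (?AM `` reach ?AM K v) \<subseteq> \<phi> ` reach ?AM K v \<longleftrightarrow> ?AM `` reach ?AM K v \<subseteq> reach ?AM K v"
    by (rule inj_on_image_subset_iff[OF encodesD(2)[OF E]]) (use A0 sub in auto)
  moreover have "\<phi> v' \<in> \<phi> ` reach ?AM K v \<longleftrightarrow> v' \<in> reach ?AM K v"
    by (rule inj_on_image_mem_iff[OF encodesD(2)[OF E] vT(2) sub])
  ultimately show ?thesis unfolding shut_in_def Let_def by (simp add: reach_phi)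
qed

lemma pair_orient: "(\<exists>z z'. {a, b} = {z, z'} \<and> P z z') \<longleftrightarrow> P a b \<or> P b a"
  by (auto simp: doubleton_eq_iff)

lemma phi_good_match:
  assumes v: "v \<in> TT" "length v + K + 2 \<le> Suc R"
  shows "(\<phi> v, y) \<in> adj (good_graph K (real L * h) G w) \<longleftrightarrow>
    (\<exists>u. y = \<phi> u \<and> (v, u) \<in> adj (good_graph K (real L) CG (code_bin \<tau>)))"
proof -
  have vR: "length v \<le> R" using v by simp
  have good: "{\<phi> v, \<phi> u} \<in> edges (good_graph K (real L * h) G w) \<longleftrightarrow>
      {v, u} \<in> edges (good_graph K (real L) CG (code_bin \<tau>))" if e: "{v, u} \<in> edges CG" for u
  proof -
    have e': "{u, v} \<in> edges CG" using e by (simp add: insert_commute)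
    have lu: "length u \<le> Suc (length v)" using e unfolding code_graph_pair_iff by (auto dest: tree_step_length)
    have bin: "code_bin \<tau> {v, u} < real L"
      using e
    proof (rule code_graph_edgeE)
      fix i assume "u = v @ [i]" "u \<in> TT"
      then show ?thesis using valid_code_bin_less(1)[OF V, of v i] by (simp add: code_bin_edge)
    next
      fix i assume "v = u @ [i]" "v \<in> TT"
      then show ?thesis using valid_code_bin_less(1)[OF V, of u i] code_bin_edge[of \<tau> u i] by (simp add: insert_commute)
    qed
    have "shut_in G w K (\<phi> v) (\<phi> u) \<longleftrightarrow> shut_in CG (code_bin \<tau>) K v u"
      by (rule phi_shut_match[OF e]) (use v in simp)
    moreover have "shut_in G w K (\<phi> u) (\<phi> v) \<longleftrightarrow> shut_in CG (code_bin \<tau>) K u v"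
      by (rule phi_shut_match[OF e']) (use v lu in simp)
    ultimately show ?thesis
      unfolding good_graph_def graph.sel mem_Collect_eq pair_orient using phi_edge[OF e] e bin by simp
  qed
  show ?thesis
  proof
    assume *: "(\<phi> v, y) \<in> adj (good_graph K (real L * h) G w)"
    then have "{\<phi> v, y} \<in> edges G \<and> w {\<phi> v, y} < real L * h" by (simp add: adj_iff good_graph_def)
    then obtain u where u: "y = \<phi> u" "{v, u} \<in> edges CG" using phi_light_match[OF v(1) vR, of y] by blast
    then show "\<exists>u. y = \<phi> u \<and> (v, u) \<in> adj (good_graph K (real L) CG (code_bin \<tau>))"
      using good[OF u(2)] * by (auto simp: adj_iff)
  next
    assume "\<exists>u. y = \<phi> u \<and> (v, u) \<in> adj (good_graph K (real L) CG (code_bin \<tau>))"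
    then obtain u where u: "y = \<phi> u" "{v, u} \<in> edges (good_graph K (real L) CG (code_bin \<tau>))" by (auto simp: adj_iff)
    then have "{v, u} \<in> edges CG" by (simp add: good_graph_def)
    then show "(\<phi> v, y) \<in> adj (good_graph K (real L * h) G w)" using good u by (simp add: adj_iff)
  qed
qed

text \<open>Whether an edge is kept by \<open>good_graph K\<close> is decided within distance \<open>K + 1\<close> of its endpoints, and
  only the relative order of the weights matters. Hence the balls of \<open>good_graph K\<close> around the root can
  be read off from the code.\<close>

theorem encodes_good_ball_iso:
  assumes G: "simple_graph G" and r: "r + K + 2 \<le> R"
  shows "rooted_iso (rooted_ball (good_graph K (real L) CG (code_bin \<tau>), []) r)
    (rooted_ball (good_graph K (real L * h) G w, \<rho>) r)"
proof -
  let ?H = "good_graph K (real L * h) G w" and ?HM = "good_graph K (real L) CG (code_bin \<tau>)"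
  have s0: "simple_graph ?HM" by (rule simple_subgraph[OF simple_code_graph]) (auto simp: good_graph_def)
  have s: "simple_graph ?H" by (rule simple_subgraph[OF G]) (auto simp: good_graph_def)
  have A0: "adj ?HM \<subseteq> TT \<times> TT" using simple_adjD[OF s0] by auto
  have len: "length u \<le> Suc (length a)" if "(a, u) \<in> adj ?HM" for a u
    using that by (auto simp: adj_iff good_graph_def code_graph_pair_iff dest: tree_step_length)
  have root: "\<phi> [] = \<rho>" using encodesD(1)[OF E] .
  have rel: "(\<rho>, y) \<in> adj ?H ^^ k \<longleftrightarrow> (\<exists>u\<in>TT. y = \<phi> u \<and> ([], u) \<in> adj ?HM ^^ k)" if "k \<le> Suc r" for k y
    unfolding root[symmetric]
    by (rule relpow_match[OF len A0, where D = r]) (use that r phi_good_match in auto)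
  have B: "verts (graph_ball ?H \<rho> r) = \<phi> ` verts (graph_ball ?HM [] r)"
  proof (rule set_eqI)
    fix y
    have "y \<in> verts (graph_ball ?H \<rho> r) \<longleftrightarrow> y \<in> verts G \<and> (\<exists>k\<le>r. \<exists>u\<in>TT. y = \<phi> u \<and> ([], u) \<in> adj ?HM ^^ k)"
      unfolding verts_graph_ball verts_good_graph mem_Collect_eq using rel[OF le_SucI] by blast
    also have "\<dots> \<longleftrightarrow> y \<in> \<phi> ` verts (graph_ball ?HM [] r)"
      unfolding verts_graph_ball using encodesD(3)[OF E] by auto
    finally show "y \<in> verts (graph_ball ?H \<rho> r) \<longleftrightarrow> y \<in> \<phi> ` verts (graph_ball ?HM [] r)" .
  qed
  have B0: "verts (graph_ball ?HM [] r) \<subseteq> TT" by (auto simp: verts_graph_ball)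
  have len0: "length u \<le> k" if "([], u) \<in> adj ?HM ^^ k" for u k
    using that
  proof (induction k arbitrary: u)
    case (Suc k)
    then obtain b where "([], b) \<in> adj ?HM ^^ k" "(b, u) \<in> adj ?HM" by auto
    then show ?case using Suc.IH[of b] len[of b u] by simp
  qed simp
  have bij: "bij_betw \<phi> (verts (graph_ball ?HM [] r)) (verts (graph_ball ?H \<rho> r))"
    unfolding bij_betw_def B using inj_on_subset[OF encodesD(2)[OF E] B0] by simp
  have adj_eq: "(u, v) \<in> adj (graph_ball ?HM [] r) \<longleftrightarrow> (\<phi> u, \<phi> v) \<in> adj (graph_ball ?H \<rho> r)"
    if uv: "u \<in> verts (graph_ball ?HM [] r)" "v \<in> verts (graph_ball ?HM [] r)" for u v
  proof -
    have uT: "u \<in> TT" "v \<in> TT" using uv B0 by auto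
    have "length u \<le> r" using uv(1) len0 unfolding verts_graph_ball by (auto intro: order_trans)
    then have "(\<phi> u, \<phi> v) \<in> adj ?H \<longleftrightarrow> (\<exists>u'. \<phi> v = \<phi> u' \<and> (u, u') \<in> adj ?HM)"
      using r by (intro phi_good_match uT) simp
    also have "\<dots> \<longleftrightarrow> (u, v) \<in> adj ?HM" using A0 uT phi_inj by blast
    finally show ?thesis
      unfolding adj_graph_ball[OF s0] adj_graph_ball[OF s] using uv B by auto
  qed
  show ?thesis
    unfolding rooted_iso_def rooted_iso_by_def rooted_ball_def
    using bij adj_eq root by (intro exI[of _ \<phi>]) auto
qed

lemma encodes_root_degree:
  "card {y. {\<rho>, y} \<in> edges G \<and> w {\<rho>, y} < real L * h} = length (\<tau> [])"
proof -
  have "{y. {\<rho>, y} \<in> edges G \<and> w {\<rho>, y} < real L * h} = \<phi> ` {u. {[], u} \<in> edges CG}"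
    using phi_light_match[of "[]"] encodesD(1)[OF E] by auto
  also have "{u. {[], u} \<in> edges CG} = (\<lambda>i. [i]) ` {1..length (\<tau> [])}"
  proof -
    have "{[], u} \<in> edges CG \<longleftrightarrow> (\<exists>i. u = [i] \<and> 1 \<le> i \<and> i \<le> length (\<tau> []))" for u
      using snoc_in_code_tree[of "[]" _ \<tau> R] unfolding code_graph_pair_iff tree_step_def by auto
    then show ?thesis by auto
  qed
  finally have eq: "{y. {\<rho>, y} \<in> edges G \<and> w {\<rho>, y} < real L * h} = \<phi> ` (\<lambda>i. [i]) ` {1..length (\<tau> [])}" .
  have "[i] \<in> TT" if "1 \<le> i" "i \<le> length (\<tau> [])" for i
    using snoc_in_code_tree[of "[]" i \<tau> R] that by simp
  then have "(\<lambda>i. [i]) ` {1..length (\<tau> [])} \<subseteq> TT" by auto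
  then have "inj_on \<phi> ((\<lambda>i. [i]) ` {1..length (\<tau> [])})" using encodesD(2)[OF E] inj_on_subset by blast
  then show ?thesis unfolding eq by (simp add: card_image inj_on_def)
qed

end

text \<open>The children of a node are recovered from the weights: they are the neighbours other than the
  parent that are joined by light edges, in the order of their bins.\<close>

theorem encodes_unique:
  assumes V: "valid_code L R \<tau>" and V': "valid_code L R \<tau>'" and h: "h > 0"
    and E: "encodes R h L \<tau> G w \<rho> \<phi>" and E': "encodes R h L \<tau>' G w \<rho> \<phi>'"
  shows "\<tau> = \<tau>' \<and> (\<forall>v\<in>code_tree \<tau> (Suc R). \<phi> v = \<phi>' v)"
proof -
  have main: "n \<le> R \<Longrightarrow> \<forall>v. length v \<le> n \<longrightarrow>
      (v \<in> code_tree \<tau> (Suc R) \<longleftrightarrow> v \<in> code_tree \<tau>' (Suc R)) \<and> (v \<in> code_tree \<tau> (Suc R) \<longrightarrow> \<phi> v = \<phi>' v)" 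
    and step: "n \<le> R \<Longrightarrow> \<forall>v. length v \<le> n \<longrightarrow>
      (v \<in> code_tree \<tau> (Suc R) \<longleftrightarrow> v \<in> code_tree \<tau>' (Suc R)) \<and> (v \<in> code_tree \<tau> (Suc R) \<longrightarrow> \<phi> v = \<phi>' v) \<Longrightarrow>
      \<forall>v. length v = n \<longrightarrow> v \<in> code_tree \<tau> (Suc R) \<longrightarrow> \<tau> v = \<tau>' v \<and> (\<forall>i. 1 \<le> i \<and> i \<le> length (\<tau> v) \<longrightarrow> \<phi> (v @ [i]) = \<phi>' (v @ [i]))"
    for n
  proof -
    \<comment> \<open>If the codes agree up to depth \<open>n\<close>, then so do the lists of bins at depth \<open>n\<close> and the children.\<close>
    show *: "\<forall>v. length v = n \<longrightarrow> v \<in> code_tree \<tau> (Suc R) \<longrightarrow>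
        \<tau> v = \<tau>' v \<and> (\<forall>i. 1 \<le> i \<and> i \<le> length (\<tau> v) \<longrightarrow> \<phi> (v @ [i]) = \<phi>' (v @ [i]))"
      if n: "n \<le> R" and IH: "\<forall>v. length v \<le> n \<longrightarrow>
      (v \<in> code_tree \<tau> (Suc R) \<longleftrightarrow> v \<in> code_tree \<tau>' (Suc R)) \<and> (v \<in> code_tree \<tau> (Suc R) \<longrightarrow> \<phi> v = \<phi>' v)" for n
    proof (intro allI impI)
      fix v assume v: "length v = n" "v \<in> code_tree \<tau> (Suc R)"
      then have v': "v \<in> code_tree \<tau>' (Suc R)" and pv: "\<phi> v = \<phi>' v" using IH by auto
      have vR: "v \<in> code_tree \<tau> R" "v \<in> code_tree \<tau>' R" using code_tree_Suc_length v v' n by auto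
      \<comment> \<open>A child in one code is a light neighbour, hence a child or the parent in the other code; the parent is
        excluded by injectivity. This is stated for arbitrary codes because both directions are used.\<close>
      have child: "\<exists>j. 1 \<le> j \<and> j \<le> length (\<tau>2 v) \<and> \<phi>1 (v @ [i]) = \<phi>2 (v @ [j])"
        if V1: "valid_code L R \<tau>1" and E1: "encodes R h L \<tau>1 G w \<rho> \<phi>1" and V2: "valid_code L R \<tau>2"
          and E2: "encodes R h L \<tau>2 G w \<rho> \<phi>2"
          and eqp: "\<And>u. length u \<le> n \<Longrightarrow> u \<in> code_tree \<tau>1 (Suc R) \<Longrightarrow> \<phi>1 u = \<phi>2 u"
          and mem: "\<And>u. length u \<le> n \<Longrightarrow> u \<in> code_tree \<tau>1 (Suc R) \<longleftrightarrow> u \<in> code_tree \<tau>2 (Suc R)"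
          and v1: "v \<in> code_tree \<tau>1 R" and v2: "v \<in> code_tree \<tau>2 R" and i: "1 \<le> i" "i \<le> length (\<tau>1 v)"
        for \<tau>1 \<phi>1 \<tau>2 \<phi>2 i
      proof -
        have vi: "v @ [i] \<in> code_tree \<tau>1 (Suc R)" using snoc_in_code_tree v1 i by blast
        have v1S: "v \<in> code_tree \<tau>1 (Suc R)" using code_tree_parent[OF vi] .
        have pv: "\<phi>1 v = \<phi>2 v" using eqp[of v] v(1) v1S by simp
        have "{\<phi>2 v, \<phi>1 (v @ [i])} \<in> edges G" "w {\<phi>2 v, \<phi>1 (v @ [i])} < real L * h"
          using encodesD(4)[OF E1 vi] encodes_light[OF V1 E1 h vi] unfolding pv by auto
        then obtain u where u: "u \<in> code_tree \<tau>2 (Suc R)" "\<phi>1 (v @ [i]) = \<phi>2 u" "tree_step v u"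
          using encodesD(7)[OF E2 v2] by blast
        from u(3) consider j where "u = v @ [j]" | j where "v = u @ [j]" unfolding tree_step_def by blast
        then show ?thesis
        proof cases
          case 1
          then show ?thesis using u snoc_in_code_tree[of v j \<tau>2 R] by auto
        next
          case 2
          have lu: "length u \<le> n" using 2 v(1) by simp
          then have u1: "u \<in> code_tree \<tau>1 (Suc R)" using mem u(1) by simp
          then have "\<phi>1 (v @ [i]) = \<phi>1 u" using eqp[OF lu u1] u(2) by simp
          then have "v @ [i] = u" using phi_inj[OF V1 E1 h vi u1] by simp
          then show ?thesis using 2 by simp
        qed
      qed
      have bins: "set (\<tau>1 v) \<subseteq> set (\<tau>2 v)"
        if V1: "valid_code L R \<tau>1" and E1: "encodes R h L \<tau>1 G w \<rho> \<phi>1" and V2: "valid_code L R \<tau>2"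
          and E2: "encodes R h L \<tau>2 G w \<rho> \<phi>2"
          and eqp: "\<And>u. length u \<le> n \<Longrightarrow> u \<in> code_tree \<tau>1 (Suc R) \<Longrightarrow> \<phi>1 u = \<phi>2 u"
          and mem: "\<And>u. length u \<le> n \<Longrightarrow> u \<in> code_tree \<tau>1 (Suc R) \<longleftrightarrow> u \<in> code_tree \<tau>2 (Suc R)"
          and v1: "v \<in> code_tree \<tau>1 R" and v2: "v \<in> code_tree \<tau>2 R"
        for \<tau>1 \<phi>1 \<tau>2 \<phi>2
      proof
        fix b assume "b \<in> set (\<tau>1 v)"
        then obtain i0 where i0: "i0 < length (\<tau>1 v)" "\<tau>1 v ! i0 = b" by (auto simp: in_set_conv_nth)
        define i where "i = Suc i0"
        have i: "1 \<le> i" "i \<le> length (\<tau>1 v)" "\<tau>1 v ! (i - 1) = b" using i0 by (auto simp: i_def)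
        obtain j where j: "1 \<le> j" "j \<le> length (\<tau>2 v)" "\<phi>1 (v @ [i]) = \<phi>2 (v @ [j])"
          using child[OF V1 E1 V2 E2 eqp mem v1 v2 i(1,2)] by blast
        have vi: "v @ [i] \<in> code_tree \<tau>1 (Suc R)" "v @ [j] \<in> code_tree \<tau>2 (Suc R)"
          using snoc_in_code_tree v1 v2 i j by blast+
        have pv: "\<phi>1 v = \<phi>2 v" using eqp[of v] v(1) code_tree_parent[OF vi(1)] by simp
        let ?x = "w {\<phi>1 v, \<phi>1 (v @ [i])}"
        have x: "real b * h \<le> ?x" "?x < real (Suc b) * h" "real (\<tau>2 v ! (j - 1)) * h \<le> ?x" "?x < real (Suc (\<tau>2 v ! (j - 1))) * h"
          using encodesD(5,6)[OF E1 vi(1)] encodesD(5,6)[OF E2 vi(2)] i(3) j(3) pv by auto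
        from x(1,4) have "real b * h < real (Suc (\<tau>2 v ! (j - 1))) * h" by linarith
        then have "b < Suc (\<tau>2 v ! (j - 1))" using h by simp
        moreover from x(2,3) have "real (\<tau>2 v ! (j - 1)) * h < real (Suc b) * h" by linarith
        then have "\<tau>2 v ! (j - 1) < Suc b" using h by simp
        ultimately have "b = \<tau>2 v ! (j - 1)" by simp
        then show "b \<in> set (\<tau>2 v)" using valid_code_bin_less(2)[OF V2 vi(2)] by simp
      qed
      have eqp: "\<phi> u = \<phi>' u" "\<phi>' u = \<phi> u" if "length u \<le> n" "u \<in> code_tree \<tau> (Suc R) \<or> u \<in> code_tree \<tau>' (Suc R)" for u
        using IH that by auto
      have mem: "u \<in> code_tree \<tau> (Suc R) \<longleftrightarrow> u \<in> code_tree \<tau>' (Suc R)" if "length u \<le> n" for u using IH that by auto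
      have "set (\<tau> v) = set (\<tau>' v)"
      proof
        show "set (\<tau> v) \<subseteq> set (\<tau>' v)" by (rule bins[OF V E V' E']) (use eqp mem vR in auto)
        show "set (\<tau>' v) \<subseteq> set (\<tau> v)" by (rule bins[OF V' E' V E]) (use eqp mem vR in auto)
      qed
      then have eq: "\<tau> v = \<tau>' v"
        using valid_codeD(2)[OF V, of v] valid_codeD(2)[OF V', of v] by (metis strict_sorted_equal)
      moreover have "\<phi> (v @ [i]) = \<phi>' (v @ [i])" if i: "1 \<le> i" "i \<le> length (\<tau> v)" for i
      proof -
        obtain j where j: "1 \<le> j" "j \<le> length (\<tau>' v)" "\<phi> (v @ [i]) = \<phi>' (v @ [j])"
          using child[OF V E V' E' _ _ vR i] eqp mem by blast
        have vi: "v @ [i] \<in> code_tree \<tau> (Suc R)" "v @ [j] \<in> code_tree \<tau>' (Suc R)" "v @ [j] \<in> code_tree \<tau> (Suc R)"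
          using snoc_in_code_tree vR i j eq by auto
        let ?x = "w {\<phi> v, \<phi> (v @ [i])}"
        have x: "real (\<tau> v ! (i - 1)) * h \<le> ?x" "?x < real (Suc (\<tau> v ! (i - 1))) * h"
            "real (\<tau> v ! (j - 1)) * h \<le> ?x" "?x < real (Suc (\<tau> v ! (j - 1))) * h"
          using encodesD(5,6)[OF E vi(1)] encodesD(5,6)[OF E' vi(2)] j(3) pv eq by auto
        from x(1,4) have "real (\<tau> v ! (i - 1)) * h < real (Suc (\<tau> v ! (j - 1))) * h" by linarith
        then have "\<tau> v ! (i - 1) < Suc (\<tau> v ! (j - 1))" using h by simp
        moreover from x(2,3) have "real (\<tau> v ! (j - 1)) * h < real (Suc (\<tau> v ! (i - 1))) * h" by linarith
        then have "\<tau> v ! (j - 1) < Suc (\<tau> v ! (i - 1))" using h by simp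
        ultimately have "\<tau> v ! (i - 1) = \<tau> v ! (j - 1)" by simp
        then have "i = j" using valid_code_bin_inj[OF V vi(1) vi(3)] by simp
        with j show ?thesis by simp
      qed
      ultimately show "\<tau> v = \<tau>' v \<and> (\<forall>i. 1 \<le> i \<and> i \<le> length (\<tau> v) \<longrightarrow> \<phi> (v @ [i]) = \<phi>' (v @ [i]))" by blast
    qed
    show "\<forall>v. length v \<le> n \<longrightarrow>
      (v \<in> code_tree \<tau> (Suc R) \<longleftrightarrow> v \<in> code_tree \<tau>' (Suc R)) \<and> (v \<in> code_tree \<tau> (Suc R) \<longrightarrow> \<phi> v = \<phi>' v)"
      if "n \<le> R"
      using that
    proof (induction n)
      case 0
      show ?case using encodesD(1)[OF E] encodesD(1)[OF E'] by simp
    next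
      case (Suc n)
      then have IH: "\<forall>v. length v \<le> n \<longrightarrow>
        (v \<in> code_tree \<tau> (Suc R) \<longleftrightarrow> v \<in> code_tree \<tau>' (Suc R)) \<and> (v \<in> code_tree \<tau> (Suc R) \<longrightarrow> \<phi> v = \<phi>' v)" by simp
      have nR: "n \<le> R" using Suc.prems by simp
      show ?case
      proof (intro allI impI)
        fix v :: "nat list" assume l: "length v \<le> Suc n"
        show "(v \<in> code_tree \<tau> (Suc R) \<longleftrightarrow> v \<in> code_tree \<tau>' (Suc R)) \<and> (v \<in> code_tree \<tau> (Suc R) \<longrightarrow> \<phi> v = \<phi>' v)"
        proof (cases "length v \<le> n")
          case True then show ?thesis using IH by blast
        next
          case False
          then obtain u i where v: "v = u @ [i]" using l by (cases v rule: rev_cases) auto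
          have lu: "length u = n" using False l v by simp
          have uS: "u \<in> code_tree \<tau> (Suc R) \<longleftrightarrow> u \<in> code_tree \<tau>' (Suc R)" using IH lu by simp
          have uR: "u \<in> code_tree \<tau> R \<longleftrightarrow> u \<in> code_tree \<tau> (Suc R)" "u \<in> code_tree \<tau>' R \<longleftrightarrow> u \<in> code_tree \<tau>' (Suc R)"
            using code_tree_mono[of R "Suc R"] code_tree_Suc_length[of u] lu nR by auto
          show ?thesis
            using *[OF nR IH] lu uS uR unfolding v snoc_in_code_tree by auto
        qed
      qed
    qed
  qed
  have "\<tau> v = \<tau>' v" for v
  proof (cases "length v \<le> R")
    case True
    have iff: "v \<in> code_tree \<tau> (Suc R) \<longleftrightarrow> v \<in> code_tree \<tau>' (Suc R)" using main[OF True] by blast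
    show ?thesis
    proof (cases "v \<in> code_tree \<tau> (Suc R)")
      case t: True
      then show ?thesis using step[OF True main[OF True]] by blast
    next
      case False
      then have "v \<notin> code_tree \<tau> R" "v \<notin> code_tree \<tau>' R" using iff code_tree_mono[of R "Suc R"] by auto
      then show ?thesis using valid_codeD(1)[OF V] valid_codeD(1)[OF V'] by simp
    qed
  next
    case False
    then have "v \<notin> code_tree \<tau> R" "v \<notin> code_tree \<tau>' R" using code_tree_length by blast+
    then show ?thesis using valid_codeD(1)[OF V] valid_codeD(1)[OF V'] by simp
  qed
  then have eq: "\<tau> = \<tau>'" by blast
  have "\<phi> v = \<phi>' v" if v: "v \<in> code_tree \<tau> (Suc R)" for v
    using v
  proof (cases rule: code_tree_cases)
    case 1 then show ?thesis using encodesD(1)[OF E] encodesD(1)[OF E'] by simp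
  next
    case (2 u i)
    have "length u \<le> R" "u \<in> code_tree \<tau> (Suc R)" using 2(2) code_tree_length code_tree_mono[of R "Suc R" \<tau>] by auto
    then show ?thesis using step[OF _ main, of "length u"] 2 by blast
  qed
  with eq show ?thesis by blast
qed

section \<open>The wired minimal spanning forest of a weighted Ulam-Harris tree\<close>

lemma verts_uh [simp]: "verts ulam_harris = {v. set v \<subseteq> {1..}}"
  by (simp add: ulam_harris_def)

lemma child_weight_edge [simp]: "child_weight x {v, v @ [i]} = x v i"
  unfolding child_weight_def snoc_doubleton_eq by (rule the_equality) auto

lemma child_weight_edge' [simp]: "child_weight x {v @ [i], v} = x v i"
  using child_weight_edge[of x v i] by (simp add: insert_commute)

lemma edge_uh_iff:
  "e \<in> edges ulam_harris \<longleftrightarrow> (\<exists>v i. e = {v, v @ [i]} \<and> set v \<subseteq> {1..} \<and> 1 \<le> i)"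
  by (auto simp: ulam_harris_def)

lemma uh_pair_iff:
  "{u, v} \<in> edges ulam_harris \<longleftrightarrow> set u \<subseteq> {1..} \<and> set v \<subseteq> {1..} \<and> tree_step u v"
proof
  assume "{u, v} \<in> edges ulam_harris"
  then obtain a i where a: "{u, v} = {a, a @ [i]}" "set a \<subseteq> {1..}" "1 \<le> i" unfolding edge_uh_iff by blast
  then have "u = a \<and> v = a @ [i] \<or> u = a @ [i] \<and> v = a" unfolding doubleton_eq_iff by blast
  with a(2,3) show "set u \<subseteq> {1..} \<and> set v \<subseteq> {1..} \<and> tree_step u v" unfolding tree_step_def by auto
next
  assume *: "set u \<subseteq> {1..} \<and> set v \<subseteq> {1..} \<and> tree_step u v"
  then consider i where "v = u @ [i]" | i where "u = v @ [i]" unfolding tree_step_def by blast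
  then show "{u, v} \<in> edges ulam_harris"
  proof cases
    case 1
    then show ?thesis unfolding edge_uh_iff using * by (intro exI[of _ u] exI[of _ i]) auto
  next
    case 2
    then show ?thesis unfolding edge_uh_iff using * by (intro exI[of _ v] exI[of _ i]) auto
  qed
qed

lemma simple_uh: "simple_graph ulam_harris"
  unfolding simple_graph_def
proof
  fix e assume "e \<in> edges ulam_harris"
  then obtain v i where "e = {v, v @ [i]}" "set v \<subseteq> {1..}" "1 \<le> i" unfolding edge_uh_iff by blast
  then have "v \<in> verts ulam_harris" "v @ [i] \<in> verts ulam_harris" "v \<noteq> v @ [i]" "e = {v, v @ [i]}" by auto
  then show "\<exists>u\<in>verts ulam_harris. \<exists>v\<in>verts ulam_harris. u \<noteq> v \<and> e = {u, v}" by metis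
qed

text \<open>The descendants of the lower endpoint of an edge are left only through this edge.\<close>

lemma uh_bridge_down:
  assumes "(v @ [i], y) \<in> A\<^sup>*" and A: "\<And>a b. (a, b) \<in> A \<Longrightarrow> {a, b} \<in> edges ulam_harris \<and> {a, b} \<noteq> {v, v @ [i]}"
  shows "prefix (v @ [i]) y"
  using assms(1)
proof induction
  case base then show ?case by simp
next
  case (step y z)
  have yz: "{y, z} \<in> edges ulam_harris" "{y, z} \<noteq> {v, v @ [i]}" using A[OF step.hyps(2)] by auto
  from yz(1) consider j where "z = y @ [j]" | j where "y = z @ [j]" unfolding uh_pair_iff tree_step_def by blast
  then show ?case
  proof cases
    case 1 then show ?thesis using step.IH by (meson prefixI prefix_order.trans)
  next
    case 2
    then have "y \<noteq> v @ [i]" using yz(2) by (auto simp: insert_commute)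
    with step.IH 2 show ?thesis by (auto simp: prefix_snoc)
  qed
qed

lemma uh_bridge:
  assumes e: "{z, z'} \<in> edges ulam_harris"
    and A: "\<And>a b. (a, b) \<in> A \<Longrightarrow> {a, b} \<in> edges ulam_harris \<and> {a, b} \<noteq> {z, z'}" and s: "sym A"
  shows "(z, z') \<notin> A\<^sup>*"
proof
  assume p: "(z, z') \<in> A\<^sup>*"
  have p': "(z', z) \<in> A\<^sup>*" using p s by (metis sym_rtrancl symD)
  from e consider i where "z' = z @ [i]" | i where "z = z' @ [i]" unfolding uh_pair_iff tree_step_def by blast
  then show False
  proof cases
    case 1
    have "prefix (z @ [i]) z" by (rule uh_bridge_down[of z i z A]) (use p' A 1 in auto)
    then show False by (auto dest: prefix_length_le)
  next
    case 2
    have "prefix (z' @ [i]) z'" by (rule uh_bridge_down[of z' i z' A]) (use p A 2 in \<open>auto simp: insert_commute\<close>)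
    then show False by (auto dest: prefix_length_le)
  qed
qed

lemma weight_arrayD:
  assumes "weight_array x" "set v \<subseteq> {1..}"
  shows "0 \<le> x v 1" "\<And>i. i \<ge> 1 \<Longrightarrow> x v i < x v (Suc i)" "filterlim (x v) at_top sequentially"
  using assms unfolding weight_array_def by auto

lemma weight_array_mono:
  assumes "weight_array x" "set v \<subseteq> {1..}" "1 \<le> i" "i < j" shows "x v i < x v j"
  using assms(4)
proof (induction j)
  case 0 then show ?case by simp
next
  case (Suc j)
  show ?case
  proof (cases "i = j")
    case True then show ?thesis using weight_arrayD(2)[OF assms(1,2), of i] assms(3) by simp
  next
    case False
    then have "x v i < x v j" using Suc by simp
    also have "x v j < x v (Suc j)" using weight_arrayD(2)[OF assms(1,2), of j] assms(3) False Suc.prems by simp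
    finally show ?thesis .
  qed
qed

lemma weight_array_nonneg:
  assumes "weight_array x" "set v \<subseteq> {1..}" "1 \<le> i" shows "0 \<le> x v i"
  using weight_arrayD(1)[OF assms(1,2)] weight_array_mono[OF assms(1,2), of 1 i] assms(3)
  by (cases "i = 1") auto

lemma weight_array_finite:
  assumes "weight_array x" "set v \<subseteq> {1..}" shows "finite {i. x v i \<le> t}"
proof -
  have "eventually (\<lambda>i. t < x v i) sequentially"
    using weight_arrayD(3)[OF assms] unfolding filterlim_at_top_dense by blast
  then obtain N where "\<And>i. i \<ge> N \<Longrightarrow> t < x v i" unfolding eventually_sequentially by blast
  then have "{i. x v i \<le> t} \<subseteq> {..<N}" by (force simp: not_le[symmetric])
  then show ?thesis using finite_subset by blast
qed

lemma finite_incident_light: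
  assumes x: "weight_array x" and F: "finite F"
  shows "finite {e \<in> edges ulam_harris. e \<inter> F \<noteq> {} \<and> child_weight x e \<le> t}" (is "finite ?S")
proof -
  let ?F = "{v \<in> F \<union> butlast ` F. set v \<subseteq> {1..}}"
  have "?S \<subseteq> (\<lambda>(v, i). {v, v @ [i]}) ` (SIGMA v:?F. {i. x v i \<le> t})"
  proof
    fix e assume "e \<in> ?S"
    then obtain v i where e: "e = {v, v @ [i]}" "set v \<subseteq> {1..}" "e \<inter> F \<noteq> {}" "child_weight x e \<le> t"
      unfolding edge_uh_iff by blast
    then have "v \<in> F \<or> v @ [i] \<in> F" by auto
    then have "v \<in> ?F" using e(2) by (auto intro: rev_image_eqI[of "v @ [i]"])
    moreover have "x v i \<le> t" using e by simp
    ultimately show "e \<in> (\<lambda>(v, i). {v, v @ [i]}) ` (SIGMA v:?F. {i. x v i \<le> t})"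
      using e(1) by (intro image_eqI[of _ _ "(v, i)"]) auto
  qed
  moreover have "finite (SIGMA v:?F. {i. x v i \<le> t})"
    using F weight_array_finite[OF x] by (intro finite_SigmaI) auto
  ultimately show ?thesis using finite_subset by blast
qed

lemma invasion_in_uh:
  assumes u: "set u \<subseteq> {1..}"
  shows "verts (invasion ulam_harris w u n) \<subseteq> verts ulam_harris \<and> edges (invasion ulam_harris w u n) \<subseteq> edges ulam_harris"
proof (induction n)
  case 0 then show ?case using u by auto
next
  case (Suc n)
  have "lowest w (boundary ulam_harris (invasion ulam_harris w u n)) \<subseteq> edges ulam_harris" by (auto simp: lowest_def boundary_def)
  moreover have "\<Union> (edges ulam_harris) \<subseteq> verts ulam_harris"
  proof
    fix y assume "y \<in> \<Union> (edges ulam_harris)"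
    then obtain f where f: "f \<in> edges ulam_harris" "y \<in> f" by blast
    obtain a b where "a \<in> verts ulam_harris" "b \<in> verts ulam_harris" "f = {a, b}" using simple_edgeE[OF simple_uh f(1)] by metis
    then show "y \<in> verts ulam_harris" using f(2) by blast
  qed
  ultimately show ?case using Suc by (auto simp: Let_def)
qed

lemma verts_wmsf: "verts (wmsf ulam_harris w) = verts ulam_harris"
proof
  show "verts (wmsf ulam_harris w) \<subseteq> verts ulam_harris"
  proof
    fix v assume "v \<in> verts (wmsf ulam_harris w)"
    then obtain u n where "u \<in> verts ulam_harris" "v \<in> verts (invasion ulam_harris w u n)"
      unfolding wmsf_def invasion_cluster_def graph.sel by blast
    then show "v \<in> verts ulam_harris" using invasion_in_uh[of u w n] by auto
  qed
  show "verts ulam_harris \<subseteq> verts (wmsf ulam_harris w)"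
  proof
    fix u assume u: "u \<in> verts ulam_harris"
    have "u \<in> verts (invasion ulam_harris w u 0)" by simp
    then show "u \<in> verts (wmsf ulam_harris w)" unfolding wmsf_def invasion_cluster_def graph.sel using u by blast
  qed
qed

lemma edges_wmsf_subset: "edges (wmsf ulam_harris w) \<subseteq> edges ulam_harris"
  using invasion_in_uh by (fastforce simp: wmsf_def invasion_cluster_def)

lemma simple_wmsf: "simple_graph (wmsf ulam_harris w)"
  by (rule simple_subgraph[OF simple_uh verts_wmsf edges_wmsf_subset])

context
  fixes x :: "nat list \<Rightarrow> nat \<Rightarrow> real"
  assumes x: "weight_array x"
begin

abbreviation (input) "wt \<equiv> child_weight x"
abbreviation (input) "UH \<equiv> ulam_harris"

lemma lowest_nonempty:
  assumes F: "finite F" and B: "e0 \<in> B" "\<And>e. e \<in> B \<Longrightarrow> e \<in> edges UH \<and> e \<inter> F \<noteq> {}"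
  shows "finite (lowest wt B)" "\<exists>e. e \<in> lowest wt B"
proof -
  have "B \<inter> {e. wt e \<le> wt e0} \<subseteq> {e \<in> edges UH. e \<inter> F \<noteq> {} \<and> wt e \<le> wt e0}" using B(2) by auto
  then have fin: "finite (B \<inter> {e. wt e \<le> wt e0})" using finite_incident_light[OF x F] finite_subset by blast
  have "lowest wt B \<subseteq> B \<inter> {e. wt e \<le> wt e0}" using B(1) by (auto simp: lowest_def)
  then show "finite (lowest wt B)" using fin finite_subset by blast
  have "B \<inter> {e. wt e \<le> wt e0} \<noteq> {}" using B(1) by auto
  from arg_min_if_finite[OF fin this, of wt]
  obtain e where e: "e \<in> B" "wt e \<le> wt e0" "\<And>f. f \<in> B \<Longrightarrow> wt f \<le> wt e0 \<Longrightarrow> wt e \<le> wt f"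
    by (metis (no_types, lifting) Int_iff mem_Collect_eq not_le)
  then have "e \<in> lowest wt B" unfolding lowest_def by (auto intro: order_trans) (meson e(2,3) linear order_trans)
  then show "\<exists>e. e \<in> lowest wt B" by blast
qed

lemma finite_invasion:
  assumes u: "set u \<subseteq> {1..}"
  shows "finite (verts (invasion UH wt u n))"
proof (induction n)
  case 0 then show ?case by simp
next
  case (Suc n)
  let ?I = "invasion UH wt u n"
  let ?B = "boundary UH ?I"
  have "finite (lowest wt ?B)"
  proof (cases "?B = {}")
    case True then show ?thesis by (simp add: lowest_def)
  next
    case False
    then obtain e0 where "e0 \<in> ?B" by auto
    then show ?thesis by (rule lowest_nonempty(1)[OF Suc]) (auto simp: boundary_def)
  qed
  moreover have "finite e" if "e \<in> lowest wt ?B" for e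
    using that by (auto simp: lowest_def boundary_def edge_uh_iff)
  ultimately show ?case using Suc by (simp add: Let_def)
qed

text \<open>When the invasion from \<open>u\<close> takes an edge \<open>e\<close> at an invaded vertex \<open>z\<close>, all lighter edges that
  can be reached from \<open>z\<close> along lighter edges have been taken before, so only finitely many
  vertices can be reached in this way.\<close>

lemma invasion_absorbs:
  assumes e: "e \<in> lowest wt (boundary UH (invasion UH wt u n))" and z: "z \<in> verts (invasion UH wt u n)"
  shows "(adj (below UH wt (wt e)))\<^sup>* `` {z} \<subseteq> verts (invasion UH wt u n)"
proof
  let ?I = "invasion UH wt u n"
  have in_edges: "f \<subseteq> verts (invasion UH wt u m)" if "f \<in> edges (invasion UH wt u m)" for f m
    using that by (induction m) (auto simp: Let_def)
  fix y assume "y \<in> (adj (below UH wt (wt e)))\<^sup>* `` {z}"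
  then have "(z, y) \<in> (adj (below UH wt (wt e)))\<^sup>*" by simp
  then show "y \<in> verts ?I"
  proof induction
    case base then show ?case using z .
  next
    case (step a b)
    have ab: "{a, b} \<in> edges UH" "wt {a, b} < wt e" using step.hyps(2) by (auto simp: adj_below_iff)
    have "{a, b} \<in> edges ?I"
    proof (rule ccontr)
      assume "{a, b} \<notin> edges ?I"
      then have "{a, b} \<in> boundary UH ?I" using ab step.IH by (auto simp: boundary_def)
      then have "wt e \<le> wt {a, b}" using e by (auto simp: lowest_def)
      with ab show False by simp
    qed
    then show ?case using in_edges by blast
  qed
qed

text \<open>Conversely, the invasion from \<open>z\<close> first fills the finite set of vertices that can be reached by
  edges lighter than \<open>e\<close>; then \<open>e\<close> is a lowest edge of its boundary.\<close>

lemma invasion_takes: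
  assumes e: "{z, z'} \<in> edges UH" and fin: "finite ((adj (below UH wt (wt {z, z'})))\<^sup>* `` {z})"
  shows "\<exists>n. {z, z'} \<in> edges (invasion UH wt z n)"
proof (rule ccontr)
  assume no: "\<not> ?thesis"
  let ?A = "adj (below UH wt (wt {z, z'}))"
  let ?C = "?A\<^sup>* `` {z}"
  let ?I = "invasion UH wt z"
  have zV: "set z \<subseteq> {1..}" using e by (simp add: uh_pair_iff)
  \<comment> \<open>As long as the edge is not taken, every step takes at least one edge inside the finite set \<open>?C\<close>.\<close>
  have inC: "verts (?I n) \<subseteq> ?C \<and> (\<forall>f\<in>edges (?I n). f \<subseteq> verts (?I n)) \<and> z \<in> verts (?I n) \<and> card (edges (?I n)) \<ge> n \<and> finite (edges (?I n))" for n
  proof (induction n)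
    case 0 then show ?case by auto
  next
    case (Suc n)
    let ?B = "boundary UH (?I n)"
    let ?L = "lowest wt ?B"
    have zz: "{z, z'} \<in> ?B" using Suc e no by (auto simp: boundary_def)
    have L: "finite ?L" "\<exists>f. f \<in> ?L"
      using lowest_nonempty[OF finite_invasion[OF zV, of n] zz] by (auto simp: boundary_def)
    have notL: "{z, z'} \<notin> ?L"
    proof
      assume "{z, z'} \<in> ?L"
      then have "{z, z'} \<in> edges (?I (Suc n))" by (simp add: Let_def)
      with no show False by blast
    qed
    have lt: "wt f < wt {z, z'}" if f: "f \<in> ?L" for f
    proof (rule ccontr)
      assume "\<not> wt f < wt {z, z'}"
      then have "wt {z, z'} \<le> wt g" if "g \<in> ?B" for g using f that by (force simp: lowest_def)
      then have "{z, z'} \<in> ?L" using zz by (auto simp: lowest_def)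
      with notL show False by simp
    qed
    have sub: "f \<subseteq> ?C" if f: "f \<in> ?L" for f
    proof -
      have fB: "f \<in> edges UH" "f \<inter> verts (?I n) \<noteq> {}" using f by (auto simp: lowest_def boundary_def)
      then obtain a where a: "a \<in> f" "a \<in> verts (?I n)" by auto
      obtain b where b: "f = {a, b}" using fB(1) a(1) unfolding edge_uh_iff by (auto simp: insert_commute)
      have "(a, b) \<in> ?A" using fB(1) lt[OF f] b by (simp add: adj_below_iff)
      moreover have "(z, a) \<in> ?A\<^sup>*" using Suc a by auto
      ultimately have "(z, b) \<in> ?A\<^sup>*" by (rule rtrancl_into_rtrancl[rotated])
      then show ?thesis using b \<open>(z, a) \<in> ?A\<^sup>*\<close> by auto
    qed
    have new: "?L \<inter> edges (?I n) = {}" by (auto simp: lowest_def boundary_def)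
    have "card (edges (?I n) \<union> ?L) = card (edges (?I n)) + card ?L"
      using Suc L(1) new by (intro card_Un_disjoint) auto
    moreover have "card ?L > 0" using L by (auto simp: card_gt_0_iff)
    ultimately show ?case using Suc sub L(1) by (auto simp: Let_def)
  qed
  have "edges (?I n) \<subseteq> Pow ?C" for n using inC[of n] by blast
  then have "card (edges (?I n)) \<le> card (Pow ?C)" for n by (intro card_mono) (use fin in auto)
  moreover have "card (edges (?I (Suc (card (Pow ?C))))) \<ge> Suc (card (Pow ?C))" using inC by blast
  ultimately show False by (metis not_less_eq_eq)
qed

text \<open>Invasion percolation is thereby replaced by a condition on clusters. If the invasion from some vertex takes
  the edge, the cluster on the invaded side is finite; if one cluster is finite, the invasion from that
  endpoint takes the edge.\<close>

theorem wmsf_edge_iff: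
  "e \<in> edges (wmsf UH wt) \<longleftrightarrow>
     e \<in> edges UH \<and> (\<exists>z\<in>e. finite ((adj (below UH wt (wt e)))\<^sup>* `` {z}))"
proof
  assume "e \<in> edges (wmsf UH wt)"
  then obtain u n where u: "set u \<subseteq> {1..}" and n: "e \<in> edges (invasion UH wt u n)"
    unfolding wmsf_def invasion_cluster_def by auto
  have "\<exists>m. e \<in> lowest wt (boundary UH (invasion UH wt u m))"
    using n by (induction n) (auto simp: Let_def)
  then obtain m where m: "e \<in> lowest wt (boundary UH (invasion UH wt u m))" by blast
  then obtain z where z: "z \<in> e" "z \<in> verts (invasion UH wt u m)" by (auto simp: lowest_def boundary_def)
  have "finite ((adj (below UH wt (wt e)))\<^sup>* `` {z})"
    using invasion_absorbs[OF m z(2)] finite_invasion[OF u] finite_subset by blast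
  then show "e \<in> edges UH \<and> (\<exists>z\<in>e. finite ((adj (below UH wt (wt e)))\<^sup>* `` {z}))"
    using z(1) m by (auto simp: lowest_def boundary_def)
next
  assume *: "e \<in> edges UH \<and> (\<exists>z\<in>e. finite ((adj (below UH wt (wt e)))\<^sup>* `` {z}))"
  then obtain z where z: "z \<in> e" "finite ((adj (below UH wt (wt e)))\<^sup>* `` {z})" by blast
  obtain z' where z': "e = {z, z'}" using * z(1) unfolding edge_uh_iff by (auto simp: insert_commute)
  have zV: "z \<in> verts UH" using * z' uh_pair_iff by auto
  obtain n where "e \<in> edges (invasion UH wt z n)" using invasion_takes[of z z'] * z(2) z' by auto
  then show "e \<in> edges (wmsf UH wt)" unfolding wmsf_def invasion_cluster_def using zV by auto
qed

lemma finite_reach_below: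
  assumes z: "set z \<subseteq> {1..}"
  shows "finite (reach (adj (below UH wt t)) k z)"
proof -
  let ?A = "adj (below UH wt t)"
  have "finite {y. (z, y) \<in> ?A ^^ j} \<and> {y. (z, y) \<in> ?A ^^ j} \<subseteq> verts UH" for j
  proof (induction j)
    case 0 then show ?case using z by auto
  next
    case (Suc j)
    let ?S = "{y. (z, y) \<in> ?A ^^ j}"
    have "{y. (z, y) \<in> ?A ^^ Suc j} \<subseteq> \<Union> {e \<in> edges UH. e \<inter> ?S \<noteq> {} \<and> wt e \<le> t}"
      by (auto simp: adj_below_iff)
    moreover have "finite (\<Union> {e \<in> edges UH. e \<inter> ?S \<noteq> {} \<and> wt e \<le> t})"
      using finite_incident_light[OF x, of ?S t] Suc by (auto simp: edge_uh_iff)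
    ultimately have "finite {y. (z, y) \<in> ?A ^^ Suc j}" using finite_subset by blast
    moreover have "{y. (z, y) \<in> ?A ^^ Suc j} \<subseteq> verts UH"
      by (auto simp: adj_below_iff uh_pair_iff)
    ultimately show ?case by blast
  qed
  then have "finite (\<Union>j\<in>{..k}. {y. (z, y) \<in> ?A ^^ j})" by blast
  then show ?thesis by (rule rev_finite_subset) (auto simp: reach_def)
qed

text \<open>A cluster that is exhausted within \<open>K\<close> steps is finite.\<close>

lemma good_subset_wmsf: "edges (good_graph K l UH wt) \<subseteq> edges (wmsf UH wt)"
proof
  fix e assume "e \<in> edges (good_graph K l UH wt)"
  then obtain z z' where e: "e \<in> edges UH" "e = {z, z'}" "shut_in UH wt K z z'" by (auto simp: good_graph_def)
  let ?A = "adj (below UH wt (wt e))"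
  have c: "?A `` reach ?A K z \<subseteq> reach ?A K z" using e(2,3) by (simp add: shut_in_def Let_def)
  have "?A\<^sup>* `` {z} \<subseteq> reach ?A K z" using reach_closed[OF c] by auto
  moreover have "set z \<subseteq> {1..}" using e uh_pair_iff by auto
  ultimately have "finite (?A\<^sup>* `` {z})" using finite_reach_below finite_subset by blast
  then show "e \<in> edges (wmsf UH wt)" unfolding wmsf_edge_iff using e by auto
qed

text \<open>A finite cluster is exhausted within some number of steps, and it cannot contain the other endpoint since
  every edge of a tree is a bridge.\<close>

lemma wmsf_eventually_good:
  assumes e: "e \<in> edges (wmsf UH wt)"
  shows "\<exists>K0. \<forall>K l. K0 \<le> K \<longrightarrow> wt e < l \<longrightarrow> e \<in> edges (good_graph K l UH wt)"
proof -
  obtain z where z: "e \<in> edges UH" "z \<in> e" "finite ((adj (below UH wt (wt e)))\<^sup>* `` {z})"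
    using e unfolding wmsf_edge_iff by blast
  then obtain z' where z': "e = {z, z'}" unfolding edge_uh_iff by (auto simp: insert_commute)
  let ?A = "adj (below UH wt (wt e))"
  let ?C = "?A\<^sup>* `` {z}"
  have "\<exists>k. (z, y) \<in> ?A ^^ k" if "y \<in> ?C" for y using that rtrancl_imp_relpow by fastforce
  then obtain k where k: "\<And>y. y \<in> ?C \<Longrightarrow> (z, y) \<in> ?A ^^ k y" by metis
  define K0 where "K0 = Max (insert 0 (k ` ?C))"
  have K0: "k y \<le> K0" if "y \<in> ?C" for y using z(3) that by (simp add: K0_def)
  have "e \<in> edges (good_graph K l UH wt)" if "K0 \<le> K" "wt e < l" for K l
  proof -
    have R: "reach ?A K z = ?C"
    proof
      show "reach ?A K z \<subseteq> ?C" by (auto dest: reach_rtrancl)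
      show "?C \<subseteq> reach ?A K z" 
      proof
        fix y assume y: "y \<in> ?C"
        have "k y \<le> K" using K0[OF y] that(1) by simp
        then show "y \<in> reach ?A K z" unfolding reach_def using k[OF y] by blast
      qed
    qed
    have closed: "?A `` reach ?A K z \<subseteq> reach ?A K z" unfolding R by (auto intro: rtrancl_into_rtrancl)
    have "(z, z') \<notin> ?A\<^sup>*"
    proof (rule uh_bridge)
      show "{z, z'} \<in> edges UH" using z z' by simp
      show "sym ?A" by (rule sym_adj)
      show "{a, b} \<in> edges UH \<and> {a, b} \<noteq> {z, z'}" if "(a, b) \<in> ?A" for a b
        using that z' by (auto simp: adj_below_iff)
    qed
    then have "z' \<notin> reach ?A K z" by (auto dest: reach_rtrancl)
    then have "shut_in UH wt K z z'" using closed z' by (simp add: shut_in_def)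
    then show ?thesis using z z' that(2) by (auto simp: good_graph_def)
  qed
  then show ?thesis by blast
qed

end

section \<open>Measurability of random rooted graphs\<close>

text \<open>Vertex sets and adjacency determine a simple graph, and on countably many vertices these
  are countably many events.\<close>

definition measurable_graph :: "'q measure \<Rightarrow> ('q \<Rightarrow> 'v graph) \<Rightarrow> bool" where
  "measurable_graph Q X \<longleftrightarrow> (\<forall>v. Measurable.pred Q (\<lambda>\<omega>. v \<in> verts (X \<omega>))) \<and>
     (\<forall>u v. Measurable.pred Q (\<lambda>\<omega>. (u, v) \<in> adj (X \<omega>)))"

lemma pred_constI: "Measurable.pred Q (\<lambda>\<omega>. c)"
  by simp

lemma pred_relpow:
  fixes A :: "'q \<Rightarrow> ('v :: countable) rel"
  assumes "\<And>x y. Measurable.pred Q (\<lambda>\<omega>. (x, y) \<in> A \<omega>)"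
  shows "Measurable.pred Q (\<lambda>\<omega>. (x, y) \<in> A \<omega> ^^ k)"
proof (induction k arbitrary: y)
  case 0 then show ?case by simp
next
  case (Suc k)
  have "Measurable.pred Q (\<lambda>\<omega>. \<exists>z. (x, z) \<in> A \<omega> ^^ k \<and> (z, y) \<in> A \<omega>)"
    by (intro pred_intros_countable pred_intros_logic Suc assms)
  then show ?case by (simp add: relcomp_unfold)
qed

lemma pred_reach:
  fixes A :: "'q \<Rightarrow> ('v :: countable) rel"
  assumes "\<And>x y. Measurable.pred Q (\<lambda>\<omega>. (x, y) \<in> A \<omega>)"
  shows "Measurable.pred Q (\<lambda>\<omega>. y \<in> reach (A \<omega>) k x)"
  unfolding reach_def mem_Collect_eq
  by (intro pred_intros_countable pred_intros_logic pred_relpow assms pred_constI)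

lemma pred_rtrancl:
  fixes A :: "'q \<Rightarrow> ('v :: countable) rel"
  assumes "\<And>x y. Measurable.pred Q (\<lambda>\<omega>. (x, y) \<in> A \<omega>)"
  shows "Measurable.pred Q (\<lambda>\<omega>. (x, y) \<in> (A \<omega>)\<^sup>*)"
proof -
  have "Measurable.pred Q (\<lambda>\<omega>. \<exists>k. (x, y) \<in> A \<omega> ^^ k)"
    by (intro pred_intros_countable pred_relpow assms)
  then show ?thesis by (simp add: rtrancl_is_UN_relpow)
qed

lemma pred_finite_set:
  fixes S :: "'q \<Rightarrow> ('v :: countable) set"
  assumes "\<And>y. Measurable.pred Q (\<lambda>\<omega>. y \<in> S \<omega>)"
  shows "Measurable.pred Q (\<lambda>\<omega>. finite (S \<omega>))"
    and "Measurable.pred Q (\<lambda>\<omega>. finite (S \<omega>) \<and> card (S \<omega>) \<le> N)"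
proof -
  have "finite (S \<omega>) \<longleftrightarrow> (\<exists>xs. \<forall>y. y \<in> S \<omega> \<longrightarrow> y \<in> set xs)" for \<omega>
    by (metis List.finite_set finite_list finite_subset subsetI)
  moreover have "Measurable.pred Q (\<lambda>\<omega>. \<exists>xs. \<forall>y. y \<in> S \<omega> \<longrightarrow> y \<in> set xs)"
    by (intro pred_intros_countable pred_intros_logic assms pred_constI)
  ultimately show "Measurable.pred Q (\<lambda>\<omega>. finite (S \<omega>))" by simp
  have "finite (S \<omega>) \<and> card (S \<omega>) \<le> N \<longleftrightarrow> (\<exists>xs. length xs \<le> N \<and> (\<forall>y. y \<in> S \<omega> \<longrightarrow> y \<in> set xs))" for \<omega>
  proof
    assume *: "finite (S \<omega>) \<and> card (S \<omega>) \<le> N"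
    then obtain xs where "set xs = S \<omega>" "distinct xs" using finite_distinct_list by blast
    then show "\<exists>xs. length xs \<le> N \<and> (\<forall>y. y \<in> S \<omega> \<longrightarrow> y \<in> set xs)"
      using * by (intro exI[of _ xs]) (auto simp: distinct_card[symmetric])
  next
    assume "\<exists>xs. length xs \<le> N \<and> (\<forall>y. y \<in> S \<omega> \<longrightarrow> y \<in> set xs)"
    then obtain xs where xs: "length xs \<le> N" "S \<omega> \<subseteq> set xs" by blast
    then have "card (S \<omega>) \<le> card (set xs)" by (intro card_mono) auto
    also have "\<dots> \<le> length xs" by (rule card_length)
    finally show "finite (S \<omega>) \<and> card (S \<omega>) \<le> N" using xs finite_subset[OF xs(2)] by simp
  qed
  moreover have "Measurable.pred Q (\<lambda>\<omega>. \<exists>xs. length xs \<le> N \<and> (\<forall>y. y \<in> S \<omega> \<longrightarrow> y \<in> set xs))"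
    by (intro pred_intros_countable pred_intros_logic assms pred_constI)
  ultimately show "Measurable.pred Q (\<lambda>\<omega>. finite (S \<omega>) \<and> card (S \<omega>) \<le> N)" by (simp only:)
qed

lemma measurable_graph_ball:
  fixes X :: "'q \<Rightarrow> ('v :: countable) graph"
  assumes "measurable_graph Q X" shows "measurable_graph Q (\<lambda>\<omega>. graph_ball (X \<omega>) v r)"
proof -
  have V: "Measurable.pred Q (\<lambda>\<omega>. u \<in> verts (X \<omega>))" and A: "Measurable.pred Q (\<lambda>\<omega>. (u, u') \<in> adj (X \<omega>))" for u u'
    using assms unfolding measurable_graph_def by auto
  have B: "Measurable.pred Q (\<lambda>\<omega>. \<exists>k\<le>r. (v, u) \<in> adj (X \<omega>) ^^ k)" for u
    by (intro pred_intros_countable pred_intros_logic pred_relpow A pred_constI)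
  show ?thesis
    unfolding measurable_graph_def verts_graph_ball
    by (auto simp: graph_ball_def adj_induced gdist_le_iff intro!: pred_intros_logic V A B)
qed

lemma verts_induced: "verts (induced G S) = verts G \<inter> S"
  by (simp add: induced_def)

lemma measurable_graph_component:
  fixes X :: "'q \<Rightarrow> ('v :: countable) graph"
  assumes "measurable_graph Q X" shows "measurable_graph Q (\<lambda>\<omega>. component (X \<omega>) v)"
proof -
  have V: "Measurable.pred Q (\<lambda>\<omega>. u \<in> verts (X \<omega>))" and A: "Measurable.pred Q (\<lambda>\<omega>. (u, u') \<in> adj (X \<omega>))" for u u'
    using assms unfolding measurable_graph_def by auto
  have B: "Measurable.pred Q (\<lambda>\<omega>. (v, u) \<in> (adj (X \<omega>))\<^sup>*)" for u
    by (intro pred_rtrancl A)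
  show ?thesis
    unfolding measurable_graph_def
    by (auto simp: component_def adj_induced verts_induced intro!: pred_intros_logic V A B)
qed

lemma simple_graph_eqI:
  assumes "simple_graph G" "simple_graph H" "verts G = verts H" "adj G = adj H"
  shows "G = H"
proof -
  have "edges G = edges H"
  proof (rule set_eqI)
    fix e
    have "e \<in> edges G \<longleftrightarrow> (\<exists>u v. e = {u, v} \<and> (u, v) \<in> adj G)"
      using simple_edgeE[OF assms(1), of e] unfolding adj_iff by metis
    moreover have "e \<in> edges H \<longleftrightarrow> (\<exists>u v. e = {u, v} \<and> (u, v) \<in> adj H)"
      using simple_edgeE[OF assms(2), of e] unfolding adj_iff by metis
    ultimately show "e \<in> edges G \<longleftrightarrow> e \<in> edges H" using assms(4) by simp
  qed
  then show ?thesis using assms(3) by (cases G; cases H) auto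
qed

lemma pred_lf_rooted:
  fixes X :: "'q \<Rightarrow> ('v :: countable) graph"
  assumes X: "measurable_graph Q X" and s: "\<And>\<omega>. \<omega> \<in> space Q \<Longrightarrow> simple_graph (X \<omega>)"
  shows "Measurable.pred Q (\<lambda>\<omega>. lf_rooted (X \<omega>, v))"
proof -
  have V: "Measurable.pred Q (\<lambda>\<omega>. u \<in> verts (X \<omega>))" and A: "Measurable.pred Q (\<lambda>\<omega>. (u, u') \<in> adj (X \<omega>))" for u u'
    using X unfolding measurable_graph_def by auto
  have "Measurable.pred Q (\<lambda>\<omega>. (\<forall>u u'. u \<in> verts (X \<omega>) \<longrightarrow> u' \<in> verts (X \<omega>) \<longrightarrow> (u, u') \<in> (adj (X \<omega>))\<^sup>*) \<and>
      (\<forall>u. u \<in> verts (X \<omega>) \<longrightarrow> finite {u'. (u, u') \<in> adj (X \<omega>)}) \<and> v \<in> verts (X \<omega>))"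
    by (intro pred_intros_countable pred_intros_logic pred_rtrancl pred_finite_set V) (simp_all add: A)
  then show ?thesis
    by (rule measurable_cong[THEN iffD1, rotated])
      (use s in \<open>auto simp: lf_rooted_def graph_connected_def locally_finite_def\<close>)
qed

lemma lf_rooted_ball:
  assumes s: "simple_graph (fst X)" and l: "locally_finite (fst X)" and root: "snd X \<in> verts (fst X)"
  shows "lf_rooted (rooted_ball X r)"
proof -
  let ?B = "graph_ball (fst X) (snd X) r"
  have sB: "simple_graph ?B" using simple_graph_ball[OF s] .
  have rB: "snd X \<in> verts ?B" using root_in_ball[OF root, of r] by (simp add: rooted_ball_def)
  have reach: "(snd X, u) \<in> (adj ?B)\<^sup>*" if "u \<in> verts ?B" for u
    using that relpow_in_ball[OF s root] unfolding verts_graph_ball by (auto dest: relpow_imp_rtrancl)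
  have "(u, v) \<in> (adj ?B)\<^sup>*" if "u \<in> verts ?B" "v \<in> verts ?B" for u v
  proof -
    have "(u, snd X) \<in> (adj ?B)\<^sup>*" using reach[OF that(1)] sym_rtrancl[OF sym_adj] by (meson symD)
    then show ?thesis using reach[OF that(2)] by simp
  qed
  then have "graph_connected ?B" using rB by (auto simp: graph_connected_def)
  moreover have "locally_finite ?B"
    unfolding locally_finite_def
  proof
    fix u assume "u \<in> verts ?B"
    then have "u \<in> verts (fst X)" by (auto simp: verts_graph_ball)
    then have "finite {v. (u, v) \<in> adj (fst X)}" using l by (auto simp: locally_finite_def)
    then show "finite {v. (u, v) \<in> adj ?B}"
      by (rule rev_finite_subset) (auto simp: graph_ball_def adj_induced)
  qed
  ultimately show ?thesis using sB rB by (simp add: lf_rooted_def rooted_ball_def)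
qed

lemma lf_rooted_rep: "lf_rooted (rep_rooted_graph x)"
  using Quotient3_rep_reflp[OF Quotient3_rooted_graph, of x] by (simp add: rooted_equiv_def)

lemma dist_rooted_class:
  assumes X: "lf_rooted X" and Y: "lf_rooted Y"
  shows "dist (rooted_class X) (rooted_class Y) = rooted_dist X Y"
proof -
  have *: "rooted_agreement X Y = rooted_agreement (rep_rooted_graph (rooted_class X)) (rep_rooted_graph (rooted_class Y))"
  proof -
    have "rooted_iso (rooted_ball X r) (rooted_ball Y r) \<longleftrightarrow>
        rooted_iso (rooted_ball (rep_rooted_graph (rooted_class X)) r) (rooted_ball (rep_rooted_graph (rooted_class Y)) r)" for r
      using rooted_iso_balls[OF X lf_rooted_rep rooted_class_iso[OF X], of r]
        rooted_iso_balls[OF Y lf_rooted_rep rooted_class_iso[OF Y], of r] X Y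
      by (meson lf_rooted_def root_in_ball rooted_iso_sym rooted_iso_trans lf_rooted_rep)
    then show ?thesis by (simp add: rooted_agreement_def)
  qed
  show ?thesis unfolding dist_rooted_graph_def map_fun_def comp_def id_def rooted_dist_def * by simp
qed

lemma rooted_class_eq_iff:
  assumes X: "lf_rooted X" and Y: "lf_rooted Y"
  shows "rooted_class X = rooted_class Y \<longleftrightarrow> rooted_iso X Y"
proof
  assume "rooted_class X = rooted_class Y"
  then show "rooted_iso X Y"
    using rooted_class_iso[OF X] rooted_class_iso[OF Y] Y
    by (metis lf_rooted_def rooted_iso_sym rooted_iso_trans)
next
  assume i: "rooted_iso X Y"
  have "enat r \<le> rooted_agreement X Y" for r
    using rooted_iso_balls[OF X Y i] rooted_agreement_ge by blast
  then have "rooted_agreement X Y = \<infinity>" by (metis Suc_n_not_le_n enat_ord_simps(1) not_infinity_eq)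
  then have "dist (rooted_class X) (rooted_class Y) = 0"
    unfolding dist_rooted_class[OF X Y] rooted_dist_def by simp
  then show "rooted_class X = rooted_class Y" by simp
qed

text \<open>A rooted graph and its ball of radius \<open>r\<close> have the same balls of radius at most \<open>r\<close>.\<close>

lemma tendsto_rooted_class_ball:
  assumes X: "lf_rooted X"
  shows "(\<lambda>r. rooted_class (rooted_ball X r)) \<longlonglongrightarrow> rooted_class X"
proof -
  have lfB: "lf_rooted (rooted_ball X r)" for r
    using X by (intro lf_rooted_ball) (auto simp: lf_rooted_def)
  have "dist (rooted_class (rooted_ball X r)) (rooted_class X) \<le> inverse (real (Suc r))" for r
  proof -
    have "rooted_ball (rooted_ball X r) r = rooted_ball X r"
      using X by (intro rooted_ball_ball) (auto simp: lf_rooted_def)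
    then have "rooted_iso (rooted_ball (rooted_ball X r) r) (rooted_ball X r)"
      using rooted_iso_refl by metis
    then have "enat r \<le> rooted_agreement (rooted_ball X r) X" by (rule rooted_agreement_ge)
    then show ?thesis
      unfolding dist_rooted_class[OF lfB X] rooted_dist_def
      by (cases "rooted_agreement (rooted_ball X r) X") (auto simp: divide_inverse intro!: le_imp_inverse_le)
  qed
  then have "(\<lambda>r. dist (rooted_class (rooted_ball X r)) (rooted_class X)) \<longlonglongrightarrow> 0"
    by (intro Lim_null_comparison[OF _ LIMSEQ_inverse_real_of_nat] always_eventually) auto
  then show ?thesis by (rule tendsto_dist_iff[THEN iffD2])
qed

lemma countable_finite_graphs:
  "countable {H :: ('v :: countable) graph. finite (verts H) \<and> edges H \<subseteq> Pow (verts H)}"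
proof -
  have "countable {E :: 'v set set. finite E \<and> E \<subseteq> {A. finite A}}"
    by (intro countable_Collect_finite_subset countable_Collect_finite)
  then have "countable ((\<lambda>(V, E). Graph V E) ` ({V :: 'v set. finite V} \<times> {E. finite E \<and> E \<subseteq> {A. finite A}}))"
    by (intro countable_image countable_SIGMA countable_Collect_finite)
  moreover have "{H :: 'v graph. finite (verts H) \<and> edges H \<subseteq> Pow (verts H)} \<subseteq>
      (\<lambda>(V, E). Graph V E) ` ({V. finite V} \<times> {E. finite E \<and> E \<subseteq> {A. finite A}})"
  proof
    fix H :: "'v graph" assume "H \<in> {H. finite (verts H) \<and> edges H \<subseteq> Pow (verts H)}"
    then have H: "finite (verts H)" "edges H \<subseteq> Pow (verts H)" by auto
    then have "finite (edges H)" "edges H \<subseteq> {A. finite A}"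
      using finite_subset[OF H(2)] by (auto dest: finite_subset)
    then show "H \<in> (\<lambda>(V, E). Graph V E) ` ({V. finite V} \<times> {E. finite E \<and> E \<subseteq> {A. finite A}})"
      using H by (intro image_eqI[of _ _ "(verts H, edges H)"]) auto
  qed
  ultimately show ?thesis using countable_subset by blast
qed

text \<open>The class of a random rooted graph is the limit of the classes of its balls, and these take
  countably many values, each on a measurable event.\<close>

theorem rooted_class_measurable:
  fixes X :: "'q \<Rightarrow> ('v :: countable) graph"
  assumes X: "measurable_graph Q X" and s: "\<And>\<omega>. \<omega> \<in> space Q \<Longrightarrow> simple_graph (X \<omega>)"
  shows "(\<lambda>\<omega>. rooted_class (X \<omega>, v)) \<in> borel_measurable Q"
proof -
  let ?lf = "\<lambda>\<omega>. lf_rooted (X \<omega>, v)"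
  let ?F = "{H :: 'v graph. finite (verts H) \<and> edges H \<subseteq> Pow (verts H)}"
  have lf: "Measurable.pred Q ?lf" by (rule pred_lf_rooted[OF X s])
  define g where "g r \<omega> = (if ?lf \<omega> then Some (graph_ball (X \<omega>) v r) else None)" for r \<omega>
  have g: "g r \<in> measurable Q (count_space (insert None (Some ` ?F)))" for r
  proof (subst measurable_count_space_eq_countable)
    show "countable (insert None (Some ` ?F))" using countable_finite_graphs by auto
    have B: "measurable_graph Q (\<lambda>\<omega>. graph_ball (X \<omega>) v r)" using measurable_graph_ball[OF X] .
    have "finite (verts (graph_ball (X \<omega>) v r)) \<and> edges (graph_ball (X \<omega>) v r) \<subseteq> Pow (verts (graph_ball (X \<omega>) v r))"
      if "?lf \<omega>" for \<omega>
    proof -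
      have s': "simple_graph (graph_ball (X \<omega>) v r)"
        using that by (auto simp: lf_rooted_def intro: simple_graph_ball)
      have "f \<subseteq> verts (graph_ball (X \<omega>) v r)" if "f \<in> edges (graph_ball (X \<omega>) v r)" for f
        using simple_edgeE[OF s' that] by (metis empty_subsetI insert_subset)
      then show ?thesis using finite_graph_ball[OF that, of r] by auto
    qed
    then have "g r \<in> space Q \<rightarrow> insert None (Some ` ?F)" by (auto simp: g_def)
    moreover have "g r -` {a} \<inter> space Q \<in> sets Q" for a
    proof (cases a)
      case None
      have "g r -` {a} \<inter> space Q = {\<omega> \<in> space Q. \<not> ?lf \<omega>}" by (auto simp: g_def None)
      also have "\<dots> \<in> sets Q" using lf by (simp add: pred_def[symmetric] pred_intros_logic)
      finally show ?thesis .
    next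
      case (Some H)
      show ?thesis
      proof (cases "simple_graph H")
        case True
        have *: "Measurable.pred Q (\<lambda>\<omega>. ?lf \<omega> \<and> (\<forall>u. u \<in> verts (graph_ball (X \<omega>) v r) \<longleftrightarrow> u \<in> verts H) \<and>
          (\<forall>u u'. (u, u') \<in> adj (graph_ball (X \<omega>) v r) \<longleftrightarrow> (u, u') \<in> adj H))"
          using B lf unfolding measurable_graph_def by (intro pred_intros_countable pred_intros_logic) auto
        have "g r -` {a} \<inter> space Q = {\<omega> \<in> space Q. ?lf \<omega> \<and> (\<forall>u. u \<in> verts (graph_ball (X \<omega>) v r) \<longleftrightarrow> u \<in> verts H) \<and>
          (\<forall>u u'. (u, u') \<in> adj (graph_ball (X \<omega>) v r) \<longleftrightarrow> (u, u') \<in> adj H)}"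
        proof (rule set_eqI)
          fix \<omega>
          have "graph_ball (X \<omega>) v r = H \<longleftrightarrow> verts (graph_ball (X \<omega>) v r) = verts H \<and> adj (graph_ball (X \<omega>) v r) = adj H"
            if "\<omega> \<in> space Q" using simple_graph_eqI[OF simple_graph_ball[OF s[OF that]] True] by metis
          then show "\<omega> \<in> g r -` {a} \<inter> space Q \<longleftrightarrow> \<omega> \<in> {\<omega> \<in> space Q. ?lf \<omega> \<and> (\<forall>u. u \<in> verts (graph_ball (X \<omega>) v r) \<longleftrightarrow> u \<in> verts H) \<and>
            (\<forall>u u'. (u, u') \<in> adj (graph_ball (X \<omega>) v r) \<longleftrightarrow> (u, u') \<in> adj H)}"
            unfolding set_eq_iff[of "verts _"] set_eq_iff[of "adj _"] by (auto simp: g_def Some)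
        qed
        also have "\<dots> \<in> sets Q" using * by (simp add: pred_def)
        finally show ?thesis .
      next
        case False
        have "graph_ball (X \<omega>) v r \<noteq> H" if "\<omega> \<in> space Q" for \<omega>
          using simple_graph_ball[OF s[OF that]] False by metis
        then have "g r -` {a} \<inter> space Q = {}" by (auto simp: g_def Some split: if_splits)
        then show ?thesis by simp
      qed
    qed
    ultimately show "g r \<in> space Q \<rightarrow> insert None (Some ` ?F) \<and>
      (\<forall>a\<in>insert None (Some ` ?F). g r -` {a} \<inter> space Q \<in> sets Q)" by blast
  qed
  define f where "f r \<omega> = (if ?lf \<omega> then rooted_class (rooted_ball (X \<omega>, v) r) else undefined)" for r \<omega>
  have "f r \<in> borel_measurable Q" for r
  proof -
    have "f r = (\<lambda>a. case a of None \<Rightarrow> undefined | Some H \<Rightarrow> rooted_class (H, v)) \<circ> g r"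
      by (rule ext) (simp add: f_def g_def rooted_ball_def)
    also have "\<dots> \<in> borel_measurable Q" by (rule measurable_comp[OF g]) auto
    finally show ?thesis .
  qed
  moreover have "(\<lambda>r. f r \<omega>) \<longlonglongrightarrow> rooted_class (X \<omega>, v)" for \<omega>
    using tendsto_rooted_class_ball[of "(X \<omega>, v)"] by (cases "?lf \<omega>") (auto simp: f_def rooted_class_def)
  ultimately show ?thesis by (rule borel_measurable_LIMSEQ_metric)
qed

section \<open>Measurability of the random subgraphs of the Poisson-weighted infinite tree\<close>

lemma pred_const_conj: "(C \<Longrightarrow> Measurable.pred Q P) \<Longrightarrow> Measurable.pred Q (\<lambda>\<omega>. C \<and> P \<omega>)"
  by (cases C) auto

lemma pred_const_imp: "(C \<Longrightarrow> Measurable.pred Q P) \<Longrightarrow> Measurable.pred Q (\<lambda>\<omega>. C \<longrightarrow> P \<omega>)"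
  by (cases C) auto

lemma measurable_child_weight:
  assumes w: "\<And>v i. set v \<subseteq> {1..} \<Longrightarrow> 1 \<le> i \<Longrightarrow> w v i \<in> borel_measurable Q" and e: "e \<in> edges ulam_harris"
  shows "(\<lambda>\<omega>. child_weight (\<lambda>v i. w v i \<omega>) e) \<in> borel_measurable Q"
proof -
  obtain v i where "e = {v, v @ [i]}" "set v \<subseteq> {1..}" "1 \<le> i" using e unfolding edge_uh_iff by blast
  then show ?thesis using w by simp
qed

lemma edge_uh_snoc: "{v, v @ [i]} \<in> edges ulam_harris \<longleftrightarrow> set v \<subseteq> {1..} \<and> 1 \<le> i"
  unfolding edge_uh_iff snoc_doubleton_eq by blast

context
  fixes Q :: "'q measure" and w :: "nat list \<Rightarrow> nat \<Rightarrow> 'q \<Rightarrow> real"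
  assumes w: "\<And>v i. set v \<subseteq> {1..} \<Longrightarrow> 1 \<le> i \<Longrightarrow> w v i \<in> borel_measurable Q"
begin

abbreviation (input) "cw \<omega> \<equiv> child_weight (\<lambda>v i. w v i \<omega>)"

lemma pred_invasion:
  "(\<forall>v. Measurable.pred Q (\<lambda>\<omega>. v \<in> verts (invasion ulam_harris (cw \<omega>) u n))) \<and>
   (\<forall>v i. Measurable.pred Q (\<lambda>\<omega>. {v, v @ [i]} \<in> edges (invasion ulam_harris (cw \<omega>) u n)))"
proof (induction n)
  case 0 then show ?case by simp
next
  case (Suc n)
  let ?I = "\<lambda>\<omega>. invasion ulam_harris (cw \<omega>) u n"
  let ?L = "\<lambda>\<omega>. lowest (cw \<omega>) (boundary ulam_harris (?I \<omega>))"
  have V: "Measurable.pred Q (\<lambda>\<omega>. v \<in> verts (?I \<omega>))" and E: "Measurable.pred Q (\<lambda>\<omega>. {v, v @ [i]} \<in> edges (?I \<omega>))" for v i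
    using Suc by auto
  have inB: "{v, v @ [i]} \<in> boundary ulam_harris (?I \<omega>) \<longleftrightarrow>
      (set v \<subseteq> {1..} \<and> 1 \<le> i) \<and> {v, v @ [i]} \<notin> edges (?I \<omega>) \<and> (v \<in> verts (?I \<omega>) \<or> v @ [i] \<in> verts (?I \<omega>))" for v i \<omega>
    unfolding boundary_def using edge_uh_snoc[of v i] by auto
  have B: "Measurable.pred Q (\<lambda>\<omega>. {v, v @ [i]} \<in> boundary ulam_harris (?I \<omega>))" for v i
    unfolding inB by (intro pred_intros_logic V E) auto
  have inL: "{v, v @ [i]} \<in> ?L \<omega> \<longleftrightarrow> (set v \<subseteq> {1..} \<and> 1 \<le> i) \<and> {v, v @ [i]} \<in> boundary ulam_harris (?I \<omega>) \<and>
      (\<forall>v' i'. (set v' \<subseteq> {1..} \<and> 1 \<le> i') \<longrightarrow> {v', v' @ [i']} \<in> boundary ulam_harris (?I \<omega>) \<longrightarrow> w v i \<omega> \<le> w v' i' \<omega>)" for v i \<omega>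
  proof -
    have "(\<forall>e'\<in>boundary ulam_harris (?I \<omega>). cw \<omega> {v, v @ [i]} \<le> cw \<omega> e') \<longleftrightarrow>
      (\<forall>v' i'. {v', v' @ [i']} \<in> boundary ulam_harris (?I \<omega>) \<longrightarrow> w v i \<omega> \<le> w v' i' \<omega>)"
    proof
      assume *: "\<forall>e'\<in>boundary ulam_harris (?I \<omega>). cw \<omega> {v, v @ [i]} \<le> cw \<omega> e'"
      show "\<forall>v' i'. {v', v' @ [i']} \<in> boundary ulam_harris (?I \<omega>) \<longrightarrow> w v i \<omega> \<le> w v' i' \<omega>"
        using * by (metis child_weight_edge)
    next
      assume *: "\<forall>v' i'. {v', v' @ [i']} \<in> boundary ulam_harris (?I \<omega>) \<longrightarrow> w v i \<omega> \<le> w v' i' \<omega>"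
      show "\<forall>e'\<in>boundary ulam_harris (?I \<omega>). cw \<omega> {v, v @ [i]} \<le> cw \<omega> e'"
      proof
        fix e' assume e': "e' \<in> boundary ulam_harris (?I \<omega>)"
        then have "e' \<in> edges ulam_harris" by (simp add: boundary_def)
        then obtain v' i' where "e' = {v', v' @ [i']}" unfolding edge_uh_iff by blast
        then show "cw \<omega> {v, v @ [i]} \<le> cw \<omega> e'" using * e' by simp
      qed
    qed
    then show ?thesis unfolding lowest_def mem_Collect_eq using inB by blast
  qed
  have L: "Measurable.pred Q (\<lambda>\<omega>. {v, v @ [i]} \<in> ?L \<omega>)" for v i
    unfolding inL
  proof (rule pred_const_conj)
    assume vi: "set v \<subseteq> {1..} \<and> 1 \<le> i"
    have le: "Measurable.pred Q (\<lambda>\<omega>. w v i \<omega> \<le> w v' i' \<omega>)" if "set v' \<subseteq> {1..} \<and> 1 \<le> i'" for v' i'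
    proof -
      have [measurable]: "w v i \<in> borel_measurable Q" "w v' i' \<in> borel_measurable Q" using w vi that by auto
      show ?thesis by measurable
    qed
    show "Measurable.pred Q (\<lambda>\<omega>. {v, v @ [i]} \<in> boundary ulam_harris (?I \<omega>) \<and>
      (\<forall>v' i'. (set v' \<subseteq> {1..} \<and> 1 \<le> i') \<longrightarrow> {v', v' @ [i']} \<in> boundary ulam_harris (?I \<omega>) \<longrightarrow> w v i \<omega> \<le> w v' i' \<omega>))"
      by (intro pred_intros_logic(3) pred_intros_countable B pred_const_imp pred_intros_logic(4)[OF B] le)
  qed
  have inV: "v \<in> verts (invasion ulam_harris (cw \<omega>) u (Suc n)) \<longleftrightarrow>
      v \<in> verts (?I \<omega>) \<or> (\<exists>v' i'. (v = v' \<or> v = v' @ [i']) \<and> {v', v' @ [i']} \<in> ?L \<omega>)" for v \<omega>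
  proof -
    have "v \<in> \<Union> (?L \<omega>) \<longleftrightarrow> (\<exists>v' i'. (v = v' \<or> v = v' @ [i']) \<and> {v', v' @ [i']} \<in> ?L \<omega>)"
    proof
      assume "v \<in> \<Union> (?L \<omega>)"
      then obtain e where e: "e \<in> ?L \<omega>" "v \<in> e" by blast
      then have "e \<in> edges ulam_harris" by (auto simp: lowest_def boundary_def)
      then obtain v' i' where "e = {v', v' @ [i']}" unfolding edge_uh_iff by blast
      with e show "\<exists>v' i'. (v = v' \<or> v = v' @ [i']) \<and> {v', v' @ [i']} \<in> ?L \<omega>" by blast
    qed blast
    then show ?thesis by (simp add: Let_def)
  qed
  have "Measurable.pred Q (\<lambda>\<omega>. v \<in> verts (invasion ulam_harris (cw \<omega>) u (Suc n)))" for v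
    unfolding inV by (intro pred_intros_countable pred_intros_logic V L) auto
  moreover have "Measurable.pred Q (\<lambda>\<omega>. {v, v @ [i]} \<in> edges (invasion ulam_harris (cw \<omega>) u (Suc n)))" for v i
    by (simp add: Let_def, intro pred_intros_logic E L)
  ultimately show ?case by blast
qed

lemma measurable_wmsf: "measurable_graph Q (\<lambda>\<omega>. wmsf ulam_harris (cw \<omega>))"
proof -
  have E: "Measurable.pred Q (\<lambda>\<omega>. {v, v @ [i]} \<in> edges (wmsf ulam_harris (cw \<omega>)))" for v i
  proof -
    have "{v, v @ [i]} \<in> edges (wmsf ulam_harris (cw \<omega>)) \<longleftrightarrow>
        (\<exists>u n. set u \<subseteq> {1..} \<and> {v, v @ [i]} \<in> edges (invasion ulam_harris (cw \<omega>) u n))" for \<omega>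
      by (auto simp: wmsf_def invasion_cluster_def)
    moreover have "Measurable.pred Q (\<lambda>\<omega>. \<exists>u n. set u \<subseteq> {1..} \<and> {v, v @ [i]} \<in> edges (invasion ulam_harris (cw \<omega>) u n))"
      using pred_invasion by (intro pred_intros_countable pred_const_conj) blast
    ultimately show ?thesis by simp
  qed
  have "Measurable.pred Q (\<lambda>\<omega>. {a, b} \<in> edges (wmsf ulam_harris (cw \<omega>)))" for a b
  proof (cases "{a, b} \<in> edges ulam_harris")
    case True
    then obtain v i where vi: "{a, b} = {v, v @ [i]}" unfolding edge_uh_iff by blast
    show ?thesis unfolding vi by (rule E)
  next
    case False
    then have "{a, b} \<notin> edges (wmsf ulam_harris (cw \<omega>))" for \<omega> using edges_wmsf_subset by blast
    then show ?thesis by simp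
  qed
  then show ?thesis unfolding measurable_graph_def adj_iff verts_wmsf by simp
qed

lemma measurable_good_graph: "measurable_graph Q (\<lambda>\<omega>. good_graph K l ulam_harris (cw \<omega>))"
proof -
  have shut: "Measurable.pred Q (\<lambda>\<omega>. shut_in ulam_harris (cw \<omega>) K a b)" if e: "{a, b} \<in> edges ulam_harris" for a b
  proof -
    let ?A = "\<lambda>\<omega>. adj (below ulam_harris (cw \<omega>) (cw \<omega> {a, b}))"
    have A: "Measurable.pred Q (\<lambda>\<omega>. (x, y) \<in> ?A \<omega>)" for x y
      unfolding adj_below_iff
    proof (rule pred_const_conj)
      assume "{x, y} \<in> edges ulam_harris"
      then have [measurable]: "(\<lambda>\<omega>. cw \<omega> {x, y}) \<in> borel_measurable Q" "(\<lambda>\<omega>. cw \<omega> {a, b}) \<in> borel_measurable Q"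
        using measurable_child_weight[of w Q] w e by auto
      show "Measurable.pred Q (\<lambda>\<omega>. cw \<omega> {x, y} < cw \<omega> {a, b})" by measurable
    qed
    have eq: "shut_in ulam_harris (cw \<omega>) K a b \<longleftrightarrow>
      (\<forall>x y. x \<in> reach (?A \<omega>) K a \<longrightarrow> (x, y) \<in> ?A \<omega> \<longrightarrow> y \<in> reach (?A \<omega>) K a) \<and> \<not> b \<in> reach (?A \<omega>) K a" for \<omega>
      unfolding shut_in_def Let_def by blast
    show ?thesis unfolding eq by (intro pred_intros_countable pred_intros_logic pred_reach A)
  qed
  have eq: "{a, b} \<in> edges (good_graph K l ulam_harris (cw \<omega>)) \<longleftrightarrow> {a, b} \<in> edges ulam_harris \<and>
      (cw \<omega> {a, b} < l \<and> (shut_in ulam_harris (cw \<omega>) K a b \<or> shut_in ulam_harris (cw \<omega>) K b a))" for a b \<omega>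
    unfolding good_graph_def graph.sel mem_Collect_eq doubleton_eq_iff by blast
  have "Measurable.pred Q (\<lambda>\<omega>. {a, b} \<in> edges (good_graph K l ulam_harris (cw \<omega>)))" for a b
    unfolding eq
  proof (rule pred_const_conj)
    assume e: "{a, b} \<in> edges ulam_harris"
    then have e': "{b, a} \<in> edges ulam_harris" by (simp add: insert_commute)
    have [measurable]: "(\<lambda>\<omega>. cw \<omega> {a, b}) \<in> borel_measurable Q" using measurable_child_weight[of w Q] w e by auto
    show "Measurable.pred Q (\<lambda>\<omega>. cw \<omega> {a, b} < l \<and> (shut_in ulam_harris (cw \<omega>) K a b \<or> shut_in ulam_harris (cw \<omega>) K b a))"
      by (intro pred_intros_logic shut e e') measurable
  qed
  then show ?thesis unfolding measurable_graph_def adj_iff verts_good_graph by simp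
qed

end

section \<open>Embeddings of a code in a regular graph with uniform weights\<close>

definition tree_embeddings :: "nat list set \<Rightarrow> 'v graph \<Rightarrow> 'v \<Rightarrow> (nat list \<Rightarrow> 'v) set" where
  "tree_embeddings S G \<rho> = {\<phi> \<in> extensional S. \<phi> [] = \<rho> \<and> inj_on \<phi> S \<and> \<phi> ` S \<subseteq> verts G \<and>
     (\<forall>v i. v @ [i] \<in> S \<longrightarrow> {\<phi> v, \<phi> (v @ [i])} \<in> edges G)}"

lemma finite_tree_embeddings:
  assumes "finite S" "finite (verts G)" shows "finite (tree_embeddings S G \<rho>)"
proof (rule finite_subset)
  show "tree_embeddings S G \<rho> \<subseteq> S \<rightarrow>\<^sub>E verts G" by (auto simp: tree_embeddings_def PiE_def)
qed (use assms in \<open>simp add: finite_PiE\<close>)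

lemma regular_neighbours:
  assumes "regular d G" "v \<in> verts G"
  shows "finite {y. {v, y} \<in> edges G}" "card {y. {v, y} \<in> edges G} = d"
  using assms by (auto simp: regular_def adj_iff)

text \<open>A leaf can be attached to any neighbour of the image of its parent that is not yet used, and at most
  \<open>N\<close> of the \<open>d\<close> neighbours are used.\<close>

lemma card_tree_embeddings:
  assumes G: "finite (verts G)" "simple_graph G" "regular d G" and \<rho>: "\<rho> \<in> verts G"
    and S: "finite S" "[] \<in> S" "\<And>v i. v @ [i] \<in> S \<Longrightarrow> v \<in> S" "card S \<le> N"
  shows "(d - N) ^ (card S - 1) \<le> card (tree_embeddings S G \<rho>)"
  using S
proof (induction "card S" arbitrary: S rule: less_induct)
  case less
  show ?case
  proof (cases "S = {[]}")
    case True
    let ?\<phi> = "\<lambda>v. if v = [] then \<rho> else undefined"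
    have "?\<phi> \<in> tree_embeddings S G \<rho>" using True \<rho> by (auto simp: tree_embeddings_def extensional_def)
    then have "card (tree_embeddings S G \<rho>) > 0"
      using finite_tree_embeddings[OF less.prems(1) G(1)] by (auto simp: card_gt_0_iff)
    then show ?thesis using True by simp
  next
    case False
    \<comment> \<open>A vertex of maximal length is a leaf.\<close>
    define l where "l = Max (length ` S)"
    have "l \<in> length ` S" unfolding l_def using less.prems by (intro Max_in) auto
    then obtain u where u: "u \<in> S" "length u = l" by auto
    have lmax: "length v \<le> l" if "v \<in> S" for v unfolding l_def using less.prems that by auto
    have "u \<noteq> []"
    proof
      assume "u = []"
      then have "v = []" if "v \<in> S" for v using lmax[OF that] u by simp
      then show False using False less.prems(2) by blast
    qed
    then obtain v i where vi: "u = v @ [i]" by (cases u rule: rev_cases) auto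
    define S' where "S' = S - {u}"
    have S': "finite S'" "[] \<in> S'" "card S' < card S" "S = insert u S'" "u \<notin> S'"
      using less.prems(1,2) u(1) \<open>u \<noteq> []\<close> card_Diff1_less[OF less.prems(1) u(1)] by (auto simp: S'_def)
    have cS: "card S = Suc (card S')" using S' by simp
    have vS': "v \<in> S'" using less.prems(3)[of v i] u vi by (auto simp: S'_def)
    have closed: "a \<in> S'" if "a @ [j] \<in> S'" for a j
      using that less.prems(3)[of a j] lmax[of "a @ [j]"] u by (auto simp: S'_def)
    have no_child: "u @ [j] \<notin> S" for j using lmax[of "u @ [j]"] u by auto
    have IH: "(d - N) ^ (card S' - 1) \<le> card (tree_embeddings S' G \<rho>)"
      using less.hyps[OF S'(3,1,2) closed] less.prems(4) S'(3) by simp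
    let ?N = "\<lambda>\<phi>. {y. {\<phi> v, y} \<in> edges G} - \<phi> ` S'"
    let ?D = "SIGMA \<phi>:tree_embeddings S' G \<rho>. ?N \<phi>"
    let ?ext = "\<lambda>(\<phi>, y). \<phi>(u := y)"
    have vV: "\<phi> v \<in> verts G" if "\<phi> \<in> tree_embeddings S' G \<rho>" for \<phi> using that vS' by (auto simp: tree_embeddings_def)
    have cN: "d - N \<le> card (?N \<phi>)" if "\<phi> \<in> tree_embeddings S' G \<rho>" for \<phi>
    proof -
      have "card (\<phi> ` S') \<le> card S'" by (rule card_image_le[OF S'(1)])
      then have "card (\<phi> ` S') \<le> N" using less.prems(4) S'(3) by simp
      moreover have "card {y. {\<phi> v, y} \<in> edges G} - card (\<phi> ` S') \<le> card (?N \<phi>)"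
        by (rule diff_card_le_card_Diff) (use S' in auto)
      ultimately show ?thesis using regular_neighbours(2)[OF G(3) vV[OF that]] by simp
    qed
    have finN: "finite (?N \<phi>)" if "\<phi> \<in> tree_embeddings S' G \<rho>" for \<phi>
      using regular_neighbours(1)[OF G(3) vV[OF that]] by simp
    have "inj_on ?ext ?D"
    proof (rule inj_onI, clarify)
      fix \<phi> y \<phi>' y'
      assume *: "\<phi> \<in> tree_embeddings S' G \<rho>" "\<phi>' \<in> tree_embeddings S' G \<rho>" "\<phi>(u := y) = \<phi>'(u := y')"
      have "\<phi> u = undefined" "\<phi>' u = undefined" using * S'(5) by (auto simp: tree_embeddings_def extensional_def)
      moreover have "y = y'" using fun_cong[OF *(3), of u] by simp
      moreover have "\<phi> a = \<phi>' a" if "a \<noteq> u" for a using fun_cong[OF *(3), of a] that by simp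
      ultimately show "\<phi> = \<phi>' \<and> y = y'" by (metis ext)
    qed
    moreover have "?ext ` ?D \<subseteq> tree_embeddings S G \<rho>"
    proof clarify
      fix \<phi> y assume \<phi>: "\<phi> \<in> tree_embeddings S' G \<rho>" and y: "{\<phi> v, y} \<in> edges G" "y \<notin> \<phi> ` S'"
      let ?f = "\<phi>(u := y)"
      have e: "\<phi> \<in> extensional S'" "\<phi> [] = \<rho>" "inj_on \<phi> S'" "\<phi> ` S' \<subseteq> verts G"
        "\<And>a j. a @ [j] \<in> S' \<Longrightarrow> {\<phi> a, \<phi> (a @ [j])} \<in> edges G" using \<phi> by (auto simp: tree_embeddings_def)
      have "?f \<in> extensional S" using e(1) S'(4) by (auto simp: extensional_def)
      moreover have "?f [] = \<rho>" using e(2) \<open>u \<noteq> []\<close> by simp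
      moreover have "inj_on ?f S" unfolding S'(4) using e(3) y(2) S'(5) by (auto simp: inj_on_def)
      moreover have "?f ` S \<subseteq> verts G" unfolding S'(4) using e(4) simple_edgeD(2)[OF G(2) y(1)] by auto
      moreover have "{?f a, ?f (a @ [j])} \<in> edges G" if aj: "a @ [j] \<in> S" for a j
      proof (cases "a @ [j] = u")
        case True
        then have "a = v" using vi by simp
        then show ?thesis using True y(1) vS' S'(5) by auto
      next
        case False
        then have "a @ [j] \<in> S'" using aj S'(4) by auto
        moreover have "a \<noteq> u" using no_child aj by auto
        ultimately show ?thesis using e(5) False by simp
      qed
      ultimately show "?f \<in> tree_embeddings S G \<rho>" unfolding tree_embeddings_def by blast
    qed
    ultimately have "card ?D \<le> card (tree_embeddings S G \<rho>)"
      by (rule card_inj_on_le[OF _ _ finite_tree_embeddings[OF less.prems(1) G(1)]])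
    moreover have "card ?D = (\<Sum>\<phi>\<in>tree_embeddings S' G \<rho>. card (?N \<phi>))"
      by (rule card_SigmaI) (use finN finite_tree_embeddings[OF S'(1) G(1)] in auto)
    moreover have "card (tree_embeddings S' G \<rho>) * (d - N) \<le> (\<Sum>\<phi>\<in>tree_embeddings S' G \<rho>. card (?N \<phi>))"
      using sum_bounded_below[of "tree_embeddings S' G \<rho>" "d - N" "\<lambda>\<phi>. card (?N \<phi>)"] cN by simp
    moreover have "(d - N) ^ (card S - 1) \<le> card (tree_embeddings S' G \<rho>) * (d - N)"
    proof -
      have "card S' > 0" using S' by (auto simp: card_gt_0_iff)
      then have "(d - N) ^ (card S - 1) = (d - N) ^ (card S' - 1) * (d - N)"
        unfolding cS by (cases "card S'") auto
      then show ?thesis using IH by simp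
    qed
    ultimately show ?thesis by linarith
  qed
qed

lemma code_tree_edges_bij:
  assumes inj: "inj_on \<phi> (code_tree \<tau> (Suc R))"
    and v: "v @ [i] \<in> code_tree \<tau> (Suc R)" and v': "v' @ [i'] \<in> code_tree \<tau> (Suc R)"
    and eq: "{\<phi> v, \<phi> (v @ [i])} = {\<phi> v', \<phi> (v' @ [i'])}"
  shows "v = v' \<and> i = i'"
proof -
  have "\<phi> ` {v, v @ [i]} = \<phi> ` {v', v' @ [i']}" using eq by simp
  then have "{v, v @ [i]} = {v', v' @ [i']}"
    using inj_on_image_eq_iff[OF inj, of "{v, v @ [i]}" "{v', v' @ [i']}"] v v' code_tree_parent[OF v] code_tree_parent[OF v'] by simp
  then show ?thesis unfolding snoc_doubleton_eq .
qed

lemma card_code_tree_edges: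
  assumes inj: "inj_on \<phi> (code_tree \<tau> (Suc R))" and fin: "finite (code_tree \<tau> (Suc R))"
  shows "card {{\<phi> v, \<phi> (v @ [i])} | v i. v @ [i] \<in> code_tree \<tau> (Suc R)} = card (code_tree \<tau> (Suc R)) - 1"
proof -
  let ?T = "code_tree \<tau> (Suc R)"
  let ?f = "\<lambda>u. {\<phi> (butlast u), \<phi> u}"
  have "{{\<phi> v, \<phi> (v @ [i])} | v i. v @ [i] \<in> ?T} = ?f ` (?T - {[]})"
  proof (rule set_eqI, rule iffI)
    fix e assume "e \<in> {{\<phi> v, \<phi> (v @ [i])} | v i. v @ [i] \<in> ?T}"
    then obtain v i where "e = {\<phi> v, \<phi> (v @ [i])}" "v @ [i] \<in> ?T" by blast
    then show "e \<in> ?f ` (?T - {[]})" by (intro image_eqI[of _ _ "v @ [i]"]) auto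
  next
    fix e assume "e \<in> ?f ` (?T - {[]})"
    then obtain u where u: "u \<in> ?T" "u \<noteq> []" "e = ?f u" by blast
    then obtain v i where "u = v @ [i]" by (cases u rule: rev_cases) auto
    then show "e \<in> {{\<phi> v, \<phi> (v @ [i])} | v i. v @ [i] \<in> ?T}" using u by auto
  qed
  moreover have "inj_on ?f (?T - {[]})"
  proof (rule inj_onI)
    fix a b assume a: "a \<in> ?T - {[]}" and b: "b \<in> ?T - {[]}" and eq: "?f a = ?f b"
    obtain v i where v: "a = v @ [i]" using a by (cases a rule: rev_cases) auto
    obtain v' i' where v': "b = v' @ [i']" using b by (cases b rule: rev_cases) auto
    show "a = b" using code_tree_edges_bij[OF inj, of v i v' i'] a b eq v v' by simp
  qed
  ultimately have "card {{\<phi> v, \<phi> (v @ [i])} | v i. v @ [i] \<in> ?T} = card (?T - {[]})"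
    by (simp add: card_image)
  then show ?thesis by simp
qed

text \<open>A lower bound for the probability that a code with \<open>m\<close> edges and \<open>t\<close> explored vertices is found at a
  vertex of a \<open>d\<close>-regular graph: the number of embeddings, the probability that the edges of the code
  fall into their bins, and the probability that the other edges at explored vertices are heavy.\<close>

definition code_bound :: "nat \<Rightarrow> nat \<Rightarrow> real \<Rightarrow> real \<Rightarrow> nat \<Rightarrow> real" where
  "code_bound m t h l d = real ((d - Suc m) ^ m) * (h / d) ^ m * ((1 - l / d) ^ d) ^ t"

lemma code_bound_tendsto:
  "(\<lambda>d. code_bound m t h l d) \<longlonglongrightarrow> h ^ m * exp (- (l * t))"
proof -
  have a: "(\<lambda>d. (real (d - Suc m) * (h / d)) ^ m) \<longlonglongrightarrow> h ^ m"
  proof -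
    have "(\<lambda>d. real (d - Suc m) * (h / d)) \<longlonglongrightarrow> h"
    proof (rule Lim_transform_eventually)
      have "(\<lambda>d. h - h * Suc m / real d) \<longlonglongrightarrow> h - 0"
        by (intro tendsto_diff tendsto_const lim_const_over_n)
      then show "(\<lambda>d. h - h * Suc m / real d) \<longlonglongrightarrow> h" by simp
      show "\<forall>\<^sub>F d in sequentially. h - h * Suc m / real d = real (d - Suc m) * (h / d)"
        using eventually_ge_at_top[of "Suc m"]
        by eventually_elim (simp add: of_nat_diff field_simps)
    qed
    then show ?thesis by (rule tendsto_power)
  qed
  have b: "(\<lambda>d. ((1 - l / real d) ^ d) ^ t) \<longlonglongrightarrow> exp (- l) ^ t"
    using tendsto_power[OF tendsto_exp_limit_sequentially[of "- l"], of t] by simp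
  have "(\<lambda>d. (real (d - Suc m) * (h / d)) ^ m * ((1 - l / real d) ^ d) ^ t) \<longlonglongrightarrow> h ^ m * exp (- l) ^ t"
    by (rule tendsto_mult[OF a b])
  moreover have "exp (- l) ^ t = exp (- (l * t))" by (simp add: exp_of_nat_mult[symmetric] mult.commute)
  moreover have "code_bound m t h l d = (real (d - Suc m) * (h / d)) ^ m * ((1 - l / real d) ^ d) ^ t" for d
    unfolding code_bound_def power_mult_distrib of_nat_power ..
  ultimately show ?thesis by simp
qed

lemma prod_if_mem:
  assumes "finite J" "A \<subseteq> J"
  shows "(\<Prod>e\<in>J. if e \<in> A then a else b) = a ^ card A * (b :: real) ^ card (J - A)"
proof -
  have "J \<inter> A = A" "J \<inter> - A = J - A" using assms(2) by auto
  then show ?thesis using assms(1) by (simp add: prod.If_cases)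
qed

locale uniform_weights = prob_space P for P :: "'p measure" +
  fixes G :: "'v graph" and W :: "'v set \<Rightarrow> 'p \<Rightarrow> real" and d :: nat
  assumes fin: "finite (verts G)" and simp: "simple_graph G" and reg: "regular d G"
    and ind: "indep_vars (\<lambda>_. borel) W (edges G)"
    and unif: "\<And>e. e \<in> edges G \<Longrightarrow> distr P borel (W e) = uniform_measure lborel {0..1}"
begin

abbreviation sw :: "'p \<Rightarrow> 'v set \<Rightarrow> real" where "sw \<omega> e \<equiv> real d * W e \<omega>"

lemma W_measurable: "e \<in> edges G \<Longrightarrow> W e \<in> borel_measurable P"
  using ind by (auto simp: indep_vars_def)

lemma prob_W:
  assumes "e \<in> edges G" "A \<in> sets borel"
  shows "prob (W e -` A \<inter> space P) = measure lborel (A \<inter> {0..1})"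
proof -
  have "prob (W e -` A \<inter> space P) = measure (distr P borel (W e)) A"
    using measure_distr[OF W_measurable[OF assms(1)], of A] assms(2) by simp
  also have "\<dots> = measure (uniform_measure lborel {0..1 :: real}) A" unfolding unif[OF assms(1)] ..
  also have "\<dots> = measure lborel ({0..1} \<inter> A) / measure lborel {0..1 :: real}"
    using assms(2) by (intro measure_uniform_measure) auto
  finally show ?thesis by (simp add: Int_commute)
qed

lemma finite_E: "finite (edges G)"
  by (rule finite_edges[OF simp fin])

context
  fixes R L :: nat and h :: real and \<tau> :: "nat list \<Rightarrow> nat list"
  assumes V: "valid_code L R \<tau>" and h: "h > 0"
begin

abbreviation (input) "T1 \<equiv> code_tree \<tau> (Suc R)"
abbreviation (input) "l \<equiv> real L * h"

text \<open>What the occurrence of the code at a given embedding demands of the weight of \<open>e\<close>. Every edge is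
  asked separately, which makes independence applicable.\<close>

definition bin_event :: "(nat list \<Rightarrow> 'v) \<Rightarrow> 'v set \<Rightarrow> real set" where
  "bin_event \<phi> e = {y. (\<forall>v i. v @ [i] \<in> T1 \<and> e = {\<phi> v, \<phi> (v @ [i])} \<longrightarrow>
       real (\<tau> v ! (i - 1)) * h \<le> d * y \<and> d * y < real (Suc (\<tau> v ! (i - 1))) * h) \<and>
     (e \<notin> {{\<phi> v, \<phi> (v @ [i])} | v i. v @ [i] \<in> T1} \<longrightarrow> l \<le> d * y)}"

lemma encodes_iff_bin_event:
  assumes \<phi>: "\<phi> \<in> tree_embeddings T1 G \<rho>"
  shows "encodes R h L \<tau> G (sw \<omega>) \<rho> \<phi> \<longleftrightarrow>
    (\<forall>e\<in>{{\<phi> v, \<phi> (v @ [i])} | v i. v @ [i] \<in> T1} \<union> {e \<in> edges G. e \<inter> \<phi> ` code_tree \<tau> R \<noteq> {}}. W e \<omega> \<in> bin_event \<phi> e)"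
    (is "_ \<longleftrightarrow> (\<forall>e\<in>?TE \<union> ?O. _)")
proof -
  have p: "\<phi> [] = \<rho>" "inj_on \<phi> T1" "\<phi> ` T1 \<subseteq> verts G" "\<And>v i. v @ [i] \<in> T1 \<Longrightarrow> {\<phi> v, \<phi> (v @ [i])} \<in> edges G"
    using \<phi> by (auto simp: tree_embeddings_def)
  have T01: "code_tree \<tau> R \<subseteq> T1" by (rule code_tree_mono) simp
  show ?thesis
  proof
    assume E: "encodes R h L \<tau> G (sw \<omega>) \<rho> \<phi>"
    show "\<forall>e\<in>?TE \<union> ?O. W e \<omega> \<in> bin_event \<phi> e"
    proof
      fix e assume e: "e \<in> ?TE \<union> ?O"
      show "W e \<omega> \<in> bin_event \<phi> e"
        unfolding bin_event_def
      proof (rule CollectI, intro conjI allI impI)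
        fix v i assume "v @ [i] \<in> T1 \<and> e = {\<phi> v, \<phi> (v @ [i])}"
        then show "real (\<tau> v ! (i - 1)) * h \<le> d * W e \<omega>" "d * W e \<omega> < real (Suc (\<tau> v ! (i - 1))) * h"
          using encodesD(5,6)[OF E, of v i] by auto
      next
        assume n: "e \<notin> ?TE"
        then have eG: "e \<in> edges G" and "e \<inter> \<phi> ` code_tree \<tau> R \<noteq> {}" using e by auto
        then obtain v where v: "v \<in> code_tree \<tau> R" "\<phi> v \<in> e" by auto
        obtain y where y: "e = {\<phi> v, y}" using simple_edgeE[OF simp eG] v(2) by (metis insertE insert_commute singletonD)
        show "l \<le> d * W e \<omega>"
        proof (rule ccontr)
          assume "\<not> l \<le> d * W e \<omega>"
          then obtain u where u: "u \<in> T1" "y = \<phi> u" "tree_step v u"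
            using encodesD(7)[OF E v(1), of y] eG y by auto
          from u(3) consider i where "u = v @ [i]" | i where "v = u @ [i]" unfolding tree_step_def by blast
          then have "e \<in> ?TE"
          proof cases
            case 1 then show ?thesis using u y by auto
          next
            case 2
            then have "e = {\<phi> u, \<phi> (u @ [i])}" "u @ [i] \<in> T1" using u y v T01 by (auto simp: insert_commute)
            then show ?thesis by blast
          qed
          with n show False by blast
        qed
      qed
    qed
  next
    assume *: "\<forall>e\<in>?TE \<union> ?O. W e \<omega> \<in> bin_event \<phi> e"
    show "encodes R h L \<tau> G (sw \<omega>) \<rho> \<phi>"
      unfolding encodes_def
    proof (intro conjI allI impI ballI)
      show "\<phi> [] = \<rho>" "inj_on \<phi> T1" "\<phi> ` T1 \<subseteq> verts G" by fact+
    next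
      fix v i assume vi: "v @ [i] \<in> T1"
      show "{\<phi> v, \<phi> (v @ [i])} \<in> edges G" using p(4)[OF vi] .
      have "{\<phi> v, \<phi> (v @ [i])} \<in> ?TE" using vi by blast
      then have "W {\<phi> v, \<phi> (v @ [i])} \<omega> \<in> bin_event \<phi> {\<phi> v, \<phi> (v @ [i])}" using * by blast
      then show "real (\<tau> v ! (i - 1)) * h \<le> d * W {\<phi> v, \<phi> (v @ [i])} \<omega>"
        "d * W {\<phi> v, \<phi> (v @ [i])} \<omega> < real (Suc (\<tau> v ! (i - 1))) * h"
        unfolding bin_event_def using vi by blast+
    next
      fix v y assume v: "v \<in> code_tree \<tau> R" and y: "{\<phi> v, y} \<in> edges G \<and> d * W {\<phi> v, y} \<omega> < l"
      have "{\<phi> v, y} \<in> ?O" using v y by auto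
      then have "W {\<phi> v, y} \<omega> \<in> bin_event \<phi> {\<phi> v, y}" using * by blast
      then have "{\<phi> v, y} \<in> ?TE" using y unfolding bin_event_def by (auto simp: not_le[symmetric])
      then obtain a i where a: "{\<phi> v, y} = {\<phi> a, \<phi> (a @ [i])}" "a @ [i] \<in> T1" by blast
      have T: "v \<in> T1" "a \<in> T1" using v T01 code_tree_parent[OF a(2)] by auto
      from a(1) consider "\<phi> v = \<phi> a" "y = \<phi> (a @ [i])" | "\<phi> v = \<phi> (a @ [i])" "y = \<phi> a" unfolding doubleton_eq_iff by blast
      then show "\<exists>u\<in>T1. y = \<phi> u \<and> tree_step v u"
      proof cases
        case 1
        then have "v = a" using p(2) T by (auto dest: inj_onD)
        then show ?thesis using 1 a(2) by (auto simp: tree_step_def)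
      next
        case 2
        then have "v = a @ [i]" using p(2) T a(2) by (auto dest: inj_onD)
        then show ?thesis using 2 T by (auto simp: tree_step_def)
      qed
    qed
  qed
qed

lemma bin_event_borel: "bin_event \<phi> e \<in> sets borel"
proof -
  have "Measurable.pred borel (\<lambda>y :: real. (\<forall>v i. v @ [i] \<in> T1 \<and> e = {\<phi> v, \<phi> (v @ [i])} \<longrightarrow>
       real (\<tau> v ! (i - 1)) * h \<le> d * y \<and> d * y < real (Suc (\<tau> v ! (i - 1))) * h) \<and>
     (e \<notin> {{\<phi> v, \<phi> (v @ [i])} | v i. v @ [i] \<in> T1} \<longrightarrow> l \<le> d * y))"
    by measurable
  then show ?thesis unfolding bin_event_def pred_def by simp
qed

lemma prob_bin_event:
  assumes \<phi>: "\<phi> \<in> tree_embeddings T1 G \<rho>" and e: "e \<in> edges G" and d: "l \<le> d" "d > 0"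
  shows "prob (W e -` bin_event \<phi> e \<inter> space P) =
    (if e \<in> {{\<phi> v, \<phi> (v @ [i])} | v i. v @ [i] \<in> T1} then h / d else 1 - l / d)"
proof -
  have inj: "inj_on \<phi> T1" using \<phi> by (auto simp: tree_embeddings_def)
  show ?thesis
  proof (cases "e \<in> {{\<phi> v, \<phi> (v @ [i])} | v i. v @ [i] \<in> T1}")
    case True
    then obtain v i where vi: "v @ [i] \<in> T1" "e = {\<phi> v, \<phi> (v @ [i])}" by blast
    define b where "b = \<tau> v ! (i - 1)"
    have b: "b < L" using valid_code_bin_less(1)[OF V vi(1)] by (simp add: b_def)
    have uniq: "v' @ [i'] \<in> T1 \<and> e = {\<phi> v', \<phi> (v' @ [i'])} \<longleftrightarrow> v' = v \<and> i' = i" for v' i'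
      using code_tree_edges_bij[OF inj _ vi(1), of v' i'] vi by auto
    have "bin_event \<phi> e = {real b * h / d ..< real (Suc b) * h / d}"
      using True d(2) unfolding bin_event_def uniq b_def by (auto simp: field_simps)
    moreover have "{real b * h / d ..< real (Suc b) * h / d} \<subseteq> {0..1}"
    proof -
      have "real (Suc b) * h \<le> l" using b h by (intro mult_right_mono) auto
      then have "real (Suc b) * h / d \<le> 1" using d by (simp add: field_simps)
      moreover have "0 \<le> real b * h / d" using h by simp
      ultimately show ?thesis by auto
    qed
    moreover have "measure lborel {real b * h / d ..< real (Suc b) * h / d} = h / d"
      using h d(2) by (simp add: divide_right_mono add_divide_distrib distrib_right)
    ultimately have "measure lborel (bin_event \<phi> e \<inter> {0..1}) = h / d" by (simp only: Int_absorb2)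
    then show ?thesis using prob_W[OF e bin_event_borel, of \<phi> e] by (simp only: True if_True)
  next
    case False
    then have "bin_event \<phi> e = {y. l \<le> d * y}" unfolding bin_event_def by blast
    moreover have "l / d \<le> y \<longleftrightarrow> l \<le> d * y" for y :: real
      using pos_divide_le_eq[of "real d" l y] d(2) by (simp add: mult.commute)
    ultimately have "bin_event \<phi> e = {l / d ..}" by (simp only: atLeast_def)
    moreover have "{l / d ..} \<inter> {0..1} = {l / d .. 1}" using h by (auto intro: order_trans[of 0 "l / d"])
    moreover have "l / d \<le> 1" using d by simp
    ultimately have "measure lborel (bin_event \<phi> e \<inter> {0..1}) = 1 - l / d" by (simp only:) simp
    then show ?thesis using prob_W[OF e bin_event_borel, of \<phi> e] by (simp only: False if_False)
  qed
qed

text \<open>The explored vertices have at most \<open>d\<close> edges each, so at most \<open>d * card (code_tree \<tau> R)\<close> further edges are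
  required to be heavy.\<close>

lemma prob_encodes_embedding:
  assumes \<phi>: "\<phi> \<in> tree_embeddings T1 G \<rho>" and d: "l \<le> d" "d > 0"
  shows "{\<omega> \<in> space P. encodes R h L \<tau> G (sw \<omega>) \<rho> \<phi>} \<in> events"
    and "(h / d) ^ (card T1 - 1) * ((1 - l / d) ^ d) ^ card (code_tree \<tau> R) \<le>
      prob {\<omega> \<in> space P. encodes R h L \<tau> G (sw \<omega>) \<rho> \<phi>}"
proof -
  let ?TE = "{{\<phi> v, \<phi> (v @ [i])} | v i. v @ [i] \<in> T1}" and ?O = "{e \<in> edges G. e \<inter> \<phi> ` code_tree \<tau> R \<noteq> {}}"
  have p: "inj_on \<phi> T1" "\<phi> ` T1 \<subseteq> verts G" "\<And>v i. v @ [i] \<in> T1 \<Longrightarrow> {\<phi> v, \<phi> (v @ [i])} \<in> edges G"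
    using \<phi> by (auto simp: tree_embeddings_def)
  have fT: "finite T1" by (rule finite_code_tree)
  have T01: "code_tree \<tau> R \<subseteq> T1" by (rule code_tree_mono) simp
  have fT0: "finite (code_tree \<tau> R)" using fT T01 finite_subset by blast
  have TE: "?TE \<subseteq> edges G" using p(3) by blast
  define J where "J = ?TE \<union> ?O"
  have J: "J \<subseteq> edges G" "finite J" using TE finite_E finite_subset unfolding J_def by auto
  have eq: "{\<omega> \<in> space P. encodes R h L \<tau> G (sw \<omega>) \<rho> \<phi>} = {\<omega> \<in> space P. \<forall>e\<in>J. W e \<omega> \<in> bin_event \<phi> e}"
    unfolding encodes_iff_bin_event[OF \<phi>] J_def ..
  have ev: "W e -` bin_event \<phi> e \<inter> space P \<in> events" if "e \<in> J" for e
    using measurable_sets[OF W_measurable bin_event_borel] that J by auto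
  have "{\<omega> \<in> space P. \<forall>e\<in>J. W e \<omega> \<in> bin_event \<phi> e} = space P \<inter> (\<Inter>e\<in>J. W e -` bin_event \<phi> e \<inter> space P)"
    by (cases "J = {}") auto
  also have "\<dots> \<in> events"
  proof (cases "J = {}")
    case True then show ?thesis by simp
  next
    case False
    show ?thesis by (intro sets.Int sets.top sets.finite_INT[OF J(2) False] ev)
  qed
  finally show "{\<omega> \<in> space P. encodes R h L \<tau> G (sw \<omega>) \<rho> \<phi>} \<in> events" unfolding eq .
  have pr: "prob {\<omega> \<in> space P. \<forall>e\<in>J. W e \<omega> \<in> bin_event \<phi> e} = (\<Prod>e\<in>J. prob (W e -` bin_event \<phi> e \<inter> space P))"
  proof (cases "J = {}")
    case True then show ?thesis by (simp add: prob_space)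
  next
    case False
    have "prob (\<Inter>e\<in>J. W e -` bin_event \<phi> e \<inter> space P) = (\<Prod>e\<in>J. prob (W e -` bin_event \<phi> e \<inter> space P))"
      by (rule indep_varsD[OF ind False J(2,1)]) (rule bin_event_borel)
    moreover have "(\<Inter>e\<in>J. W e -` bin_event \<phi> e \<inter> space P) = {\<omega> \<in> space P. \<forall>e\<in>J. W e \<omega> \<in> bin_event \<phi> e}"
      using False by auto
    ultimately show ?thesis by simp
  qed
  also have "\<dots> = (\<Prod>e\<in>J. if e \<in> ?TE then h / d else 1 - l / d)"
    by (rule prod.cong[OF refl], rule prob_bin_event[OF \<phi> _ d]) (use J in blast)
  also have "\<dots> = (h / d) ^ card ?TE * (1 - l / d) ^ card (J - ?TE)"
    by (rule prod_if_mem[OF J(2)]) (auto simp: J_def)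
  also have "card ?TE = card T1 - 1" by (rule card_code_tree_edges[OF p(1) fT])
  finally have pr: "prob {\<omega> \<in> space P. \<forall>e\<in>J. W e \<omega> \<in> bin_event \<phi> e} = (h / d) ^ (card T1 - 1) * (1 - l / d) ^ card (J - ?TE)" .
  have "card (J - ?TE) \<le> d * card (code_tree \<tau> R)"
  proof -
    have "J - ?TE \<subseteq> (\<Union>v\<in>code_tree \<tau> R. (\<lambda>y. {\<phi> v, y}) ` {y. {\<phi> v, y} \<in> edges G})"
    proof
      fix e assume "e \<in> J - ?TE"
      then have eG: "e \<in> edges G" and "e \<inter> \<phi> ` code_tree \<tau> R \<noteq> {}" by (auto simp: J_def)
      then obtain v where v: "v \<in> code_tree \<tau> R" "\<phi> v \<in> e" by auto
      obtain y where y: "e = {\<phi> v, y}" using simple_edgeE[OF simp eG] v(2) by (metis insertE insert_commute singletonD)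
      then show "e \<in> (\<Union>v\<in>code_tree \<tau> R. (\<lambda>y. {\<phi> v, y}) ` {y. {\<phi> v, y} \<in> edges G})" using v eG by blast
    qed
    moreover have nb: "finite {y. {\<phi> v, y} \<in> edges G}" "card {y. {\<phi> v, y} \<in> edges G} = d" if "v \<in> code_tree \<tau> R" for v
      using regular_neighbours[OF reg, of "\<phi> v"] p(2) T01 that by auto
    ultimately have "card (J - ?TE) \<le> card (\<Union>v\<in>code_tree \<tau> R. (\<lambda>y. {\<phi> v, y}) ` {y. {\<phi> v, y} \<in> edges G})"
      using fT0 by (intro card_mono finite_UN_I finite_imageI) auto
    also have "\<dots> \<le> (\<Sum>v\<in>code_tree \<tau> R. card ((\<lambda>y. {\<phi> v, y}) ` {y. {\<phi> v, y} \<in> edges G}))"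
      by (rule card_UN_le[OF fT0])
    also have "\<dots> \<le> (\<Sum>v\<in>code_tree \<tau> R. d)"
      using nb by (intro sum_mono) (metis card_image_le)
    finally show ?thesis by (simp add: mult.commute)
  qed
  moreover have "0 \<le> 1 - l / d" "1 - l / d \<le> 1" using d h by (auto simp: field_simps)
  ultimately have "(1 - l / d) ^ (d * card (code_tree \<tau> R)) \<le> (1 - l / d) ^ card (J - ?TE)"
    by (intro power_decreasing)
  then have "(h / d) ^ (card T1 - 1) * ((1 - l / d) ^ d) ^ card (code_tree \<tau> R) \<le> (h / d) ^ (card T1 - 1) * (1 - l / d) ^ card (J - ?TE)"
    using h by (intro mult_left_mono) (auto simp: power_mult)
  then show "(h / d) ^ (card T1 - 1) * ((1 - l / d) ^ d) ^ card (code_tree \<tau> R) \<le>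
      prob {\<omega> \<in> space P. encodes R h L \<tau> G (sw \<omega>) \<rho> \<phi>}"
    unfolding eq pr .
qed

lemma encodes_restrict:
  "encodes R h L \<tau> G w \<rho> \<phi> \<Longrightarrow>
    restrict \<phi> T1 \<in> tree_embeddings T1 G \<rho> \<and> encodes R h L \<tau> G w \<rho> (restrict \<phi> T1)"
proof -
  assume E: "encodes R h L \<tau> G w \<rho> \<phi>"
  have T01: "v \<in> T1" if "v \<in> code_tree \<tau> R" for v using that code_tree_mono[of R "Suc R" \<tau>] by auto
  have par: "v \<in> T1" if "v @ [i] \<in> T1" for v i by (rule code_tree_parent[OF that])
  have "restrict \<phi> T1 \<in> tree_embeddings T1 G \<rho>"
    using E par by (auto simp: tree_embeddings_def encodes_def inj_on_def)
  moreover have "encodes R h L \<tau> G w \<rho> (restrict \<phi> T1)"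
    unfolding encodes_def
  proof (intro conjI allI impI ballI)
    show "restrict \<phi> T1 [] = \<rho>" using encodesD(1)[OF E] by simp
    show "inj_on (restrict \<phi> T1) T1" using encodesD(2)[OF E] by (simp add: inj_on_def)
    show "restrict \<phi> T1 ` T1 \<subseteq> verts G" using encodesD(3)[OF E] by auto
  next
    fix v i assume vi: "v @ [i] \<in> T1"
    have r: "restrict \<phi> T1 v = \<phi> v" "restrict \<phi> T1 (v @ [i]) = \<phi> (v @ [i])" using vi par[OF vi] by auto
    show "{restrict \<phi> T1 v, restrict \<phi> T1 (v @ [i])} \<in> edges G"
      "real (\<tau> v ! (i - 1)) * h \<le> w {restrict \<phi> T1 v, restrict \<phi> T1 (v @ [i])}"
      "w {restrict \<phi> T1 v, restrict \<phi> T1 (v @ [i])} < real (Suc (\<tau> v ! (i - 1))) * h"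
      unfolding r using encodesD(4-6)[OF E vi] by auto
  next
    fix v y assume v: "v \<in> code_tree \<tau> R" and y: "{restrict \<phi> T1 v, y} \<in> edges G \<and> w {restrict \<phi> T1 v, y} < l"
    have r: "restrict \<phi> T1 v = \<phi> v" using T01[OF v] by simp
    obtain u where "u \<in> T1" "y = \<phi> u" "tree_step v u" using encodesD(7)[OF E v, of y] y r by auto
    then show "\<exists>u\<in>T1. y = restrict \<phi> T1 u \<and> tree_step v u" by (intro bexI[of _ u]) auto
  qed
  ultimately show ?thesis by blast
qed

text \<open>The code determines its embedding, so the events of different embeddings are disjoint and their
  probabilities add up.\<close>

lemma prob_encodes:
  assumes \<rho>: "\<rho> \<in> verts G" and d: "l \<le> d" "d > 0"
  shows "{\<omega> \<in> space P. \<exists>\<phi>. encodes R h L \<tau> G (sw \<omega>) \<rho> \<phi>} \<in> events"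
    and "code_bound (card T1 - 1) (card (code_tree \<tau> R)) h l d \<le>
      prob {\<omega> \<in> space P. \<exists>\<phi>. encodes R h L \<tau> G (sw \<omega>) \<rho> \<phi>}"
proof -
  let ?M = "tree_embeddings T1 G \<rho>"
  let ?e = "\<lambda>\<phi>. {\<omega> \<in> space P. encodes R h L \<tau> G (sw \<omega>) \<rho> \<phi>}"
  have fT: "finite T1" by (rule finite_code_tree)
  have fM: "finite ?M" by (rule finite_tree_embeddings[OF fT fin])
  have eq: "{\<omega> \<in> space P. \<exists>\<phi>. encodes R h L \<tau> G (sw \<omega>) \<rho> \<phi>} = (\<Union>\<phi>\<in>?M. ?e \<phi>)"
    using encodes_restrict by blast
  have ev: "?e \<phi> \<in> events" if "\<phi> \<in> ?M" for \<phi> using prob_encodes_embedding(1)[OF that d] .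
  show "{\<omega> \<in> space P. \<exists>\<phi>. encodes R h L \<tau> G (sw \<omega>) \<rho> \<phi>} \<in> events" unfolding eq using fM ev by auto
  have dj: "disjoint_family_on ?e ?M"
    unfolding disjoint_family_on_def
  proof (intro ballI impI equals0I)
    fix \<phi> \<phi>' \<omega> assume \<phi>: "\<phi> \<in> ?M" "\<phi>' \<in> ?M" "\<phi> \<noteq> \<phi>'" "\<omega> \<in> ?e \<phi> \<inter> ?e \<phi>'"
    then have "\<forall>v\<in>T1. \<phi> v = \<phi>' v" using encodes_unique[OF V V h, of G "sw \<omega>" \<rho> \<phi> \<phi>'] by simp
    moreover have "\<phi> v = \<phi>' v" if "v \<notin> T1" for v using \<phi>(1,2) that by (auto simp: tree_embeddings_def extensional_def)
    ultimately have "\<phi> = \<phi>'" by blast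
    with \<phi>(3) show False by simp
  qed
  let ?b = "(h / d) ^ (card T1 - 1) * ((1 - l / d) ^ d) ^ card (code_tree \<tau> R)"
  have b0: "0 \<le> ?b" using d h by simp
  have T1: "card T1 = Suc (card T1 - 1)" 
  proof -
    have "T1 \<noteq> {}" using Nil_in_code_tree[of \<tau> "Suc R"] by blast
    then have "card T1 > 0" using fT by (simp only: card_gt_0_iff) simp
    then show ?thesis by simp
  qed
  have "(d - card T1) ^ (card T1 - 1) \<le> card ?M"
    by (rule card_tree_embeddings[OF fin simp reg \<rho> fT Nil_in_code_tree _ order_refl]) (rule code_tree_parent)
  then have "real ((d - card T1) ^ (card T1 - 1)) \<le> real (card ?M)" by (simp only: of_nat_le_iff)
  then have "real ((d - card T1) ^ (card T1 - 1)) * ?b \<le> real (card ?M) * ?b"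
    by (rule mult_right_mono[OF _ b0])
  also have "\<dots> = (\<Sum>\<phi>\<in>?M. ?b)" by simp
  also have "\<dots> \<le> (\<Sum>\<phi>\<in>?M. prob (?e \<phi>))" using prob_encodes_embedding(2)[OF _ d] by (intro sum_mono)
  also have "\<dots> = prob (\<Union>\<phi>\<in>?M. ?e \<phi>)"
    by (rule finite_measure_finite_Union[symmetric, OF fM _ dj]) (use ev in auto)
  finally show "code_bound (card T1 - 1) (card (code_tree \<tau> R)) h l d \<le>
      prob {\<omega> \<in> space P. \<exists>\<phi>. encodes R h L \<tau> G (sw \<omega>) \<rho> \<phi>}"
    unfolding eq code_bound_def using T1 by (simp add: mult.assoc)
qed

end

end

section \<open>Codes of the Poisson-weighted infinite tree\<close>

text \<open>The children of \<open>v\<close> with weight below \<open>l\<close> are the first ones, since the weights increase.\<close>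

definition raw_code :: "real \<Rightarrow> real \<Rightarrow> (nat list \<Rightarrow> nat \<Rightarrow> real) \<Rightarrow> nat list \<Rightarrow> nat list" where
  "raw_code h l x v = map (\<lambda>i. nat \<lfloor>x v i / h\<rfloor>) [1..<Suc (card {i. 1 \<le> i \<and> x v i < l})]"

definition pwit_code :: "nat \<Rightarrow> real \<Rightarrow> real \<Rightarrow> (nat list \<Rightarrow> nat \<Rightarrow> real) \<Rightarrow> nat list \<Rightarrow> nat list" where
  "pwit_code R h l x v = (if v \<in> code_tree (raw_code h l x) R then raw_code h l x v else [])"

definition bin_count :: "real \<Rightarrow> (nat list \<Rightarrow> nat \<Rightarrow> real) \<Rightarrow> nat list \<Rightarrow> nat \<Rightarrow> nat" where
  "bin_count h x v j = card {i. 1 \<le> i \<and> x v i \<in> {real j * h ..< real (Suc j) * h}}"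

lemma code_tree_cong:
  assumes "\<And>v. v \<in> code_tree \<tau> R \<Longrightarrow> \<tau> v = \<tau>' v"
  shows "code_tree \<tau>' (Suc R) = code_tree \<tau> (Suc R)"
proof -
  have "v \<in> code_tree \<tau>' (Suc R) \<longleftrightarrow> v \<in> code_tree \<tau> (Suc R)" for v
  proof (induction v rule: rev_induct)
    case Nil then show ?case by simp
  next
    case (snoc i v)
    have "v \<in> code_tree \<tau>' R \<longleftrightarrow> v \<in> code_tree \<tau> R"
      using snoc code_tree_Suc_length[of v _ R] code_tree_mono[of R "Suc R"] code_tree_length[of v _ R]
      by (metis in_mono lessI less_imp_le)
    then show ?case unfolding snoc_in_code_tree using assms by auto
  qed
  then show ?thesis by blast
qed

lemma code_tree_pwit_code: "code_tree (pwit_code R h l x) (Suc R) = code_tree (raw_code h l x) (Suc R)"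
  by (rule code_tree_cong) (simp add: pwit_code_def)

lemma code_tree_Suc_restrict: "code_tree \<tau> R = {v \<in> code_tree \<tau> (Suc R). length v \<le> R}"
  by (auto simp: code_tree_def)

lemma code_tree_pwit_code': "code_tree (pwit_code R h l x) R = code_tree (raw_code h l x) R"
  using code_tree_pwit_code by (simp add: code_tree_Suc_restrict[of _ R])

lemma light_children:
  assumes x: "weight_array x" and v: "set v \<subseteq> {1..}"
  shows "{i. 1 \<le> i \<and> x v i < l} = {1..card {i. 1 \<le> i \<and> x v i < l}}"
proof -
  let ?S = "{i. 1 \<le> i \<and> x v i < l}"
  have fin: "finite ?S" by (rule finite_subset[OF _ weight_array_finite[OF x v, of l]]) auto
  have down: "j \<in> ?S" if "i \<in> ?S" "1 \<le> j" "j \<le> i" for i j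
    using weight_array_mono[OF x v that(2), of i] that by (cases "j = i") auto
  show ?thesis
  proof (cases "?S = {}")
    case True then show ?thesis unfolding True by simp
  next
    case False
    define m where "m = Max ?S"
    have m: "m \<in> ?S" unfolding m_def using fin False by (rule Max_in)
    have "i \<le> m" if "i \<in> ?S" for i unfolding m_def using fin that by simp
    then have "?S = {1..m}" using down[OF m] by auto
    then show ?thesis by simp
  qed
qed

lemma length_raw_code:
  assumes "weight_array x" "set v \<subseteq> {1..}" "1 \<le> i"
  shows "i \<le> length (raw_code h l x v) \<longleftrightarrow> x v i < l"
proof -
  have "length (raw_code h l x v) = card {i. 1 \<le> i \<and> x v i < l}" by (simp add: raw_code_def)
  moreover have "i \<in> {i. 1 \<le> i \<and> x v i < l} \<longleftrightarrow> i \<in> {1..card {i. 1 \<le> i \<and> x v i < l}}"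
    by (rule arg_cong[OF light_children[OF assms(1,2)], of "\<lambda>S. i \<in> S"])
  ultimately show ?thesis using assms(3) by simp
qed

lemma in_raw_code_tree:
  assumes x: "weight_array x"
  shows "v \<in> code_tree (raw_code h l x) R' \<longleftrightarrow>
    set v \<subseteq> {1..} \<and> length v \<le> R' \<and> (\<forall>k<length v. x (take k v) (v ! k) < l)"
proof -
  have *: "1 \<le> v ! k \<and> v ! k \<le> length (raw_code h l x (take k v)) \<longleftrightarrow> x (take k v) (v ! k) < l"
    if v: "set v \<subseteq> {1..}" and k: "k < length v" for k
  proof -
    have "set (take k v) \<subseteq> {1..}" using v set_take_subset[of k v] by auto
    moreover have "1 \<le> v ! k" using subsetD[OF v nth_mem[OF k]] by simp
    ultimately show ?thesis using length_raw_code[OF x] by blast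
  qed
  show ?thesis
  proof
    assume a: "v \<in> code_tree (raw_code h l x) R'"
    show "set v \<subseteq> {1..} \<and> length v \<le> R' \<and> (\<forall>k<length v. x (take k v) (v ! k) < l)"
      using code_tree_uh[OF a] * a unfolding code_tree_def by blast
  next
    assume "set v \<subseteq> {1..} \<and> length v \<le> R' \<and> (\<forall>k<length v. x (take k v) (v ! k) < l)"
    then show "v \<in> code_tree (raw_code h l x) R'" using * unfolding code_tree_def by blast
  qed
qed

context
  fixes x :: "nat list \<Rightarrow> nat \<Rightarrow> real" and h l :: real and L R :: nat
  assumes x: "weight_array x" and h: "h > 0" and l: "l = real L * h"
begin

lemma nth_raw_code:
  assumes "1 \<le> i" "i \<le> length (raw_code h l x v)"
  shows "raw_code h l x v ! (i - 1) = nat \<lfloor>x v i / h\<rfloor>"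
proof -
  have "i - 1 < card {i. 1 \<le> i \<and> x v i < l}" using assms by (simp add: raw_code_def del: upt_Suc)
  then show ?thesis using assms(1) unfolding raw_code_def by (subst nth_map_upt) auto
qed

lemma nat_floor_bin:
  assumes y: "0 \<le> y"
  shows "nat \<lfloor>y / h\<rfloor> = j \<longleftrightarrow> real j * h \<le> y \<and> y < real (Suc j) * h"
proof -
  have "0 \<le> y / h" using y h by simp
  then have "nat \<lfloor>y / h\<rfloor> = j \<longleftrightarrow> \<lfloor>y / h\<rfloor> = int j" by (simp add: nat_eq_iff)
  also have "\<dots> \<longleftrightarrow> real j \<le> y / h \<and> y / h < real j + 1" by (simp add: floor_eq_iff)
  also have "\<dots> \<longleftrightarrow> real j * h \<le> y \<and> y < real (Suc j) * h" using h by (simp add: field_simps)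
  finally show ?thesis .
qed

text \<open>Children of weight at least \<open>l\<close> are cut off, and so the explored tree consists exactly of the vertices joined
  to the root by at most \<open>R\<close> edges lighter than \<open>l\<close>; the identity is the embedding.\<close>

theorem encodes_pwit_code:
  "encodes R h L (pwit_code R h l x) ulam_harris (child_weight x) [] id"
proof -
  let ?\<tau> = "pwit_code R h l x" and ?r = "raw_code h l x"
  have in1: "v @ [i] \<in> code_tree ?\<tau> (Suc R) \<longleftrightarrow> v \<in> code_tree ?r R \<and> 1 \<le> i \<and> i \<le> length (?r v)" for v i
    unfolding code_tree_pwit_code snoc_in_code_tree ..
  show ?thesis
    unfolding encodes_def
  proof (intro conjI allI impI ballI)
    show "id [] = []" "inj_on id (code_tree ?\<tau> (Suc R))" by simp_all
    show "id ` code_tree ?\<tau> (Suc R) \<subseteq> verts ulam_harris" using code_tree_uh by auto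
  next
    fix v i assume "v @ [i] \<in> code_tree ?\<tau> (Suc R)"
    then have v: "v \<in> code_tree ?r R" and i: "1 \<le> i" "i \<le> length (?r v)" unfolding in1 by auto
    have uh: "set v \<subseteq> {1..}" using code_tree_uh[OF v] .
    show "{id v, id (v @ [i])} \<in> edges ulam_harris" using edge_uh_snoc[of v i] uh i by simp
    have "nat \<lfloor>x v i / h\<rfloor> = ?\<tau> v ! (i - 1)" using nth_raw_code[OF i] v by (simp add: pwit_code_def)
    then have "real (?\<tau> v ! (i - 1)) * h \<le> x v i \<and> x v i < real (Suc (?\<tau> v ! (i - 1))) * h"
      by (rule nat_floor_bin[OF weight_array_nonneg[OF x uh i(1)], THEN iffD1])
    then show "real (?\<tau> v ! (i - 1)) * h \<le> child_weight x {id v, id (v @ [i])}"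
      "child_weight x {id v, id (v @ [i])} < real (Suc (?\<tau> v ! (i - 1))) * h" by simp_all
  next
    fix v y assume v: "v \<in> code_tree ?\<tau> R" and y: "{id v, y} \<in> edges ulam_harris \<and> child_weight x {id v, y} < real L * h"
    have vr: "v \<in> code_tree ?r R" using v unfolding code_tree_pwit_code' .
    have uh: "set v \<subseteq> {1..}" using code_tree_uh[OF v] .
    from y have "tree_step v y" "set y \<subseteq> {1..}" unfolding uh_pair_iff id_apply by auto
    then consider i where "y = v @ [i]" | i where "v = y @ [i]" unfolding tree_step_def by blast
    then show "\<exists>u\<in>code_tree ?\<tau> (Suc R). y = id u \<and> tree_step v u"
    proof cases
      case 1
      then have i: "1 \<le> i" using \<open>set y \<subseteq> {1..}\<close> by auto
      have "x v i < l" using y 1 l by simp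
      then have "v @ [i] \<in> code_tree ?\<tau> (Suc R)" unfolding in1 using vr i length_raw_code[OF x uh i] by simp
      then show ?thesis using 1 by (intro bexI[of _ y]) (auto simp: tree_step_def)
    next
      case 2
      have "v \<in> code_tree ?\<tau> (Suc R)" using v code_tree_mono[of R "Suc R" ?\<tau>] by auto
      then have "y \<in> code_tree ?\<tau> (Suc R)" unfolding 2 by (rule code_tree_parent)
      then show ?thesis using 2 by (intro bexI[of _ y]) (auto simp: tree_step_def)
    qed
  qed
qed

lemma bin_set:
  assumes v: "set v \<subseteq> {1..}" and j: "j < L"
  shows "{i. 1 \<le> i \<and> x v i \<in> {real j * h ..< real (Suc j) * h}} =
    {i. 1 \<le> i \<and> i \<le> length (raw_code h l x v) \<and> raw_code h l x v ! (i - 1) = j}"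
proof (rule Collect_cong)
  fix i
  have "real (Suc j) * h \<le> l" unfolding l using j h by (intro mult_right_mono) auto
  then show "1 \<le> i \<and> x v i \<in> {real j * h ..< real (Suc j) * h} \<longleftrightarrow>
      1 \<le> i \<and> i \<le> length (raw_code h l x v) \<and> raw_code h l x v ! (i - 1) = j"
    using length_raw_code[OF x v, of i] nth_raw_code[of i v] nat_floor_bin[OF weight_array_nonneg[OF x v], of i j]
    by auto
qed

lemma bin_less:
  assumes v: "set v \<subseteq> {1..}" and i: "1 \<le> i" "i \<le> length (raw_code h l x v)"
  shows "raw_code h l x v ! (i - 1) < L"
proof -
  define j where "j = raw_code h l x v ! (i - 1)"
  have "nat \<lfloor>x v i / h\<rfloor> = j" using nth_raw_code[OF i] by (simp add: j_def)
  then have "real j * h \<le> x v i" using nat_floor_bin[OF weight_array_nonneg[OF x v i(1)]] by blast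
  also have "x v i < real L * h" using length_raw_code[OF x v i(1)] i(2) l by simp
  finally show ?thesis using h by (simp add: j_def)
qed

text \<open>The bins increase weakly with the weights, and strictly if no bin is used twice. The set \<open>B\<close> is larger
  than the explored tree because it will be fixed in advance, while the explored tree is random.\<close>

lemma valid_pwit_code:
  assumes B: "code_tree (raw_code h l x) R \<subseteq> B"
    and one: "\<And>v j. v \<in> B \<Longrightarrow> set v \<subseteq> {1..} \<Longrightarrow> j < L \<Longrightarrow> bin_count h x v j \<le> 1"
    and two: "\<And>v v' j. v \<in> B \<Longrightarrow> v' \<in> B \<Longrightarrow> set v \<subseteq> {1..} \<Longrightarrow> set v' \<subseteq> {1..} \<Longrightarrow> v \<noteq> v' \<Longrightarrow> j < L \<Longrightarrow>
      bin_count h x v j = 0 \<or> bin_count h x v' j = 0"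
  shows "valid_code L R (pwit_code R h l x)" "\<And>v. v \<notin> B \<Longrightarrow> pwit_code R h l x v = []"
proof -
  let ?\<tau> = "pwit_code R h l x" and ?r = "raw_code h l x"
  show supp: "pwit_code R h l x v = []" if "v \<notin> B" for v using that B by (auto simp: pwit_code_def)
  have finb: "finite {i. 1 \<le> i \<and> i \<le> length (?r v) \<and> P i}" for v P by (rule finite_subset[of _ "{..length (?r v)}"]) auto
  have memD: "\<exists>i. 1 \<le> i \<and> i \<le> length (?r v) \<and> ?r v ! (i - 1) = b" if b: "b \<in> set (?r v)" for b v
  proof -
    obtain k where "k < length (?r v)" "?r v ! k = b" using b by (auto simp: in_set_conv_nth)
    then show ?thesis by (intro exI[of _ "Suc k"]) auto
  qed
  have set_lt: "set (?r v) \<subseteq> {..<L}" if "set v \<subseteq> {1..}" for v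
    using memD bin_less[OF that] by fastforce
  have pos: "bin_count h x v b \<noteq> 0" if v: "set v \<subseteq> {1..}" and b: "b \<in> set (?r v)" for v b
  proof -
    have bL: "b < L" using set_lt[OF v] b by auto
    show ?thesis unfolding bin_count_def bin_set[OF v bL] using memD[OF b] finb by (auto simp: card_eq_0_iff)
  qed
  show "valid_code L R ?\<tau>"
    unfolding valid_code_def code_tree_pwit_code'
  proof (intro conjI allI impI)
    fix v assume "v \<notin> code_tree ?r R" then show "?\<tau> v = []" by (simp add: pwit_code_def)
  next
    fix v
    show "sorted_wrt (<) (?\<tau> v)"
    proof (cases "v \<in> code_tree ?r R")
      case False then show ?thesis by (simp add: pwit_code_def)
    next
      case True
      have uh: "set v \<subseteq> {1..}" by (rule code_tree_uh[OF True])
      have vB: "v \<in> B" using True B by blast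
      have "?r v ! a < ?r v ! b" if ab: "a < b" "b < length (?r v)" for a b
      proof -
        have i: "1 \<le> Suc a" "Suc a \<le> length (?r v)" "1 \<le> Suc b" "Suc b \<le> length (?r v)" using ab by auto
        have eq: "?r v ! a = nat \<lfloor>x v (Suc a) / h\<rfloor>" "?r v ! b = nat \<lfloor>x v (Suc b) / h\<rfloor>"
          using nth_raw_code[OF i(1,2)] nth_raw_code[OF i(3,4)] by auto
        have "x v (Suc a) < x v (Suc b)" using weight_array_mono[OF x uh, of "Suc a" "Suc b"] ab by simp
        then have "x v (Suc a) / h \<le> x v (Suc b) / h" using h by (simp add: divide_right_mono)
        then have le: "?r v ! a \<le> ?r v ! b" unfolding eq by (intro nat_mono floor_mono)
        have "?r v ! a \<noteq> ?r v ! b"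
        proof
          assume e: "?r v ! a = ?r v ! b"
          have bL: "?r v ! b < L" using bin_less[OF uh i(3,4)] by simp
          have "{Suc a, Suc b} \<subseteq> {i. 1 \<le> i \<and> i \<le> length (?r v) \<and> ?r v ! (i - 1) = ?r v ! b}" using i e by auto
          then have "card {Suc a, Suc b} \<le> bin_count h x v (?r v ! b)"
            unfolding bin_count_def bin_set[OF uh bL] by (rule card_mono[OF finb])
          then show False using one[OF vB uh bL] ab by simp
        qed
        with le show ?thesis by simp
      qed
      then have "sorted_wrt (<) (?r v)" unfolding sorted_wrt_iff_nth_less by blast
      then show ?thesis using True by (simp add: pwit_code_def)
    qed
    show "set (?\<tau> v) \<subseteq> {..<L}" using set_lt[of v] code_tree_uh[of v] by (auto simp: pwit_code_def)
  next
    fix v v' :: "nat list" assume ne: "v \<noteq> v'"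
    show "set (?\<tau> v) \<inter> set (?\<tau> v') = {}"
    proof (rule equals0I)
      fix b assume b: "b \<in> set (?\<tau> v) \<inter> set (?\<tau> v')"
      then have vr: "v \<in> code_tree ?r R" "v' \<in> code_tree ?r R" "b \<in> set (?r v)" "b \<in> set (?r v')"
        by (auto simp: pwit_code_def split: if_splits)
      have uh: "set v \<subseteq> {1..}" "set v' \<subseteq> {1..}" using code_tree_uh vr by blast+
      have "b < L" using set_lt[OF uh(1)] vr by auto
      then show False using two[of v v' b] vr(1,2) B ne uh pos[OF uh(1) vr(3)] pos[OF uh(2) vr(4)] by auto
    qed
  qed
qed

lemma bin_count_of_code:
  assumes V: "valid_code L R \<tau>" and eq: "pwit_code R h l x = \<tau>" and v: "v \<in> code_tree \<tau> R" and j: "j < L"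
  shows "bin_count h x v j = (if j \<in> set (\<tau> v) then 1 else 0)"
proof -
  let ?r = "raw_code h l x"
  have vr: "v \<in> code_tree ?r R" using v unfolding eq[symmetric] code_tree_pwit_code' .
  have r: "?r v = \<tau> v" using vr unfolding eq[symmetric] by (simp add: pwit_code_def)
  have uh: "set v \<subseteq> {1..}" by (rule code_tree_uh[OF v])
  have d: "distinct (\<tau> v)" using valid_codeD(2)[OF V] strict_sorted_iff by blast
  have c: "bin_count h x v j = card {i. 1 \<le> i \<and> i \<le> length (\<tau> v) \<and> \<tau> v ! (i - 1) = j}"
    unfolding bin_count_def bin_set[OF uh j] r ..
  show ?thesis
  proof (cases "j \<in> set (\<tau> v)")
    case True
    then obtain k where k: "k < length (\<tau> v)" "\<tau> v ! k = j" by (auto simp: in_set_conv_nth)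
    have "{i. 1 \<le> i \<and> i \<le> length (\<tau> v) \<and> \<tau> v ! (i - 1) = j} = {Suc k}"
    proof (rule set_eqI)
      fix i
      show "i \<in> {i. 1 \<le> i \<and> i \<le> length (\<tau> v) \<and> \<tau> v ! (i - 1) = j} \<longleftrightarrow> i \<in> {Suc k}"
        using k d nth_eq_iff_index_eq[OF d, of "i - 1" k] by (cases i) auto
    qed
    then show ?thesis using c True by simp
  next
    case False
    then have "\<tau> v ! (i - 1) \<noteq> j" if "1 \<le> i" "i \<le> length (\<tau> v)" for i using that nth_mem[of "i - 1" "\<tau> v"] by auto
    then have "{i. 1 \<le> i \<and> i \<le> length (\<tau> v) \<and> \<tau> v ! (i - 1) = j} = {}" by blast
    then show ?thesis using c False by simp
  qed
qed

end

lemma pred_card_eq: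
  fixes S :: "'q \<Rightarrow> ('v :: countable) set"
  assumes "\<And>y. Measurable.pred Q (\<lambda>\<omega>. y \<in> S \<omega>)"
  shows "Measurable.pred Q (\<lambda>\<omega>. card (S \<omega>) = k)"
proof -
  note m = pred_finite_set[of S Q, OF assms]
  show ?thesis
  proof (cases k)
    case 0
    have "card (S \<omega>) = k \<longleftrightarrow> finite (S \<omega>) \<and> card (S \<omega>) \<le> 0 \<or> \<not> finite (S \<omega>)" for \<omega>
      unfolding 0 by auto
    then show ?thesis using m by (simp only:) (intro pred_intros_logic m)
  next
    case (Suc k')
    have "card (S \<omega>) = k \<longleftrightarrow> (finite (S \<omega>) \<and> card (S \<omega>) \<le> k) \<and> \<not> (finite (S \<omega>) \<and> card (S \<omega>) \<le> k')" for \<omega>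
      unfolding Suc by (auto intro: card_ge_0_finite)
    then show ?thesis using m by (simp only:) (intro pred_intros_logic m)
  qed
qed

locale pwit = prob_space Q for Q :: "'q measure" +
  fixes w :: "nat list \<Rightarrow> nat \<Rightarrow> 'q \<Rightarrow> real"
  assumes poisson: "\<And>v. set v \<subseteq> {1..} \<Longrightarrow> unit_poisson_points Q (w v)"
    and ind: "indep_vars (\<lambda>_. PiM {1..} (\<lambda>_. borel)) (\<lambda>v \<omega>. \<lambda>i\<in>{1..}. w v i \<omega>) {v. set v \<subseteq> {1..}}"
begin

abbreviation arr :: "'q \<Rightarrow> nat list \<Rightarrow> nat \<Rightarrow> real" where "arr \<omega> \<equiv> \<lambda>v i. w v i \<omega>"

lemma w_measurable: "set v \<subseteq> {1..} \<Longrightarrow> 1 \<le> i \<Longrightarrow> w v i \<in> borel_measurable Q"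
  using poisson[of v] by (auto simp: unit_poisson_points_def)

lemma AE_weight_array: "AE \<omega> in Q. weight_array (arr \<omega>)"
proof -
  have "AE \<omega> in Q. \<forall>v\<in>{v. set v \<subseteq> {1..}}. 0 \<le> w v 1 \<omega> \<and> (\<forall>i\<ge>1. w v i \<omega> < w v (Suc i) \<omega>) \<and>
      filterlim (\<lambda>i. w v i \<omega>) at_top sequentially"
  proof (subst AE_ball_countable)
    show "countable {v :: nat list. set v \<subseteq> {1..}}" by auto
    show "\<forall>v\<in>{v. set v \<subseteq> {1..}}. AE \<omega> in Q. 0 \<le> w v 1 \<omega> \<and> (\<forall>i\<ge>1. w v i \<omega> < w v (Suc i) \<omega>) \<and>
      filterlim (\<lambda>i. w v i \<omega>) at_top sequentially"
      using poisson unfolding unit_poisson_points_def by blast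
  qed
  then show ?thesis by (simp add: weight_array_def)
qed

lemma count_pred:
  assumes v: "set v \<subseteq> {1..}"
  shows "Measurable.pred Q (\<lambda>\<omega>. bin_count h (arr \<omega>) v j = k)"
  unfolding bin_count_def
proof (rule pred_card_eq)
  fix i
  show "Measurable.pred Q (\<lambda>\<omega>. i \<in> {i. 1 \<le> i \<and> w v i \<omega> \<in> {real j * h ..< real (Suc j) * h}})"
    unfolding mem_Collect_eq
  proof (rule pred_const_conj)
    assume "1 \<le> i"
    then have [measurable]: "w v i \<in> borel_measurable Q" using w_measurable v by simp
    show "Measurable.pred Q (\<lambda>\<omega>. w v i \<omega> \<in> {real j * h ..< real (Suc j) * h})" by measurable
  qed
qed

lemma prob_bin_count:
  assumes v: "set v \<subseteq> {1..}" and h: "h > 0"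
  shows "prob {\<omega> \<in> space Q. bin_count h (arr \<omega>) v j = k} = exp (- h) * h ^ k / fact k"
proof -
  let ?A = "{real j * h ..< real (Suc j) * h}"
  have m: "measure lborel ?A = h" using h by (simp add: distrib_right)
  have b: "?A \<subseteq> {0..}" "bounded ?A" "?A \<in> sets borel" using h by (auto intro: order_trans[of 0 "real j * h"])
  have "measure Q {\<omega> \<in> space Q. card {i. 1 \<le> i \<and> w v i \<omega> \<in> ?A} = k} = exp (- measure lborel ?A) * measure lborel ?A ^ k / fact k"
    using poisson[OF v] b unfolding unit_poisson_points_def by blast
  then show ?thesis unfolding m bin_count_def .
qed

text \<open>The bins are disjoint intervals of length \<open>h\<close>, on which a Poisson process has independent counts.\<close>

lemma prob_bin_counts:
  assumes v: "set v \<subseteq> {1..}" and h: "h > 0"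
  shows "prob {\<omega> \<in> space Q. \<forall>j<L. bin_count h (arr \<omega>) v j = c j} = (\<Prod>j<L. exp (- h) * h ^ c j / fact (c j))"
proof (cases "L = 0")
  case True then show ?thesis by (simp add: prob_space)
next
  case False
  let ?A = "\<lambda>j. {real j * h ..< real (Suc j) * h}"
  have dj: "disjoint_family_on ?A {..<L}"
    unfolding disjoint_family_on_def
  proof (intro ballI impI)
    have "?A i \<inter> ?A j = {}" if "i < j" for i j
    proof -
      have "real (Suc i) * h \<le> real j * h" using that h by (intro mult_right_mono) auto
      then show ?thesis by auto
    qed
    then show "?A i \<inter> ?A j = {}" if "i \<noteq> j" for i j using that by (metis Int_commute linorder_neqE_nat)
  qed
  have b: "\<forall>j\<in>{..<L}. ?A j \<in> sets borel \<and> ?A j \<subseteq> {0..} \<and> bounded (?A j)"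
  proof
    fix j assume "j \<in> {..<L}"
    have "0 \<le> real j * h" using h by simp
    then show "?A j \<in> sets borel \<and> ?A j \<subseteq> {0..} \<and> bounded (?A j)" by auto
  qed
  have iv: "indep_vars (\<lambda>_. count_space UNIV) (\<lambda>j \<omega>. card {i. 1 \<le> i \<and> w v i \<omega> \<in> ?A j}) {..<L}"
    using poisson[OF v] dj b unfolding unit_poisson_points_def by blast
  have "prob (\<Inter>j\<in>{..<L}. (\<lambda>\<omega>. card {i. 1 \<le> i \<and> w v i \<omega> \<in> ?A j}) -` {c j} \<inter> space Q) =
      (\<Prod>j\<in>{..<L}. prob ((\<lambda>\<omega>. card {i. 1 \<le> i \<and> w v i \<omega> \<in> ?A j}) -` {c j} \<inter> space Q))"
    by (rule indep_varsD[OF iv]) (use False in auto)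
  also have "\<dots> = (\<Prod>j<L. exp (- h) * h ^ c j / fact (c j))"
  proof (rule prod.cong[OF refl])
    fix j
    have "(\<lambda>\<omega>. card {i. 1 \<le> i \<and> w v i \<omega> \<in> ?A j}) -` {c j} \<inter> space Q = {\<omega> \<in> space Q. bin_count h (arr \<omega>) v j = c j}"
      by (auto simp: bin_count_def)
    then show "prob ((\<lambda>\<omega>. card {i. 1 \<le> i \<and> w v i \<omega> \<in> ?A j}) -` {c j} \<inter> space Q) = exp (- h) * h ^ c j / fact (c j)"
      using prob_bin_count[OF v h] by simp
  qed
  also have "(\<Inter>j\<in>{..<L}. (\<lambda>\<omega>. card {i. 1 \<le> i \<and> w v i \<omega> \<in> ?A j}) -` {c j} \<inter> space Q) =
      {\<omega> \<in> space Q. \<forall>j<L. bin_count h (arr \<omega>) v j = c j}"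
    using False by (auto simp: bin_count_def)
  finally show ?thesis .
qed

text \<open>The bin counts at a vertex are measurable functions of the weights at this vertex. The events are
  restricted to the form \<open>\<forall>j<L. f j \<in> C v j\<close> to make their measurability evident.\<close>

lemma prob_vertex_events:
  fixes P :: "nat list \<Rightarrow> (nat \<Rightarrow> nat) \<Rightarrow> bool"
  assumes S: "finite S" "S \<subseteq> {v. set v \<subseteq> {1..}}"
    and P: "\<And>v. P v = (\<lambda>f. \<forall>j<L. f j \<in> C v j)"
  shows "prob {\<omega> \<in> space Q. \<forall>v\<in>S. P v (bin_count h (arr \<omega>) v)} =
    (\<Prod>v\<in>S. prob {\<omega> \<in> space Q. P v (bin_count h (arr \<omega>) v)})"
proof (cases "S = {}")
  case True then show ?thesis by (simp add: prob_space)
next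
  case False
  let ?M = "PiM {1..} (\<lambda>_. borel) :: (nat \<Rightarrow> real) measure"
  let ?cnt = "\<lambda>y j. card {i. 1 \<le> i \<and> y i \<in> {real j * h ..< real (Suc j) * h}}"
  have cm: "Measurable.pred ?M (\<lambda>y. ?cnt y j = k)" for j k
  proof (rule pred_card_eq)
    fix i
    show "Measurable.pred ?M (\<lambda>y. i \<in> {i. 1 \<le> i \<and> y i \<in> {real j * h ..< real (Suc j) * h}})"
      unfolding mem_Collect_eq
    proof (rule pred_const_conj)
      assume "1 \<le> i"
      then have [measurable]: "(\<lambda>y. y i) \<in> borel_measurable ?M" by (intro measurable_component_singleton) auto
      show "Measurable.pred ?M (\<lambda>y. y i \<in> {real j * h ..< real (Suc j) * h})" by measurable
    qed
  qed
  have eqP: "P v f \<longleftrightarrow> (\<forall>j<L. \<exists>k. k \<in> C v j \<and> f j = k)" for v f unfolding P by auto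
  have Pm: "Measurable.pred ?M (\<lambda>y. P v (?cnt y))" for v
    unfolding eqP by (intro pred_intros_countable pred_intros_logic pred_const_imp pred_const_conj cm)
  let ?Y = "\<lambda>v. {y \<in> space ?M. P v (?cnt y)}"
  let ?X = "\<lambda>v \<omega>. \<lambda>i\<in>{1..}. w v i \<omega>"
  have Y: "?Y v \<in> sets ?M" for v using Pm by (simp add: pred_def)
  have "prob (\<Inter>v\<in>S. ?X v -` ?Y v \<inter> space Q) = (\<Prod>v\<in>S. prob (?X v -` ?Y v \<inter> space Q))"
    by (rule indep_varsD[OF ind False S]) (rule Y)
  moreover have X: "?X v -` ?Y v \<inter> space Q = {\<omega> \<in> space Q. P v (bin_count h (arr \<omega>) v)}" for v
  proof -
    have "{i. 1 \<le> i \<and> (?X v \<omega>) i \<in> I} = {i. 1 \<le> i \<and> w v i \<omega> \<in> I}" for \<omega> I by auto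
    then have "?cnt (?X v \<omega>) = bin_count h (arr \<omega>) v" for \<omega> by (intro ext) (simp only: bin_count_def)
    moreover have "?X v \<omega> \<in> space ?M" for \<omega> by (simp add: space_PiM)
    ultimately show ?thesis by auto
  qed
  moreover have "(\<Inter>v\<in>S. {\<omega> \<in> space Q. P v (bin_count h (arr \<omega>) v)}) = {\<omega> \<in> space Q. \<forall>v\<in>S. P v (bin_count h (arr \<omega>) v)}"
    using False by auto
  ultimately show ?thesis by (simp only:)
qed

text \<open>Contains the event that the code is \<open>\<tau>\<close>, and depends on the bin counts only, so that its probability is a
  product.\<close>

definition code_event :: "nat \<Rightarrow> real \<Rightarrow> nat \<Rightarrow> (nat list \<Rightarrow> nat list) \<Rightarrow> 'q set" where
  "code_event R h L \<tau> = {\<omega> \<in> space Q. \<forall>v\<in>code_tree \<tau> R. \<forall>j<L.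
     bin_count h (arr \<omega>) v j \<in> {if j \<in> set (\<tau> v) then 1 else 0}}"

lemma code_event_sets: "code_event R h L \<tau> \<in> events"
proof -
  have "Measurable.pred Q (\<lambda>\<omega>. \<forall>v. v \<in> code_tree \<tau> R \<longrightarrow> (\<forall>j. j < L \<longrightarrow>
      bin_count h (arr \<omega>) v j = (if j \<in> set (\<tau> v) then 1 else 0)))"
    by (rule pred_intros_countable, rule pred_const_imp, rule pred_intros_countable, rule pred_const_imp,
        rule count_pred, erule code_tree_uh)
  moreover have "code_event R h L \<tau> = {\<omega> \<in> space Q. \<forall>v. v \<in> code_tree \<tau> R \<longrightarrow> (\<forall>j. j < L \<longrightarrow>
      bin_count h (arr \<omega>) v j = (if j \<in> set (\<tau> v) then 1 else 0))}"
    by (auto simp: code_event_def)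
  ultimately show ?thesis by (simp only: pred_def)
qed

lemma in_code_event:
  assumes "\<omega> \<in> space Q" "weight_array (arr \<omega>)" "h > 0" "valid_code L R \<tau>" "pwit_code R h (real L * h) (arr \<omega>) = \<tau>"
  shows "\<omega> \<in> code_event R h L \<tau>"
  unfolding code_event_def using bin_count_of_code[OF assms(2,3) refl assms(4,5)] assms(1) by simp

text \<open>A bin has one point with probability \<open>h * exp (- h)\<close> and none with probability \<open>exp (- h)\<close>. There are
  \<open>L\<close> bins at each explored vertex, and every vertex of the code except the root occupies one bin.\<close>

theorem prob_code_event:
  assumes V: "valid_code L R \<tau>" and h: "h > 0"
  shows "prob (code_event R h L \<tau>) =
    h ^ (card (code_tree \<tau> (Suc R)) - 1) * exp (- (real L * h * card (code_tree \<tau> R)))"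
proof -
  let ?T = "code_tree \<tau> R"
  let ?c = "\<lambda>v j. if j \<in> set (\<tau> v) then 1 else 0 :: nat"
  let ?P = "\<lambda>v f. \<forall>j<L. f j \<in> {?c v j}"
  have fT: "finite ?T" "?T \<subseteq> {v. set v \<subseteq> {1..}}" using finite_code_tree code_tree_uh by blast+
  have "prob (code_event R h L \<tau>) = prob {\<omega> \<in> space Q. \<forall>v\<in>?T. ?P v (bin_count h (arr \<omega>) v)}"
    by (simp only: code_event_def)
  also have "\<dots> = (\<Prod>v\<in>?T. prob {\<omega> \<in> space Q. ?P v (bin_count h (arr \<omega>) v)})"
    by (rule prob_vertex_events[OF fT]) (rule refl)
  also have "\<dots> = (\<Prod>v\<in>?T. exp (- (real L * h)) * h ^ length (\<tau> v))"
  proof (rule prod.cong[OF refl])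
    fix v assume v: "v \<in> ?T"
    have dv: "distinct (\<tau> v)" "set (\<tau> v) \<subseteq> {..<L}" using valid_codeD(2,3)[OF V] strict_sorted_iff by blast+
    have "prob {\<omega> \<in> space Q. ?P v (bin_count h (arr \<omega>) v)} = (\<Prod>j<L. exp (- h) * h ^ ?c v j / fact (?c v j))"
    proof -
      have "set v \<subseteq> {1..}" using fT(2) v by blast
      from prob_bin_counts[OF this h, of L "?c v"] show ?thesis by (simp only: singleton_iff)
    qed
    also have "\<dots> = (\<Prod>j<L. exp (- h)) * (\<Prod>j<L. h ^ ?c v j)"
      by (subst prod.distrib[symmetric]) (auto intro!: prod.cong)
    also have "(\<Prod>j<L. h ^ ?c v j) = h ^ (\<Sum>j<L. ?c v j)" by (simp add: power_sum)
    also have "(\<Sum>j<L. ?c v j) = card (set (\<tau> v))"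
      using dv(2) by (simp add: sum.If_cases Int_absorb1)
    also have "\<dots> = length (\<tau> v)" using dv(1) by (rule distinct_card)
    also have "(\<Prod>j<L. exp (- h)) = exp (- (real L * h))" by (simp add: exp_of_nat_mult[symmetric])
    finally show "prob {\<omega> \<in> space Q. ?P v (bin_count h (arr \<omega>) v)} = exp (- (real L * h)) * h ^ length (\<tau> v)" .
  qed
  also have "\<dots> = exp (- (real L * h)) ^ card ?T * h ^ (\<Sum>v\<in>?T. length (\<tau> v))"
    by (simp add: prod.distrib power_sum)
  also have "exp (- (real L * h)) ^ card ?T = exp (- (real L * h * card ?T))"
    by (simp add: exp_of_nat_mult[symmetric] mult.commute)
  also have "(\<Sum>v\<in>?T. length (\<tau> v)) = card (code_tree \<tau> (Suc R)) - 1"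
  proof -
    have "bij_betw (\<lambda>(v, i). v @ [i]) (SIGMA v:?T. {1..length (\<tau> v)}) (code_tree \<tau> (Suc R) - {[]})"
      unfolding bij_betw_def
    proof
      show "inj_on (\<lambda>(v, i). v @ [i]) (SIGMA v:?T. {1..length (\<tau> v)})" by (auto simp: inj_on_def)
      show "(\<lambda>(v, i). v @ [i]) ` (SIGMA v:?T. {1..length (\<tau> v)}) = code_tree \<tau> (Suc R) - {[]}"
      proof
        show "(\<lambda>(v, i). v @ [i]) ` (SIGMA v:?T. {1..length (\<tau> v)}) \<subseteq> code_tree \<tau> (Suc R) - {[]}"
          using snoc_in_code_tree by auto
        show "code_tree \<tau> (Suc R) - {[]} \<subseteq> (\<lambda>(v, i). v @ [i]) ` (SIGMA v:?T. {1..length (\<tau> v)})"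
        proof
          fix u assume u: "u \<in> code_tree \<tau> (Suc R) - {[]}"
          then have "u \<in> code_tree \<tau> (Suc R)" by simp
          then show "u \<in> (\<lambda>(v, i). v @ [i]) ` (SIGMA v:?T. {1..length (\<tau> v)})"
          proof (cases rule: code_tree_cases)
            case 1 then show ?thesis using u by simp
          next
            case (2 v i)
            then show ?thesis by (intro image_eqI[of _ _ "(v, i)"]) auto
          qed
        qed
      qed
    qed
    then have "card (SIGMA v:?T. {1..length (\<tau> v)}) = card (code_tree \<tau> (Suc R) - {[]})" by (rule bij_betw_same_card)
    moreover have "card (SIGMA v:?T. {1..length (\<tau> v)}) = (\<Sum>v\<in>?T. length (\<tau> v))"
      using fT by (subst card_SigmaI) auto
    ultimately show ?thesis using finite_code_tree[of \<tau> "Suc R"] by simp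
  qed
  finally show ?thesis by (simp add: mult.commute)
qed

text \<open>Each of the two points costs a factor \<open>h\<close>. Summed over \<open>L = l / h\<close> bins and finitely many
  vertices, the probability that some bin is used twice is of order \<open>l * h\<close>.\<close>

lemma prob_bin_double:
  assumes v: "set v \<subseteq> {1..}" and h: "h > 0"
  shows "prob {\<omega> \<in> space Q. \<not> bin_count h (arr \<omega>) v j \<le> 1} \<le> h * h"
proof -
  let ?E = "\<lambda>k. {\<omega> \<in> space Q. bin_count h (arr \<omega>) v j = k}"
  have ev: "?E k \<in> events" for k using count_pred[OF v, of h j k] by (simp add: pred_def)
  have "{\<omega> \<in> space Q. \<not> bin_count h (arr \<omega>) v j \<le> 1} = space Q - (?E 0 \<union> ?E 1)" by auto
  then have "prob {\<omega> \<in> space Q. \<not> bin_count h (arr \<omega>) v j \<le> 1} = 1 - prob (?E 0 \<union> ?E 1)"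
    using prob_compl[of "?E 0 \<union> ?E 1"] ev by simp
  also have "prob (?E 0 \<union> ?E 1) = prob (?E 0) + prob (?E 1)"
    by (rule finite_measure_Union[OF ev ev]) auto
  also have "\<dots> = exp (- h) * (1 + h)" using prob_bin_count[OF v h] by (simp add: distrib_left)
  also have "1 - exp (- h) * (1 + h) \<le> h * h"
  proof -
    have "1 - h \<le> exp (- h)" using exp_ge_add_one_self[of "- h"] by simp
    then have "(1 - h) * (1 + h) \<le> exp (- h) * (1 + h)" using h by (intro mult_right_mono) auto
    then show ?thesis by (simp add: algebra_simps)
  qed
  finally show ?thesis .
qed

lemma prob_bin_shared:
  assumes v: "set v \<subseteq> {1..}" "set v' \<subseteq> {1..}" "v \<noteq> v'" and h: "h > 0" and j: "j < L"
  shows "prob {\<omega> \<in> space Q. \<not> (bin_count h (arr \<omega>) v j = 0 \<or> bin_count h (arr \<omega>) v' j = 0)} \<le> h * h"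
proof -
  let ?C = "\<lambda>(_ :: nat list) i. if i = j then {1..} else (UNIV :: nat set)"
  have P: "(\<forall>i<L. f i \<in> ?C u i) \<longleftrightarrow> f j \<noteq> 0" for f :: "nat \<Rightarrow> nat" and u using j by (auto split: if_splits)
  have one: "prob {\<omega> \<in> space Q. bin_count h (arr \<omega>) u j \<noteq> 0} \<le> h" if u: "set u \<subseteq> {1..}" for u
  proof -
    let ?E = "{\<omega> \<in> space Q. bin_count h (arr \<omega>) u j = 0}"
    have ev: "?E \<in> events" using count_pred[OF u, of h j 0] by (simp add: pred_def)
    have "{\<omega> \<in> space Q. bin_count h (arr \<omega>) u j \<noteq> 0} = space Q - ?E" by auto
    then have "prob {\<omega> \<in> space Q. bin_count h (arr \<omega>) u j \<noteq> 0} = 1 - exp (- h)"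
      using prob_compl[OF ev] prob_bin_count[OF u h, of j 0] by simp
    then show ?thesis using exp_ge_add_one_self[of "- h"] by simp
  qed
  have "prob {\<omega> \<in> space Q. \<forall>u\<in>{v, v'}. \<forall>i<L. bin_count h (arr \<omega>) u i \<in> ?C u i} =
      (\<Prod>u\<in>{v, v'}. prob {\<omega> \<in> space Q. \<forall>i<L. bin_count h (arr \<omega>) u i \<in> ?C u i})"
    by (rule prob_vertex_events[where C = ?C and P = "\<lambda>u f. \<forall>i<L. f i \<in> ?C u i"]) (use v in auto)
  then have "prob {\<omega> \<in> space Q. \<forall>u\<in>{v, v'}. bin_count h (arr \<omega>) u j \<noteq> 0} =
      (\<Prod>u\<in>{v, v'}. prob {\<omega> \<in> space Q. bin_count h (arr \<omega>) u j \<noteq> 0})" unfolding P .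
  also have "\<dots> = prob {\<omega> \<in> space Q. bin_count h (arr \<omega>) v j \<noteq> 0} * prob {\<omega> \<in> space Q. bin_count h (arr \<omega>) v' j \<noteq> 0}"
    using v(3) by simp
  also have "\<dots> \<le> h * h" using one v h by (intro mult_mono) auto
  also have "{\<omega> \<in> space Q. \<forall>u\<in>{v, v'}. bin_count h (arr \<omega>) u j \<noteq> 0} =
      {\<omega> \<in> space Q. \<not> (bin_count h (arr \<omega>) v j = 0 \<or> bin_count h (arr \<omega>) v' j = 0)}" by auto
  finally show ?thesis .
qed

text \<open>The explored tree is almost surely finite because the weights at each vertex diverge; so with high
  probability all its vertices have entries at most \<open>m\<close>, for a suitable \<open>m\<close>.\<close>

lemma explored_tree_in_box:
  assumes e: "\<epsilon> > 0"
  shows "\<exists>B D. finite B \<and> D \<in> events \<and> prob D \<ge> 1 - \<epsilon> \<and> (\<forall>\<omega>\<in>D. \<forall>v. set v \<subseteq> {1..} \<and> length v \<le> R \<and>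
      (\<forall>k<length v. w (take k v) (v ! k) \<omega> < l) \<longrightarrow> v \<in> B)"
proof -
  let ?T = "\<lambda>\<omega>. {v. set v \<subseteq> {1..} \<and> length v \<le> R \<and> (\<forall>k<length v. w (take k v) (v ! k) \<omega> < l)}"
  let ?B = "\<lambda>m. {v. set v \<subseteq> {..m} \<and> length v \<le> R}"
  define E where "E m = {\<omega> \<in> space Q. \<forall>v. v \<in> ?T \<omega> \<longrightarrow> v \<in> ?B m}" for m :: nat
  have ev: "E m \<in> events" for m
  proof -
    have "Measurable.pred Q (\<lambda>\<omega>. \<forall>v. (set v \<subseteq> {1..} \<and> length v \<le> R) \<longrightarrow> (\<forall>k. k < length v \<longrightarrow> w (take k v) (v ! k) \<omega> < l) \<longrightarrow> v \<in> ?B m)"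
    proof (rule pred_intros_countable, rule pred_const_imp, rule pred_intros_logic(4)[OF _ pred_constI],
        rule pred_intros_countable, rule pred_const_imp)
      fix v k assume v: "set v \<subseteq> {1 :: nat..} \<and> length v \<le> R" and k: "k < length v"
      have "set (take k v) \<subseteq> {1..}" using v set_take_subset[of k v] by auto
      moreover have "1 \<le> v ! k" using subsetD[OF conjunct1[OF v] nth_mem[OF k]] by simp
      ultimately have [measurable]: "w (take k v) (v ! k) \<in> borel_measurable Q" by (rule w_measurable)
      show "Measurable.pred Q (\<lambda>\<omega>. w (take k v) (v ! k) \<omega> < l)" by measurable
    qed
    moreover have "E m = {\<omega> \<in> space Q. \<forall>v. (set v \<subseteq> {1..} \<and> length v \<le> R) \<longrightarrow>
        (\<forall>k. k < length v \<longrightarrow> w (take k v) (v ! k) \<omega> < l) \<longrightarrow> v \<in> ?B m}"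
      unfolding E_def by blast
    ultimately show ?thesis by (simp only: pred_def)
  qed
  have inc: "incseq E"
    unfolding E_def by (rule incseq_SucI) fastforce
  have "AE \<omega> in Q. \<omega> \<in> (\<Union>m. E m)"
    using AE_weight_array AE_space
  proof eventually_elim
    case (elim \<omega>)
    have "?T \<omega> = code_tree (raw_code 1 l (arr \<omega>)) R"
      by (rule set_eqI) (simp only: in_raw_code_tree[OF elim(1)] mem_Collect_eq)
    then have fT: "finite (?T \<omega>)" using finite_code_tree by simp
    define m where "m = Max (insert 0 (\<Union> (set ` ?T \<omega>)))"
    have "a \<le> m" if "v \<in> ?T \<omega>" "a \<in> set v" for v a
      unfolding m_def using fT that by (intro Max_ge) auto
    then have "\<omega> \<in> E m" using elim(2) by (auto simp: E_def)
    then show ?case by blast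
  qed
  then have "prob (\<Union>m. E m) = 1" using ev by (intro prob_eq_1[THEN iffD2]) auto
  then have "(\<lambda>m. prob (E m)) \<longlonglongrightarrow> 1"
    using finite_Lim_measure_incseq[OF _ inc] ev by (metis image_subset_iff)
  then have "eventually (\<lambda>m. prob (E m) > 1 - \<epsilon>) sequentially" using e by (intro order_tendstoD) auto
  then obtain m where "prob (E m) > 1 - \<epsilon>" by (auto simp: eventually_sequentially)
  moreover have "finite (?B m)" by (rule finite_lists_length_le) simp
  ultimately show ?thesis
  proof (intro exI[of _ "?B m"] exI[of _ "E m"] conjI ballI allI impI)
    show "E m \<in> events" by (rule ev)
    fix \<omega> v assume "\<omega> \<in> E m" "set v \<subseteq> {1..} \<and> length v \<le> R \<and> (\<forall>k<length v. w (take k v) (v ! k) \<omega> < l)"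
    then show "v \<in> ?B m" unfolding E_def by blast
  qed simp_all
qed

text \<open>The explored tree lies in a fixed finite set \<open>B\<close> up to probability \<open>\<epsilon> / 2\<close>, and for bins that are small
  in terms of \<open>B\<close> no bin is used twice in \<open>B\<close> up to probability \<open>\<epsilon> / 2\<close>. There are finitely many
  valid codes that vanish outside \<open>B\<close>.\<close>

theorem valid_codes_likely:
  assumes e: "\<epsilon> > 0" and l: "l > 0"
  shows "\<exists>L h \<T> D. h > 0 \<and> real L * h = l \<and> finite \<T> \<and> D \<in> events \<and> prob D \<ge> 1 - \<epsilon> \<and>
    (\<forall>\<tau>\<in>\<T>. valid_code L R \<tau>) \<and> (\<forall>\<omega>\<in>D. weight_array (arr \<omega>) \<and> pwit_code R h l (arr \<omega>) \<in> \<T>)"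
proof -
  obtain B D0 where B: "finite B" and D0: "D0 \<in> events" "prob D0 \<ge> 1 - \<epsilon> / 2"
    and box: "\<And>\<omega> v. \<omega> \<in> D0 \<Longrightarrow> set v \<subseteq> {1..} \<Longrightarrow> length v \<le> R \<Longrightarrow>
      (\<forall>k<length v. w (take k v) (v ! k) \<omega> < l) \<Longrightarrow> v \<in> B"
    using explored_tree_in_box[of "\<epsilon> / 2" R l] e by auto
  obtain N1 where N1: "N1 \<in> null_sets Q" "{\<omega> \<in> space Q. \<not> weight_array (arr \<omega>)} \<subseteq> N1"
    using AE_weight_array by (auto elim: AE_E_prob simp: eventually_ae_filter)
  \<comment> \<open>One term for each vertex and one for each pair of vertices of \<open>B\<close>.\<close>
  define n where "n = card B + card B * card B"
  obtain L :: nat where L: "real L > 2 * (real n + 1) * (l * l) / \<epsilon> + 1" using reals_Archimedean2 by blast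
  have L0: "L > 0"
  proof (rule ccontr)
    assume "\<not> L > 0"
    then have "0 > 2 * (real n + 1) * (l * l) / \<epsilon> + 1" using L by simp
    moreover have "2 * (real n + 1) * (l * l) / \<epsilon> \<ge> 0" using e l by simp
    ultimately show False by simp
  qed
  define h where "h = l / L"
  have h: "h > 0" "real L * h = l" using l L0 by (auto simp: h_def)
  define B' where "B' = {v \<in> B. set v \<subseteq> {1..}}"
  have B': "finite B'" "B' \<subseteq> B" using B by (auto simp: B'_def)
  define X1 where "X1 v j = {\<omega> \<in> space Q. \<not> bin_count h (arr \<omega>) v j \<le> 1}" for v j
  define X2 where "X2 v v' j = {\<omega> \<in> space Q. \<not> (bin_count h (arr \<omega>) v j = 0 \<or> bin_count h (arr \<omega>) v' j = 0)}" for v v' j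
  have X1ev: "X1 v j \<in> events" if "v \<in> B'" for v j
  proof -
    have "{\<omega> \<in> space Q. bin_count h (arr \<omega>) v j = k} \<in> events" for k
      using count_pred[of v h j k] that by (simp add: pred_def B'_def)
    moreover have "X1 v j = space Q - ({\<omega> \<in> space Q. bin_count h (arr \<omega>) v j = 0} \<union> {\<omega> \<in> space Q. bin_count h (arr \<omega>) v j = 1})"
      by (auto simp: X1_def)
    ultimately show ?thesis by simp
  qed
  have X2ev: "X2 v v' j \<in> events" if "v \<in> B'" "v' \<in> B'" for v v' j
  proof -
    have "{\<omega> \<in> space Q. bin_count h (arr \<omega>) u j = 0} \<in> events" if "u \<in> B'" for u
      using count_pred[of u h j 0] that by (simp add: pred_def B'_def)
    moreover have "X2 v v' j = space Q - ({\<omega> \<in> space Q. bin_count h (arr \<omega>) v j = 0} \<union> {\<omega> \<in> space Q. bin_count h (arr \<omega>) v' j = 0})"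
      by (auto simp: X2_def)
    ultimately show ?thesis using that by simp
  qed
  define I1 where "I1 = B' \<times> {..<L}"
  define I2 where "I2 = {(v, v') \<in> B' \<times> B'. v \<noteq> v'} \<times> {..<L}"
  define Y where "Y = (\<Union>(v, j)\<in>I1. X1 v j) \<union> (\<Union>((v, v'), j)\<in>I2. X2 v v' j)"
  have fI: "finite I1" "finite I2"
    using B' unfolding I1_def I2_def by (auto intro: finite_subset[of _ "B' \<times> B'"])
  have evs: "(\<Union>(v, j)\<in>I1. X1 v j) \<in> events" "(\<Union>((v, v'), j)\<in>I2. X2 v v' j) \<in> events"
    using fI X1ev X2ev by (auto intro!: sets.finite_UN simp: I1_def I2_def)
  have Yev: "Y \<in> events" unfolding Y_def using evs by (rule sets.Un)
  have cI1: "card I1 = card B' * L" by (simp add: I1_def card_cartesian_product)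
  have cI2: "card I2 \<le> card B' * card B' * L"
  proof -
    have "card {(v, v') \<in> B' \<times> B'. v \<noteq> v'} \<le> card (B' \<times> B')" using B' by (intro card_mono) auto
    then show ?thesis by (simp add: I2_def card_cartesian_product)
  qed
  have "prob (\<Union>(v, j)\<in>I1. X1 v j) \<le> (\<Sum>(v, j)\<in>I1. prob (X1 v j))"
    using finite_measure_subadditive_finite[OF fI(1), of "\<lambda>(v, j). X1 v j"] X1ev
    by (auto simp: I1_def case_prod_beta' image_subset_iff)
  also have "\<dots> \<le> (\<Sum>(v, j)\<in>I1. h * h)"
  proof (intro sum_mono)
    fix p assume "p \<in> I1"
    then obtain v j where p: "p = (v, j)" "set v \<subseteq> {1..}" by (cases p) (auto simp: I1_def B'_def)
    show "(case p of (v, j) \<Rightarrow> prob (X1 v j)) \<le> (case p of (v, j) \<Rightarrow> h * h)"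
      unfolding p(1) prod.case X1_def by (rule prob_bin_double[OF p(2) h(1)])
  qed
  also have "\<dots> = card B' * L * (h * h)" by (simp add: cI1)
  finally have p1: "prob (\<Union>(v, j)\<in>I1. X1 v j) \<le> card B' * L * (h * h)" .
  have "prob (\<Union>((v, v'), j)\<in>I2. X2 v v' j) \<le> (\<Sum>((v, v'), j)\<in>I2. prob (X2 v v' j))"
    using finite_measure_subadditive_finite[OF fI(2), of "\<lambda>((v, v'), j). X2 v v' j"] X2ev
    by (auto simp: I2_def case_prod_beta' image_subset_iff)
  also have "\<dots> \<le> (\<Sum>((v, v'), j)\<in>I2. h * h)"
  proof (intro sum_mono)
    fix p assume "p \<in> I2"
    then obtain v v' j where p: "p = ((v, v'), j)" "set v \<subseteq> {1..}" "set v' \<subseteq> {1..}" "v \<noteq> v'" "j < L"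
      by (cases p) (auto simp: I2_def B'_def)
    show "(case p of (x, j) \<Rightarrow> (case x of (v, v') \<Rightarrow> \<lambda>j. prob (X2 v v' j)) j) \<le> (case p of (x, j) \<Rightarrow> (case x of (v, v') \<Rightarrow> \<lambda>j. h * h) j)"
      unfolding p(1) prod.case X2_def by (rule prob_bin_shared[OF p(2-4) h(1) p(5)])
  qed
  also have "\<dots> = card I2 * (h * h)" by (simp add: case_prod_beta')
  also have "\<dots> \<le> (card B' * card B' * L) * (h * h)" using cI2 h by (intro mult_right_mono) (auto simp flip: of_nat_mult)
  finally have p2: "prob (\<Union>((v, v'), j)\<in>I2. X2 v v' j) \<le> card B' * card B' * L * (h * h)" by simp
  have "prob Y \<le> prob (\<Union>(v, j)\<in>I1. X1 v j) + prob (\<Union>((v, v'), j)\<in>I2. X2 v v' j)"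
    unfolding Y_def by (rule measure_Un_le[OF evs])
  also have "\<dots> \<le> (card B' + card B' * card B') * (L * (h * h))" using p1 p2 by (simp add: algebra_simps)
  also have "\<dots> \<le> n * (L * (h * h))"
  proof (rule mult_right_mono)
    have "card B' \<le> card B" using B B' by (intro card_mono)
    then have "card B' + card B' * card B' \<le> n" unfolding n_def by (intro add_mono mult_le_mono)
    then show "real (card B' + card B' * card B') \<le> real n" by (simp only: of_nat_le_iff)
  qed (use h in simp)
  also have "real n * (L * (h * h)) = n * (l * l) / L" using L0 by (simp add: h_def field_simps)
  also have "\<dots> \<le> \<epsilon> / 2"
  proof -
    have "2 * real n * (l * l) / \<epsilon> \<le> 2 * (real n + 1) * (l * l) / \<epsilon> + 1"
      using e l by (simp add: field_simps)
    then have "2 * real n * (l * l) / \<epsilon> \<le> L" using L by simp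
    then show ?thesis using e L0 by (simp add: field_simps)
  qed
  finally have pY: "prob Y \<le> \<epsilon> / 2" .
  define D where "D = D0 - Y - N1"
  have Dev: "D \<in> events" unfolding D_def using D0 Yev N1(1) by (auto simp: null_sets_def)
  have pD: "prob D \<ge> 1 - \<epsilon>"
  proof -
    have "prob D0 \<le> prob (D \<union> (Y \<union> N1))"
      using Dev Yev N1(1) by (intro finite_measure_mono) (auto simp: D_def null_sets_def)
    also have "\<dots> \<le> prob D + prob (Y \<union> N1)"
      using Dev Yev N1(1) by (intro measure_Un_le) (auto simp: null_sets_def)
    also have "prob (Y \<union> N1) \<le> prob Y + prob N1"
      using Yev N1(1) by (intro measure_Un_le) (auto simp: null_sets_def)
    also have "prob N1 = 0" using N1(1) by (rule measure_eq_0_null_sets)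
    finally show ?thesis using D0(2) pY by simp
  qed
  let ?T = "{\<tau>. (\<forall>v. (v \<in> B \<longrightarrow> \<tau> v \<in> {xs. set xs \<subseteq> {..<L} \<and> length xs \<le> L}) \<and> (v \<notin> B \<longrightarrow> \<tau> v = []))} \<inter> {\<tau>. valid_code L R \<tau>}"
  have fT: "finite ?T"
    by (intro finite_Int disjI1 finite_set_of_finite_funs B finite_lists_length_le) simp
  have "weight_array (arr \<omega>) \<and> pwit_code R h l (arr \<omega>) \<in> ?T" if \<omega>: "\<omega> \<in> D" for \<omega>
  proof
    have sp: "\<omega> \<in> space Q" "\<omega> \<in> D0" "\<omega> \<notin> Y" "\<omega> \<notin> N1" using \<omega> D0(1) sets.sets_into_space unfolding D_def by auto
    show wa: "weight_array (arr \<omega>)" using N1(2) sp by auto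
    have tree: "code_tree (raw_code h l (arr \<omega>)) R \<subseteq> B"
      using box[OF sp(2)] unfolding subset_iff in_raw_code_tree[OF wa] by blast
    have one: "bin_count h (arr \<omega>) v j \<le> 1" if "v \<in> B" "set v \<subseteq> {1..}" "j < L" for v j
    proof (rule ccontr)
      assume "\<not> bin_count h (arr \<omega>) v j \<le> 1"
      then have "\<omega> \<in> X1 v j" "(v, j) \<in> I1" using sp that by (auto simp: X1_def I1_def B'_def)
      then have "\<omega> \<in> (\<Union>(v, j)\<in>I1. X1 v j)" by (intro UN_I[of "(v, j)"]) simp_all
      then have "\<omega> \<in> Y" unfolding Y_def by (rule UnI1)
      with sp show False by simp
    qed
    have two: "bin_count h (arr \<omega>) v j = 0 \<or> bin_count h (arr \<omega>) v' j = 0"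
      if "v \<in> B" "v' \<in> B" "set v \<subseteq> {1..}" "set v' \<subseteq> {1..}" "v \<noteq> v'" "j < L" for v v' j
    proof (rule ccontr)
      assume "\<not> ?thesis"
      then have "\<omega> \<in> X2 v v' j" "((v, v'), j) \<in> I2" using sp that by (auto simp: X2_def I2_def B'_def)
      then have "\<omega> \<in> (\<Union>((v, v'), j)\<in>I2. X2 v v' j)" by (intro UN_I[of "((v, v'), j)"]) simp_all
      then have "\<omega> \<in> Y" unfolding Y_def by (rule UnI2)
      with sp show False by simp
    qed
    have V: "valid_code L R (pwit_code R h l (arr \<omega>))" "\<And>v. v \<notin> B \<Longrightarrow> pwit_code R h l (arr \<omega>) v = []"
      using valid_pwit_code[OF wa h(1) h(2)[symmetric] tree one two] by blast+
    have "length (pwit_code R h l (arr \<omega>) v) \<le> L" for v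
    proof -
      have "distinct (pwit_code R h l (arr \<omega>) v)" using valid_codeD(2)[OF V(1)] strict_sorted_iff by blast
      then have "length (pwit_code R h l (arr \<omega>) v) = card (set (pwit_code R h l (arr \<omega>) v))" by (simp add: distinct_card)
      also have "\<dots> \<le> card {..<L}" by (rule card_mono) (use valid_codeD(3)[OF V(1)] in auto)
      finally show ?thesis by simp
    qed
    then show "pwit_code R h l (arr \<omega>) \<in> ?T" using V valid_codeD(3)[OF V(1)] by blast
  qed
  then show ?thesis using h fT Dev pD
    by (intro exI[of _ L] exI[of _ h] exI[of _ ?T] exI[of _ D]) blast
qed

end

section \<open>Comparing balls in nested graphs\<close>

text \<open>A shortest path in \<open>M\<close> from \<open>\<rho>\<close> that leaves \<open>F\<close> does so through an edge with an endpoint in the ball of \<open>F\<close>.\<close>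

lemma graph_ball_eqI:
  assumes M: "simple_graph M" and V: "verts F = verts M" and E: "edges F \<subseteq> edges M" and \<rho>: "\<rho> \<in> verts M"
    and agree: "\<And>a b. a \<in> verts (graph_ball F \<rho> r) \<Longrightarrow> b \<in> verts (graph_ball M \<rho> r) \<Longrightarrow> {a, b} \<in> edges M \<Longrightarrow> {a, b} \<in> edges F"
  shows "graph_ball F \<rho> r = graph_ball M \<rho> r"
proof -
  have F: "simple_graph F" by (rule simple_subgraph[OF M V E])
  have sub: "adj F \<subseteq> adj M" using E by (auto simp: adj_def)
  have mono: "adj F ^^ k \<subseteq> adj M ^^ k" for k by (induction k) (use sub in auto)
  have bwd: "(\<rho>, u) \<in> adj F ^^ k" if "(\<rho>, u) \<in> adj M ^^ k" "k \<le> r" for u k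
    using that
  proof (induction k arbitrary: u)
    case 0 then show ?case by simp
  next
    case (Suc k)
    then obtain z where z: "(\<rho>, z) \<in> adj M ^^ k" "(z, u) \<in> adj M" by auto
    have zF: "(\<rho>, z) \<in> adj F ^^ k" using Suc.IH[OF z(1)] Suc.prems(2) by simp
    have "z \<in> verts M" "u \<in> verts M" using simple_adjD[OF M z(2)] by auto
    moreover have "\<exists>j\<le>r. (\<rho>, z) \<in> adj F ^^ j" "\<exists>j\<le>r. (\<rho>, u) \<in> adj M ^^ j"
      using zF Suc.prems Suc_leD by blast+
    ultimately have "z \<in> verts (graph_ball F \<rho> r)" "u \<in> verts (graph_ball M \<rho> r)"
      unfolding verts_graph_ball V by blast+
    then have "(z, u) \<in> adj F" using agree[of z u] z(2) by (simp add: adj_iff)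
    with zF show ?case by auto
  qed
  have Vb: "verts (graph_ball F \<rho> r) = verts (graph_ball M \<rho> r)"
    unfolding verts_graph_ball V using mono bwd by blast
  have "adj (graph_ball F \<rho> r) = adj (graph_ball M \<rho> r)"
    unfolding adj_graph_ball[OF F] adj_graph_ball[OF M] Vb using E agree by (auto simp: adj_iff Vb)
  then show ?thesis by (intro simple_graph_eqI simple_graph_ball F M Vb)
qed

text \<open>Walks from \<open>v\<close> stay in the component.\<close>

lemma graph_ball_component:
  assumes G: "simple_graph G" and v: "v \<in> verts G"
  shows "graph_ball (component G v) v r = graph_ball G v r"
proof -
  let ?C = "component G v"
  have sC: "simple_graph ?C" unfolding component_def by (rule simple_induced[OF G])
  have adjC: "(a, b) \<in> adj ?C \<longleftrightarrow> (a, b) \<in> adj G \<and> (v, a) \<in> (adj G)\<^sup>* \<and> (v, b) \<in> (adj G)\<^sup>*" for a b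
    unfolding component_def adj_induced by auto
  have rel: "(v, u) \<in> adj ?C ^^ k \<longleftrightarrow> (v, u) \<in> adj G ^^ k" for u k
  proof (induction k arbitrary: u)
    case 0 then show ?case by simp
  next
    case (Suc k)
    show ?case
    proof
      assume "(v, u) \<in> adj ?C ^^ Suc k"
      then obtain z where "(v, z) \<in> adj ?C ^^ k" "(z, u) \<in> adj ?C" by auto
      then show "(v, u) \<in> adj G ^^ Suc k" using Suc adjC by auto
    next
      assume "(v, u) \<in> adj G ^^ Suc k"
      then obtain z where z: "(v, z) \<in> adj G ^^ k" "(z, u) \<in> adj G" by auto
      then have "(v, z) \<in> (adj G)\<^sup>*" by (blast dest: relpow_imp_rtrancl)
      then have "(z, u) \<in> adj ?C" using z(2) adjC by (auto intro: rtrancl_into_rtrancl)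
      then show "(v, u) \<in> adj ?C ^^ Suc k" using Suc z(1) by auto
    qed
  qed
  have Vb: "verts (graph_ball ?C v r) = verts (graph_ball G v r)"
  proof -
    have "u \<in> verts ?C \<longleftrightarrow> u \<in> verts G \<and> (v, u) \<in> (adj G)\<^sup>*" for u by (simp add: component_def induced_def)
    then show ?thesis unfolding verts_graph_ball rel by (auto dest: relpow_imp_rtrancl)
  qed
  have "adj (graph_ball ?C v r) = adj (graph_ball G v r)"
    unfolding adj_graph_ball[OF sC] adj_graph_ball[OF G] Vb adjC
    by (auto simp: verts_graph_ball dest: relpow_imp_rtrancl)
  then show ?thesis by (intro simple_graph_eqI simple_graph_ball sC G Vb)
qed

lemma verts_graph_ball_1:
  assumes "simple_graph G" "v \<in> verts G"
  shows "verts (graph_ball G v 1) = insert v {u. {v, u} \<in> edges G}"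
proof -
  have "(\<exists>k\<le>1. (v, u) \<in> adj G ^^ k) \<longleftrightarrow> u = v \<or> (v, u) \<in> adj G" for u
    by (auto simp: le_Suc_eq)
  then show ?thesis using assms simple_edgeD[OF assms(1)] by (auto simp: verts_graph_ball adj_iff)
qed

section \<open>Counting vertices near a bad vertex\<close>

lemma card_bad_vertices:
  assumes s: "simple_graph M" and fin: "finite D" "D \<subseteq> edges M"
  shows "finite {v. \<exists>y. {v, y} \<in> D}" "card {v. \<exists>y. {v, y} \<in> D} \<le> 2 * card D"
proof -
  have two: "finite e \<and> card e \<le> 2" if eD: "e \<in> D" for e
  proof -
    have "e \<in> edges M" using eD fin(2) by blast
    then obtain u v where "e = {u, v}" by (rule simple_edgeE[OF s])
    then show ?thesis by (simp add: card_insert_if)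
  qed
  have eq: "{v. \<exists>y. {v, y} \<in> D} \<subseteq> \<Union> D" by auto
  have fU: "finite (\<Union> D)" using fin(1) two by blast
  show "finite {v. \<exists>y. {v, y} \<in> D}" by (rule finite_subset[OF eq fU])
  have "card {v. \<exists>y. {v, y} \<in> D} \<le> card (\<Union> D)" by (rule card_mono[OF fU eq])
  also have "\<dots> \<le> sum card D" by (rule card_Union_le_sum_card)
  also have "\<dots> \<le> (\<Sum>e\<in>D. 2)" by (rule sum_mono) (use two in blast)
  finally show "card {v. \<exists>y. {v, y} \<in> D} \<le> 2 * card D" by simp
qed

lemma relpow_sym:
  assumes "sym A" "(x, y) \<in> A ^^ k" shows "(y, x) \<in> A ^^ k"
  using assms(2)
proof (induction k arbitrary: y)
  case 0 then show ?case by simp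
next
  case (Suc k)
  then obtain z where "(x, z) \<in> A ^^ k" "(z, y) \<in> A" by auto
  then have "(y, z) \<in> A" "(z, x) \<in> A ^^ k" using Suc.IH assms(1) by (auto dest: symD)
  then show ?case by (rule relpow_Suc_I2)
qed

text \<open>If \<open>v\<close> is within distance \<open>r\<close> of \<open>\<rho>\<close> and of \<open>\<rho>'\<close>, then \<open>\<rho>'\<close> is within distance \<open>2 * r\<close> of \<open>\<rho>\<close>.
  So at most \<open>N\<close> vertices whose \<open>2 * r\<close>-ball has at most \<open>N\<close> vertices are within distance \<open>r\<close> of \<open>v\<close>.\<close>

lemma card_vertices_near:
  assumes fin: "finite (verts F)"
  shows "card {\<rho> \<in> verts F. card (verts (graph_ball F \<rho> (2 * r))) \<le> N \<and> v \<in> verts (graph_ball F \<rho> r)} \<le> N"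
    (is "card ?X \<le> N")
proof (cases "?X = {}")
  case True then show ?thesis unfolding True by simp
next
  case False
  then obtain \<rho> where \<rho>: "\<rho> \<in> ?X" by blast
  have "?X \<subseteq> verts (graph_ball F \<rho> (2 * r))"
  proof
    fix \<rho>' assume \<rho>': "\<rho>' \<in> ?X"
    obtain k where k: "k \<le> r" "(\<rho>, v) \<in> adj F ^^ k" using \<rho> by (auto simp: verts_graph_ball)
    obtain k' where k': "k' \<le> r" "(\<rho>', v) \<in> adj F ^^ k'" using \<rho>' by (auto simp: verts_graph_ball)
    have "(\<rho>, \<rho>') \<in> adj F ^^ (k + k')"
      unfolding relpow_add using k(2) relpow_sym[OF sym_adj k'(2)] by blast
    moreover have "k + k' \<le> 2 * r" using k k' by simp
    ultimately show "\<rho>' \<in> verts (graph_ball F \<rho> (2 * r))" using \<rho>' by (auto simp: verts_graph_ball)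
  qed
  then have "card ?X \<le> card (verts (graph_ball F \<rho> (2 * r)))"
    by (rule card_mono[rotated]) (rule finite_subset[OF _ fin], auto simp: verts_graph_ball)
  then show ?thesis using \<rho> by simp
qed

text \<open>The balls can differ only if the ball in \<open>F\<close> contains an endpoint of one of the additional edges of \<open>M\<close>, and
  each of these endpoints is seen from at most \<open>N\<close> roots.\<close>

lemma card_balls_agree:
  fixes Z :: "'v graph \<times> 'v \<Rightarrow> bool"
  assumes s: "simple_graph M" and fin: "finite (verts M)" and V: "verts F = verts M" and E: "edges F \<subseteq> edges M"
  shows "card {\<rho> \<in> verts M. card (verts (graph_ball F \<rho> (2 * r))) \<le> N \<and> Z (graph_ball F \<rho> r, \<rho>)}
    \<le> card {\<rho> \<in> verts M. Z (graph_ball M \<rho> r, \<rho>)} + N * (2 * card (edges M - edges F))"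
proof -
  let ?D = "edges M - edges F"
  let ?bad = "{v. \<exists>y. {v, y} \<in> ?D}"
  let ?X = "\<lambda>v. {\<rho> \<in> verts F. card (verts (graph_ball F \<rho> (2 * r))) \<le> N \<and> v \<in> verts (graph_ball F \<rho> r)}"
  let ?L = "{\<rho> \<in> verts M. card (verts (graph_ball F \<rho> (2 * r))) \<le> N \<and> Z (graph_ball F \<rho> r, \<rho>)}"
  let ?R = "{\<rho> \<in> verts M. Z (graph_ball M \<rho> r, \<rho>)}"
  have fD: "finite ?D" using finite_edges[OF s fin] by blast
  have bad: "finite ?bad" "card ?bad \<le> 2 * card ?D" using card_bad_vertices[OF s fD] by auto
  have "?L \<subseteq> ?R \<union> (\<Union>v\<in>?bad. ?X v)"
  proof
    fix \<rho> assume \<rho>: "\<rho> \<in> ?L"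
    show "\<rho> \<in> ?R \<union> (\<Union>v\<in>?bad. ?X v)"
    proof (cases "\<exists>v\<in>?bad. v \<in> verts (graph_ball F \<rho> r)")
      case True then show ?thesis using \<rho> V by blast
    next
      case False
      have "graph_ball F \<rho> r = graph_ball M \<rho> r"
      proof (rule graph_ball_eqI[OF s V E])
        show "\<rho> \<in> verts M" using \<rho> by simp
        show "{a, b} \<in> edges F" if "a \<in> verts (graph_ball F \<rho> r)" "{a, b} \<in> edges M" for a b
          using that False by blast
      qed
      then show ?thesis using \<rho> by simp
    qed
  qed
  then have "card ?L \<le> card (?R \<union> (\<Union>v\<in>?bad. ?X v))"
    by (rule card_mono[rotated]) (use fin V bad in auto)
  also have "\<dots> \<le> card ?R + card (\<Union>v\<in>?bad. ?X v)" by (rule card_Un_le)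
  also have "card (\<Union>v\<in>?bad. ?X v) \<le> (\<Sum>v\<in>?bad. card (?X v))" by (rule card_UN_le[OF bad(1)])
  also have "\<dots> \<le> (\<Sum>v\<in>?bad. N)" by (rule sum_mono) (rule card_vertices_near, use fin V in simp)
  also have "\<dots> = N * card ?bad" by simp
  also have "\<dots> \<le> N * (2 * card ?D)" using bad(2) by simp
  finally show ?thesis by simp
qed

text \<open>The sum of the degrees is twice the number of edges.\<close>

lemma sum_card_unit_balls:
  assumes s: "simple_graph F" and fin: "finite (verts F)"
  shows "(\<Sum>v\<in>verts F. card (verts (graph_ball F v 1))) \<le> card (verts F) + 2 * card (edges F)"
proof -
  have fE: "finite (edges F)" by (rule finite_edges[OF s fin])
  have nb: "card {u. {v, u} \<in> edges F} = card {e \<in> edges F. v \<in> e}" if "v \<in> verts F" for v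
  proof (rule bij_betw_same_card[of "\<lambda>u. {v, u}"])
    show "bij_betw (\<lambda>u. {v, u}) {u. {v, u} \<in> edges F} {e \<in> edges F. v \<in> e}"
      unfolding bij_betw_def
    proof
      show "inj_on (\<lambda>u. {v, u}) {u. {v, u} \<in> edges F}" by (auto simp: inj_on_def doubleton_eq_iff)
      show "(\<lambda>u. {v, u}) ` {u. {v, u} \<in> edges F} = {e \<in> edges F. v \<in> e}"
      proof
        show "{e \<in> edges F. v \<in> e} \<subseteq> (\<lambda>u. {v, u}) ` {u. {v, u} \<in> edges F}"
        proof
          fix e assume e: "e \<in> {e \<in> edges F. v \<in> e}"
          then have eF: "e \<in> edges F" by simp
          obtain a b where ab: "e = {a, b}" by (rule simple_edgeE[OF s eF])
          then obtain u where "e = {v, u}" using e by auto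
          then show "e \<in> (\<lambda>u. {v, u}) ` {u. {v, u} \<in> edges F}" using eF by blast
        qed
      qed auto
    qed
  qed
  have fN: "finite {u. {v, u} \<in> edges F}" for v
    by (rule finite_subset[OF _ fin]) (use simple_edgeD[OF s] in blast)
  have "(\<Sum>v\<in>verts F. card (verts (graph_ball F v 1))) \<le> (\<Sum>v\<in>verts F. 1 + card {e \<in> edges F. v \<in> e})"
  proof (rule sum_mono)
    fix v assume v: "v \<in> verts F"
    have "card (verts (graph_ball F v 1)) \<le> Suc (card {u. {v, u} \<in> edges F})"
      unfolding verts_graph_ball_1[OF s v] by (rule card_insert_le_m1) auto
    then show "card (verts (graph_ball F v 1)) \<le> 1 + card {e \<in> edges F. v \<in> e}" using nb[OF v] by simp
  qed
  also have "\<dots> = card (verts F) + (\<Sum>v\<in>verts F. card {e \<in> edges F. v \<in> e})" by (simp only: sum.distrib) simp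
  also have "(\<Sum>v\<in>verts F. card {e \<in> edges F. v \<in> e}) = (\<Sum>e\<in>edges F. card {v \<in> verts F. v \<in> e})"
    by (rule sum_multicount_gen[OF fin fE]) auto
  also have "\<dots> \<le> (\<Sum>e\<in>edges F. 2)"
  proof (rule sum_mono)
    fix e assume "e \<in> edges F"
    then obtain a b where "e = {a, b}" by (rule simple_edgeE[OF s])
    then have "{v \<in> verts F. v \<in> e} \<subseteq> {a, b}" by auto
    then have "card {v \<in> verts F. v \<in> e} \<le> card {a, b}" by (rule card_mono[rotated]) simp
    also have "\<dots> \<le> 2" by (simp add: card_insert_if)
    finally show "card {v \<in> verts F. v \<in> e} \<le> 2" .
  qed
  finally show ?thesis by simp
qed

section \<open>Events that depend on finitely many comparisons\<close>

text \<open>The function takes finitely many values, one for each set of indices that can be the set of true \<open>P i\<close>.\<close>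

lemma measurable_factor_finite:
  fixes f :: "'q \<Rightarrow> 'b"
  assumes I: "finite I" and P: "\<And>i. i \<in> I \<Longrightarrow> Measurable.pred M (P i)"
    and f: "\<And>\<omega> \<omega>'. (\<And>i. i \<in> I \<Longrightarrow> P i \<omega> \<longleftrightarrow> P i \<omega>') \<Longrightarrow> f \<omega> = f \<omega>'"
  shows "f \<in> measurable M (count_space UNIV)"
proof (rule measurableI)
  fix Y :: "'b set" assume "Y \<in> sets (count_space UNIV)"
  let ?J = "{J \<in> Pow I. \<exists>\<omega>. {i \<in> I. P i \<omega>} = J \<and> f \<omega> \<in> Y}"
  let ?E = "\<lambda>J. {\<omega> \<in> space M. \<forall>i. i \<in> I \<longrightarrow> (P i \<omega> \<longleftrightarrow> i \<in> J)}"
  have "f -` Y \<inter> space M = (\<Union>J\<in>?J. ?E J)"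
  proof (rule set_eqI, rule iffI)
    fix \<omega> assume "\<omega> \<in> f -` Y \<inter> space M"
    then show "\<omega> \<in> (\<Union>J\<in>?J. ?E J)" by (intro UN_I[of "{i \<in> I. P i \<omega>}"]) auto
  next
    fix \<omega> assume "\<omega> \<in> (\<Union>J\<in>?J. ?E J)"
    then obtain J \<omega>' where J: "{i \<in> I. P i \<omega>'} = J" "f \<omega>' \<in> Y" "\<omega> \<in> space M" "\<And>i. i \<in> I \<Longrightarrow> P i \<omega> \<longleftrightarrow> i \<in> J" by blast
    have "f \<omega> = f \<omega>'" by (rule f) (use J in blast)
    then show "\<omega> \<in> f -` Y \<inter> space M" using J by simp
  qed
  moreover have "?E J \<in> sets M" for J
  proof -
    have "?E J = space M \<inter> (\<Inter>i\<in>I. {\<omega> \<in> space M. P i \<omega> \<longleftrightarrow> i \<in> J})" if "I \<noteq> {}" using that by blast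
    moreover have "{\<omega> \<in> space M. P i \<omega> \<longleftrightarrow> i \<in> J} \<in> sets M" if "i \<in> I" for i
      using P[OF that] by (cases "i \<in> J") (auto simp: pred_def sets.sets_Collect_neg)
    ultimately show ?thesis using I by (cases "I = {}") (auto intro!: sets.Int sets.finite_INT)
  qed
  moreover have "finite ?J" using I by simp
  ultimately show "f -` Y \<inter> space M \<in> sets M" by (simp add: sets.finite_UN)
qed auto

lemma below_cong:
  assumes "\<And>e. e \<in> edges G \<Longrightarrow> w e < t \<longleftrightarrow> w' e < t'"
  shows "below G w t = below G w' t'"
  unfolding below_def using assms by auto

lemma good_graph_cong:
  assumes o: "\<And>e f. e \<in> edges G \<Longrightarrow> f \<in> edges G \<Longrightarrow> w e < w f \<longleftrightarrow> w' e < w' f"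
    and l: "\<And>e. e \<in> edges G \<Longrightarrow> w e < l \<longleftrightarrow> w' e < l"
  shows "good_graph K l G w = good_graph K l G w'"
proof -
  have shut: "shut_in G w K z z' \<longleftrightarrow> shut_in G w' K z z'" if "{z, z'} \<in> edges G" for z z'
    unfolding shut_in_def using below_cong[of G w "w {z, z'}" w' "w' {z, z'}"] o[OF _ that] by simp
  have "{e \<in> edges G. w e < l \<and> (\<exists>z z'. e = {z, z'} \<and> shut_in G w K z z')} =
      {e \<in> edges G. w' e < l \<and> (\<exists>z z'. e = {z, z'} \<and> shut_in G w' K z z')}"
    using shut l by blast
  then show ?thesis by (simp add: good_graph_def)
qed

lemma kruskal_scale:
  assumes "c > 0" shows "kruskal G (\<lambda>e. c * w e) = kruskal G w"
proof -
  have "below G (\<lambda>e. c * w e) (c * w e) = below G w (w e)" for e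
    using assms by (intro below_cong) simp
  then show ?thesis by (simp add: kruskal_def)
qed

section \<open>Probabilistic tools\<close>

lemma (in prob_space) integrable_indicator_event: "S \<in> events \<Longrightarrow> integrable M (indicat_real S)"
  by (rule integrable_real_indicator) (simp_all add: emeasure_eq_measure)

lemma (in prob_space) expected_count:
  assumes V: "finite V" and A: "\<And>v. v \<in> V \<Longrightarrow> {\<omega> \<in> space M. A v \<omega>} \<in> events"
  shows "integrable M (\<lambda>\<omega>. real (card {v \<in> V. A v \<omega>}))"
    and "expectation (\<lambda>\<omega>. real (card {v \<in> V. A v \<omega>})) = (\<Sum>v\<in>V. prob {\<omega> \<in> space M. A v \<omega>})"
proof -
  have eq: "real (card {v \<in> V. A v \<omega>}) = (\<Sum>v\<in>V. indicat_real {\<omega> \<in> space M. A v \<omega>} \<omega>)" if "\<omega> \<in> space M" for \<omega>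
    using that V by (simp add: indicator_def sum.If_cases Int_def)
  have int: "integrable M (\<lambda>\<omega>. \<Sum>v\<in>V. indicat_real {\<omega> \<in> space M. A v \<omega>} \<omega>)"
    by (intro Bochner_Integration.integrable_sum integrable_indicator_event A)
  show "integrable M (\<lambda>\<omega>. real (card {v \<in> V. A v \<omega>}))"
    using int by (rule Bochner_Integration.integrable_cong[THEN iffD2, rotated -1]) (simp_all add: eq)
  have "expectation (\<lambda>\<omega>. real (card {v \<in> V. A v \<omega>})) = expectation (\<lambda>\<omega>. \<Sum>v\<in>V. indicat_real {\<omega> \<in> space M. A v \<omega>} \<omega>)"
    by (rule Bochner_Integration.integral_cong) (simp_all add: eq)
  also have "\<dots> = (\<Sum>v\<in>V. expectation (indicat_real {\<omega> \<in> space M. A v \<omega>}))"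
    by (intro Bochner_Integration.integral_sum integrable_indicator_event A)
  also have "\<dots> = (\<Sum>v\<in>V. prob {\<omega> \<in> space M. A v \<omega>})"
    using A by (intro sum.cong) simp_all
  finally show "expectation (\<lambda>\<omega>. real (card {v \<in> V. A v \<omega>})) = (\<Sum>v\<in>V. prob {\<omega> \<in> space M. A v \<omega>})" .
qed

lemma (in prob_space) prob_tendsto_AE:
  assumes A: "\<And>k :: nat. {\<omega> \<in> space M. A k \<omega>} \<in> events" and B: "{\<omega> \<in> space M. B \<omega>} \<in> events"
    and ev: "AE \<omega> in M. \<exists>k0. \<forall>k\<ge>k0. A k \<omega> \<longleftrightarrow> B \<omega>"
  shows "(\<lambda>k. prob {\<omega> \<in> space M. A k \<omega>}) \<longlonglongrightarrow> prob {\<omega> \<in> space M. B \<omega>}"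
proof -
  let ?a = "\<lambda>k. indicat_real {\<omega> \<in> space M. A k \<omega>}" and ?b = "indicat_real {\<omega> \<in> space M. B \<omega>}"
  have "(\<lambda>k. integral\<^sup>L M (?a k)) \<longlonglongrightarrow> integral\<^sup>L M ?b"
  proof (rule integral_dominated_convergence[where w = "\<lambda>_. 1"])
    show "AE \<omega> in M. (\<lambda>k. ?a k \<omega>) \<longlonglongrightarrow> ?b \<omega>"
      using ev
    proof eventually_elim
      case (elim \<omega>)
      then obtain k0 where k0: "\<And>k. k \<ge> k0 \<Longrightarrow> A k \<omega> \<longleftrightarrow> B \<omega>" by blast
      have "\<forall>\<^sub>F k in sequentially. ?a k \<omega> = ?b \<omega>"
        using eventually_ge_at_top[of k0] by eventually_elim (simp add: k0 indicator_def)
      then show ?case by (rule tendsto_eventually)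
    qed
  qed (use A B in \<open>auto simp: indicator_def\<close>)
  then show ?thesis using A B by simp
qed

text \<open>Rounding \<open>f\<close> down to multiples of \<open>\<delta>\<close> gives a step function that is uniformly close to \<open>f\<close>, and for step
  functions the claim is the convergence on finitely many sets.\<close>

lemma setwise_imp_integral_tendsto:
  fixes f :: "'m :: metric_space \<Rightarrow> real"
  assumes \<mu>: "\<And>n. prob_space (\<mu> n)" "\<And>n. sets (\<mu> n) = sets borel" and \<nu>: "prob_space \<nu>" "sets \<nu> = sets borel"
    and conv: "\<And>S. S \<in> sets borel \<Longrightarrow> (\<lambda>n. measure (\<mu> n) S) \<longlonglongrightarrow> measure \<nu> S"
    and f: "f \<in> borel_measurable borel" "\<And>x. \<bar>f x\<bar> \<le> B"
  shows "(\<lambda>n. integral\<^sup>L (\<mu> n) f) \<longlonglongrightarrow> integral\<^sup>L \<nu> f"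
proof (rule LIMSEQ_I)
  fix \<epsilon> :: real assume \<epsilon>: "\<epsilon> > 0"
  define \<delta> where "\<delta> = \<epsilon> / 4"
  have \<delta>: "\<delta> > 0" using \<epsilon> by (simp add: \<delta>_def)
  define m where "m = \<lceil>B / \<delta>\<rceil> + 1"
  define S where "S k = {x. \<lfloor>f x / \<delta>\<rfloor> = k}" for k
  define g where "g x = (\<Sum>k\<in>{-m..m}. of_int k * \<delta> * indicat_real (S k) x)" for x
  have S: "S k \<in> sets borel" for k
  proof -
    have "S k = (\<lambda>x. \<lfloor>f x / \<delta>\<rfloor>) -` {k} \<inter> space borel" by (auto simp: S_def)
    also have "\<dots> \<in> sets borel"
    proof -
      have [measurable]: "f \<in> borel_measurable borel" by (rule f(1))
      have "(\<lambda>x. \<lfloor>f x / \<delta>\<rfloor>) \<in> borel \<rightarrow>\<^sub>M count_space UNIV" by measurable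
      then show ?thesis by (rule measurable_sets) simp
    qed
    finally show ?thesis .
  qed
  have g_eq: "g x = of_int \<lfloor>f x / \<delta>\<rfloor> * \<delta>" for x
  proof -
    let ?k = "\<lfloor>f x / \<delta>\<rfloor>"
    have "f x / \<delta> \<le> B / \<delta>" "- (B / \<delta>) \<le> f x / \<delta>" using f(2)[of x] \<delta> by (auto simp: field_simps abs_le_iff)
    then have "?k \<in> {-m..m}" unfolding m_def by (auto simp: le_floor_iff) linarith+
    then have "g x = (\<Sum>k\<in>{?k}. of_int k * \<delta> * indicat_real (S k) x)"
      unfolding g_def by (intro sum.mono_neutral_right) (auto simp: S_def indicator_def)
    then show ?thesis by (simp add: S_def)
  qed
  have close: "\<bar>f x - g x\<bar> \<le> \<delta>" for x
  proof -
    have "of_int \<lfloor>f x / \<delta>\<rfloor> * \<delta> \<le> f x / \<delta> * \<delta>" by (rule mult_right_mono) (use \<delta> in linarith)+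
    moreover have "f x / \<delta> * \<delta> \<le> (of_int \<lfloor>f x / \<delta>\<rfloor> + 1) * \<delta>" by (rule mult_right_mono) (use \<delta> in linarith)+
    moreover have "f x / \<delta> * \<delta> = f x" using \<delta> by simp
    ultimately have "of_int \<lfloor>f x / \<delta>\<rfloor> * \<delta> \<le> f x" "f x \<le> of_int \<lfloor>f x / \<delta>\<rfloor> * \<delta> + \<delta>"
      by (simp_all add: distrib_right)
    then show ?thesis unfolding g_eq by linarith
  qed
  have ints: "integral\<^sup>L M g = (\<Sum>k\<in>{-m..m}. of_int k * \<delta> * measure M (S k))" "\<bar>integral\<^sup>L M f - integral\<^sup>L M g\<bar> \<le> \<delta>"
    if M: "prob_space M" "sets M = sets borel" for M
  proof -
    interpret prob_space M by (rule M)
    have SM: "S k \<in> events" for k using S M(2) by simp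
    have "integrable M (indicat_real (S k))" for k by (rule integrable_indicator_event[OF SM])
    then have ik: "integrable M (\<lambda>x. of_int k * \<delta> * indicat_real (S k) x)" for k by simp
    have "integral\<^sup>L M g = (\<Sum>k\<in>{-m..m}. integral\<^sup>L M (\<lambda>x. of_int k * \<delta> * indicat_real (S k) x))"
      unfolding g_def by (rule Bochner_Integration.integral_sum) (rule ik)
    also have "\<dots> = (\<Sum>k\<in>{-m..m}. of_int k * \<delta> * measure M (S k))" using SM by simp
    finally show "integral\<^sup>L M g = (\<Sum>k\<in>{-m..m}. of_int k * \<delta> * measure M (S k))" .
    have ig: "integrable M g" unfolding g_def by (rule Bochner_Integration.integrable_sum) (rule ik)
    have fM: "f \<in> borel_measurable M" using f(1) measurable_cong_sets[OF M(2) refl] by blast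
    have if': "integrable M f" by (rule integrable_const_bound[of _ B]) (use f(2) fM in auto)
    have "\<bar>integral\<^sup>L M f - integral\<^sup>L M g\<bar> = \<bar>integral\<^sup>L M (\<lambda>x. f x - g x)\<bar>" using ig if' by simp
    also have "\<dots> \<le> integral\<^sup>L M (\<lambda>x. \<bar>f x - g x\<bar>)" by (rule integral_abs_bound)
    also have "\<dots> \<le> integral\<^sup>L M (\<lambda>x. \<delta>)" by (rule integral_mono) (use ig if' close in auto)
    also have "\<dots> = \<delta>" by (simp add: prob_space)
    finally show "\<bar>integral\<^sup>L M f - integral\<^sup>L M g\<bar> \<le> \<delta>" .
  qed
  have "(\<lambda>n. integral\<^sup>L (\<mu> n) g) \<longlonglongrightarrow> integral\<^sup>L \<nu> g"
    unfolding ints(1)[OF \<mu>] ints(1)[OF \<nu>] by (intro tendsto_intros conv S)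
  then obtain n0 where n0: "\<And>n. n \<ge> n0 \<Longrightarrow> \<bar>integral\<^sup>L (\<mu> n) g - integral\<^sup>L \<nu> g\<bar> < \<delta>"
    using LIMSEQ_D[OF _ \<delta>] by (metis real_norm_def)
  have "norm (integral\<^sup>L (\<mu> n) f - integral\<^sup>L \<nu> f) < \<epsilon>" if "n \<ge> n0" for n
    using n0[OF that] ints(2)[OF \<mu>, of n] ints(2)[OF \<nu>] \<delta> unfolding real_norm_def \<delta>_def by linarith
  then show "\<exists>n0. \<forall>n\<ge>n0. norm (integral\<^sup>L (\<mu> n) f - integral\<^sup>L \<nu> f) < \<epsilon>" by blast
qed

context uniform_weights
begin

text \<open>Two independent uniform variables fall into the same one of \<open>m\<close> intervals of equal length with probability
  \<open>1 / m\<close>.\<close>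

lemma AE_distinct_weights: "AE \<omega> in P. inj_on (\<lambda>e. W e \<omega>) (edges G)"
proof -
  have pair: "AE \<omega> in P. W e \<omega> \<noteq> W f \<omega>" if e: "e \<in> edges G" and f: "f \<in> edges G" and ne: "e \<noteq> f" for e f
  proof -
    have me: "W e \<in> borel_measurable P" "W f \<in> borel_measurable P" using W_measurable e f by auto
    let ?Z = "{\<omega> \<in> space P. W e \<omega> = W f \<omega>}"
    have Z: "?Z \<in> events" using me by measurable
    \<comment> \<open>The half-open intervals of length \<open>1 / m\<close> cover \<open>{0..<1}\<close> only.\<close>
    let ?out = "W e -` (- {0..<1}) \<inter> space P"
    have out_ev: "?out \<in> events" by (rule measurable_sets[OF me(1)]) auto
    have "- {0..<1} \<inter> {0..1} = {1 :: real}" by auto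
    then have out: "prob ?out = 0" using prob_W[OF e, of "- {0..<1}"] by simp
    have bound: "prob ?Z \<le> 1 / real m" if m: "m > 0" for m :: nat
    proof -
      let ?b = "\<lambda>j. {real j / m ..< real (Suc j) / m}"
      let ?E = "\<lambda>j. (W e -` ?b j \<inter> space P) \<inter> (W f -` ?b j \<inter> space P)"
      have E_ev: "?E j \<in> events" for j
        by (intro sets.Int measurable_sets[OF me(1)] measurable_sets[OF me(2)]) auto
      have bl: "prob (W g -` ?b j \<inter> space P) = 1 / m" if "j < m" "g \<in> edges G" for j g
      proof -
        have sub: "?b j \<subseteq> {0..1}"
        proof
          fix x assume x: "x \<in> ?b j"
          have "real (Suc j) / m \<le> 1" using that m by (simp add: field_simps)
          moreover have "0 \<le> real j / m" by simp
          moreover have "real j / m \<le> x" "x < real (Suc j) / m" using x by simp_all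
          ultimately have "0 \<le> x" "x \<le> 1" by linarith+
          then show "x \<in> {0..1}" by simp
        qed
        have "prob (W g -` ?b j \<inter> space P) = measure lborel (?b j \<inter> {0..1})" by (rule prob_W[OF that(2)]) auto
        also have "?b j \<inter> {0..1} = ?b j" using sub by blast
        also have "measure lborel (?b j) = 1 / m" using m by (simp add: divide_right_mono add_divide_distrib)
        finally show ?thesis .
      qed
      have E_pr: "prob (?E j) = 1 / m * (1 / m)" if j: "j < m" for j
      proof -
        have "prob (\<Inter>g\<in>{e, f}. W g -` ?b j \<inter> space P) = (\<Prod>g\<in>{e, f}. prob (W g -` ?b j \<inter> space P))"
          by (rule indep_varsD[OF ind]) (use e f in auto)
        then show ?thesis using bl[OF j] e f ne by (simp add: Int_ac)
      qed
      have "?Z \<subseteq> ?out \<union> (\<Union>j\<in>{..<m}. ?E j)"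
      proof
        fix \<omega> assume \<omega>: "\<omega> \<in> ?Z"
        show "\<omega> \<in> ?out \<union> (\<Union>j\<in>{..<m}. ?E j)"
        proof (cases "W e \<omega> \<in> {0..<1}")
          case False then show ?thesis using \<omega> by auto
        next
          case True
          define j where "j = nat \<lfloor>W e \<omega> * m\<rfloor>"
          have nn: "0 \<le> W e \<omega> * m" using True by simp
          have j: "real j \<le> W e \<omega> * m" "W e \<omega> * m < real j + 1"
            using nn by (auto simp: j_def)
          have "W e \<omega> * real m < 1 * real m" using True m by (intro mult_strict_right_mono) auto
          then have "j < m" using j(1) by linarith
          moreover have "W e \<omega> \<in> ?b j" using j m by (simp add: field_simps)
          ultimately show ?thesis using \<omega> by auto
        qed
      qed
      then have "prob ?Z \<le> prob (?out \<union> (\<Union>j\<in>{..<m}. ?E j))"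
        by (rule finite_measure_mono) (use out_ev E_ev in auto)
      also have "\<dots> \<le> prob ?out + prob (\<Union>j\<in>{..<m}. ?E j)"
        by (rule measure_Un_le) (use out_ev E_ev in auto)
      also have "prob (\<Union>j\<in>{..<m}. ?E j) \<le> (\<Sum>j\<in>{..<m}. prob (?E j))"
        by (rule finite_measure_subadditive_finite) (use E_ev in auto)
      also have "\<dots> = (\<Sum>j\<in>{..<m}. 1 / m * (1 / m))" by (rule sum.cong) (use E_pr in auto)
      also have "\<dots> = 1 / m" using m by simp
      finally show ?thesis using out by simp
    qed
    have "prob ?Z \<le> 0"
    proof (rule field_le_epsilon)
      fix c :: real assume "c > 0"
      then obtain m :: nat where m: "m > 0" "1 / real m < c" using nat_approx_posE by (metis zero_less_Suc inverse_eq_divide)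
      then show "prob ?Z \<le> 0 + c" using bound[OF m(1)] by simp
    qed
    then have "prob ?Z = 0" using measure_nonneg[of P ?Z] by linarith
    then have "?Z \<in> null_sets P" using Z by (simp add: null_sets_def emeasure_eq_measure)
    then show ?thesis by (rule AE_I') auto
  qed
  have "AE \<omega> in P. \<forall>e\<in>edges G. \<forall>f\<in>edges G. e \<noteq> f \<longrightarrow> W e \<omega> \<noteq> W f \<omega>"
  proof (rule AE_finite_allI[OF finite_E], rule AE_finite_allI[OF finite_E])
    fix e f assume "e \<in> edges G" "f \<in> edges G"
    then show "AE \<omega> in P. e \<noteq> f \<longrightarrow> W e \<omega> \<noteq> W f \<omega>" using pair[of e f] by (cases "e = f") auto
  qed
  then show ?thesis by eventually_elim (auto simp: inj_on_def)
qed

text \<open>Which spanning trees are minimal is decided by comparing the finitely many total weights, also where the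
  minimum is not unique.\<close>

lemma mst_measurable: "(\<lambda>\<omega>. mst G (\<lambda>e. W e \<omega>)) \<in> measurable P (count_space UNIV)"
proof -
  let ?ST = "{T. spanning_tree G T}"
  let ?P = "\<lambda>(T, T') \<omega>. sum (\<lambda>e. W e \<omega>) (edges T) \<le> sum (\<lambda>e. W e \<omega>) (edges T')"
  show ?thesis
  proof (rule measurable_factor_finite[where I = "?ST \<times> ?ST" and P = ?P])
    show "finite (?ST \<times> ?ST)" using finite_spanning_trees[OF simp fin] by simp
    fix i assume i: "i \<in> ?ST \<times> ?ST"
    obtain T T' where T: "i = (T, T')" by (cases i)
    have m: "(\<lambda>\<omega>. sum (\<lambda>e. W e \<omega>) (edges U)) \<in> borel_measurable P" if "U \<in> ?ST" for U
      using that by (intro borel_measurable_sum W_measurable) (auto simp: spanning_tree_def)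
    have [measurable]: "(\<lambda>\<omega>. sum (\<lambda>e. W e \<omega>) (edges T)) \<in> borel_measurable P"
      "(\<lambda>\<omega>. sum (\<lambda>e. W e \<omega>) (edges T')) \<in> borel_measurable P" using m i T by auto
    show "Measurable.pred P (?P i)" unfolding T prod.case by measurable
  next
    fix \<omega> \<omega>' assume *: "\<And>i. i \<in> ?ST \<times> ?ST \<Longrightarrow> ?P i \<omega> \<longleftrightarrow> ?P i \<omega>'"
    have "is_mst G (\<lambda>e. W e \<omega>) T \<longleftrightarrow> is_mst G (\<lambda>e. W e \<omega>') T" for T
      using *[of "(T, _)"] unfolding is_mst_def by auto
    then show "mst G (\<lambda>e. W e \<omega>) = mst G (\<lambda>e. W e \<omega>')" by (simp add: mst_def)
  qed
qed

text \<open>The pair \<open>(e, None)\<close> stands for the comparison of \<open>e\<close> with the level \<open>t\<close>.\<close>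

lemma good_graph_measurable: "(\<lambda>\<omega>. good_graph K t G (sw \<omega>)) \<in> measurable P (count_space UNIV)"
proof -
  let ?P = "\<lambda>(e, f) \<omega>. case f of None \<Rightarrow> sw \<omega> e < t | Some g \<Rightarrow> sw \<omega> e < sw \<omega> g"
  show ?thesis
  proof (rule measurable_factor_finite[where I = "edges G \<times> (insert None (Some ` edges G))" and P = ?P])
    show "finite (edges G \<times> insert None (Some ` edges G))" using finite_E by simp
    fix i assume i: "i \<in> edges G \<times> insert None (Some ` edges G)"
    obtain e f where ef: "i = (e, f)" by (cases i)
    have [measurable]: "W e \<in> borel_measurable P" using i ef by (auto intro: W_measurable)
    show "Measurable.pred P (?P i)"
    proof (cases f)
      case None then show ?thesis unfolding ef None prod.case option.case by measurable
    next
      case (Some g)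
      then have [measurable]: "W g \<in> borel_measurable P" using i ef by (auto intro: W_measurable)
      show ?thesis unfolding ef Some prod.case option.case by measurable
    qed
  next
    fix \<omega> \<omega>' assume *: "\<And>i. i \<in> edges G \<times> insert None (Some ` edges G) \<Longrightarrow> ?P i \<omega> \<longleftrightarrow> ?P i \<omega>'"
    show "good_graph K t G (sw \<omega>) = good_graph K t G (sw \<omega>')"
    proof (rule good_graph_cong)
      fix e f assume ef: "e \<in> edges G" "f \<in> edges G"
      then show "sw \<omega> e < sw \<omega> f \<longleftrightarrow> sw \<omega>' e < sw \<omega>' f" using *[of "(e, Some f)"] by simp
    next
      fix e assume "e \<in> edges G"
      then show "sw \<omega> e < t \<longleftrightarrow> sw \<omega>' e < t" using *[of "(e, None)"] by simp
    qed
  qed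
qed

lemma light_degree_measurable:
  "(\<lambda>\<omega>. card {y. {v, y} \<in> edges G \<and> sw \<omega> {v, y} < t}) \<in> measurable P (count_space UNIV)"
proof (rule measurable_factor_finite[OF finite_E, where P = "\<lambda>e \<omega>. sw \<omega> e < t"])
  fix e assume "e \<in> edges G"
  then have [measurable]: "W e \<in> borel_measurable P" by (rule W_measurable)
  show "Measurable.pred P (\<lambda>\<omega>. sw \<omega> e < t)" by measurable
next
  fix \<omega> \<omega>' assume *: "\<And>e. e \<in> edges G \<Longrightarrow> sw \<omega> e < t \<longleftrightarrow> sw \<omega>' e < t"
  have "{y. {v, y} \<in> edges G \<and> sw \<omega> {v, y} < t} = {y. {v, y} \<in> edges G \<and> sw \<omega>' {v, y} < t}" using * by blast
  then show "card {y. {v, y} \<in> edges G \<and> sw \<omega> {v, y} < t} = card {y. {v, y} \<in> edges G \<and> sw \<omega>' {v, y} < t}" by simp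
qed

lemma count_space_event: "f \<in> measurable P (count_space UNIV) \<Longrightarrow> {\<omega> \<in> space P. Z (f \<omega>)} \<in> events"
  using measurable_sets[of f P "count_space UNIV" "{x. Z x}"] by (simp add: vimage_def Int_def conj_commute)

end

section \<open>Events of the Poisson-weighted infinite tree pass to the graphs\<close>

locale mst_limit = pwit Q w
  for Q :: "'q measure" and w :: "nat list \<Rightarrow> nat \<Rightarrow> 'q \<Rightarrow> real" +
  fixes G :: "nat \<Rightarrow> 'v graph" and d :: "nat \<Rightarrow> nat" and P :: "nat \<Rightarrow> 'p measure"
    and W :: "nat \<Rightarrow> 'v set \<Rightarrow> 'p \<Rightarrow> real"
  assumes uw: "\<And>n. uniform_weights (P n) (G n) (W n) (d n)"
    and conn: "\<And>n. graph_connected (G n)"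
    and dlim: "filterlim d at_top sequentially"
begin

abbreviation dw :: "nat \<Rightarrow> 'p \<Rightarrow> 'v set \<Rightarrow> real" where "dw n \<omega> e \<equiv> real (d n) * W n e \<omega>"
abbreviation cwt :: "'q \<Rightarrow> nat list set \<Rightarrow> real" where "cwt \<omega> \<equiv> child_weight (arr \<omega>)"

text \<open>The assumption \<open>transfer\<close> says that codes of depth \<open>R\<close> carry the event \<open>A\<close> over to \<open>\<Psi>\<close>. Up to
  probability \<open>\<epsilon> / 2\<close> the event \<open>A\<close> is a finite union of codes, and at every vertex of \<open>G n\<close> each of them
  is found with asymptotically at least the same probability. The codes exclude each other in \<open>G n\<close>, too,
  so the lower bounds can be added.\<close>

theorem local_lower_bound:
  assumes l: "l > 0" and A: "A \<in> events" and \<epsilon>: "\<epsilon> > 0"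
    and transfer: "\<And>h L \<tau> \<omega> n \<rho> \<omega>' \<phi>. h > 0 \<Longrightarrow> real L * h = l \<Longrightarrow> valid_code L R \<tau> \<Longrightarrow> \<omega> \<in> A \<Longrightarrow>
      weight_array (arr \<omega>) \<Longrightarrow> encodes R h L \<tau> ulam_harris (cwt \<omega>) [] id \<Longrightarrow> \<rho> \<in> verts (G n) \<Longrightarrow>
      encodes R h L \<tau> (G n) (dw n \<omega>') \<rho> \<phi> \<Longrightarrow> \<Psi> n \<rho> \<omega>'"
    and meas: "\<And>n \<rho>. \<rho> \<in> verts (G n) \<Longrightarrow> {\<omega> \<in> space (P n). \<Psi> n \<rho> \<omega>} \<in> sets (P n)"
  shows "\<forall>\<^sub>F n in sequentially. \<forall>\<rho>\<in>verts (G n). prob A - \<epsilon> \<le> measure (P n) {\<omega> \<in> space (P n). \<Psi> n \<rho> \<omega>}"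
proof -
  obtain L h \<T> D where h: "h > 0" and lh: "real L * h = l" and T: "finite \<T>" and D: "D \<in> events" "prob D \<ge> 1 - \<epsilon> / 2"
    and V: "\<And>\<tau>. \<tau> \<in> \<T> \<Longrightarrow> valid_code L R \<tau>"
    and code: "\<And>\<omega>. \<omega> \<in> D \<Longrightarrow> weight_array (arr \<omega>) \<and> pwit_code R h l (arr \<omega>) \<in> \<T>"
    using valid_codes_likely[of "\<epsilon> / 2" l R] \<epsilon> l by auto
  define \<T>A where "\<T>A = {\<tau> \<in> \<T>. \<exists>\<omega>\<in>A \<inter> D. pwit_code R h l (arr \<omega>) = \<tau>}"
  have fA: "finite \<T>A" using T by (simp add: \<T>A_def)
  have VA: "valid_code L R \<tau>" if "\<tau> \<in> \<T>A" for \<tau> using that V by (simp add: \<T>A_def)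
  define q where "q \<tau> = h ^ (card (code_tree \<tau> (Suc R)) - 1) * exp (- (l * card (code_tree \<tau> R)))" for \<tau>
  have upper: "prob A \<le> (\<Sum>\<tau>\<in>\<T>A. q \<tau>) + \<epsilon> / 2"
  proof -
    have "A \<inter> D \<subseteq> (\<Union>\<tau>\<in>\<T>A. code_event R h L \<tau>)"
    proof
      fix \<omega> assume \<omega>: "\<omega> \<in> A \<inter> D"
      then have "\<omega> \<in> space Q" using A sets.sets_into_space by blast
      moreover have "pwit_code R h l (arr \<omega>) \<in> \<T>A" using \<omega> code[of \<omega>] unfolding \<T>A_def by blast
      ultimately show "\<omega> \<in> (\<Union>\<tau>\<in>\<T>A. code_event R h L \<tau>)"
        using in_code_event[OF _ _ h VA, of \<omega> "pwit_code R h l (arr \<omega>)"] code[of \<omega>] \<omega> lh by blast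
    qed
    then have "prob (A \<inter> D) \<le> prob (\<Union>\<tau>\<in>\<T>A. code_event R h L \<tau>)"
      by (rule finite_measure_mono) (use fA code_event_sets in auto)
    also have "\<dots> \<le> (\<Sum>\<tau>\<in>\<T>A. prob (code_event R h L \<tau>))"
      by (rule finite_measure_subadditive_finite[OF fA]) (use code_event_sets in auto)
    also have "\<dots> = (\<Sum>\<tau>\<in>\<T>A. q \<tau>)"
      by (rule sum.cong[OF refl]) (simp only: prob_code_event[OF VA h] q_def lh)
    finally have "prob (A \<inter> D) \<le> (\<Sum>\<tau>\<in>\<T>A. q \<tau>)" .
    moreover have "prob A \<le> prob (A \<inter> D) + prob (space Q - D)"
    proof -
      have "prob A \<le> prob ((A \<inter> D) \<union> (space Q - D))"
        by (rule finite_measure_mono) (use A D sets.sets_into_space in auto)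
      also have "\<dots> \<le> prob (A \<inter> D) + prob (space Q - D)" by (rule measure_Un_le) (use A D in auto)
      finally show ?thesis .
    qed
    moreover have "prob (space Q - D) \<le> \<epsilon> / 2" using prob_compl[OF D(1)] D(2) by simp
    ultimately show ?thesis by simp
  qed
  \<comment> \<open>The loss allowed for each single code.\<close>
  define \<delta> where "\<delta> = \<epsilon> / (2 * (card \<T>A + 1))"
  have \<delta>: "\<delta> > 0" using \<epsilon> by (simp add: \<delta>_def)
  have "\<forall>\<^sub>F n in sequentially. q \<tau> - \<delta> < code_bound (card (code_tree \<tau> (Suc R)) - 1) (card (code_tree \<tau> R)) h l (d n)" for \<tau>
  proof -
    have "(\<lambda>n. code_bound (card (code_tree \<tau> (Suc R)) - 1) (card (code_tree \<tau> R)) h l (d n)) \<longlonglongrightarrow> q \<tau>"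
      unfolding q_def by (rule filterlim_compose[OF code_bound_tendsto dlim])
    then show ?thesis using \<delta> by (intro order_tendstoD(1)) auto
  qed
  then have e1: "\<forall>\<^sub>F n in sequentially. \<forall>\<tau>\<in>\<T>A. q \<tau> - \<delta> < code_bound (card (code_tree \<tau> (Suc R)) - 1) (card (code_tree \<tau> R)) h l (d n)"
    using fA by (simp add: eventually_ball_finite_distrib)
  have e2: "\<forall>\<^sub>F n in sequentially. nat \<lceil>l\<rceil> + 1 \<le> d n" using dlim by (simp add: filterlim_at_top)
  show ?thesis using e1 e2
  proof eventually_elim
    case (elim n)
    have dn: "l \<le> d n" "d n > 0" using elim(2) by linarith+
    interpret U: uniform_weights "P n" "G n" "W n" "d n" by (rule uw)
    show ?case
    proof
      fix \<rho> assume \<rho>: "\<rho> \<in> verts (G n)"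
      let ?e = "\<lambda>\<tau>. {\<omega> \<in> space (P n). \<exists>\<phi>. encodes R h L \<tau> (G n) (dw n \<omega>) \<rho> \<phi>}"
      have dn': "real L * h \<le> d n" using dn lh by simp
      have ev: "?e \<tau> \<in> sets (P n)" if "\<tau> \<in> \<T>A" for \<tau>
        using U.prob_encodes(1)[OF VA[OF that] h \<rho> dn' dn(2)] .
      have pr: "code_bound (card (code_tree \<tau> (Suc R)) - 1) (card (code_tree \<tau> R)) h l (d n) \<le> measure (P n) (?e \<tau>)" if "\<tau> \<in> \<T>A" for \<tau>
        using U.prob_encodes(2)[OF VA[OF that] h \<rho> dn' dn(2)] unfolding lh .
      have dj: "disjoint_family_on ?e \<T>A"
        unfolding disjoint_family_on_def
      proof (intro ballI impI equals0I)
        fix \<tau> \<tau>' \<omega> assume t: "\<tau> \<in> \<T>A" "\<tau>' \<in> \<T>A" "\<tau> \<noteq> \<tau>'" "\<omega> \<in> ?e \<tau> \<inter> ?e \<tau>'"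
        then obtain \<phi> \<phi>' where e: "encodes R h L \<tau> (G n) (dw n \<omega>) \<rho> \<phi>" "encodes R h L \<tau>' (G n) (dw n \<omega>) \<rho> \<phi>'" by blast
        show False using encodes_unique[OF VA[OF t(1)] VA[OF t(2)] h e] t(3) by simp
      qed
      have sub: "(\<Union>\<tau>\<in>\<T>A. ?e \<tau>) \<subseteq> {\<omega> \<in> space (P n). \<Psi> n \<rho> \<omega>}"
      proof
        fix \<omega>' assume "\<omega>' \<in> (\<Union>\<tau>\<in>\<T>A. ?e \<tau>)"
        then obtain \<tau> \<phi> where t: "\<tau> \<in> \<T>A" "\<omega>' \<in> space (P n)" "encodes R h L \<tau> (G n) (dw n \<omega>') \<rho> \<phi>" by blast
        then obtain \<omega> where \<omega>: "\<omega> \<in> A" "\<omega> \<in> D" "pwit_code R h l (arr \<omega>) = \<tau>" by (auto simp: \<T>A_def)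
        have wa: "weight_array (arr \<omega>)" using code[OF \<omega>(2)] by simp
        have "encodes R h L \<tau> ulam_harris (cwt \<omega>) [] id"
          using encodes_pwit_code[OF wa h lh[symmetric], of R] unfolding \<omega>(3) .
        then show "\<omega>' \<in> {\<omega> \<in> space (P n). \<Psi> n \<rho> \<omega>}"
          using transfer[OF h lh VA[OF t(1)] \<omega>(1) wa _ \<rho> t(3)] t(2) by simp
      qed
      have "prob A - \<epsilon> \<le> (\<Sum>\<tau>\<in>\<T>A. q \<tau>) - card \<T>A * \<delta>"
      proof -
        have "card \<T>A * \<delta> \<le> \<epsilon> / 2" using \<epsilon> by (simp add: \<delta>_def field_simps)
        then show ?thesis using upper by linarith
      qed
      also have "\<dots> = (\<Sum>\<tau>\<in>\<T>A. q \<tau> - \<delta>)" by (simp add: sum_subtractf)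
      also have "\<dots> \<le> (\<Sum>\<tau>\<in>\<T>A. measure (P n) (?e \<tau>))"
        by (rule sum_mono) (use pr elim(1) in \<open>force intro: order_trans less_imp_le\<close>)
      also have "\<dots> = measure (P n) (\<Union>\<tau>\<in>\<T>A. ?e \<tau>)"
        by (rule U.finite_measure_finite_Union[symmetric, OF fA _ dj]) (use ev in auto)
      also have "\<dots> \<le> measure (P n) {\<omega> \<in> space (P n). \<Psi> n \<rho> \<omega>}"
        by (rule U.finite_measure_mono[OF sub meas[OF \<rho>]])
      finally show "prob A - \<epsilon> \<le> measure (P n) {\<omega> \<in> space (P n). \<Psi> n \<rho> \<omega>}" .
    qed
  qed
qed

lemma good_ball_transfer:
  assumes h: "h > 0" "real L * h = l" and V: "valid_code L R \<tau>" and R: "r + K + 2 \<le> R"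
    and E: "encodes R h L \<tau> ulam_harris (cwt \<omega>) [] id" and E': "encodes R h L \<tau> (G n) (dw n \<omega>') \<rho> \<phi>"
  shows "rooted_iso (rooted_ball (good_graph K l ulam_harris (cwt \<omega>), []) r)
    (rooted_ball (good_graph K l (G n) (dw n \<omega>'), \<rho>) r)"
proof -
  interpret U: uniform_weights "P n" "G n" "W n" "d n" by (rule uw)
  let ?C = "rooted_ball (good_graph K (real L) (code_graph \<tau> R) (code_bin \<tau>), []) r"
  have "rooted_iso ?C (rooted_ball (good_graph K l ulam_harris (cwt \<omega>), []) r)"
    using encodes_good_ball_iso[OF V E h(1) simple_uh R] unfolding h(2) .
  moreover have "rooted_iso ?C (rooted_ball (good_graph K l (G n) (dw n \<omega>'), \<rho>) r)"
    using encodes_good_ball_iso[OF V E' h(1) U.simp R] unfolding h(2) .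
  moreover have "snd ?C \<in> verts (fst ?C)" by (rule root_in_ball) simp
  ultimately show ?thesis using rooted_iso_sym rooted_iso_trans by blast
qed

lemma rooted_iso_card:
  assumes "rooted_iso X Y" shows "card (verts (fst X)) = card (verts (fst Y))"
  using assms bij_betw_same_card unfolding rooted_iso_def rooted_iso_by_def by blast

lemma simple_good_uh: "simple_graph (good_graph K l ulam_harris x)"
  by (rule simple_subgraph[OF simple_uh]) (auto simp: good_graph_def)

lemma simple_good_G: "simple_graph (good_graph K l (G n) x)"
proof -
  interpret U: uniform_weights "P n" "G n" "W n" "d n" by (rule uw)
  show ?thesis by (rule simple_subgraph[OF U.simp]) (auto simp: good_graph_def)
qed

lemma locally_finite_good:
  assumes "weight_array (arr \<omega>)" shows "locally_finite (good_graph K l ulam_harris (cwt \<omega>))"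
  unfolding locally_finite_def
proof
  fix v assume "v \<in> verts (good_graph K l ulam_harris (cwt \<omega>))"
  have "{u. (v, u) \<in> adj (good_graph K l ulam_harris (cwt \<omega>))} \<subseteq> \<Union> {e \<in> edges ulam_harris. e \<inter> {v} \<noteq> {} \<and> cwt \<omega> e \<le> l}"
    by (auto simp: good_graph_def adj_iff)
  moreover have "finite (\<Union> {e \<in> edges ulam_harris. e \<inter> {v} \<noteq> {} \<and> cwt \<omega> e \<le> l})"
    using finite_incident_light[OF assms, of "{v}" l] by (auto simp: edge_uh_iff)
  ultimately show "finite {u. (v, u) \<in> adj (good_graph K l ulam_harris (cwt \<omega>))}" by (rule finite_subset)
qed

lemma finite_good_uh_ball_1:
  assumes "weight_array (arr \<omega>)"
  shows "finite {u. {[], u} \<in> edges (good_graph K l ulam_harris (cwt \<omega>))}"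
  using locally_finite_good[OF assms, of K l] by (simp add: locally_finite_def adj_iff)

lemma measurable_good: "measurable_graph Q (\<lambda>\<omega>. good_graph K l ulam_harris (cwt \<omega>))"
  by (rule measurable_good_graph[OF w_measurable])

lemma measurable_forest: "measurable_graph Q (\<lambda>\<omega>. wmsf ulam_harris (cwt \<omega>))"
  by (rule measurable_wmsf[OF w_measurable])

section \<open>Local finiteness of the wired minimal spanning forest\<close>

text \<open>Since a minimal spanning tree has at most as many edges as vertices, the mean number of vertices in a
  unit ball is at most 3. By Markov's inequality the unit ball at the root of the infinite tree cannot
  be larger than \<open>N\<close> with probability more than \<open>3 / N\<close>.\<close>

lemma good_root_ball_bound:
  fixes N :: nat
  assumes N: "N > 0" and A_ev: "A \<in> events" and l: "l > 0" and \<epsilon>: "\<epsilon> > 0"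
    and big: "\<And>\<omega>. \<omega> \<in> A \<Longrightarrow> \<not> card (verts (graph_ball (good_graph K l ulam_harris (cwt \<omega>)) [] 1)) \<le> N"
  shows "prob A \<le> 3 / N + \<epsilon>"
proof -
  let ?\<Psi> = "\<lambda>n \<rho> \<omega>'. \<not> card (verts (graph_ball (good_graph K l (G n) (dw n \<omega>')) \<rho> 1)) \<le> N"
  have "\<forall>\<^sub>F n in sequentially. \<forall>\<rho>\<in>verts (G n). prob A - \<epsilon> \<le> measure (P n) {\<omega> \<in> space (P n). ?\<Psi> n \<rho> \<omega>}"
  proof (rule local_lower_bound[OF l A_ev \<epsilon>, of "1 + K + 2"])
    fix h L \<tau> \<omega> n \<rho> \<omega>' \<phi>
    assume h: "h > 0" "real L * h = l" "valid_code L (1 + K + 2) \<tau>" and \<omega>: "\<omega> \<in> A"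
      and E: "encodes (1 + K + 2) h L \<tau> ulam_harris (cwt \<omega>) [] id" "encodes (1 + K + 2) h L \<tau> (G n) (dw n \<omega>') \<rho> \<phi>"
    have "rooted_iso (rooted_ball (good_graph K l ulam_harris (cwt \<omega>), []) 1)
      (rooted_ball (good_graph K l (G n) (dw n \<omega>'), \<rho>) 1)"
      by (rule good_ball_transfer[OF h _ E]) simp
    from rooted_iso_card[OF this] show "?\<Psi> n \<rho> \<omega>'" using big[OF \<omega>] by (simp add: rooted_ball_def)
  next
    fix n \<rho>
    interpret U: uniform_weights "P n" "G n" "W n" "d n" by (rule uw)
    show "{\<omega> \<in> space (P n). ?\<Psi> n \<rho> \<omega>} \<in> sets (P n)"
      by (rule U.count_space_event[OF U.good_graph_measurable])
  qed
  moreover have "\<forall>\<^sub>F n in sequentially. 1 \<le> d n" using dlim by (simp add: filterlim_at_top)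
  ultimately obtain n where n: "\<And>\<rho>. \<rho> \<in> verts (G n) \<Longrightarrow> prob A - \<epsilon> \<le> measure (P n) {\<omega> \<in> space (P n). ?\<Psi> n \<rho> \<omega>}" and dn: "1 \<le> d n"
    using eventually_happens'[OF sequentially_bot eventually_conj] by blast
  interpret U: uniform_weights "P n" "G n" "W n" "d n" by (rule uw)
  let ?V = "verts (G n)"
  have V: "?V \<noteq> {}" using conn[of n] by (auto simp: graph_connected_def)
  have ev: "{\<omega> \<in> space (P n). ?\<Psi> n \<rho> \<omega>} \<in> sets (P n)" for \<rho>
    by (rule U.count_space_event[OF U.good_graph_measurable])
  have "card ?V * (prob A - \<epsilon>) \<le> (\<Sum>\<rho>\<in>?V. measure (P n) {\<omega> \<in> space (P n). ?\<Psi> n \<rho> \<omega>})"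
    using sum_bounded_below[of ?V "prob A - \<epsilon>" "\<lambda>\<rho>. measure (P n) {\<omega> \<in> space (P n). ?\<Psi> n \<rho> \<omega>}"] n by simp
  also have "\<dots> = U.expectation (\<lambda>\<omega>. real (card {\<rho> \<in> ?V. ?\<Psi> n \<rho> \<omega>}))"
    by (rule U.expected_count(2)[symmetric, OF U.fin ev])
  also have "\<dots> \<le> U.expectation (\<lambda>\<omega>. 3 * card ?V / N)"
  proof (rule integral_mono_AE[OF U.expected_count(1)[OF U.fin ev]])
    show "AE \<omega> in P n. real (card {\<rho> \<in> ?V. ?\<Psi> n \<rho> \<omega>}) \<le> 3 * card ?V / N"
      using U.AE_distinct_weights
    proof eventually_elim
      case (elim \<omega>)
      let ?F = "good_graph K l (G n) (dw n \<omega>)"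
      have inj: "inj_on (dw n \<omega>) (edges (G n))" using elim dn by (auto simp: inj_on_def)
      have sF: "simple_graph ?F" by (rule simple_good_G)
      have "card (edges ?F) \<le> card (edges (kruskal (G n) (dw n \<omega>)))"
        using U.finite_E kruskal_subset[of "G n"] finite_subset by (intro card_mono good_subset_kruskal) blast
      also have "\<dots> \<le> card ?V" by (rule card_kruskal_le[OF U.simp U.fin inj])
      finally have E: "card (edges ?F) \<le> card ?V" .
      have "N * card {\<rho> \<in> ?V. ?\<Psi> n \<rho> \<omega>} \<le> (\<Sum>\<rho>\<in>{\<rho> \<in> ?V. ?\<Psi> n \<rho> \<omega>}. card (verts (graph_ball ?F \<rho> 1)))"
        using sum_bounded_below[of "{\<rho> \<in> ?V. ?\<Psi> n \<rho> \<omega>}" N "\<lambda>\<rho>. card (verts (graph_ball ?F \<rho> 1))"] by (simp add: mult.commute)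
      also have "\<dots> \<le> (\<Sum>\<rho>\<in>?V. card (verts (graph_ball ?F \<rho> 1)))" by (rule sum_mono2) (use U.fin in auto)
      also have "\<dots> \<le> card ?V + 2 * card (edges ?F)" using sum_card_unit_balls[OF sF] U.fin by simp
      also have "\<dots> \<le> 3 * card ?V" using E by simp
      finally have "real (N * card {\<rho> \<in> ?V. ?\<Psi> n \<rho> \<omega>}) \<le> real (3 * card ?V)" by (simp only: of_nat_le_iff)
      then show ?case using N by (simp add: field_simps)
    qed
  qed simp
  also have "\<dots> = 3 * card ?V / N" by (simp add: U.prob_space)
  finally have "card ?V * (prob A - \<epsilon>) \<le> card ?V * (3 / N)" by (simp add: mult.commute)
  moreover have "real (card ?V) > 0" using V U.fin by (simp add: card_gt_0_iff)
  ultimately have "prob A - \<epsilon> \<le> 3 / N" by (simp only: mult_le_cancel_left_pos)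
  then show ?thesis by simp
qed

text \<open>If the root had infinitely many neighbours in the forest, then for every \<open>N\<close> the unit balls at the root in
  \<open>good_graph K\<close> would have more than \<open>N\<close> vertices for all large \<open>K\<close>; this has probability at most \<open>3 / N\<close>.
  The level \<open>K + 1\<close> is any choice that tends to infinity with \<open>K\<close>.\<close>

lemma AE_finite_root_degree: "AE \<omega> in Q. finite {u. {[], u} \<in> edges (wmsf ulam_harris (cwt \<omega>))}"
proof -
  let ?deg = "\<lambda>\<omega>. {u. {[], u} \<in> edges (wmsf ulam_harris (cwt \<omega>))}"
  let ?ball = "\<lambda>K \<omega>. verts (graph_ball (good_graph K (real K + 1) ulam_harris (cwt \<omega>)) [] 1)"
  obtain X0 where X0: "X0 \<in> null_sets Q" "{\<omega> \<in> space Q. \<not> weight_array (arr \<omega>)} \<subseteq> X0"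
    using AE_weight_array by (auto simp: eventually_ae_filter)
  have fin_ball: "finite (?ball K \<omega>)" if "weight_array (arr \<omega>)" for K \<omega>
    using verts_graph_ball_1[OF simple_good_uh, of "[]" K "real K + 1" "cwt \<omega>"] finite_good_uh_ball_1[OF that] by simp
  have degm: "Measurable.pred Q (\<lambda>\<omega>. u \<in> ?deg \<omega>)" for u
    using measurable_forest by (simp add: measurable_graph_def adj_iff)
  have Zev: "{\<omega> \<in> space Q. \<not> finite (?deg \<omega>)} \<in> events"
    using pred_finite_set(1)[of ?deg Q, OF degm] by (simp add: pred_def sets.sets_Collect_neg)
  have ballm: "Measurable.pred Q (\<lambda>\<omega>. finite (?ball K \<omega>) \<and> card (?ball K \<omega>) \<le> N)" for K N
    using measurable_graph_ball[OF measurable_good] by (intro pred_finite_set(2)) (simp add: measurable_graph_def)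
  define A where "A N K \<omega> \<longleftrightarrow> \<not> (finite (?ball K \<omega>) \<and> card (?ball K \<omega>) \<le> N) \<and> \<not> finite (?deg \<omega>)" for N K \<omega>
  have Aev: "{\<omega> \<in> space Q. A N K \<omega>} \<in> events" for N K
  proof -
    have "{\<omega> \<in> space Q. A N K \<omega>} = {\<omega> \<in> space Q. \<not> (finite (?ball K \<omega>) \<and> card (?ball K \<omega>) \<le> N)} \<inter> {\<omega> \<in> space Q. \<not> finite (?deg \<omega>)}"
      by (auto simp: A_def)
    then show ?thesis using sets.Int[OF predE[OF pred_intros_logic(2)[OF ballm[of K N]]] Zev] by simp
  qed
  have lim: "(\<lambda>K. prob {\<omega> \<in> space Q. A N K \<omega>}) \<longlonglongrightarrow> prob {\<omega> \<in> space Q. \<not> finite (?deg \<omega>)}" for N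
  proof (rule prob_tendsto_AE[OF Aev Zev])
    show "AE \<omega> in Q. \<exists>k0. \<forall>k\<ge>k0. A N k \<omega> \<longleftrightarrow> \<not> finite (?deg \<omega>)"
      using AE_weight_array
    proof eventually_elim
      case (elim \<omega>)
      show ?case
      proof (cases "finite (?deg \<omega>)")
        case True then show ?thesis by (simp add: A_def)
      next
        case False
        then obtain B where B: "finite B" "card B = Suc N" "B \<subseteq> ?deg \<omega>" using infinite_arbitrarily_large by blast
        have "\<exists>K0. \<forall>K\<ge>K0. {[], u} \<in> edges (good_graph K (real K + 1) ulam_harris (cwt \<omega>))" if "u \<in> B" for u
        proof -
          have "{[], u} \<in> edges (wmsf ulam_harris (cwt \<omega>))" using that B by blast
          then obtain K0 where K0: "\<And>K l. K0 \<le> K \<Longrightarrow> cwt \<omega> {[], u} < l \<Longrightarrow> {[], u} \<in> edges (good_graph K l ulam_harris (cwt \<omega>))"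
            using wmsf_eventually_good[OF elim] by blast
          have "{[], u} \<in> edges (good_graph K (real K + 1) ulam_harris (cwt \<omega>))" if "max K0 (nat \<lceil>cwt \<omega> {[], u}\<rceil>) \<le> K" for K
            by (rule K0) (use that in linarith)+
          then show ?thesis by blast
        qed
        then obtain K0 where K0: "\<And>u K. u \<in> B \<Longrightarrow> K \<ge> K0 u \<Longrightarrow> {[], u} \<in> edges (good_graph K (real K + 1) ulam_harris (cwt \<omega>))"
          by metis
        have "A N K \<omega>" if K: "K \<ge> Max (K0 ` B)" for K
        proof -
          have "K0 u \<le> K" if "u \<in> B" for u
            using Max_ge[of "K0 ` B" "K0 u"] B(1) that K by (meson finite_imageI image_eqI order_trans)
          then have "B \<subseteq> ?ball K \<omega>"
            using K0 verts_graph_ball_1[OF simple_good_uh, of "[]" K "real K + 1" "cwt \<omega>"] by auto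
          then have "card B \<le> card (?ball K \<omega>)" by (rule card_mono[OF fin_ball[OF elim]])
          then show ?thesis using B False by (simp add: A_def)
        qed
        then show ?thesis using False by blast
      qed
    qed
  qed
  have bound: "prob {\<omega> \<in> space Q. \<not> finite (?deg \<omega>)} \<le> 3 / N" if N: "N > 0" for N :: nat
  proof (rule LIMSEQ_le_const2[OF lim[of N]], intro exI[of _ 0] allI impI)
    fix K
    let ?B = "{\<omega> \<in> space Q. \<not> (finite (?ball K \<omega>) \<and> card (?ball K \<omega>) \<le> N)}"
    have Bev: "?B \<in> events" by (rule predE[OF pred_intros_logic(2)[OF ballm]])
    \<comment> \<open>Removing a null set that contains all irregular weights makes the assumption on \<open>big\<close> hold everywhere.\<close>
    define A'' where "A'' = ?B - X0"
    have A''ev: "A'' \<in> events" using Bev X0(1) by (auto simp: A''_def null_sets_def)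
    have A''wa: "weight_array (arr \<omega>) \<and> \<not> card (?ball K \<omega>) \<le> N \<and> \<omega> \<in> space Q" if "\<omega> \<in> A''" for \<omega>
      using that X0(2) fin_ball[of \<omega> K] by (auto simp: A''_def)
    have "prob A'' \<le> 3 / N"
    proof (rule field_le_epsilon)
      fix \<epsilon> :: real assume \<epsilon>: "\<epsilon> > 0"
      show "prob A'' \<le> 3 / N + \<epsilon>" by (rule good_root_ball_bound[OF N A''ev _ \<epsilon>, of "real K + 1" K]) (use A''wa in auto)
    qed
    moreover have "prob {\<omega> \<in> space Q. A N K \<omega>} \<le> prob (A'' \<union> X0)"
    proof (rule finite_measure_mono)
      show "{\<omega> \<in> space Q. A N K \<omega>} \<subseteq> A'' \<union> X0" unfolding A''_def A_def by blast
      show "A'' \<union> X0 \<in> events" using A''ev null_setsD2[OF X0(1)] by (rule sets.Un)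
    qed
    moreover have "prob (A'' \<union> X0) \<le> prob A'' + prob X0"
      by (rule measure_Un_le) (use A''ev X0(1) in \<open>auto simp: null_sets_def\<close>)
    moreover have "prob X0 = 0" using X0(1) by (rule measure_eq_0_null_sets)
    ultimately show "prob {\<omega> \<in> space Q. A N K \<omega>} \<le> 3 / N" by simp
  qed
  have "prob {\<omega> \<in> space Q. \<not> finite (?deg \<omega>)} \<le> 0"
  proof (rule field_le_epsilon)
    fix c :: real assume "c > 0"
    then obtain m :: nat where m: "real m > 3 / c" using reals_Archimedean2 by blast
    then have "m > 0" using \<open>c > 0\<close> by (cases m) auto
    then have "3 / m \<le> c" using m \<open>c > 0\<close> by (simp add: field_simps)
    then show "prob {\<omega> \<in> space Q. \<not> finite (?deg \<omega>)} \<le> 0 + c" using bound[OF \<open>m > 0\<close>] by simp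
  qed
  then have "prob {\<omega> \<in> space Q. \<not> finite (?deg \<omega>)} = 0" by (rule antisym[OF _ measure_nonneg])
  then show ?thesis by (subst AE_iff_measurable[OF Zev]) (auto simp: emeasure_eq_measure)
qed

end

context pwit
begin

text \<open>Prefixing \<open>v\<close> is injective, so the independence of the weights at different vertices is inherited. This
  transports almost sure properties of the root to all vertices.\<close>

lemma pwit_descendants:
  assumes v: "set v \<subseteq> {1..}" shows "pwit Q (\<lambda>u. w (v @ u))"
proof
  fix u :: "nat list" assume "set u \<subseteq> {1..}"
  then show "unit_poisson_points Q (w (v @ u))" using v by (intro poisson) simp
next
  let ?V = "{u :: nat list. set u \<subseteq> {1..}}"
  let ?M = "\<lambda>_. PiM {1..} (\<lambda>_. borel) :: (nat \<Rightarrow> real) measure"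
  let ?X = "\<lambda>u \<omega>. \<lambda>i\<in>{1..}. w u i \<omega>"
  have rv: "\<And>u. u \<in> ?V \<Longrightarrow> random_variable (?M u) (?X u)"
    and ind_X: "indep_sets (\<lambda>u. {?X u -` A \<inter> space Q | A. A \<in> sets (?M u)}) ?V"
    using ind unfolding indep_vars_def2 by auto
  have sub: "v @ u \<in> ?V" if "u \<in> ?V" for u using that v by simp
  show "indep_vars (\<lambda>_. PiM {1..} (\<lambda>_. borel)) (\<lambda>u \<omega>. \<lambda>i\<in>{1..}. w (v @ u) i \<omega>) ?V"
    unfolding indep_vars_def2
  proof (intro conjI ballI)
    fix u assume "u \<in> ?V"
    then show "random_variable (?M u) (?X (v @ u))" using rv[OF sub] by blast
  next
    show "indep_sets (\<lambda>u. {?X (v @ u) -` A \<inter> space Q | A. A \<in> sets (?M u)}) ?V"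
    proof (rule indep_setsI)
      fix u assume "u \<in> ?V"
      then show "{?X (v @ u) -` A \<inter> space Q | A. A \<in> sets (?M u)} \<subseteq> events"
        using measurable_sets[OF rv[OF sub]] by blast
    next
      fix A J assume J: "J \<noteq> {}" "J \<subseteq> ?V" "finite J"
        and A: "\<forall>j\<in>J. A j \<in> {?X (v @ j) -` A \<inter> space Q | A. A \<in> sets (?M j)}"
      define A' where "A' x = A (drop (length v) x)" for x
      have A': "A' (v @ j) = A j" for j by (simp add: A'_def)
      have "prob (\<Inter>x\<in>(@) v ` J. A' x) = (\<Prod>x\<in>(@) v ` J. prob (A' x))"
      proof (rule indep_setsD[OF ind_X])
        show "(@) v ` J \<subseteq> ?V" using J(2) sub by blast
        show "\<forall>x\<in>(@) v ` J. A' x \<in> {?X x -` A \<inter> space Q | A. A \<in> sets (?M x)}"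
          unfolding Set.ball_simps(9) A' by (rule A)
      qed (use J in auto)
      then show "prob (\<Inter>j\<in>J. A j) = (\<Prod>j\<in>J. prob (A j))"
        by (simp add: A' prod.reindex inj_on_def)
    qed
  qed
qed

end

lemma weight_array_descendants:
  "weight_array x \<Longrightarrow> set v \<subseteq> {1..} \<Longrightarrow> weight_array (\<lambda>u. x (v @ u))"
  unfolding weight_array_def by simp

text \<open>A side of an edge that is finite in the whole tree is finite in the subtree, so a forest
  edge from \<open>v\<close> to a child is also an edge of the forest of the subtree at \<open>v\<close>.\<close>

lemma wmsf_descendants:
  assumes x: "weight_array x" and v: "set v \<subseteq> {1..}"
    and e: "{v, v @ [i]} \<in> edges (wmsf ulam_harris (child_weight x))"
  shows "{[], [i]} \<in> edges (wmsf ulam_harris (child_weight (\<lambda>u. x (v @ u))))"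
proof -
  let ?x' = "\<lambda>u. x (v @ u)"
  have x': "weight_array ?x'" by (rule weight_array_descendants[OF x v])
  have wt0: "child_weight ?x' {[], [i]} = x v i" using child_weight_edge[of ?x' "[]" i] by simp
  let ?A = "adj (below ulam_harris (child_weight x) (x v i))"
  let ?A' = "adj (below ulam_harris (child_weight ?x') (x v i))"
  obtain z where i: "1 \<le> i" and z: "z \<in> {v, v @ [i]}" "finite (?A\<^sup>* `` {z})"
    using e edge_uh_snoc[of v i] unfolding wmsf_edge_iff[OF x] child_weight_edge by blast
  then obtain z' where z': "z' \<in> {[], [i]}" "z = v @ z'" by auto
  have step: "(v @ a, v @ b) \<in> ?A" if "(a, b) \<in> ?A'" for a b
  proof -
    have ab: "{a, b} \<in> edges ulam_harris" "child_weight ?x' {a, b} < x v i" using that by (auto simp: adj_below_iff)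
    have ab': "tree_step a b" "set a \<subseteq> {1..}" "set b \<subseteq> {1..}" using ab(1) unfolding uh_pair_iff by auto
    then consider j where "b = a @ [j]" | j where "a = b @ [j]" unfolding tree_step_def by blast
    then have "tree_step (v @ a) (v @ b) \<and> child_weight x {v @ a, v @ b} = child_weight ?x' {a, b}"
    proof cases
      case (1 j)
      have "child_weight x {v @ a, (v @ a) @ [j]} = x (v @ a) j" by (rule child_weight_edge)
      moreover have "child_weight ?x' {a, a @ [j]} = x (v @ a) j" by (rule child_weight_edge)
      ultimately show ?thesis unfolding 1 tree_step_def by simp
    next
      case (2 j)
      have "child_weight x {(v @ b) @ [j], v @ b} = x (v @ b) j" by (rule child_weight_edge')
      moreover have "child_weight ?x' {b @ [j], b} = x (v @ b) j" by (rule child_weight_edge')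
      ultimately show ?thesis unfolding 2 tree_step_def by simp
    qed
    then show ?thesis using ab ab' v by (simp add: adj_below_iff uh_pair_iff)
  qed
  have "(v @ z', v @ y) \<in> ?A\<^sup>*" if "(z', y) \<in> ?A'\<^sup>*" for y
    using that by induction (auto intro: rtrancl_into_rtrancl step)
  then have "(@) v ` (?A'\<^sup>* `` {z'}) \<subseteq> ?A\<^sup>* `` {z}" unfolding z'(2) by auto
  then have "finite ((@) v ` (?A'\<^sup>* `` {z'}))" using z(2) finite_subset by blast
  then have "finite (?A'\<^sup>* `` {z'})" by (rule finite_imageD) (simp add: inj_on_def)
  moreover have "{[], [i]} \<in> edges ulam_harris" using edge_uh_snoc[of "[]" i] i by simp
  ultimately show ?thesis unfolding wmsf_edge_iff[OF x'] wt0 using z'(1) by blast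
qed

lemma lf_rooted_component:
  assumes G: "simple_graph G" and v: "v \<in> verts G" and l: "\<And>u. u \<in> verts G \<Longrightarrow> finite {u'. {u, u'} \<in> edges G}"
  shows "lf_rooted (component G v, v)"
proof -
  let ?C = "component G v"
  have sC: "simple_graph ?C" unfolding component_def by (rule simple_induced[OF G])
  have adjC: "(a, b) \<in> adj ?C \<longleftrightarrow> (a, b) \<in> adj G \<and> (v, a) \<in> (adj G)\<^sup>* \<and> (v, b) \<in> (adj G)\<^sup>*" for a b
    unfolding component_def adj_induced by auto
  have VC: "u \<in> verts ?C \<longleftrightarrow> u \<in> verts G \<and> (v, u) \<in> (adj G)\<^sup>*" for u by (simp add: component_def induced_def)
  have from_v: "(v, u) \<in> (adj ?C)\<^sup>*" if "(v, u) \<in> (adj G)\<^sup>*" for u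
    using that
  proof induction
    case base then show ?case by simp
  next
    case (step y z)
    then have "(y, z) \<in> adj ?C" unfolding adjC by (auto intro: rtrancl_into_rtrancl)
    with step.IH show ?case by (rule rtrancl_into_rtrancl)
  qed
  have "graph_connected ?C"
    unfolding graph_connected_def
  proof (intro conjI ballI)
    show "verts ?C \<noteq> {}" using VC[of v] v by auto
    fix a b assume "a \<in> verts ?C" "b \<in> verts ?C"
    then have "(v, a) \<in> (adj ?C)\<^sup>*" "(v, b) \<in> (adj ?C)\<^sup>*" using VC from_v by auto
    moreover have "(a, v) \<in> (adj ?C)\<^sup>*" using calculation(1) sym_rtrancl[OF sym_adj] by (meson symD)
    ultimately show "(a, b) \<in> (adj ?C)\<^sup>*" by simp
  qed
  moreover have "locally_finite ?C"
    unfolding locally_finite_def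
  proof
    fix u assume "u \<in> verts ?C"
    then have "finite {u'. {u, u'} \<in> edges G}" using VC l by auto
    then show "finite {u'. (u, u') \<in> adj ?C}" by (rule rev_finite_subset) (use adjC adj_iff[of u _ G] in blast)
  qed
  ultimately show ?thesis using sC VC[of v] v by (simp add: lf_rooted_def)
qed

context mst_limit
begin

text \<open>A vertex has at most one neighbour that is not a child, and the edges to its children are edges at the root of
  the forest on its descendants.\<close>

lemma AE_finite_degrees:
  "AE \<omega> in Q. \<forall>v\<in>{v. set v \<subseteq> {1..}}. finite {u. {v, u} \<in> edges (wmsf ulam_harris (cwt \<omega>))}"
proof (subst AE_ball_countable)
  show "countable {v :: nat list. set v \<subseteq> {1..}}" by auto
  show "\<forall>v\<in>{v. set v \<subseteq> {1..}}. AE \<omega> in Q. finite {u. {v, u} \<in> edges (wmsf ulam_harris (cwt \<omega>))}"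
  proof
    fix v :: "nat list" assume "v \<in> {v. set v \<subseteq> {1..}}"
    then have v: "set v \<subseteq> {1..}" by simp
    interpret D: pwit Q "\<lambda>u. w (v @ u)" by (rule pwit_descendants[OF v])
    interpret D: mst_limit Q "\<lambda>u. w (v @ u)" G d P W 
      by (intro mst_limit.intro mst_limit_axioms.intro) (rule pwit_descendants[OF v] uw conn dlim)+
    show "AE \<omega> in Q. finite {u. {v, u} \<in> edges (wmsf ulam_harris (cwt \<omega>))}"
      using D.AE_finite_root_degree AE_weight_array
    proof eventually_elim
      case (elim \<omega>)
      let ?N = "{u. {[], u} \<in> edges (wmsf ulam_harris (D.cwt \<omega>))}"
      have "{u. {v, u} \<in> edges (wmsf ulam_harris (cwt \<omega>))} \<subseteq> insert (butlast v) ((@) v ` ?N)"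
      proof
        fix u assume u: "u \<in> {u. {v, u} \<in> edges (wmsf ulam_harris (cwt \<omega>))}"
        then have "{v, u} \<in> edges ulam_harris" using edges_wmsf_subset by blast
        then consider i where "u = v @ [i]" | i where "v = u @ [i]" unfolding uh_pair_iff tree_step_def by blast
        then show "u \<in> insert (butlast v) ((@) v ` ?N)"
        proof cases
          case (1 i)
          then have "{[], [i]} \<in> edges (wmsf ulam_harris (D.cwt \<omega>))" using wmsf_descendants[OF elim(2) v, of i] u by simp
          then show ?thesis using 1 by blast
        qed simp
      qed
      then show ?case using elim(1) by (meson finite_imageI finite_insert finite_subset)
    qed
  qed
qed

lemma AE_lf_component: "AE \<omega> in Q. lf_rooted (component (wmsf ulam_harris (cwt \<omega>)) [], [])"
  using AE_finite_degrees
proof eventually_elim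
  case (elim \<omega>)
  show ?case by (rule lf_rooted_component[OF simple_wmsf]) (use elim verts_wmsf in auto)
qed

section \<open>The local limit of the minimal spanning trees\<close>

abbreviation forest :: "'q \<Rightarrow> nat list graph" where "forest \<omega> \<equiv> wmsf ulam_harris (cwt \<omega>)"
abbreviation good :: "nat \<Rightarrow> real \<Rightarrow> 'q \<Rightarrow> nat list graph" where "good K l \<omega> \<equiv> good_graph K l ulam_harris (cwt \<omega>)"
abbreviation goodG :: "nat \<Rightarrow> real \<Rightarrow> nat \<Rightarrow> 'p \<Rightarrow> 'v graph" where "goodG K l n \<omega> \<equiv> good_graph K l (G n) (dw n \<omega>)"
abbreviation tree :: "nat \<Rightarrow> 'p \<Rightarrow> 'v graph" where "tree n \<omega> \<equiv> mst (G n) (\<lambda>e. W n e \<omega>)"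

text \<open>The ball in the forest has finitely many edges, and each of them is kept eventually.\<close>

lemma forest_balls_eventually_good:
  assumes x: "weight_array (arr \<omega>)" and lf: "\<And>v. set v \<subseteq> {1..} \<Longrightarrow> finite {u. {v, u} \<in> edges (forest \<omega>)}"
    and lv: "\<And>K. real K \<le> lv K"
  shows "\<exists>K0. \<forall>K\<ge>K0. graph_ball (good K (lv K) \<omega>) [] r = graph_ball (forest \<omega>) [] r"
    and "finite (verts (graph_ball (forest \<omega>) [] r))"
proof -
  let ?B = "verts (graph_ball (forest \<omega>) [] r)"
  have "lf_rooted (component (forest \<omega>) [], [])"
    by (rule lf_rooted_component[OF simple_wmsf]) (use lf verts_wmsf in auto)
  from finite_graph_ball[OF this, of r] show fB: "finite ?B"
    using graph_ball_component[OF simple_wmsf, of "[]"] verts_wmsf by auto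
  let ?E = "{e \<in> edges (forest \<omega>). e \<subseteq> ?B}"
  have fE: "finite ?E" by (rule finite_subset[of _ "Pow ?B"]) (use fB in auto)
  have "\<exists>K0. \<forall>K\<ge>K0. e \<in> edges (good K (lv K) \<omega>)" if e: "e \<in> ?E" for e
  proof -
    obtain K0 where K0: "\<And>K l. K0 \<le> K \<Longrightarrow> cwt \<omega> e < l \<Longrightarrow> e \<in> edges (good K l \<omega>)"
      using wmsf_eventually_good[OF x, of e] e by blast
    have "e \<in> edges (good K (lv K) \<omega>)" if K: "max K0 (nat \<lceil>cwt \<omega> e\<rceil> + 1) \<le> K" for K
    proof (rule K0)
      show "K0 \<le> K" using K by simp
      have "cwt \<omega> e < real K" using K by linarith
      then show "cwt \<omega> e < lv K" using lv[of K] by linarith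
    qed
    then show ?thesis by blast
  qed
  then have "\<forall>e\<in>?E. \<exists>K0. \<forall>K\<ge>K0. e \<in> edges (good K (lv K) \<omega>)" by blast
  from bchoice[OF this] obtain K0 where "\<forall>e\<in>?E. \<forall>K\<ge>K0 e. e \<in> edges (good K (lv K) \<omega>)" by (elim exE)
  then have K0: "\<And>e K. e \<in> ?E \<Longrightarrow> K0 e \<le> K \<Longrightarrow> e \<in> edges (good K (lv K) \<omega>)" by blast
  have "graph_ball (good K (lv K) \<omega>) [] r = graph_ball (forest \<omega>) [] r" if K: "Max (insert 0 (K0 ` ?E)) \<le> K" for K
  proof (rule graph_ball_eqI[OF simple_wmsf])
    show "verts (good K (lv K) \<omega>) = verts (forest \<omega>)" by (simp add: verts_wmsf)
    show sub: "edges (good K (lv K) \<omega>) \<subseteq> edges (forest \<omega>)" by (rule good_subset_wmsf[OF x])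
    show "[] \<in> verts (forest \<omega>)" by (simp add: verts_wmsf)
    fix a b assume ab: "a \<in> verts (graph_ball (good K (lv K) \<omega>) [] r)" "b \<in> ?B" "{a, b} \<in> edges (forest \<omega>)"
    have "adj (good K (lv K) \<omega>) \<subseteq> adj (forest \<omega>)" using sub by (auto simp: adj_def)
    then have "adj (good K (lv K) \<omega>) ^^ k \<subseteq> adj (forest \<omega>) ^^ k" for k by (induction k) auto
    then have "a \<in> ?B" using ab(1) by (auto simp: verts_graph_ball verts_wmsf)
    then have e: "{a, b} \<in> ?E" using ab by simp
    then have "K0 {a, b} \<le> Max (insert 0 (K0 ` ?E))" using fE by (intro Max_ge) auto
    then have "K0 {a, b} \<le> K" using K by linarith
    then show "{a, b} \<in> edges (good K (lv K) \<omega>)" by (rule K0[OF e])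
  qed
  then show "\<exists>K0. \<forall>K\<ge>K0. graph_ball (good K (lv K) \<omega>) [] r = graph_ball (forest \<omega>) [] r" by blast
qed

lemma class_event:
  fixes X :: "'q \<Rightarrow> nat list graph"
  assumes "measurable_graph Q X" "\<And>\<omega>. simple_graph (X \<omega>)" "S \<in> sets borel"
  shows "{\<omega> \<in> space Q. rooted_class (graph_ball (X \<omega>) [] r, []) \<in> S} \<in> events"
  using measurable_sets[OF rooted_class_measurable[OF measurable_graph_ball[OF assms(1)] simple_graph_ball[OF assms(2)]] assms(3), of "[]" r]
  by (simp add: vimage_def Int_def conj_commute)

lemma ball_size_event:
  fixes X :: "'q \<Rightarrow> nat list graph"
  assumes "measurable_graph Q X"
  shows "{\<omega> \<in> space Q. finite (verts (graph_ball (X \<omega>) [] r)) \<and> card (verts (graph_ball (X \<omega>) [] r)) \<le> N} \<in> events"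
proof -
  have "Measurable.pred Q (\<lambda>\<omega>. finite (verts (graph_ball (X \<omega>) [] r)) \<and> card (verts (graph_ball (X \<omega>) [] r)) \<le> N)"
    using measurable_graph_ball[OF assms] by (intro pred_finite_set(2)) (simp add: measurable_graph_def)
  then show ?thesis by (simp add: pred_def)
qed

text \<open>In the limit tree the root has fewer than \<open>K\<close> children below \<open>l\<close> only if the child \<open>K + 1\<close> is not below
  \<open>l\<close>, which is unlikely for large \<open>l\<close>. The root degree is read off a code of depth 0.\<close>

lemma light_degree_lower_bound:
  assumes K: "1 - \<delta> \<le> prob {\<omega> \<in> space Q. w [] (Suc K) \<omega> < l}" and l: "l > 0" and \<epsilon>: "\<epsilon> > 0"
  shows "\<forall>\<^sub>F n in sequentially. \<forall>\<rho>\<in>verts (G n).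
    measure (P n) {\<omega> \<in> space (P n). card {y. {\<rho>, y} \<in> edges (G n) \<and> dw n \<omega> {\<rho>, y} < l} < K} \<le> \<delta> + \<epsilon>"
proof -
  let ?A = "{\<omega> \<in> space Q. w [] (Suc K) \<omega> < l}"
  let ?\<Psi> = "\<lambda>n \<rho> \<omega>. \<not> card {y. {\<rho>, y} \<in> edges (G n) \<and> dw n \<omega> {\<rho>, y} < l} < K"
  have Aev: "?A \<in> events"
  proof -
    have [measurable]: "w [] (Suc K) \<in> borel_measurable Q" by (rule w_measurable) auto
    show ?thesis by measurable
  qed
  have ev: "{\<omega> \<in> space (P n). Z (card {y. {\<rho>, y} \<in> edges (G n) \<and> dw n \<omega> {\<rho>, y} < l})} \<in> sets (P n)" for n \<rho> Z
  proof -
    interpret U: uniform_weights "P n" "G n" "W n" "d n" by (rule uw)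
    show ?thesis by (rule U.count_space_event[OF U.light_degree_measurable])
  qed
  have "\<forall>\<^sub>F n in sequentially. \<forall>\<rho>\<in>verts (G n). prob ?A - \<epsilon> \<le> measure (P n) {\<omega> \<in> space (P n). ?\<Psi> n \<rho> \<omega>}"
  proof (rule local_lower_bound[OF l Aev \<epsilon>, of 0])
    fix h L \<tau> \<omega> n \<rho> \<omega>' \<phi>
    assume h: "h > 0" "real L * h = l" and V: "valid_code L 0 \<tau>" and \<omega>: "\<omega> \<in> ?A" and wa: "weight_array (arr \<omega>)"
      and E: "encodes 0 h L \<tau> ulam_harris (cwt \<omega>) [] id" and E': "encodes 0 h L \<tau> (G n) (dw n \<omega>') \<rho> \<phi>"
    let ?Y = "{y. {[], y} \<in> edges ulam_harris \<and> cwt \<omega> {[], y} < l}"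
    have "(\<lambda>i. [i]) ` {1..K} \<subseteq> ?Y"
    proof
      fix y assume "y \<in> (\<lambda>i. [i]) ` {1..K}"
      then obtain i where i: "y = [i]" "1 \<le> i" "i \<le> K" by auto
      have "arr \<omega> [] i < arr \<omega> [] (Suc K)" by (rule weight_array_mono[OF wa]) (use i in auto)
      then have "cwt \<omega> {[], [] @ [i]} < l" using \<omega> unfolding child_weight_edge by simp
      then show "y \<in> ?Y" using i edge_uh_snoc[of "[]" i] by simp
    qed
    moreover have "finite ?Y"
    proof (rule finite_subset)
      show "?Y \<subseteq> \<Union> {e \<in> edges ulam_harris. e \<inter> {[]} \<noteq> {} \<and> cwt \<omega> e \<le> l}" by auto
      show "finite (\<Union> {e \<in> edges ulam_harris. e \<inter> {[]} \<noteq> {} \<and> cwt \<omega> e \<le> l})"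
        using finite_incident_light[OF wa, of "{[]}" l] by (auto simp: edge_uh_iff)
    qed
    ultimately have "card ((\<lambda>i. [i]) ` {1..K}) \<le> card ?Y" by (rule card_mono[rotated])
    then have "K \<le> card ?Y" by (simp add: card_image inj_on_def)
    then show "?\<Psi> n \<rho> \<omega>'"
      using encodes_root_degree[OF V E h(1)] encodes_root_degree[OF V E' h(1)] unfolding h(2) by simp
  qed (rule ev)
  then show ?thesis
  proof eventually_elim
    case (elim n)
    interpret U: uniform_weights "P n" "G n" "W n" "d n" by (rule uw)
    show ?case
    proof
      fix \<rho> assume "\<rho> \<in> verts (G n)"
      then have "1 - \<delta> - \<epsilon> \<le> measure (P n) {\<omega> \<in> space (P n). ?\<Psi> n \<rho> \<omega>}" using elim K by fastforce
      moreover have "{\<omega> \<in> space (P n). \<not> ?\<Psi> n \<rho> \<omega>} = space (P n) - {\<omega> \<in> space (P n). ?\<Psi> n \<rho> \<omega>}" by blast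
      ultimately have "measure (P n) {\<omega> \<in> space (P n). \<not> ?\<Psi> n \<rho> \<omega>} \<le> \<delta> + \<epsilon>"
        using U.prob_compl[OF ev[of n "\<lambda>k. \<not> k < K" \<rho>]] by simp
      then show "measure (P n) {\<omega> \<in> space (P n). card {y. {\<rho>, y} \<in> edges (G n) \<and> dw n \<omega> {\<rho>, y} < l} < K} \<le> \<delta> + \<epsilon>" by simp
    qed
  qed
qed

text \<open>The ball of radius \<open>2 * r\<close> occurs because its size is what bounds the effect of the additional edges of the
  minimal spanning tree on balls of radius \<open>r\<close>.\<close>

lemma good_ball_lower_bound:
  assumes l: "l > 0" and S: "S \<in> sets borel" and \<epsilon>: "\<epsilon> > 0"
  shows "\<forall>\<^sub>F n in sequentially. \<forall>\<rho>\<in>verts (G n).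
    prob {\<omega> \<in> space Q. (finite (verts (graph_ball (good K l \<omega>) [] (2 * r))) \<and> card (verts (graph_ball (good K l \<omega>) [] (2 * r))) \<le> N) \<and>
      rooted_class (graph_ball (good K l \<omega>) [] r, []) \<in> S} - \<epsilon>
    \<le> measure (P n) {\<omega> \<in> space (P n). card (verts (graph_ball (goodG K l n \<omega>) \<rho> (2 * r))) \<le> N \<and>
      rooted_class (graph_ball (goodG K l n \<omega>) \<rho> r, \<rho>) \<in> S}"
proof -
  let ?A = "{\<omega> \<in> space Q. (finite (verts (graph_ball (good K l \<omega>) [] (2 * r))) \<and> card (verts (graph_ball (good K l \<omega>) [] (2 * r))) \<le> N) \<and>
      rooted_class (graph_ball (good K l \<omega>) [] r, []) \<in> S}"
  have Aev: "?A \<in> events"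
    using sets.Int[OF ball_size_event[OF measurable_good, of K l "2 * r" N] class_event[OF measurable_good simple_good_uh S, of K l r]]
    by (rule back_subst[of "\<lambda>X. X \<in> events"]) blast
  show ?thesis
  proof (rule local_lower_bound[OF l Aev \<epsilon>, of "2 * r + K + 2"])
    fix h L \<tau> \<omega> n \<rho> \<omega>' \<phi>
    assume h: "h > 0" "real L * h = l" "valid_code L (2 * r + K + 2) \<tau>" and \<omega>: "\<omega> \<in> ?A" and wa: "weight_array (arr \<omega>)"
      and E: "encodes (2 * r + K + 2) h L \<tau> ulam_harris (cwt \<omega>) [] id"
        "encodes (2 * r + K + 2) h L \<tau> (G n) (dw n \<omega>') \<rho> \<phi>" and \<rho>: "\<rho> \<in> verts (G n)"
    interpret U: uniform_weights "P n" "G n" "W n" "d n" by (rule uw)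
    have i2: "rooted_iso (rooted_ball (good K l \<omega>, []) (2 * r)) (rooted_ball (goodG K l n \<omega>', \<rho>) (2 * r))"
      by (rule good_ball_transfer[OF h _ E]) simp
    have i1: "rooted_iso (rooted_ball (good K l \<omega>, []) r) (rooted_ball (goodG K l n \<omega>', \<rho>) r)"
      by (rule good_ball_transfer[OF h _ E]) simp
    have lf1: "lf_rooted (rooted_ball (good K l \<omega>, []) r)"
      by (rule lf_rooted_ball) (use simple_good_uh locally_finite_good[OF wa] in auto)
    have "locally_finite (goodG K l n \<omega>')"
      unfolding locally_finite_def
      by (intro ballI finite_subset[OF _ U.fin]) (use simple_adjD[OF simple_good_G] in fastforce)
    then have lf2: "lf_rooted (rooted_ball (goodG K l n \<omega>', \<rho>) r)"
      by (intro lf_rooted_ball) (use simple_good_G \<rho> in auto)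
    have "rooted_class (rooted_ball (good K l \<omega>, []) r) = rooted_class (rooted_ball (goodG K l n \<omega>', \<rho>) r)"
      using rooted_class_eq_iff[OF lf1 lf2] i1 by simp
    then show "card (verts (graph_ball (goodG K l n \<omega>') \<rho> (2 * r))) \<le> N \<and>
      rooted_class (graph_ball (goodG K l n \<omega>') \<rho> r, \<rho>) \<in> S"
      using \<omega> rooted_iso_card[OF i2] by (simp add: rooted_ball_def)
  next
    fix n \<rho>
    interpret U: uniform_weights "P n" "G n" "W n" "d n" by (rule uw)
    show "{\<omega> \<in> space (P n). card (verts (graph_ball (goodG K l n \<omega>) \<rho> (2 * r))) \<le> N \<and>
      rooted_class (graph_ball (goodG K l n \<omega>) \<rho> r, \<rho>) \<in> S} \<in> sets (P n)"
      by (rule U.count_space_event[OF U.good_graph_measurable])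
  qed
qed

text \<open>How large the level has to be in terms of \<open>K\<close> for vertices with fewer than \<open>K\<close> light edges to be rare.\<close>

lemma exists_level: "\<exists>l. real K + 1 \<le> l \<and> 1 - 1 / (real K + 1) \<le> prob {\<omega> \<in> space Q. w [] (Suc K) \<omega> < l}"
proof -
  have [measurable]: "w [] (Suc K) \<in> borel_measurable Q" by (rule w_measurable) auto
  have "(\<lambda>m. prob {\<omega> \<in> space Q. w [] (Suc K) \<omega> < real m}) \<longlonglongrightarrow> prob {\<omega> \<in> space Q. True}"
  proof (rule prob_tendsto_AE)
    show "AE \<omega> in Q. \<exists>k0. \<forall>k\<ge>k0. w [] (Suc K) \<omega> < real k \<longleftrightarrow> True"
    proof (rule AE_I2)
      fix \<omega>
      obtain k0 :: nat where "w [] (Suc K) \<omega> < real k0" using reals_Archimedean2 by blast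
      then show "\<exists>k0. \<forall>k\<ge>k0. w [] (Suc K) \<omega> < real k \<longleftrightarrow> True"
        by (intro exI[of _ k0]) (auto intro: less_le_trans)
    qed
  qed measurable
  then have "(\<lambda>m. prob {\<omega> \<in> space Q. w [] (Suc K) \<omega> < real m}) \<longlonglongrightarrow> 1" by (simp add: prob_space)
  then have "\<forall>\<^sub>F m in sequentially. 1 - 1 / (real K + 1) < prob {\<omega> \<in> space Q. w [] (Suc K) \<omega> < real m}"
    by (rule order_tendstoD) simp
  moreover have "\<forall>\<^sub>F m in sequentially. K + 1 \<le> m" by (rule eventually_ge_at_top)
  ultimately have "\<forall>\<^sub>F m in sequentially. 1 - 1 / (real K + 1) < prob {\<omega> \<in> space Q. w [] (Suc K) \<omega> < real m} \<and> K + 1 \<le> m"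
    by (rule eventually_conj)
  then obtain m where "1 - 1 / (real K + 1) < prob {\<omega> \<in> space Q. w [] (Suc K) \<omega> < real m}" "K + 1 \<le> m"
    unfolding eventually_sequentially by blast
  then show ?thesis by (intro exI[of _ "real m"]) auto
qed

text \<open>Compared with the edges kept by \<open>good_graph\<close>, the minimal spanning tree has few additional edges,
  and these are visible only from few vertices.\<close>

lemma tree_ball_count:
  assumes dn: "1 \<le> d n" and inj: "inj_on (\<lambda>e. W n e \<omega>) (edges (G n))"
  shows "real (card {\<rho> \<in> verts (G n). card (verts (graph_ball (goodG K l n \<omega>) \<rho> (2 * r))) \<le> N \<and> Z (graph_ball (goodG K l n \<omega>) \<rho> r, \<rho>)})
    \<le> real (card {\<rho> \<in> verts (G n). Z (graph_ball (tree n \<omega>) \<rho> r, \<rho>)}) +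
      2 * real N * (card (verts (G n)) / (real K + 1) +
        real (card {\<rho> \<in> verts (G n). card {y. {\<rho>, y} \<in> edges (G n) \<and> dw n \<omega> {\<rho>, y} < l} < K}))"
proof -
  interpret U: uniform_weights "P n" "G n" "W n" "d n" by (rule uw)
  have inj': "inj_on (dw n \<omega>) (edges (G n))" using inj dn by (auto simp: inj_on_def)
  let ?M = "kruskal (G n) (dw n \<omega>)" and ?F = "goodG K l n \<omega>"
  let ?low = "{\<rho> \<in> verts (G n). card {y. {\<rho>, y} \<in> edges (G n) \<and> dw n \<omega> {\<rho>, y} < l} < K}"
  have tree: "tree n \<omega> = ?M"
    using mst_eq_kruskal[OF U.simp U.fin conn inj] kruskal_scale[of "real (d n)" "G n" "\<lambda>e. W n e \<omega>"] dn by simp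
  have sM: "simple_graph ?M" by (rule simple_subgraph[OF U.simp]) (simp_all add: kruskal_subset)
  let ?D = "edges ?M - edges ?F"
  have "card {\<rho> \<in> verts ?M. card (verts (graph_ball ?F \<rho> (2 * r))) \<le> N \<and> Z (graph_ball ?F \<rho> r, \<rho>)}
    \<le> card {\<rho> \<in> verts ?M. Z (graph_ball ?M \<rho> r, \<rho>)} + N * (2 * card ?D)"
    by (rule card_balls_agree[OF sM]) (use U.fin subsetD[OF good_subset_kruskal] in auto)
  then have "real (card {\<rho> \<in> verts (G n). card (verts (graph_ball ?F \<rho> (2 * r))) \<le> N \<and> Z (graph_ball ?F \<rho> r, \<rho>)})
    \<le> real (card {\<rho> \<in> verts (G n). Z (graph_ball ?M \<rho> r, \<rho>)} + N * (2 * card ?D))"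
    by (simp only: of_nat_le_iff verts_kruskal)
  also have "\<dots> = real (card {\<rho> \<in> verts (G n). Z (graph_ball ?M \<rho> r, \<rho>)}) + 2 * real N * real (card ?D)" by simp
  also have "real (card ?D) \<le> card (verts (G n)) / (real K + 1) + real (card ?low)"
  proof -
    have "Suc K * card ?D \<le> card (verts (G n)) + Suc K * card ?low"
      by (rule kruskal_minus_good_card[OF U.simp U.fin inj'])
    then have "real (Suc K * card ?D) \<le> real (card (verts (G n)) + Suc K * card ?low)" by (simp only: of_nat_le_iff)
    then show ?thesis by (simp add: field_simps)
  qed
  finally show ?thesis unfolding tree by (simp add: mult_left_mono)
qed

text \<open>First \<open>N\<close> is chosen such that balls of radius \<open>2 * r\<close> in the forest have more than \<open>N\<close> vertices with
  small probability, then \<open>K\<close> such that \<open>good_graph K\<close> agrees with the forest on these balls with high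
  probability and \<open>N / K\<close> is small, and \<open>n\<close> is large in terms of both. Taking the mean of \<open>tree_ball_count\<close>
  gives the bound.\<close>

theorem tree_ball_lower_bound:
  assumes S: "S \<in> sets borel" and \<epsilon>: "\<epsilon> > 0"
  shows "\<forall>\<^sub>F n in sequentially. prob {\<omega> \<in> space Q. rooted_class (graph_ball (forest \<omega>) [] r, []) \<in> S} - \<epsilon>
    \<le> (\<Sum>\<rho>\<in>verts (G n). measure (P n) {\<omega> \<in> space (P n). rooted_class (graph_ball (tree n \<omega>) \<rho> r, \<rho>) \<in> S}) / card (verts (G n))"
proof -
  obtain lv where lv: "\<And>K. real K + 1 \<le> lv K" "\<And>K. 1 - 1 / (real K + 1) \<le> prob {\<omega> \<in> space Q. w [] (Suc K) \<omega> < lv K}"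
    using exists_level by metis
  have lv': "real K \<le> lv K" "0 < lv K" for K using lv(1)[of K] by linarith+
  let ?sz = "\<lambda>X N. finite (verts (graph_ball X [] (2 * r))) \<and> card (verts (graph_ball X [] (2 * r))) \<le> N"
  let ?cl = "\<lambda>X. rooted_class (graph_ball X [] r, []) \<in> S"
  have m: "{\<omega> \<in> space Q. ?sz (X \<omega>) N \<and> ?cl (X \<omega>)} \<in> events"
    if "measurable_graph Q X" "\<And>\<omega>. simple_graph (X \<omega>)" for X :: "'q \<Rightarrow> nat list graph" and N
    using sets.Int[OF ball_size_event[OF that(1), of "2 * r" N] class_event[OF that S, of r]]
    by (rule back_subst[of "\<lambda>X. X \<in> events"]) blast
  have lim1: "(\<lambda>K. prob {\<omega> \<in> space Q. ?sz (good K (lv K) \<omega>) N \<and> ?cl (good K (lv K) \<omega>)})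
      \<longlonglongrightarrow> prob {\<omega> \<in> space Q. ?sz (forest \<omega>) N \<and> ?cl (forest \<omega>)}" for N
  proof (rule prob_tendsto_AE)
    show "AE \<omega> in Q. \<exists>k0. \<forall>k\<ge>k0. (?sz (good k (lv k) \<omega>) N \<and> ?cl (good k (lv k) \<omega>)) \<longleftrightarrow> (?sz (forest \<omega>) N \<and> ?cl (forest \<omega>))"
      using AE_weight_array AE_finite_degrees
    proof eventually_elim
      case (elim \<omega>)
      have lf: "finite {u. {v, u} \<in> edges (forest \<omega>)}" if "set v \<subseteq> {1..}" for v using elim(2) that by blast
      obtain K1 where K1: "\<And>K. K \<ge> K1 \<Longrightarrow> graph_ball (good K (lv K) \<omega>) [] r = graph_ball (forest \<omega>) [] r"
        using forest_balls_eventually_good(1)[OF elim(1) lf lv'(1), of r] by blast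
      obtain K2 where K2: "\<And>K. K \<ge> K2 \<Longrightarrow> graph_ball (good K (lv K) \<omega>) [] (2 * r) = graph_ball (forest \<omega>) [] (2 * r)"
        using forest_balls_eventually_good(1)[OF elim(1) lf lv'(1), of "2 * r"] by blast
      show ?case by (intro exI[of _ "max K1 K2"]) (simp add: K1 K2)
    qed
  qed (rule m measurable_good measurable_forest simple_good_uh simple_wmsf)+
  have lim2: "(\<lambda>N. prob {\<omega> \<in> space Q. ?sz (forest \<omega>) N \<and> ?cl (forest \<omega>)}) \<longlonglongrightarrow> prob {\<omega> \<in> space Q. ?cl (forest \<omega>)}"
  proof (rule prob_tendsto_AE)
    show "AE \<omega> in Q. \<exists>k0. \<forall>k\<ge>k0. (?sz (forest \<omega>) k \<and> ?cl (forest \<omega>)) \<longleftrightarrow> ?cl (forest \<omega>)"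
      using AE_weight_array AE_finite_degrees
    proof eventually_elim
      case (elim \<omega>)
      have "finite (verts (graph_ball (forest \<omega>) [] (2 * r)))"
        using forest_balls_eventually_good(2)[OF elim(1) _ lv'(1)] elim(2) by blast
      then show ?case by (intro exI[of _ "card (verts (graph_ball (forest \<omega>) [] (2 * r)))"]) auto
    qed
  qed (rule m class_event measurable_forest simple_wmsf S)+
  let ?\<mu> = "prob {\<omega> \<in> space Q. ?cl (forest \<omega>)}"
  have "\<forall>\<^sub>F N in sequentially. ?\<mu> - \<epsilon> / 4 < prob {\<omega> \<in> space Q. ?sz (forest \<omega>) N \<and> ?cl (forest \<omega>)}"
    using lim2 by (rule order_tendstoD) (use \<epsilon> in simp)
  then obtain N where N: "?\<mu> - \<epsilon> / 4 < prob {\<omega> \<in> space Q. ?sz (forest \<omega>) N \<and> ?cl (forest \<omega>)}"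
    unfolding eventually_sequentially by blast
  have "\<forall>\<^sub>F K in sequentially. ?\<mu> - \<epsilon> / 4 < prob {\<omega> \<in> space Q. ?sz (good K (lv K) \<omega>) N \<and> ?cl (good K (lv K) \<omega>)}"
    by (rule order_tendstoD(1)[OF lim1 N])
  moreover have "\<forall>\<^sub>F K in sequentially. nat \<lceil>16 * N / \<epsilon>\<rceil> \<le> K" by (rule eventually_ge_at_top)
  ultimately have "\<forall>\<^sub>F K in sequentially. ?\<mu> - \<epsilon> / 4 < prob {\<omega> \<in> space Q. ?sz (good K (lv K) \<omega>) N \<and> ?cl (good K (lv K) \<omega>)} \<and> nat \<lceil>16 * N / \<epsilon>\<rceil> \<le> K"
    by (rule eventually_conj)
  then obtain K where K: "?\<mu> - \<epsilon> / 4 < prob {\<omega> \<in> space Q. ?sz (good K (lv K) \<omega>) N \<and> ?cl (good K (lv K) \<omega>)}"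
    and K': "nat \<lceil>16 * N / \<epsilon>\<rceil> \<le> K" unfolding eventually_sequentially by blast
  \<comment> \<open>The two terms \<open>2 * N / (K + 1)\<close> come from the additional edges and from the vertices with few light edges.\<close>
  have NK: "4 * real N / (real K + 1) \<le> \<epsilon> / 4"
  proof -
    have "16 * N / \<epsilon> \<le> real K" using K' by linarith
    then have "16 * N / \<epsilon> \<le> real K + 1" by simp
    then show ?thesis using \<epsilon> by (simp add: field_simps)
  qed
  define \<delta> where "\<delta> = \<epsilon> / (8 * (real N + 1))"
  have \<delta>: "\<delta> > 0" using \<epsilon> by (simp add: \<delta>_def)
  have N\<delta>: "2 * real N * \<delta> \<le> \<epsilon> / 4" using \<epsilon> by (simp add: \<delta>_def field_simps)
  let ?l = "lv K"
  have e1: "\<forall>\<^sub>F n in sequentially. \<forall>\<rho>\<in>verts (G n).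
    measure (P n) {\<omega> \<in> space (P n). card {y. {\<rho>, y} \<in> edges (G n) \<and> dw n \<omega> {\<rho>, y} < ?l} < K} \<le> 1 / (real K + 1) + \<delta>"
    by (rule light_degree_lower_bound[OF lv(2) lv'(2) \<delta>])
  have e2: "\<forall>\<^sub>F n in sequentially. \<forall>\<rho>\<in>verts (G n).
    prob {\<omega> \<in> space Q. ?sz (good K ?l \<omega>) N \<and> ?cl (good K ?l \<omega>)} - \<epsilon> / 4
    \<le> measure (P n) {\<omega> \<in> space (P n). card (verts (graph_ball (goodG K ?l n \<omega>) \<rho> (2 * r))) \<le> N \<and>
      rooted_class (graph_ball (goodG K ?l n \<omega>) \<rho> r, \<rho>) \<in> S}"
    by (rule good_ball_lower_bound[OF lv'(2) S]) (use \<epsilon> in simp)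
  have e3: "\<forall>\<^sub>F n in sequentially. 1 \<le> d n" using dlim by (simp add: filterlim_at_top)
  from e1 e2 e3 show ?thesis
  proof eventually_elim
    case (elim n)
    interpret U: uniform_weights "P n" "G n" "W n" "d n" by (rule uw)
    let ?V = "verts (G n)"
    have V: "?V \<noteq> {}" using conn[of n] by (auto simp: graph_connected_def)
    then have cV: "real (card ?V) > 0" using U.fin by (simp add: card_gt_0_iff)
    let ?a = "\<lambda>\<rho> \<omega>. card (verts (graph_ball (goodG K ?l n \<omega>) \<rho> (2 * r))) \<le> N \<and> rooted_class (graph_ball (goodG K ?l n \<omega>) \<rho> r, \<rho>) \<in> S"
    let ?b = "\<lambda>\<rho> \<omega>. rooted_class (graph_ball (tree n \<omega>) \<rho> r, \<rho>) \<in> S"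
    let ?c = "\<lambda>\<rho> \<omega>. card {y. {\<rho>, y} \<in> edges (G n) \<and> dw n \<omega> {\<rho>, y} < ?l} < K"
    have ev: "{\<omega> \<in> space (P n). ?a \<rho> \<omega>} \<in> U.events" "{\<omega> \<in> space (P n). ?b \<rho> \<omega>} \<in> U.events" "{\<omega> \<in> space (P n). ?c \<rho> \<omega>} \<in> U.events" for \<rho>
      by (rule U.count_space_event[OF U.good_graph_measurable] U.count_space_event[OF U.mst_measurable]
          U.count_space_event[OF U.light_degree_measurable])+
    note cnt = U.expected_count[OF U.fin ev(1)] U.expected_count[OF U.fin ev(2)] U.expected_count[OF U.fin ev(3)]
    let ?sum = "\<lambda>a. \<Sum>\<rho>\<in>?V. U.prob {\<omega> \<in> space (P n). a \<rho> \<omega>}"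
    have "?sum ?a = U.expectation (\<lambda>\<omega>. real (card {\<rho> \<in> ?V. ?a \<rho> \<omega>}))" by (rule cnt(2)[symmetric])
    also have "\<dots> \<le> U.expectation (\<lambda>\<omega>. real (card {\<rho> \<in> ?V. ?b \<rho> \<omega>}) + 2 * real N * (card ?V / (real K + 1) + real (card {\<rho> \<in> ?V. ?c \<rho> \<omega>})))"
    proof (rule integral_mono_AE)
      show "integrable (P n) (\<lambda>\<omega>. real (card {\<rho> \<in> ?V. ?a \<rho> \<omega>}))" by (rule cnt(1))
      show "integrable (P n) (\<lambda>\<omega>. real (card {\<rho> \<in> ?V. ?b \<rho> \<omega>}) + 2 * real N * (card ?V / (real K + 1) + real (card {\<rho> \<in> ?V. ?c \<rho> \<omega>})))"
        by (intro Bochner_Integration.integrable_add integrable_mult_right cnt U.integrable_const)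
      show "AE \<omega> in P n. real (card {\<rho> \<in> ?V. ?a \<rho> \<omega>}) \<le> real (card {\<rho> \<in> ?V. ?b \<rho> \<omega>}) + 2 * real N * (card ?V / (real K + 1) + real (card {\<rho> \<in> ?V. ?c \<rho> \<omega>}))"
        using U.AE_distinct_weights
      proof eventually_elim
        case (elim \<omega>)
        show ?case using tree_ball_count[OF \<open>1 \<le> d n\<close> elim, of K ?l r N "\<lambda>X. rooted_class X \<in> S"] .
      qed
    qed
    also have "\<dots> = ?sum ?b + 2 * real N * (card ?V / (real K + 1) + ?sum ?c)"
      by (simp add: cnt(1,3,5) cnt(2,4,6) U.prob_space)
    finally have ineq: "?sum ?a \<le> ?sum ?b + 2 * real N * (card ?V / (real K + 1) + ?sum ?c)" .
    have sa: "card ?V * (?\<mu> - \<epsilon> / 2) \<le> ?sum ?a"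
      using sum_bounded_below[of ?V "?\<mu> - \<epsilon> / 2" "\<lambda>\<rho>. U.prob {\<omega> \<in> space (P n). ?a \<rho> \<omega>}"] elim(2) K by fastforce
    have sc: "?sum ?c \<le> card ?V * (1 / (real K + 1) + \<delta>)"
      using sum_bounded_above[of ?V "\<lambda>\<rho>. U.prob {\<omega> \<in> space (P n). ?c \<rho> \<omega>}" "1 / (real K + 1) + \<delta>"] elim(1) by simp
    have "card ?V * (?\<mu> - \<epsilon> / 2) \<le> ?sum ?b + 2 * real N * (card ?V / (real K + 1) + card ?V * (1 / (real K + 1) + \<delta>))"
      using sa ineq mult_left_mono[OF sc, of "2 * real N"] by (simp add: distrib_left)
    also have "\<dots> = ?sum ?b + card ?V * (4 * real N / (real K + 1) + 2 * real N * \<delta>)" by (simp add: algebra_simps add_divide_distrib)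
    also have "\<dots> \<le> ?sum ?b + card ?V * (\<epsilon> / 4 + \<epsilon> / 4)"
      using NK N\<delta> cV by (intro add_left_mono mult_left_mono add_mono) auto
    finally have "card ?V * (?\<mu> - \<epsilon>) \<le> ?sum ?b" by (simp add: algebra_simps)
    then show ?case using cV by (simp add: field_simps)
  qed
qed

end

section \<open>The laws of the balls\<close>

context uniform_weights
begin

lemma ball_law:
  fixes r :: nat
  assumes conn: "graph_connected G"
  defines "\<mu> \<equiv> uniform_root_ball_law P (\<lambda>\<omega>. mst G (\<lambda>e. W e \<omega>)) r"
  shows "prob_space \<mu>" "sets \<mu> = sets borel"
    and "S \<in> sets borel \<Longrightarrow> measure \<mu> S =
      (\<Sum>\<rho>\<in>verts G. prob {\<omega> \<in> space P. rooted_class (graph_ball (mst G (\<lambda>e. W e \<omega>)) \<rho> r, \<rho>) \<in> S}) / card (verts G)"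
proof -
  let ?k = "\<lambda>H :: 'v graph. distr (measure_pmf (pmf_of_set (verts H))) borel (\<lambda>\<rho>. rooted_class (rooted_ball (H, \<rho>) r))"
  let ?T = "\<lambda>\<omega>. mst G (\<lambda>e. W e \<omega>)"
  have pk: "prob_space (?k H)" for H by (rule measure_pmf.prob_space_distr) simp
  have k: "?k \<in> count_space UNIV \<rightarrow>\<^sub>M subprob_algebra borel"
    using pk by (auto simp: space_subprob_algebra intro: prob_space_imp_subprob_space)
  have kT: "(\<lambda>\<omega>. ?k (?T \<omega>)) \<in> P \<rightarrow>\<^sub>M subprob_algebra borel" by (rule measurable_compose[OF mst_measurable k])
  have \<mu>: "\<mu> = P \<bind> (\<lambda>\<omega>. ?k (?T \<omega>))" by (simp add: \<mu>_def uniform_root_ball_law_def)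
  show "prob_space \<mu>" unfolding \<mu> by (rule prob_space_bind[OF _ kT]) (simp add: pk)
  show "sets \<mu> = sets borel" unfolding \<mu> by (rule sets_bind) (simp_all add: not_empty)
  assume S: "S \<in> sets borel"
  let ?V = "verts G"
  have V: "?V \<noteq> {}" using conn by (auto simp: graph_connected_def)
  have ev: "{\<omega> \<in> space P. rooted_class (graph_ball (?T \<omega>) \<rho> r, \<rho>) \<in> S} \<in> events" for \<rho>
    by (rule count_space_event[OF mst_measurable])
  have "measure \<mu> S = expectation (\<lambda>\<omega>. measure (?k (?T \<omega>)) S)" unfolding \<mu> by (rule measure_bind[OF kT S])
  also have "\<dots> = expectation (\<lambda>\<omega>. real (card {\<rho> \<in> ?V. rooted_class (graph_ball (?T \<omega>) \<rho> r, \<rho>) \<in> S}) / card ?V)"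
  proof (rule integral_cong_AE)
    show "(\<lambda>\<omega>. measure (?k (?T \<omega>)) S) \<in> borel_measurable P"
      by (rule measurable_compose[OF mst_measurable, where g = "\<lambda>H. measure (?k H) S"]) simp
    show "(\<lambda>\<omega>. real (card {\<rho> \<in> ?V. rooted_class (graph_ball (?T \<omega>) \<rho> r, \<rho>) \<in> S}) / card ?V) \<in> borel_measurable P"
      by (rule measurable_compose[OF mst_measurable, where g = "\<lambda>H. real (card {\<rho> \<in> ?V. rooted_class (graph_ball H \<rho> r, \<rho>) \<in> S}) / card ?V"]) simp
    show "AE \<omega> in P. measure (?k (?T \<omega>)) S = real (card {\<rho> \<in> ?V. rooted_class (graph_ball (?T \<omega>) \<rho> r, \<rho>) \<in> S}) / card ?V"
      using AE_distinct_weights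
    proof eventually_elim
      case (elim \<omega>)
      have VT: "verts (?T \<omega>) = ?V" using mst_eq_kruskal[OF simp fin conn elim] by simp
      have "measure (?k (?T \<omega>)) S = measure (measure_pmf (pmf_of_set ?V)) {\<rho>. rooted_class (rooted_ball (?T \<omega>, \<rho>) r) \<in> S}"
        unfolding VT using S by (subst measure_distr) (auto simp: vimage_def)
      also have "\<dots> = card (?V \<inter> {\<rho>. rooted_class (rooted_ball (?T \<omega>, \<rho>) r) \<in> S}) / card ?V"
        by (rule measure_pmf_of_set[OF V fin])
      finally show ?case by (simp add: rooted_ball_def Int_def)
    qed
  qed
  also have "\<dots> = (\<Sum>\<rho>\<in>?V. prob {\<omega> \<in> space P. rooted_class (graph_ball (?T \<omega>) \<rho> r, \<rho>) \<in> S}) / card ?V"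
    using expected_count[OF fin ev] by simp
  finally show "measure \<mu> S = (\<Sum>\<rho>\<in>?V. prob {\<omega> \<in> space P. rooted_class (graph_ball (?T \<omega>) \<rho> r, \<rho>) \<in> S}) / card ?V" .
qed

lemma random_finite_mst:
  assumes conn: "graph_connected G" shows "random_finite_graph P (\<lambda>\<omega>. mst G (\<lambda>e. W e \<omega>))"
  unfolding random_finite_graph_def
proof (intro conjI)
  show "prob_space P" by unfold_locales
  show "(\<lambda>\<omega>. mst G (\<lambda>e. W e \<omega>)) \<in> P \<rightarrow>\<^sub>M count_space UNIV" by (rule mst_measurable)
  have V: "verts G \<noteq> {}" using conn by (auto simp: graph_connected_def)
  show "AE \<omega> in P. simple_graph (mst G (\<lambda>e. W e \<omega>)) \<and> finite (verts (mst G (\<lambda>e. W e \<omega>))) \<and> verts (mst G (\<lambda>e. W e \<omega>)) \<noteq> {}"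
    using AE_distinct_weights
  proof eventually_elim
    case (elim \<omega>)
    have "simple_graph (kruskal G (\<lambda>e. W e \<omega>))" by (rule simple_subgraph[OF simp]) (simp_all add: kruskal_subset)
    then show ?case unfolding mst_eq_kruskal[OF simp fin conn elim] using fin V by simp
  qed
qed

end

context mst_limit
begin

text \<open>The lower bound holds for \<open>S\<close> and for its complement.\<close>

lemma tree_ball_law_tendsto:
  assumes S: "S \<in> sets borel"
  shows "(\<lambda>n. measure (uniform_root_ball_law (P n) (tree n) r) S)
    \<longlonglongrightarrow> prob {\<omega> \<in> space Q. rooted_class (graph_ball (forest \<omega>) [] r, []) \<in> S}"
proof -
  let ?\<mu> = "\<lambda>n. uniform_root_ball_law (P n) (tree n) r"
  let ?\<nu> = "\<lambda>S. prob {\<omega> \<in> space Q. rooted_class (graph_ball (forest \<omega>) [] r, []) \<in> S}"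
  have law: "prob_space (?\<mu> n)" "sets (?\<mu> n) = sets borel"
    "S \<in> sets borel \<Longrightarrow> measure (?\<mu> n) S = (\<Sum>\<rho>\<in>verts (G n). measure (P n) {\<omega> \<in> space (P n). rooted_class (graph_ball (tree n \<omega>) \<rho> r, \<rho>) \<in> S}) / card (verts (G n))" for n S
  proof -
    interpret U: uniform_weights "P n" "G n" "W n" "d n" by (rule uw)
    show "prob_space (?\<mu> n)" "sets (?\<mu> n) = sets borel" by (rule U.ball_law[OF conn])+
    show "measure (?\<mu> n) S = (\<Sum>\<rho>\<in>verts (G n). measure (P n) {\<omega> \<in> space (P n). rooted_class (graph_ball (tree n \<omega>) \<rho> r, \<rho>) \<in> S}) / card (verts (G n))"
      if "S \<in> sets borel" by (rule U.ball_law(3)[OF conn that])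
  qed
  have low: "\<forall>\<^sub>F n in sequentially. ?\<nu> S - \<epsilon> \<le> measure (?\<mu> n) S" if "S \<in> sets borel" "\<epsilon> > 0" for S \<epsilon>
    using tree_ball_lower_bound[OF that, of r] by (simp only: law(3)[OF that(1)])
  have compl: "?\<nu> (- S) = 1 - ?\<nu> S" "measure (?\<mu> n) (- S) = 1 - measure (?\<mu> n) S" for n
  proof -
    have "{\<omega> \<in> space Q. rooted_class (graph_ball (forest \<omega>) [] r, []) \<in> - S} =
      space Q - {\<omega> \<in> space Q. rooted_class (graph_ball (forest \<omega>) [] r, []) \<in> S}" by blast
    then show "?\<nu> (- S) = 1 - ?\<nu> S"
      using prob_compl[OF class_event[OF measurable_forest simple_wmsf S]] by simp
    interpret M: prob_space "?\<mu> n" by (rule law(1))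
    have "space (?\<mu> n) = UNIV" using sets_eq_imp_space_eq[OF law(2)] by simp
    then show "measure (?\<mu> n) (- S) = 1 - measure (?\<mu> n) S"
      using M.prob_compl[of S] S law(2) by (simp add: Compl_eq_Diff_UNIV)
  qed
  show ?thesis
  proof (rule tendstoI)
    fix \<epsilon> :: real assume \<epsilon>: "\<epsilon> > 0"
    then have e2: "\<epsilon> / 2 > 0" by simp
    have S': "- S \<in> sets borel" using S by auto
    show "\<forall>\<^sub>F n in sequentially. dist (measure (?\<mu> n) S) (?\<nu> S) < \<epsilon>"
      using low[OF S e2] low[OF S' e2]
    proof eventually_elim
      case (elim n)
      then show ?case using \<epsilon> unfolding compl dist_real_def by linarith
    qed
  qed
qed

theorem mst_local_limit:
  "is_local_limit P tree Q (\<lambda>\<omega>. (component (forest \<omega>) [], []))"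
  unfolding is_local_limit_def
proof (intro conjI allI impI)
  fix n
  interpret U: uniform_weights "P n" "G n" "W n" "d n" by (rule uw)
  show "random_finite_graph (P n) (tree n)" by (rule U.random_finite_mst[OF conn])
next
  have sC: "simple_graph (component (forest \<omega>) [])" for \<omega>
    unfolding component_def by (rule simple_induced[OF simple_wmsf])
  show "random_rooted_graph Q (\<lambda>\<omega>. (component (forest \<omega>) [], []))"
    unfolding random_rooted_graph_def
  proof (intro conjI)
    show "prob_space Q" by unfold_locales
    show "(\<lambda>\<omega>. rooted_class (component (forest \<omega>) [], [])) \<in> borel_measurable Q"
      by (rule rooted_class_measurable[OF measurable_graph_component[OF measurable_forest] sC])
    show "AE \<omega> in Q. lf_rooted (component (forest \<omega>) [], [])" by (rule AE_lf_component)
  qed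
next
  fix r :: nat
  let ?\<mu> = "\<lambda>n. uniform_root_ball_law (P n) (tree n) r"
  have eq: "rooted_class (rooted_ball (component (forest \<omega>) [], []) r) = rooted_class (graph_ball (forest \<omega>) [] r, [])" for \<omega>
    using graph_ball_component[OF simple_wmsf, of "[]"] verts_wmsf by (simp add: rooted_ball_def)
  let ?\<nu> = "distr Q borel (\<lambda>\<omega>. rooted_class (rooted_ball (component (forest \<omega>) [], []) r))"
  have meas: "(\<lambda>\<omega>. rooted_class (graph_ball (forest \<omega>) [] r, [])) \<in> borel_measurable Q"
    by (rule rooted_class_measurable[OF measurable_graph_ball[OF measurable_forest] simple_graph_ball[OF simple_wmsf]])
  show "converges_weakly ?\<mu> ?\<nu>"
    unfolding converges_weakly_def
  proof (intro allI impI)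
    fix f :: "rooted_graph \<Rightarrow> real" assume f: "continuous_on UNIV f \<and> bounded (range f)"
    then obtain B where B: "\<And>x. \<bar>f x\<bar> \<le> B" unfolding bounded_iff by auto
    show "(\<lambda>n. integral\<^sup>L (?\<mu> n) f) \<longlonglongrightarrow> integral\<^sup>L ?\<nu> f"
    proof (rule setwise_imp_integral_tendsto[OF _ _ _ _ _ _ B])
      fix n
      interpret U: uniform_weights "P n" "G n" "W n" "d n" by (rule uw)
      show "prob_space (?\<mu> n)" "sets (?\<mu> n) = sets borel" by (rule U.ball_law[OF conn])+
    next
      show "prob_space ?\<nu>" unfolding eq by (rule prob_space_distr[OF meas])
      show "f \<in> borel_measurable borel" using f by (intro borel_measurable_continuous_onI) simp
      fix S :: "rooted_graph set" assume S: "S \<in> sets borel"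
      have "measure ?\<nu> S = prob {\<omega> \<in> space Q. rooted_class (graph_ball (forest \<omega>) [] r, []) \<in> S}"
        unfolding eq measure_distr[OF meas S] by (rule arg_cong[of _ _ prob]) auto
      then show "(\<lambda>n. measure (?\<mu> n) S) \<longlonglongrightarrow> measure ?\<nu> S" using tree_ball_law_tendsto[OF S] by simp
    qed simp
  qed
qed

end

theorem theorem6p1:
  fixes G :: "nat \<Rightarrow> 'a graph" and d :: "nat \<Rightarrow> nat"
    and P :: "nat \<Rightarrow> 'p measure" and W :: "nat \<Rightarrow> 'a set \<Rightarrow> 'p \<Rightarrow> real"
    and Q :: "'q measure" and w :: "nat list \<Rightarrow> nat \<Rightarrow> 'q \<Rightarrow> real"
  assumes "\<And>n. finite (verts (G n))"
    and "\<And>n. simple_graph (G n)"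
    and "\<And>n. graph_connected (G n)"
    and "\<And>n. regular (d n) (G n)"
    and "filterlim d at_top sequentially"
    and "\<And>n. prob_space (P n)"
    and "\<And>n. prob_space.indep_vars (P n) (\<lambda>_. borel) (W n) (edges (G n))"
    and "\<And>n e. e \<in> edges (G n) \<Longrightarrow> distr (P n) borel (W n e) = uniform_measure lborel {0..1}"
    and "pwit_weights Q w"
  shows "is_local_limit P (\<lambda>n \<omega>. mst (G n) (\<lambda>e. W n e \<omega>))
           Q (\<lambda>\<omega>. (component (wmsf ulam_harris (child_weight (\<lambda>v i. w v i \<omega>))) [], []))"
proof -
  have Q: "prob_space Q" using assms(9) by (simp add: pwit_weights_def)
  have "pwit Q w"
    unfolding pwit_def pwit_axioms_def using assms(9) Q by (simp add: pwit_weights_def)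
  moreover have "uniform_weights (P n) (G n) (W n) (d n)" for n
    unfolding uniform_weights_def uniform_weights_axioms_def using assms by blast
  ultimately have "mst_limit Q w G d P W"
    unfolding mst_limit_def mst_limit_axioms_def using assms by blast
  then show ?thesis by (rule mst_limit.mst_local_limit)
qed

end
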